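(* Let $\Pi,\mathcal{L}$ be left Hopf algebroids over $B$ and let $\tau,\kappa$ be two skew pairings between them. Then the map $\Gamma$ in ${}_{B^e}\mathrm{Hom}\big((\Pi\,{}^{\kappa}\!\bowtie_{\kappa}\mathcal{L})\otimes_{B^e}(\Pi\,{}^{\kappa}\!\bowtie_{\kappa}\mathcal{L}),B\big)$ given by $$\Gamma\big(\alpha\otimes X,\ \beta\otimes Y\big)=\varepsilon\big((\alpha\otimes X)\cdot_{\tau\kappa}(\beta\otimes Y)\big)$$ is an (invertible normalised) 2-cocycle on the left bialgebroid $\Pi\,{}^{\kappa}\!\bowtie_{\kappa}\mathcal{L}$, with inverse given by $$\Gamma^{-1}\big(\alpha\otimes X,\ \beta\otimes Y\big)=\varepsilon\big((\alpha\otimes X)\cdot_{\kappa\tau}(\beta\otimes Y)\big).$$ Moreover, $\Pi\,{}^{\tau}\!\bowtie_{\tau}\mathcal{L}=(\Pi\,{}^{\kappa}\!\bowtie_{\kappa}\mathcal{L})^{\Gamma}$, and $\Pi\,{}^{\tau}\!\bowtie_{\kappa}\mathcal{L}={}_{\Gamma}(\Pi\,{}^{\kappa}\!\bowtie_{\kappa}\mathcal{L})$, the left one-sided twist of the regular left comodule algebra $\Pi\,{}^{\kappa}\!\bowtie_{\kappa}\mathcal{L}$, i.e. $V\cdot_{\tau\kappa}W=\Gamma(V_{(1)},W_{(1)})\,(V_{(2)}\cdot_{\kappa\kappa}W_{(2)})$ for all $V,W$.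
   Context: $k$ is a field, $B$ a unital $k$-algebra, $\overline B$ its opposite algebra with canonical anti-isomorphism $B\to\overline B$, $b\mapsto\bar b$, and $B^e=B\otimes\overline B$. $M\diamond_B N:=M\otimes N/\langle \bar bm\otimes n-m\otimes bn\rangle$; $M\times_BN:=\{\sum m_i\otimes n_i\in M\diamond_BN:\ \sum m_i\bar a\otimes n_i=\sum m_i\otimes n_ia\ \forall a\in B\}$. A left bialgebroid over $B$ is an algebra $\mathcal{L}$ with algebra maps $s:B\to\mathcal{L}$, $t:\overline B\to\mathcal{L}$ with commuting images (one writes $b,\bar b$ for $s(b),t(\bar b)$), with left $B^e$-module maps $\Delta:\mathcal{L}\to\mathcal{L}\times_B\mathcal{L}$, $\Delta(X)=X_{(1)}\otimes X_{(2)}$ (so $\Delta(b\bar cX)=bX_{(1)}\otimes\bar cX_{(2)}$) and $\varepsilon:\mathcal{L}\to B$ (so $\varepsilon(b\bar cX)=b\varepsilon(X)c$), coassociative and counital ($\varepsilon(X_{(1)})X_{(2)}=\overline{\varepsilon(X_{(2)})}X_{(1)}=X$), such that $\Delta$ is an algebra map (componentwise product on $\mathcal{L}\times_B\mathcal{L}$), $\varepsilon(1)=1$ and $\varepsilon(X\varepsilon(Y))=\varepsilon(XY)=\varepsilon(X\overline{\varepsilon(Y)})$. Standing assumption: all $B$-module and $\overline B$-module structures are faithfully flat. $\mathcal{L}$ is a left Hopf algebroid if $\lambda:\mathcal{L}\otimes_{\overline B}\mathcal{L}\to\mathcal{L}\diamond_B\mathcal{L}$, $\lambda(X\otimes Y)=X_{(1)}\otimes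 X_{(2)}Y$, is bijective; then $X_+\otimes_{\overline B}X_-:=\lambda^{-1}(X\diamond1)$. A skew pairing is a linear map $\tau[\cdot|\cdot]:\mathcal{L}\otimes\Pi\to B$ with, for $a,b,c,d,f\in B$, $X,Y\in\mathcal{L}$, $\alpha,\beta\in\Pi$: $\tau[a\bar bXc\bar d|\alpha]f=a\tau[X|c\bar f\alpha d\bar b]$; $\tau[X|\alpha\beta]=\tau[X_{(1)}|\alpha\overline{\tau[X_{(2)}|\beta]}]=\tau[\overline{\tau[X_{(2)}|\beta]}X_{(1)}|\alpha]$; $\tau[XY|\alpha]=\tau[X\tau[Y|\alpha_{(1)}]|\alpha_{(2)}]=\tau[X|\tau[Y|\alpha_{(1)}]\alpha_{(2)}]$; $\tau[X|1]=\varepsilon(X)$; $\tau[1|\alpha]=\varepsilon(\alpha)$. For skew pairings $\tau,\kappa$, $\Pi\,{}^{\tau}\!\bowtie_{\kappa}\mathcal{L}$ is the vector space $\Pi\otimes_{B^e}\mathcal{L}$ with the product $$(\alpha\otimes X)\cdot_{\tau\kappa}(\beta\otimes Y)=\alpha\,\tau[X_{(1)}|\beta_{(1)}]\,\beta_{(2)+}\otimes\overline{\kappa[X_{(3)}|\beta_{(2)-}]}\,X_{(2)}Y,$$ which is a $B^e$-ring (with structure map $b\otimes\bar c\mapsto b\bar c\otimes1$). On $\Pi\otimes_{B^e}\mathcal{L}$ one has the coproduct $\alpha\otimes X\mapsto(\alpha_{(1)}\otimes X_{(1)})\otimes(\alpha_{(2)}\otimes X_{(2)})$ and counit $\varepsilon(\alpha\otimes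 X)=\varepsilon(\alpha\varepsilon(X))$; with these, $\Pi\,{}^{\tau}\!\bowtie_{\tau}\mathcal{L}$ and $\Pi\,{}^{\kappa}\!\bowtie_{\kappa}\mathcal{L}$ are left bialgebroids over $B$. An invertible normalised 2-cocycle on a left bialgebroid $\mathcal{H}$ is a left $B^e$-linear map $\Gamma:\mathcal{H}\otimes_{B^e}\mathcal{H}\to B$, invertible for the convolution $(f*g)(V,W)=f(V_{(1)},W_{(1)})g(V_{(2)},W_{(2)})$ with unit $\varepsilon(VW)$, such that $\Gamma(U,\Gamma(V_{(1)},W_{(1)})V_{(2)}W_{(2)})=\Gamma(\Gamma(U_{(1)},V_{(1)})U_{(2)}V_{(2)},W)$, $\Gamma(1,V)=\varepsilon(V)=\Gamma(V,1)$ and $\Gamma(V,Wb)=\Gamma(V,W\bar b)$ for $b\in B$. $\mathcal{H}^\Gamma$ is the left bialgebroid with product $V\cdot_\Gamma W=\Gamma(V_{(1)},W_{(1)})\overline{\Gamma^{-1}(V_{(3)},W_{(3)})}V_{(2)}W_{(2)}$ and unchanged coproduct, counit, source, target. For a left $\mathcal{H}$-comodule algebra $P$, ${}_\Gamma P$ is $P$ with product $p\cdot_\Gamma q=\Gamma(p_{(-1)},q_{(-1)})p_{(0)}q_{(0)}$. *)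

theory Defs
  imports "HOL-Algebra.Module" "HOL-Algebra.RingHom" "HOL-Algebra.Generated_Groups"
    "HOL-Algebra.Free_Abelian_Groups"
begin

section \<open>Tensor products\<close>

text \<open>
  A tensor product is a free abelian group on a set of tuples modulo a subgroup, so its elements are
  cosets of formal integral combinations of tuples.  For a quotient \<open>T\<close> of this kind the unit
  \<open>\<one>\<^bsub>T\<^esub>\<close> is the subgroup itself, which determines the class of a formal combination.
\<close>

definition tclass :: "(('c \<Rightarrow>\<^sub>0 int) set, 'x) monoid_scheme \<Rightarrow> ('c \<Rightarrow>\<^sub>0 int) \<Rightarrow> ('c \<Rightarrow>\<^sub>0 int) set"
  where "tclass T c = (\<lambda>k. k + c) ` \<one>\<^bsub>T\<^esub>"

definition tens ::
  "((('m \<times> 'n) \<Rightarrow>\<^sub>0 int) set, 'x) monoid_scheme \<Rightarrow> 'm \<Rightarrow> 'n \<Rightarrow> (('m \<times> 'n) \<Rightarrow>\<^sub>0 int) set"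
  where "tens T m n = tclass T (frag_of (m, n))"

text \<open>
  The tensor product of two abelian groups (additive groups of ring-like records) with the relations
  \<open>\<rho> i m \<otimes> n = m \<otimes> \<sigma> i n\<close> for \<open>i \<in> I\<close>.  Every tensor product needed below is over a \<open>k\<close>-algebra
  whose \<open>k\<close>-multiples of the unit act as the scalars of \<open>k\<close>, so \<open>k\<close>-balancedness is among these
  relations and integral coefficients suffice.
\<close>

definition tensor_rels ::
  "('m, 'x) ring_scheme \<Rightarrow> ('n, 'y) ring_scheme \<Rightarrow> 'i set \<Rightarrow> ('i \<Rightarrow> 'm \<Rightarrow> 'm) \<Rightarrow> ('i \<Rightarrow> 'n \<Rightarrow> 'n)
    \<Rightarrow> (('m \<times> 'n) \<Rightarrow>\<^sub>0 int) set"
  where "tensor_rels M N I \<rho> \<sigma> =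
      {frag_of (m \<oplus>\<^bsub>M\<^esub> m', n) - frag_of (m, n) - frag_of (m', n) |m m' n.
         m \<in> carrier M \<and> m' \<in> carrier M \<and> n \<in> carrier N}
    \<union> {frag_of (m, n \<oplus>\<^bsub>N\<^esub> n') - frag_of (m, n) - frag_of (m, n') |m n n'.
         m \<in> carrier M \<and> n \<in> carrier N \<and> n' \<in> carrier N}
    \<union> {frag_of (\<rho> i m, n) - frag_of (m, \<sigma> i n) |i m n.
         i \<in> I \<and> m \<in> carrier M \<and> n \<in> carrier N}"

definition tensor ::
  "('m, 'x) ring_scheme \<Rightarrow> ('n, 'y) ring_scheme \<Rightarrow> 'i set \<Rightarrow> ('i \<Rightarrow> 'm \<Rightarrow> 'm) \<Rightarrow> ('i \<Rightarrow> 'n \<Rightarrow> 'n)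
    \<Rightarrow> (('m \<times> 'n) \<Rightarrow>\<^sub>0 int) set monoid"
  where "tensor M N I \<rho> \<sigma> =
    (let F = free_Abelian_group (carrier M \<times> carrier N)
     in F Mod generate F (tensor_rels M N I \<rho> \<sigma>))"

text \<open>
  \<open>lin_ext G f\<close> is the \<open>\<int>\<close>-linear extension of \<open>f\<close> to formal combinations, for an abelian group \<open>G\<close>
  written multiplicatively.  \<open>tlift G f t\<close> evaluates it on a representative of the class \<open>t\<close>.  This
  is how an expression \<open>\<Sum>\<^sub>i f m\<^sub>i n\<^sub>i\<close> in an element \<open>\<Sum>\<^sub>i m\<^sub>i \<otimes> n\<^sub>i\<close> is written; the choice of the
  representative is irrelevant as soon as the expression respects the relations of the tensor
  product (lemmas \<open>tlift_tclass\<close> and \<open>tlift_tens\<close>).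
\<close>

definition lin_ext :: "('a, 'x) monoid_scheme \<Rightarrow> ('c \<Rightarrow> 'a) \<Rightarrow> ('c \<Rightarrow>\<^sub>0 int) \<Rightarrow> 'a"
  where "lin_ext G f c =
    finprod G (\<lambda>p. f p [^]\<^bsub>G\<^esub> Poly_Mapping.lookup c p) (Poly_Mapping.keys c)"

definition tlift :: "('a, 'x) monoid_scheme \<Rightarrow> ('c \<Rightarrow> 'a) \<Rightarrow> ('c \<Rightarrow>\<^sub>0 int) set \<Rightarrow> 'a"
  where "tlift G f t = lin_ext G f (SOME c. c \<in> t)"

lemma lin_ext_eq_gfinprod:
  assumes "comm_group G" "f ` S \<subseteq> carrier G" "Poly_Mapping.keys c \<subseteq> S"
  shows "lin_ext G f c = gfinprod G (\<lambda>p. f p [^]\<^bsub>G\<^esub> Poly_Mapping.lookup c p) S"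
proof -
  interpret comm_group G by fact
  have cl: "f p [^]\<^bsub>G\<^esub> Poly_Mapping.lookup c p \<in> carrier G" if "p \<in> S" for p
    using assms(2) that by (meson image_subset_iff int_pow_closed)
  have "gfinprod G (\<lambda>p. f p [^]\<^bsub>G\<^esub> Poly_Mapping.lookup c p) (Poly_Mapping.keys c)
      = gfinprod G (\<lambda>p. f p [^]\<^bsub>G\<^esub> Poly_Mapping.lookup c p) S"
    using assms(3) cl by (intro gfinprod_mono_neutral_cong_left) (auto simp: in_keys_iff)
  moreover have "gfinprod G (\<lambda>p. f p [^]\<^bsub>G\<^esub> Poly_Mapping.lookup c p) (Poly_Mapping.keys c)
      = lin_ext G f c"
    unfolding lin_ext_def using assms(3) cl by (intro gfinprod_eq_finprod) auto
  ultimately show ?thesis by simp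
qed

lemma lin_ext_hom:
  assumes "comm_group G" "f ` S \<subseteq> carrier G"
  shows "lin_ext G f \<in> hom (free_Abelian_group S) G"
proof -
  interpret comm_group G by fact
  have fin: "finite {p \<in> S. f p [^]\<^bsub>G\<^esub> Poly_Mapping.lookup c p \<noteq> \<one>\<^bsub>G\<^esub>}" for c :: "_ \<Rightarrow>\<^sub>0 int"
    by (rule finite_subset[OF _ finite_keys[of c]]) (auto simp: in_keys_iff)
  have cl: "f p [^]\<^bsub>G\<^esub> n \<in> carrier G" if "p \<in> S" for p and n :: int
    using assms(2) that by (meson image_subset_iff int_pow_closed)
  show ?thesis
  proof (rule homI)
    fix c assume "c \<in> carrier (free_Abelian_group S)"
    then show "lin_ext G f c \<in> carrier G"
      using lin_ext_eq_gfinprod[OF assms] cl by (auto intro!: gfinprod_closed)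
  next
    fix c d assume cd: "c \<in> carrier (free_Abelian_group S)" "d \<in> carrier (free_Abelian_group S)"
    then have k: "Poly_Mapping.keys (c + d) \<subseteq> S"
      using keys_add[of c d] by auto
    have "gfinprod G (\<lambda>p. f p [^]\<^bsub>G\<^esub> Poly_Mapping.lookup (c + d) p) S
      = gfinprod G (\<lambda>p. f p [^]\<^bsub>G\<^esub> Poly_Mapping.lookup c p \<otimes>\<^bsub>G\<^esub> f p [^]\<^bsub>G\<^esub> Poly_Mapping.lookup d p) S"
      using assms(2) cl by (intro gfinprod_cong) (auto simp: lookup_add int_pow_mult image_subset_iff simp_implies_def)
    also have "\<dots> = gfinprod G (\<lambda>p. f p [^]\<^bsub>G\<^esub> Poly_Mapping.lookup c p) S
        \<otimes>\<^bsub>G\<^esub> gfinprod G (\<lambda>p. f p [^]\<^bsub>G\<^esub> Poly_Mapping.lookup d p) S"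
      using fin cl by (intro gfinprod_distrib) auto
    finally show "lin_ext G f (c \<otimes>\<^bsub>free_Abelian_group S\<^esub> d) = lin_ext G f c \<otimes>\<^bsub>G\<^esub> lin_ext G f d"
      using cd k by (simp add: lin_ext_eq_gfinprod[OF assms])
  qed
qed

lemma lin_ext_frag_of:
  assumes "comm_group G" "f p \<in> carrier G"
  shows "lin_ext G f (frag_of p) = f p"
proof -
  interpret comm_group G by fact
  show ?thesis using assms by (simp add: lin_ext_def int_pow_1)
qed

lemma tlift_tclass:
  assumes G: "comm_group G" and f: "f ` S \<subseteq> carrier G"
    and R: "R \<subseteq> carrier (free_Abelian_group S)" "\<And>r. r \<in> R \<Longrightarrow> lin_ext G f r = \<one>\<^bsub>G\<^esub>"
    and T: "T = free_Abelian_group S Mod generate (free_Abelian_group S) R"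
    and c: "c \<in> carrier (free_Abelian_group S)"
  shows "tlift G f (tclass T c) = lin_ext G f c"
proof -
  interpret comm_group G by fact
  interpret h: group_hom "free_Abelian_group S" G "lin_ext G f"
    using lin_ext_hom[OF G f] by (simp add: group_hom_def group_hom_axioms_def)
  have K: "subgroup (kernel (free_Abelian_group S) G (lin_ext G f)) (free_Abelian_group S)"
    by (rule h.subgroup_kernel)
  have "generate (free_Abelian_group S) R \<subseteq> kernel (free_Abelian_group S) G (lin_ext G f)"
    by (intro group.generate_subgroup_incl[OF group_free_Abelian_group] K)
      (use R in \<open>auto simp only: kernel_def\<close>)
  then have 1: "lin_ext G f (k + c) = lin_ext G f c" if "k \<in> generate (free_Abelian_group S) R" for k
    using h.hom_mult[of k c] that c h.hom_closed[OF c] by (auto simp: kernel_def)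
  have "c \<in> tclass T c"
    using generate.one[of "free_Abelian_group S" R] by (force simp: tclass_def T)
  then have "(SOME d. d \<in> tclass T c) \<in> tclass T c" by (rule someI)
  then show ?thesis using 1 by (auto simp: tclass_def tlift_def T)
qed

lemma tlift_tens:
  assumes G: "comm_group G"
    and f: "\<And>m n. m \<in> carrier M \<Longrightarrow> n \<in> carrier N \<Longrightarrow> f m n \<in> carrier G"
    and M: "abelian_group M" and N: "abelian_group N"
    and \<rho>: "\<And>i m. i \<in> I \<Longrightarrow> m \<in> carrier M \<Longrightarrow> \<rho> i m \<in> carrier M"
    and \<sigma>: "\<And>i n. i \<in> I \<Longrightarrow> n \<in> carrier N \<Longrightarrow> \<sigma> i n \<in> carrier N"
    and fl: "\<And>m m' n. m \<in> carrier M \<Longrightarrow> m' \<in> carrier M \<Longrightarrow> n \<in> carrier N \<Longrightarrow>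
               f (m \<oplus>\<^bsub>M\<^esub> m') n = f m n \<otimes>\<^bsub>G\<^esub> f m' n"
    and fr: "\<And>m n n'. m \<in> carrier M \<Longrightarrow> n \<in> carrier N \<Longrightarrow> n' \<in> carrier N \<Longrightarrow>
               f m (n \<oplus>\<^bsub>N\<^esub> n') = f m n \<otimes>\<^bsub>G\<^esub> f m n'"
    and fb: "\<And>i m n. i \<in> I \<Longrightarrow> m \<in> carrier M \<Longrightarrow> n \<in> carrier N \<Longrightarrow> f (\<rho> i m) n = f m (\<sigma> i n)"
    and mn: "m \<in> carrier M" "n \<in> carrier N"
  shows "tlift G (\<lambda>(x, y). f x y) (tens (tensor M N I \<rho> \<sigma>) m n) = f m n"
proof -
  interpret comm_group G by fact
  interpret M: abelian_group M by fact
  interpret N: abelian_group N by fact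
  define S where "S = carrier M \<times> carrier N"
  define g where "g = (\<lambda>(x, y). f x y)"
  have g: "g ` S \<subseteq> carrier G" using f by (auto simp: g_def S_def)
  interpret h: group_hom "free_Abelian_group S" G "lin_ext G g"
    using lin_ext_hom[OF G g] by (simp add: group_hom_def group_hom_axioms_def)
  have frag: "lin_ext G g (frag_of p) = g p" if "p \<in> S" for p
    using that g by (intro lin_ext_frag_of[OF G]) auto
  have S_frag: "frag_of p \<in> carrier (free_Abelian_group S)" if "p \<in> S" for p
    using that by simp
  have diff: "lin_ext G g (c - d) = lin_ext G g c \<otimes>\<^bsub>G\<^esub> inv\<^bsub>G\<^esub> lin_ext G g d"
    and diff_closed: "c - d \<in> carrier (free_Abelian_group S)"
    if cd: "c \<in> carrier (free_Abelian_group S)" "d \<in> carrier (free_Abelian_group S)" for c d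
  proof -
    have md: "- d \<in> carrier (free_Abelian_group S)" using cd by simp
    have "lin_ext G g (c + - d) = lin_ext G g c \<otimes>\<^bsub>G\<^esub> lin_ext G g (- d)"
      using h.hom_mult[OF cd(1) md] by simp
    moreover have "lin_ext G g (- d) = inv\<^bsub>G\<^esub> lin_ext G g d"
      using h.hom_inv[OF cd(2)] cd by simp
    ultimately show "lin_ext G g (c - d) = lin_ext G g c \<otimes>\<^bsub>G\<^esub> inv\<^bsub>G\<^esub> lin_ext G g d" by simp
    show "c - d \<in> carrier (free_Abelian_group S)"
      using cd keys_diff[of c d] by auto
  qed
  have rel3: "lin_ext G g (frag_of p - frag_of q - frag_of q') = \<one>\<^bsub>G\<^esub>"
    and rel3_closed: "frag_of p - frag_of q - frag_of q' \<in> carrier (free_Abelian_group S)"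
    if p: "p \<in> S" "q \<in> S" "q' \<in> S" and e: "g p = g q \<otimes>\<^bsub>G\<^esub> g q'" for p q q'
  proof -
    have gc: "g q \<in> carrier G" "g q' \<in> carrier G" using g p by auto
    have "lin_ext G g (frag_of p - frag_of q - frag_of q')
        = g q \<otimes>\<^bsub>G\<^esub> g q' \<otimes>\<^bsub>G\<^esub> inv\<^bsub>G\<^esub> g q \<otimes>\<^bsub>G\<^esub> inv\<^bsub>G\<^esub> g q'"
      by (simp only: diff diff_closed S_frag p frag e)
    also have "\<dots> = (g q \<otimes>\<^bsub>G\<^esub> g q') \<otimes>\<^bsub>G\<^esub> inv\<^bsub>G\<^esub> (g q \<otimes>\<^bsub>G\<^esub> g q')"
      by (simp only: m_assoc inv_mult inv_closed m_closed gc)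
    also have "\<dots> = \<one>\<^bsub>G\<^esub>" by (simp only: r_inv m_closed gc)
    finally show "lin_ext G g (frag_of p - frag_of q - frag_of q') = \<one>\<^bsub>G\<^esub>" .
    show "frag_of p - frag_of q - frag_of q' \<in> carrier (free_Abelian_group S)"
      by (intro diff_closed S_frag p)
  qed
  have rel2: "lin_ext G g (frag_of p - frag_of q) = \<one>\<^bsub>G\<^esub>"
    and rel2_closed: "frag_of p - frag_of q \<in> carrier (free_Abelian_group S)"
    if p: "p \<in> S" "q \<in> S" and e: "g p = g q" for p q
  proof -
    have "g q \<in> carrier G" using g p by auto
    then show "lin_ext G g (frag_of p - frag_of q) = \<one>\<^bsub>G\<^esub>"
      by (simp only: diff S_frag p frag e r_inv)
    show "frag_of p - frag_of q \<in> carrier (free_Abelian_group S)"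
      by (intro diff_closed S_frag p)
  qed
  have rels: "r \<in> carrier (free_Abelian_group S) \<and> lin_ext G g r = \<one>\<^bsub>G\<^esub>"
    if r: "r \<in> tensor_rels M N I \<rho> \<sigma>" for r
  proof -
    consider (ll) x x' y where "r = frag_of (x \<oplus>\<^bsub>M\<^esub> x', y) - frag_of (x, y) - frag_of (x', y)"
          "x \<in> carrier M" "x' \<in> carrier M" "y \<in> carrier N"
      | (rr) x y y' where "r = frag_of (x, y \<oplus>\<^bsub>N\<^esub> y') - frag_of (x, y) - frag_of (x, y')"
          "x \<in> carrier M" "y \<in> carrier N" "y' \<in> carrier N"
      | (bb) i x y where "r = frag_of (\<rho> i x, y) - frag_of (x, \<sigma> i y)"
          "i \<in> I" "x \<in> carrier M" "y \<in> carrier N"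
      using r unfolding tensor_rels_def by blast
    then show ?thesis
    proof cases
      case ll
      then have "(x \<oplus>\<^bsub>M\<^esub> x', y) \<in> S" "(x, y) \<in> S" "(x', y) \<in> S"
          "g (x \<oplus>\<^bsub>M\<^esub> x', y) = g (x, y) \<otimes>\<^bsub>G\<^esub> g (x', y)"
        by (auto simp: S_def g_def fl)
      then show ?thesis unfolding ll(1) using rel3 rel3_closed by blast
    next
      case rr
      then have "(x, y \<oplus>\<^bsub>N\<^esub> y') \<in> S" "(x, y) \<in> S" "(x, y') \<in> S"
          "g (x, y \<oplus>\<^bsub>N\<^esub> y') = g (x, y) \<otimes>\<^bsub>G\<^esub> g (x, y')"
        by (auto simp: S_def g_def fr)
      then show ?thesis unfolding rr(1) using rel3 rel3_closed by blast
    next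
      case bb
      then have "(\<rho> i x, y) \<in> S" "(x, \<sigma> i y) \<in> S" "g (\<rho> i x, y) = g (x, \<sigma> i y)"
        using \<rho> \<sigma> by (auto simp: S_def g_def fb)
      then show ?thesis unfolding bb(1) using rel2 rel2_closed by blast
    qed
  qed
  have car: "tensor_rels M N I \<rho> \<sigma> \<subseteq> carrier (free_Abelian_group S)" using rels by blast
  have rel: "lin_ext G g r = \<one>\<^bsub>G\<^esub>" if "r \<in> tensor_rels M N I \<rho> \<sigma>" for r
    using rels that by blast
  have "tlift G g (tclass (tensor M N I \<rho> \<sigma>) (frag_of (m, n))) = lin_ext G g (frag_of (m, n))"
    using mn by (intro tlift_tclass[OF G g car rel]) (auto simp: tensor_def S_def Let_def)
  then show ?thesis using mn by (simp add: tens_def S_def frag g_def[symmetric]) (simp add: g_def)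
qed


section \<open>Algebras and modules\<close>

definition opp :: "('b, 'x) ring_scheme \<Rightarrow> ('b, 'x) ring_scheme"
  where "opp B = B\<lparr>monoid.mult := \<lambda>x y. y \<otimes>\<^bsub>B\<^esub> x\<rparr>"

text \<open>Unital associative algebras over a field; the library locale \<open>algebra\<close> is commutative.\<close>

locale kalgebra = field K + A: ring A + module K A
  for K :: "('k, 'x) ring_scheme" and A :: "('k, 'a, 'y) module_scheme" +
  assumes smult_mult_left: "\<lbrakk>c \<in> carrier K; x \<in> carrier A; y \<in> carrier A\<rbrakk> \<Longrightarrow>
      (c \<odot>\<^bsub>A\<^esub> x) \<otimes>\<^bsub>A\<^esub> y = c \<odot>\<^bsub>A\<^esub> (x \<otimes>\<^bsub>A\<^esub> y)"
    and smult_mult_right: "\<lbrakk>c \<in> carrier K; x \<in> carrier A; y \<in> carrier A\<rbrakk> \<Longrightarrow>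
      x \<otimes>\<^bsub>A\<^esub> (c \<odot>\<^bsub>A\<^esub> y) = c \<odot>\<^bsub>A\<^esub> (x \<otimes>\<^bsub>A\<^esub> y)"

definition kalg_hom :: "('k, 'x) ring_scheme \<Rightarrow> ('k, 'a, 'y) module_scheme \<Rightarrow>
    ('k, 'c, 'z) module_scheme \<Rightarrow> ('a \<Rightarrow> 'c) set"
  where "kalg_hom K A C =
    {h \<in> ring_hom A C. \<forall>c\<in>carrier K. \<forall>x\<in>carrier A. h (c \<odot>\<^bsub>A\<^esub> x) = c \<odot>\<^bsub>C\<^esub> h x}"

text \<open>
  Left modules over a not necessarily commutative ring.  A module is the additive group of \<open>N\<close>
  together with an action; the multiplication of \<open>N\<close> is ignored.
\<close>

locale left_module = R: ring R + N: abelian_group N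
  for R :: "('r, 'x) ring_scheme" and N :: "('n, 'y) ring_scheme" and act :: "'r \<Rightarrow> 'n \<Rightarrow> 'n" +
  assumes act_closed: "\<lbrakk>r \<in> carrier R; x \<in> carrier N\<rbrakk> \<Longrightarrow> act r x \<in> carrier N"
    and act_add_left: "\<lbrakk>r \<in> carrier R; r' \<in> carrier R; x \<in> carrier N\<rbrakk> \<Longrightarrow>
      act (r \<oplus>\<^bsub>R\<^esub> r') x = act r x \<oplus>\<^bsub>N\<^esub> act r' x"
    and act_add_right: "\<lbrakk>r \<in> carrier R; x \<in> carrier N; x' \<in> carrier N\<rbrakk> \<Longrightarrow>
      act r (x \<oplus>\<^bsub>N\<^esub> x') = act r x \<oplus>\<^bsub>N\<^esub> act r x'"
    and act_mult: "\<lbrakk>r \<in> carrier R; r' \<in> carrier R; x \<in> carrier N\<rbrakk> \<Longrightarrow>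
      act (r \<otimes>\<^bsub>R\<^esub> r') x = act r (act r' x)"
    and act_one: "x \<in> carrier N \<Longrightarrow> act \<one>\<^bsub>R\<^esub> x = x"

definition left_module_hom :: "('r, 'x) ring_scheme \<Rightarrow> ('n, 'y) ring_scheme \<Rightarrow> ('r \<Rightarrow> 'n \<Rightarrow> 'n) \<Rightarrow>
    ('q, 'z) ring_scheme \<Rightarrow> ('r \<Rightarrow> 'q \<Rightarrow> 'q) \<Rightarrow> ('n \<Rightarrow> 'q) set"
  where "left_module_hom R N actN Q actQ =
    {f \<in> hom (add_monoid N) (add_monoid Q).
       \<forall>r\<in>carrier R. \<forall>x\<in>carrier N. f (actN r x) = actQ r (f x)}"

definition exact_at :: "('a, 'x) monoid_scheme \<Rightarrow> ('b, 'y) monoid_scheme \<Rightarrow> ('c, 'z) monoid_scheme \<Rightarrow>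
    ('a \<Rightarrow> 'b) \<Rightarrow> ('b \<Rightarrow> 'c) \<Rightarrow> bool"
  where "exact_at G H J f g \<longleftrightarrow> f ` carrier G = kernel H J g"

text \<open>
  Faithful flatness of a right \<open>R\<close>-module \<open>M\<close> with action \<open>act r m = m \<cdot> r\<close>: a sequence of left
  \<open>R\<close>-modules \<open>N1 \<rightarrow> N2 \<rightarrow> N3\<close> is exact iff \<open>M \<otimes>\<^sub>R N1 \<rightarrow> M \<otimes>\<^sub>R N2 \<rightarrow> M \<otimes>\<^sub>R N3\<close> is.  HOL cannot
  quantify over the carrier types of the \<open>N\<close>s, so these are fixed to \<open>('i \<Rightarrow> 'r) set\<close>.  The cosets
  that make up a quotient of the free module of finitely supported functions \<open>'i \<Rightarrow> 'r\<close> live there,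
  hence so does a copy of every \<open>R\<close>-module with a generating family indexed by \<open>'i\<close>, and also a copy
  of every left ideal of \<open>R\<close>.  Since left ideals detect flatness, and cyclic modules detect
  faithfulness of a flat module, the restriction does not change the notion, whatever \<open>'i\<close> is.
\<close>

definition tensor_over :: "('r, 'x) ring_scheme \<Rightarrow> ('m, 'y) ring_scheme \<Rightarrow> ('r \<Rightarrow> 'm \<Rightarrow> 'm) \<Rightarrow>
    ('n, 'z) ring_scheme \<Rightarrow> ('r \<Rightarrow> 'n \<Rightarrow> 'n) \<Rightarrow> (('m \<times> 'n) \<Rightarrow>\<^sub>0 int) set monoid"
  where "tensor_over R M actM N actN = tensor M N (carrier R) actM actN"

definition faithfully_flat_right ::
  "'i itself \<Rightarrow> ('r, 'x) ring_scheme \<Rightarrow> ('m, 'y) ring_scheme \<Rightarrow> ('r \<Rightarrow> 'm \<Rightarrow> 'm) \<Rightarrow> bool"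
  where "faithfully_flat_right TYPE('i) R M act \<longleftrightarrow>
    left_module (opp R) M act \<and>
    (\<forall>(N1 :: ('i \<Rightarrow> 'r) set ring) (N2 :: ('i \<Rightarrow> 'r) set ring) (N3 :: ('i \<Rightarrow> 'r) set ring) a1 a2 a3 f g.
       left_module R N1 a1 \<and> left_module R N2 a2 \<and> left_module R N3 a3 \<and>
       f \<in> left_module_hom R N1 a1 N2 a2 \<and> g \<in> left_module_hom R N2 a2 N3 a3 \<longrightarrow>
       (let T1 = tensor_over R M act N1 a1; T2 = tensor_over R M act N2 a2;
            T3 = tensor_over R M act N3 a3
        in exact_at (add_monoid N1) (add_monoid N2) (add_monoid N3) f g \<longleftrightarrow>
           exact_at T1 T2 T3 (tlift T2 (\<lambda>(m, x). tens T2 m (f x)))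
                             (tlift T3 (\<lambda>(m, x). tens T3 m (g x)))))"


section \<open>Left bialgebroids\<close>

text \<open>
  A \<open>B\<^sup>e\<close>-ring is given by source and target maps; \<open>src b\<close> and \<open>tgt b\<close> are the elements written
  \<open>b\<close> and \<open>\<bar>b\<close>.  The opposite algebra has the same carrier as \<open>B\<close>, so \<open>b \<mapsto> \<bar>b\<close> is the
  identity and \<open>tgt\<close> is an algebra map on \<open>opp B\<close>.
\<close>

record ('k, 'b, 'l) be_ring = "('k, 'l) module" +
  src :: "'b \<Rightarrow> 'l"
  tgt :: "'b \<Rightarrow> 'l"

record ('k, 'b, 'l) bialgebroid = "('k, 'b, 'l) be_ring" +
  cop :: "'l \<Rightarrow> (('l \<times> 'l) \<Rightarrow>\<^sub>0 int) set"
  cou :: "'l \<Rightarrow> 'b"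

locale Be_ring = B: kalgebra K B + L: kalgebra K L
  for K :: "('k, 'x) ring_scheme" and B :: "('k, 'b, 'y) module_scheme"
    and L :: "('k, 'b, 'l, 'z) be_ring_scheme" +
  assumes src_hom: "src L \<in> kalg_hom K B L"
    and tgt_hom: "tgt L \<in> kalg_hom K (opp B) L"
    and src_tgt_comm: "\<lbrakk>b \<in> carrier B; c \<in> carrier B\<rbrakk> \<Longrightarrow>
      src L b \<otimes>\<^bsub>L\<^esub> tgt L c = tgt L c \<otimes>\<^bsub>L\<^esub> src L b"

text \<open>\<open>M \<diamondop>\<^sub>B N\<close>, where \<open>\<bar>b m \<otimes> n = m \<otimes> b n\<close>\<close>

definition diamond :: "('b, 'y) ring_scheme \<Rightarrow> ('k, 'b, 'm, 'z) be_ring_scheme \<Rightarrow>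
    ('k, 'b, 'n, 'w) be_ring_scheme \<Rightarrow> (('m \<times> 'n) \<Rightarrow>\<^sub>0 int) set monoid"
  where "diamond B M N =
    tensor M N (carrier B) (\<lambda>b m. tgt M b \<otimes>\<^bsub>M\<^esub> m) (\<lambda>b n. src N b \<otimes>\<^bsub>N\<^esub> n)"

definition takeuchi :: "('b, 'y) ring_scheme \<Rightarrow> ('k, 'b, 'm, 'z) be_ring_scheme \<Rightarrow>
    ('k, 'b, 'n, 'w) be_ring_scheme \<Rightarrow> (('m \<times> 'n) \<Rightarrow>\<^sub>0 int) set set"
  where "takeuchi B M N =
    (let D = diamond B M N in
     {u \<in> carrier D. \<forall>a\<in>carrier B.
        tlift D (\<lambda>(m, n). tens D (m \<otimes>\<^bsub>M\<^esub> tgt M a) n) u =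
        tlift D (\<lambda>(m, n). tens D m (n \<otimes>\<^bsub>N\<^esub> src N a)) u})"

text \<open>The triple product \<open>L \<diamondop>\<^sub>B L \<diamondop>\<^sub>B L\<close>, in which coassociativity is stated\<close>

definition diamond3_rels :: "('b, 'y) ring_scheme \<Rightarrow> ('k, 'b, 'l, 'z) be_ring_scheme \<Rightarrow>
    (('l \<times> 'l \<times> 'l) \<Rightarrow>\<^sub>0 int) set"
  where "diamond3_rels B L =
      {frag_of (x \<oplus>\<^bsub>L\<^esub> x', y, z) - frag_of (x, y, z) - frag_of (x', y, z) |x x' y z.
         x \<in> carrier L \<and> x' \<in> carrier L \<and> y \<in> carrier L \<and> z \<in> carrier L}
    \<union> {frag_of (x, y \<oplus>\<^bsub>L\<^esub> y', z) - frag_of (x, y, z) - frag_of (x, y', z) |x y y' z.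
         x \<in> carrier L \<and> y \<in> carrier L \<and> y' \<in> carrier L \<and> z \<in> carrier L}
    \<union> {frag_of (x, y, z \<oplus>\<^bsub>L\<^esub> z') - frag_of (x, y, z) - frag_of (x, y, z') |x y z z'.
         x \<in> carrier L \<and> y \<in> carrier L \<and> z \<in> carrier L \<and> z' \<in> carrier L}
    \<union> {frag_of (tgt L b \<otimes>\<^bsub>L\<^esub> x, y, z) - frag_of (x, src L b \<otimes>\<^bsub>L\<^esub> y, z) |b x y z.
         b \<in> carrier B \<and> x \<in> carrier L \<and> y \<in> carrier L \<and> z \<in> carrier L}
    \<union> {frag_of (x, tgt L b \<otimes>\<^bsub>L\<^esub> y, z) - frag_of (x, y, src L b \<otimes>\<^bsub>L\<^esub> z) |b x y z.
         b \<in> carrier B \<and> x \<in> carrier L \<and> y \<in> carrier L \<and> z \<in> carrier L}"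

definition diamond3 :: "('b, 'y) ring_scheme \<Rightarrow> ('k, 'b, 'l, 'z) be_ring_scheme \<Rightarrow>
    (('l \<times> 'l \<times> 'l) \<Rightarrow>\<^sub>0 int) set monoid"
  where "diamond3 B L =
    (let F = free_Abelian_group (carrier L \<times> carrier L \<times> carrier L)
     in F Mod generate F (diamond3_rels B L))"

text \<open>
  Sweedler notation: \<open>sw G L f X\<close> is \<open>f X\<^sub>(\<^sub>1\<^sub>) X\<^sub>(\<^sub>2\<^sub>)\<close>, summed in the abelian group \<open>G\<close>, and \<open>sw3 G L f X\<close>
  is \<open>f X\<^sub>(\<^sub>1\<^sub>) X\<^sub>(\<^sub>2\<^sub>) X\<^sub>(\<^sub>3\<^sub>)\<close> for \<open>X\<^sub>(\<^sub>1\<^sub>) \<otimes> X\<^sub>(\<^sub>2\<^sub>) \<otimes> X\<^sub>(\<^sub>3\<^sub>) = (id \<otimes> \<Delta>) (\<Delta> X)\<close>.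
\<close>

definition sw :: "('a, 'w) monoid_scheme \<Rightarrow> ('k, 'b, 'l, 'z) bialgebroid_scheme \<Rightarrow>
    ('l \<Rightarrow> 'l \<Rightarrow> 'a) \<Rightarrow> 'l \<Rightarrow> 'a"
  where "sw G L f X = tlift G (\<lambda>(x, y). f x y) (cop L X)"

definition sw3 :: "('a, 'w) monoid_scheme \<Rightarrow> ('k, 'b, 'l, 'z) bialgebroid_scheme \<Rightarrow>
    ('l \<Rightarrow> 'l \<Rightarrow> 'l \<Rightarrow> 'a) \<Rightarrow> 'l \<Rightarrow> 'a"
  where "sw3 G L f X = sw G L (\<lambda>x1 y. sw G L (\<lambda>x2 x3. f x1 x2 x3) y) X"

locale left_bialgebroid = Be_ring K B L
  for K :: "('k, 'x) ring_scheme" and B :: "('k, 'b, 'y) module_scheme"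
    and L :: "('k, 'b, 'l, 'z) bialgebroid_scheme" +
  assumes cop_closed: "X \<in> carrier L \<Longrightarrow> cop L X \<in> takeuchi B L L"
    and cop_add: "\<lbrakk>X \<in> carrier L; Y \<in> carrier L\<rbrakk> \<Longrightarrow>
      cop L (X \<oplus>\<^bsub>L\<^esub> Y) = cop L X \<otimes>\<^bsub>diamond B L L\<^esub> cop L Y"
    and cop_linear: "\<lbrakk>b \<in> carrier B; c \<in> carrier B; X \<in> carrier L\<rbrakk> \<Longrightarrow>
      cop L (src L b \<otimes>\<^bsub>L\<^esub> tgt L c \<otimes>\<^bsub>L\<^esub> X) =
      sw (diamond B L L) L
        (\<lambda>X1 X2. tens (diamond B L L) (src L b \<otimes>\<^bsub>L\<^esub> X1) (tgt L c \<otimes>\<^bsub>L\<^esub> X2)) X"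
    and cou_closed: "X \<in> carrier L \<Longrightarrow> cou L X \<in> carrier B"
    and cou_add: "\<lbrakk>X \<in> carrier L; Y \<in> carrier L\<rbrakk> \<Longrightarrow> cou L (X \<oplus>\<^bsub>L\<^esub> Y) = cou L X \<oplus>\<^bsub>B\<^esub> cou L Y"
    and cou_linear: "\<lbrakk>b \<in> carrier B; c \<in> carrier B; X \<in> carrier L\<rbrakk> \<Longrightarrow>
      cou L (src L b \<otimes>\<^bsub>L\<^esub> tgt L c \<otimes>\<^bsub>L\<^esub> X) = b \<otimes>\<^bsub>B\<^esub> cou L X \<otimes>\<^bsub>B\<^esub> c"
    and coassoc: "X \<in> carrier L \<Longrightarrow>
      sw (diamond3 B L) L (\<lambda>Y X3.
        sw (diamond3 B L) L (\<lambda>X1 X2. tclass (diamond3 B L) (frag_of (X1, X2, X3))) Y) X =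
      sw (diamond3 B L) L (\<lambda>X1 Y.
        sw (diamond3 B L) L (\<lambda>X2 X3. tclass (diamond3 B L) (frag_of (X1, X2, X3))) Y) X"
    and counit_left: "X \<in> carrier L \<Longrightarrow>
      sw (add_monoid L) L (\<lambda>X1 X2. src L (cou L X1) \<otimes>\<^bsub>L\<^esub> X2) X = X"
    and counit_right: "X \<in> carrier L \<Longrightarrow>
      sw (add_monoid L) L (\<lambda>X1 X2. tgt L (cou L X2) \<otimes>\<^bsub>L\<^esub> X1) X = X"
    and cop_mult: "\<lbrakk>X \<in> carrier L; Y \<in> carrier L\<rbrakk> \<Longrightarrow>
      cop L (X \<otimes>\<^bsub>L\<^esub> Y) =
      sw (diamond B L L) L (\<lambda>X1 X2. sw (diamond B L L) L (\<lambda>Y1 Y2.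
        tens (diamond B L L) (X1 \<otimes>\<^bsub>L\<^esub> Y1) (X2 \<otimes>\<^bsub>L\<^esub> Y2)) Y) X"
    and cop_one: "cop L \<one>\<^bsub>L\<^esub> = tens (diamond B L L) \<one>\<^bsub>L\<^esub> \<one>\<^bsub>L\<^esub>"
    and cou_one: "cou L \<one>\<^bsub>L\<^esub> = \<one>\<^bsub>B\<^esub>"
    and cou_mult_src: "\<lbrakk>X \<in> carrier L; Y \<in> carrier L\<rbrakk> \<Longrightarrow>
      cou L (X \<otimes>\<^bsub>L\<^esub> src L (cou L Y)) = cou L (X \<otimes>\<^bsub>L\<^esub> Y)"
    and cou_mult_tgt: "\<lbrakk>X \<in> carrier L; Y \<in> carrier L\<rbrakk> \<Longrightarrow>
      cou L (X \<otimes>\<^bsub>L\<^esub> tgt L (cou L Y)) = cou L (X \<otimes>\<^bsub>L\<^esub> Y)"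

text \<open>
  The right \<open>B\<close>-, left \<open>B\<close>-, right \<open>\<bar>B\<close>- and left \<open>\<bar>B\<close>-module structures of \<open>L\<close>, in this order.
  Left modules over a ring are right modules over its opposite.
\<close>

definition faithfully_flat_over_base ::
  "'i itself \<Rightarrow> ('b, 'y) ring_scheme \<Rightarrow> ('k, 'b, 'l, 'z) be_ring_scheme \<Rightarrow> bool"
  where "faithfully_flat_over_base I B L \<longleftrightarrow>
    faithfully_flat_right I B L (\<lambda>b X. X \<otimes>\<^bsub>L\<^esub> src L b) \<and>
    faithfully_flat_right I (opp B) L (\<lambda>b X. src L b \<otimes>\<^bsub>L\<^esub> X) \<and>
    faithfully_flat_right I (opp B) L (\<lambda>b X. X \<otimes>\<^bsub>L\<^esub> tgt L b) \<and>
    faithfully_flat_right I B L (\<lambda>b X. tgt L b \<otimes>\<^bsub>L\<^esub> X)"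


section \<open>Left Hopf algebroids and skew pairings\<close>

text \<open>\<open>L \<otimes> L\<close> over \<open>\<bar>B\<close>, where \<open>X \<bar>b \<otimes> Y = X \<otimes> \<bar>b Y\<close>\<close>

definition tensor_bar :: "('b, 'y) ring_scheme \<Rightarrow> ('k, 'b, 'l, 'z) be_ring_scheme \<Rightarrow>
    (('l \<times> 'l) \<Rightarrow>\<^sub>0 int) set monoid"
  where "tensor_bar B L =
    tensor L L (carrier B) (\<lambda>b X. X \<otimes>\<^bsub>L\<^esub> tgt L b) (\<lambda>b Y. tgt L b \<otimes>\<^bsub>L\<^esub> Y)"

definition galois_map :: "('b, 'y) ring_scheme \<Rightarrow> ('k, 'b, 'l, 'z) bialgebroid_scheme \<Rightarrow>
    (('l \<times> 'l) \<Rightarrow>\<^sub>0 int) set \<Rightarrow> (('l \<times> 'l) \<Rightarrow>\<^sub>0 int) set"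
  where "galois_map B L =
    (let D = diamond B L L
     in tlift D (\<lambda>(X, Y). sw D L (\<lambda>X1 X2. tens D X1 (X2 \<otimes>\<^bsub>L\<^esub> Y)) X))"

locale left_hopf_algebroid = left_bialgebroid K B L
  for K :: "('k, 'x) ring_scheme" and B :: "('k, 'b, 'y) module_scheme"
    and L :: "('k, 'b, 'l, 'z) bialgebroid_scheme" +
  assumes galois_bij:
    "bij_betw (galois_map B L) (carrier (tensor_bar B L)) (carrier (diamond B L L))"

text \<open>\<open>X\<^sub>+ \<otimes> X\<^sub>-\<close>\<close>

definition plus_minus :: "('b, 'y) ring_scheme \<Rightarrow> ('k, 'b, 'l, 'z) bialgebroid_scheme \<Rightarrow>
    'l \<Rightarrow> (('l \<times> 'l) \<Rightarrow>\<^sub>0 int) set"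
  where "plus_minus B L X =
    inv_into (carrier (tensor_bar B L)) (galois_map B L) (tens (diamond B L L) X \<one>\<^bsub>L\<^esub>)"

locale skew_pairing = L: left_bialgebroid K B L + P: left_bialgebroid K B P
  for K :: "('k, 'x) ring_scheme" and B :: "('k, 'b, 'y) module_scheme"
    and L :: "('k, 'b, 'l, 'z) bialgebroid_scheme"
    and P :: "('k, 'b, 'p, 'w) bialgebroid_scheme" +
  fixes \<tau> :: "'l \<Rightarrow> 'p \<Rightarrow> 'b"
  assumes closed: "\<lbrakk>X \<in> carrier L; \<alpha> \<in> carrier P\<rbrakk> \<Longrightarrow> \<tau> X \<alpha> \<in> carrier B"
    and add_left: "\<lbrakk>X \<in> carrier L; Y \<in> carrier L; \<alpha> \<in> carrier P\<rbrakk> \<Longrightarrow>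
      \<tau> (X \<oplus>\<^bsub>L\<^esub> Y) \<alpha> = \<tau> X \<alpha> \<oplus>\<^bsub>B\<^esub> \<tau> Y \<alpha>"
    and add_right: "\<lbrakk>X \<in> carrier L; \<alpha> \<in> carrier P; \<beta> \<in> carrier P\<rbrakk> \<Longrightarrow>
      \<tau> X (\<alpha> \<oplus>\<^bsub>P\<^esub> \<beta>) = \<tau> X \<alpha> \<oplus>\<^bsub>B\<^esub> \<tau> X \<beta>"
    and smult_left: "\<lbrakk>r \<in> carrier K; X \<in> carrier L; \<alpha> \<in> carrier P\<rbrakk> \<Longrightarrow>
      \<tau> (r \<odot>\<^bsub>L\<^esub> X) \<alpha> = r \<odot>\<^bsub>B\<^esub> \<tau> X \<alpha>"
    and smult_right: "\<lbrakk>r \<in> carrier K; X \<in> carrier L; \<alpha> \<in> carrier P\<rbrakk> \<Longrightarrow>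
      \<tau> X (r \<odot>\<^bsub>P\<^esub> \<alpha>) = r \<odot>\<^bsub>B\<^esub> \<tau> X \<alpha>"
    and base: "\<lbrakk>a \<in> carrier B; b \<in> carrier B; c \<in> carrier B; d \<in> carrier B; f \<in> carrier B;
        X \<in> carrier L; \<alpha> \<in> carrier P\<rbrakk> \<Longrightarrow>
      \<tau> (src L a \<otimes>\<^bsub>L\<^esub> tgt L b \<otimes>\<^bsub>L\<^esub> X \<otimes>\<^bsub>L\<^esub> src L c \<otimes>\<^bsub>L\<^esub> tgt L d) \<alpha> \<otimes>\<^bsub>B\<^esub> f =
      a \<otimes>\<^bsub>B\<^esub> \<tau> X (src P c \<otimes>\<^bsub>P\<^esub> tgt P f \<otimes>\<^bsub>P\<^esub> \<alpha> \<otimes>\<^bsub>P\<^esub> src P d \<otimes>\<^bsub>P\<^esub> tgt P b)"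
    and mult_right_1: "\<lbrakk>X \<in> carrier L; \<alpha> \<in> carrier P; \<beta> \<in> carrier P\<rbrakk> \<Longrightarrow>
      \<tau> X (\<alpha> \<otimes>\<^bsub>P\<^esub> \<beta>) = sw (add_monoid B) L (\<lambda>X1 X2. \<tau> X1 (\<alpha> \<otimes>\<^bsub>P\<^esub> tgt P (\<tau> X2 \<beta>))) X"
    and mult_right_2: "\<lbrakk>X \<in> carrier L; \<alpha> \<in> carrier P; \<beta> \<in> carrier P\<rbrakk> \<Longrightarrow>
      \<tau> X (\<alpha> \<otimes>\<^bsub>P\<^esub> \<beta>) = sw (add_monoid B) L (\<lambda>X1 X2. \<tau> (tgt L (\<tau> X2 \<beta>) \<otimes>\<^bsub>L\<^esub> X1) \<alpha>) X"
    and mult_left_1: "\<lbrakk>X \<in> carrier L; Y \<in> carrier L; \<alpha> \<in> carrier P\<rbrakk> \<Longrightarrow>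
      \<tau> (X \<otimes>\<^bsub>L\<^esub> Y) \<alpha> = sw (add_monoid B) P (\<lambda>\<alpha>1 \<alpha>2. \<tau> (X \<otimes>\<^bsub>L\<^esub> src L (\<tau> Y \<alpha>1)) \<alpha>2) \<alpha>"
    and mult_left_2: "\<lbrakk>X \<in> carrier L; Y \<in> carrier L; \<alpha> \<in> carrier P\<rbrakk> \<Longrightarrow>
      \<tau> (X \<otimes>\<^bsub>L\<^esub> Y) \<alpha> = sw (add_monoid B) P (\<lambda>\<alpha>1 \<alpha>2. \<tau> X (src P (\<tau> Y \<alpha>1) \<otimes>\<^bsub>P\<^esub> \<alpha>2)) \<alpha>"
    and one_right: "X \<in> carrier L \<Longrightarrow> \<tau> X \<one>\<^bsub>P\<^esub> = cou L X"
    and one_left: "\<alpha> \<in> carrier P \<Longrightarrow> \<tau> \<one>\<^bsub>L\<^esub> \<alpha> = cou P \<alpha>"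


section \<open>Double cross products\<close>

text \<open>\<open>P \<otimes> L\<close> over \<open>B\<^sup>e\<close>, where \<open>\<alpha> b \<bar>c \<otimes> X = \<alpha> \<otimes> b \<bar>c X\<close>\<close>

definition tensor_Be :: "('b, 'y) ring_scheme \<Rightarrow> ('k, 'b, 'p, 'w) be_ring_scheme \<Rightarrow>
    ('k, 'b, 'l, 'z) be_ring_scheme \<Rightarrow> (('p \<times> 'l) \<Rightarrow>\<^sub>0 int) set monoid"
  where "tensor_Be B P L = tensor P L (carrier B \<times> carrier B)
    (\<lambda>(b, c) \<alpha>. \<alpha> \<otimes>\<^bsub>P\<^esub> src P b \<otimes>\<^bsub>P\<^esub> tgt P c) (\<lambda>(b, c) X. src L b \<otimes>\<^bsub>L\<^esub> tgt L c \<otimes>\<^bsub>L\<^esub> X)"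

text \<open>
  The value of \<open>(\<alpha> \<otimes> X) \<cdot> (\<beta> \<otimes> Y)\<close>; the two outer sums run over
  \<open>\<beta>\<^sub>(\<^sub>1\<^sub>) \<otimes> \<beta>\<^sub>(\<^sub>2\<^sub>)\<^sub>+ \<otimes> \<beta>\<^sub>(\<^sub>2\<^sub>)\<^sub>-\<close>, bound to \<open>\<beta>1\<close>, \<open>\<beta>p\<close>, \<open>\<beta>m\<close>.
\<close>

definition bowtie_mult_pure :: "('b, 'y) ring_scheme \<Rightarrow> ('k, 'b, 'p, 'w) bialgebroid_scheme \<Rightarrow>
    ('k, 'b, 'l, 'z) bialgebroid_scheme \<Rightarrow> ('l \<Rightarrow> 'p \<Rightarrow> 'b) \<Rightarrow> ('l \<Rightarrow> 'p \<Rightarrow> 'b) \<Rightarrow>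
    'p \<Rightarrow> 'l \<Rightarrow> 'p \<Rightarrow> 'l \<Rightarrow> (('p \<times> 'l) \<Rightarrow>\<^sub>0 int) set"
  where "bowtie_mult_pure B P L \<tau> \<kappa> \<alpha> X \<beta> Y =
    (let T = tensor_Be B P L in
     sw T P (\<lambda>\<beta>1 \<beta>2. tlift T (\<lambda>(\<beta>p, \<beta>m).
       sw3 T L (\<lambda>X1 X2 X3.
         tens T (\<alpha> \<otimes>\<^bsub>P\<^esub> src P (\<tau> X1 \<beta>1) \<otimes>\<^bsub>P\<^esub> \<beta>p) (tgt L (\<kappa> X3 \<beta>m) \<otimes>\<^bsub>L\<^esub> X2 \<otimes>\<^bsub>L\<^esub> Y)) X)
       (plus_minus B P \<beta>2)) \<beta>)"

text \<open>
  The \<open>B\<^sup>e\<close>-ring \<open>P \<^sup>\<tau>\<bowtie>\<^sub>\<kappa> L\<close>.  Products are \<open>undefined\<close> outside the carrier, so that equality of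
  records below is equality of structures.
\<close>

definition bowtie :: "('b, 'y) ring_scheme \<Rightarrow> ('k, 'b, 'p, 'w) bialgebroid_scheme \<Rightarrow>
    ('k, 'b, 'l, 'z) bialgebroid_scheme \<Rightarrow> ('l \<Rightarrow> 'p \<Rightarrow> 'b) \<Rightarrow> ('l \<Rightarrow> 'p \<Rightarrow> 'b) \<Rightarrow>
    ('k, 'b, (('p \<times> 'l) \<Rightarrow>\<^sub>0 int) set) be_ring"
  where "bowtie B P L \<tau> \<kappa> =
    (let T = tensor_Be B P L in
     \<lparr>carrier = carrier T,
      monoid.mult = (\<lambda>V\<in>carrier T. \<lambda>W\<in>carrier T.
        tlift T (\<lambda>(\<alpha>, X). tlift T (\<lambda>(\<beta>, Y). bowtie_mult_pure B P L \<tau> \<kappa> \<alpha> X \<beta> Y) W) V),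
      one = tens T \<one>\<^bsub>P\<^esub> \<one>\<^bsub>L\<^esub>,
      ring.zero = \<one>\<^bsub>T\<^esub>,
      ring.add = (\<otimes>\<^bsub>T\<^esub>),
      smult = (\<lambda>c. tlift T (\<lambda>(\<alpha>, X). tens T (c \<odot>\<^bsub>P\<^esub> \<alpha>) X)),
      src = (\<lambda>b. tens T (src P b) \<one>\<^bsub>L\<^esub>),
      tgt = (\<lambda>b. tens T (tgt P b) \<one>\<^bsub>L\<^esub>)\<rparr>)"

definition bowtie_bialgebroid :: "('b, 'y) ring_scheme \<Rightarrow> ('k, 'b, 'p, 'w) bialgebroid_scheme \<Rightarrow>
    ('k, 'b, 'l, 'z) bialgebroid_scheme \<Rightarrow> ('l \<Rightarrow> 'p \<Rightarrow> 'b) \<Rightarrow>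
    ('k, 'b, (('p \<times> 'l) \<Rightarrow>\<^sub>0 int) set) bialgebroid"
  where "bowtie_bialgebroid B P L \<tau> =
    (let T = tensor_Be B P L; H = bowtie B P L \<tau> \<tau>; D = diamond B H H in
     be_ring.extend H (bialgebroid.fields
       (tlift D (\<lambda>(\<alpha>, X). sw D P (\<lambda>\<alpha>1 \<alpha>2. sw D L (\<lambda>X1 X2.
          tens D (tens T \<alpha>1 X1) (tens T \<alpha>2 X2)) X) \<alpha>))
       (tlift (add_monoid B) (\<lambda>(\<alpha>, X). cou P (\<alpha> \<otimes>\<^bsub>P\<^esub> src P (cou L X))))))"


section \<open>Two-cocycles and twists\<close>

text \<open>
  Left \<open>B\<^sup>e\<close>-linear maps from \<open>H \<otimes> H\<close>, tensored over \<open>B\<^sup>e\<close>, to \<open>B\<close>, given as balanced functions of two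
  arguments.  The action of \<open>B\<^sup>e\<close> on \<open>B\<close> is \<open>b \<bar>c \<cdot> a = b a c\<close>.
\<close>

definition Be_hom2 :: "('b, 'y) ring_scheme \<Rightarrow> ('k, 'b, 'h, 'z) be_ring_scheme \<Rightarrow> ('h \<Rightarrow> 'h \<Rightarrow> 'b) set"
  where "Be_hom2 B H = {\<Gamma>.
    (\<forall>V\<in>carrier H. \<forall>W\<in>carrier H. \<Gamma> V W \<in> carrier B) \<and>
    (\<forall>V\<in>carrier H. \<forall>V'\<in>carrier H. \<forall>W\<in>carrier H. \<Gamma> (V \<oplus>\<^bsub>H\<^esub> V') W = \<Gamma> V W \<oplus>\<^bsub>B\<^esub> \<Gamma> V' W) \<and>
    (\<forall>V\<in>carrier H. \<forall>W\<in>carrier H. \<forall>W'\<in>carrier H. \<Gamma> V (W \<oplus>\<^bsub>H\<^esub> W') = \<Gamma> V W \<oplus>\<^bsub>B\<^esub> \<Gamma> V W') \<and>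
    (\<forall>V\<in>carrier H. \<forall>W\<in>carrier H. \<forall>b\<in>carrier B. \<forall>c\<in>carrier B.
       \<Gamma> (V \<otimes>\<^bsub>H\<^esub> src H b \<otimes>\<^bsub>H\<^esub> tgt H c) W = \<Gamma> V (src H b \<otimes>\<^bsub>H\<^esub> tgt H c \<otimes>\<^bsub>H\<^esub> W)) \<and>
    (\<forall>V\<in>carrier H. \<forall>W\<in>carrier H. \<forall>b\<in>carrier B. \<forall>c\<in>carrier B.
       \<Gamma> (src H b \<otimes>\<^bsub>H\<^esub> tgt H c \<otimes>\<^bsub>H\<^esub> V) W = b \<otimes>\<^bsub>B\<^esub> \<Gamma> V W \<otimes>\<^bsub>B\<^esub> c)}"

definition conv :: "('b, 'y) ring_scheme \<Rightarrow> ('k, 'b, 'h, 'z) bialgebroid_scheme \<Rightarrow>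
    ('h \<Rightarrow> 'h \<Rightarrow> 'b) \<Rightarrow> ('h \<Rightarrow> 'h \<Rightarrow> 'b) \<Rightarrow> 'h \<Rightarrow> 'h \<Rightarrow> 'b"
  where "conv B H f g V W =
    sw (add_monoid B) H (\<lambda>V1 V2. sw (add_monoid B) H (\<lambda>W1 W2. f V1 W1 \<otimes>\<^bsub>B\<^esub> g V2 W2) W) V"

definition conv_inverse :: "('b, 'y) ring_scheme \<Rightarrow> ('k, 'b, 'h, 'z) bialgebroid_scheme \<Rightarrow>
    ('h \<Rightarrow> 'h \<Rightarrow> 'b) \<Rightarrow> ('h \<Rightarrow> 'h \<Rightarrow> 'b) \<Rightarrow> bool"
  where "conv_inverse B H \<Gamma> \<Gamma>' \<longleftrightarrow> \<Gamma> \<in> Be_hom2 B H \<and> \<Gamma>' \<in> Be_hom2 B H \<and>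
    (\<forall>V\<in>carrier H. \<forall>W\<in>carrier H.
       conv B H \<Gamma> \<Gamma>' V W = cou H (V \<otimes>\<^bsub>H\<^esub> W) \<and> conv B H \<Gamma>' \<Gamma> V W = cou H (V \<otimes>\<^bsub>H\<^esub> W))"

locale two_cocycle = left_bialgebroid K B H
  for K :: "('k, 'x) ring_scheme" and B :: "('k, 'b, 'y) module_scheme"
    and H :: "('k, 'b, 'h, 'z) bialgebroid_scheme" +
  fixes \<Gamma> :: "'h \<Rightarrow> 'h \<Rightarrow> 'b"
  assumes Be_hom: "\<Gamma> \<in> Be_hom2 B H"
    and invertible: "\<exists>\<Gamma>'. conv_inverse B H \<Gamma> \<Gamma>'"
    and cocycle: "\<lbrakk>U \<in> carrier H; V \<in> carrier H; W \<in> carrier H\<rbrakk> \<Longrightarrow>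
      \<Gamma> U (sw (add_monoid H) H (\<lambda>V1 V2. sw (add_monoid H) H (\<lambda>W1 W2.
              src H (\<Gamma> V1 W1) \<otimes>\<^bsub>H\<^esub> (V2 \<otimes>\<^bsub>H\<^esub> W2)) W) V) =
      \<Gamma> (sw (add_monoid H) H (\<lambda>U1 U2. sw (add_monoid H) H (\<lambda>V1 V2.
              src H (\<Gamma> U1 V1) \<otimes>\<^bsub>H\<^esub> (U2 \<otimes>\<^bsub>H\<^esub> V2)) V) U) W"
    and normalised: "V \<in> carrier H \<Longrightarrow> \<Gamma> \<one>\<^bsub>H\<^esub> V = cou H V \<and> \<Gamma> V \<one>\<^bsub>H\<^esub> = cou H V"
    and right_base: "\<lbrakk>V \<in> carrier H; W \<in> carrier H; b \<in> carrier B\<rbrakk> \<Longrightarrow>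
      \<Gamma> V (W \<otimes>\<^bsub>H\<^esub> src H b) = \<Gamma> V (W \<otimes>\<^bsub>H\<^esub> tgt H b)"

text \<open>\<open>H\<^sup>\<Gamma>\<close>, where \<open>\<Gamma>'\<close> is the convolution inverse of \<open>\<Gamma>\<close>\<close>

definition cocycle_twist :: "('k, 'b, 'h, 'z) bialgebroid_scheme \<Rightarrow>
    ('h \<Rightarrow> 'h \<Rightarrow> 'b) \<Rightarrow> ('h \<Rightarrow> 'h \<Rightarrow> 'b) \<Rightarrow> ('k, 'b, 'h, 'z) bialgebroid_scheme"
  where "cocycle_twist H \<Gamma> \<Gamma>' =
    H\<lparr>monoid.mult := \<lambda>V\<in>carrier H. \<lambda>W\<in>carrier H.
      sw3 (add_monoid H) H (\<lambda>V1 V2 V3. sw3 (add_monoid H) H (\<lambda>W1 W2 W3.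
        src H (\<Gamma> V1 W1) \<otimes>\<^bsub>H\<^esub> tgt H (\<Gamma>' V3 W3) \<otimes>\<^bsub>H\<^esub> (V2 \<otimes>\<^bsub>H\<^esub> W2)) W) V\<rparr>"

text \<open>
  The one-sided twist of a left comodule algebra \<open>A\<close> with coaction
  \<open>\<delta> p = p\<^sub>(\<^sub>-\<^sub>1\<^sub>) \<otimes> p\<^sub>(\<^sub>0\<^sub>)\<close> in \<open>H \<diamondop>\<^sub>B A\<close>.  The regular comodule algebra is \<open>H\<close> with coaction \<open>cop H\<close>.
\<close>

definition left_twist :: "('h \<Rightarrow> 'h \<Rightarrow> 'b) \<Rightarrow> ('a \<Rightarrow> (('h \<times> 'a) \<Rightarrow>\<^sub>0 int) set) \<Rightarrow>
    ('k, 'b, 'a, 'z) be_ring_scheme \<Rightarrow> ('k, 'b, 'a, 'z) be_ring_scheme"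
  where "left_twist \<Gamma> \<delta> A =
    A\<lparr>monoid.mult := \<lambda>p\<in>carrier A. \<lambda>q\<in>carrier A.
      tlift (add_monoid A) (\<lambda>(p1, p0). tlift (add_monoid A) (\<lambda>(q1, q0).
        src A (\<Gamma> p1 q1) \<otimes>\<^bsub>A\<^esub> (p0 \<otimes>\<^bsub>A\<^esub> q0)) (\<delta> q)) (\<delta> p)\<rparr>"

end

theory Submission
  imports Defs
begin

text \<open>
  The product of \<open>P \<^sup>\<tau>\<bowtie>\<^sub>\<kappa> L\<close> is \<open>(\<alpha> \<otimes> X) (\<beta> \<otimes> Y) = \<alpha> (X \<cdot> \<beta>) Y\<close>, where \<open>X\<close> is moved past \<open>\<beta>\<close> by the exchange
  \<open>X \<otimes> \<beta> \<mapsto> \<tau>[X\<^sub>(\<^sub>1\<^sub>)|\<beta>\<^sub>(\<^sub>1\<^sub>)] \<beta>\<^sub>(\<^sub>2\<^sub>)\<^sub>+ \<otimes> \<bar>\<kappa>[X\<^sub>(\<^sub>3\<^sub>)|\<beta>\<^sub>(\<^sub>2\<^sub>)\<^sub>-] X\<^sub>(\<^sub>2\<^sub>)\<close>.  The exchange is the composite of a left half, which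
  uses \<open>\<tau>\<close> and the two coproducts, and a right half, which uses \<open>\<kappa>\<close> and the translation map
  \<open>\<beta> \<mapsto> \<beta>\<^sub>+ \<otimes> \<beta>\<^sub>-\<close> of \<open>P\<close>.  Each half is compatible with products (\<open>lcross_mult_L\<close> to \<open>rcross_mult_P\<close>) and the
  halves commute with each other, so the product is associative for any two pairings (\<open>mult_assoc\<close>).

  The key fact is that the right half for \<open>\<kappa>\<close> on the first leg of a coproduct cancels the left half for the
  same \<open>\<kappa>\<close> on the second leg (\<open>rcross_lcross_cancel\<close>); this is where \<open>\<beta>\<^sub>(\<^sub>1\<^sub>)\<^sub>+ \<otimes> \<beta>\<^sub>(\<^sub>1\<^sub>)\<^sub>- \<beta>\<^sub>(\<^sub>2\<^sub>) = \<beta> \<otimes> 1\<close> enters.  Inserting this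
  cancelling pair into the exchange for \<open>\<tau>, \<sigma>\<close> shows, for any three skew pairings,
  \<open>\<Delta>(V \<cdot>\<^sub>\<tau>\<^sub>\<sigma> W) = (V\<^sub>(\<^sub>1\<^sub>) \<cdot>\<^sub>\<tau>\<^sub>\<kappa> W\<^sub>(\<^sub>1\<^sub>)) \<otimes> (V\<^sub>(\<^sub>2\<^sub>) \<cdot>\<^sub>\<kappa>\<^sub>\<sigma> W\<^sub>(\<^sub>2\<^sub>))\<close>, which is lemma \<open>Sw_mult\<close>.  For equal pairings it says that
  the coproduct of \<open>P \<^sup>\<tau>\<bowtie>\<^sub>\<tau> L\<close> is multiplicative.  Applying the counit to the first leg gives
  \<open>V \<cdot>\<^sub>\<tau>\<^sub>\<sigma> W = \<Gamma>(V\<^sub>(\<^sub>1\<^sub>), W\<^sub>(\<^sub>1\<^sub>)) (V\<^sub>(\<^sub>2\<^sub>) \<cdot>\<^sub>\<kappa>\<^sub>\<sigma> W\<^sub>(\<^sub>2\<^sub>))\<close> with \<open>\<Gamma>(V, W) = \<epsilon>(V \<cdot>\<^sub>\<tau>\<^sub>\<kappa> W)\<close>, and applying it to the second leg gives the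
  mirror image (\<open>twist_left\<close>, \<open>twist_right\<close>).  The case \<open>\<sigma> = \<kappa>\<close> is the one-sided twist; splitting the second
  factor once more in the case \<open>\<sigma> = \<tau>\<close> gives the two-sided twist.  Applying the counit to both legs gives
  \<open>\<epsilon>(V\<^sub>(\<^sub>1\<^sub>) \<cdot>\<^sub>\<tau>\<^sub>\<kappa> W\<^sub>(\<^sub>1\<^sub>)) \<epsilon>(V\<^sub>(\<^sub>2\<^sub>) \<cdot>\<^sub>\<kappa>\<^sub>\<sigma> W\<^sub>(\<^sub>2\<^sub>)) = \<epsilon>(V \<cdot>\<^sub>\<tau>\<^sub>\<sigma> W)\<close> (\<open>conv_cou\<close>), and since \<open>\<epsilon>(V \<cdot>\<^sub>\<tau>\<^sub>\<tau> W) = \<epsilon>(V \<cdot>\<^sub>\<tau>\<^sub>\<tau> \<epsilon>(W))\<close> is the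
  same for every \<open>\<tau>\<close> (\<open>cou_mult_cong\<close>), \<open>\<epsilon>(V \<cdot>\<^sub>\<kappa>\<^sub>\<tau> W)\<close> is the convolution inverse.  By the one-sided twist the
  two sides of the cocycle condition are \<open>\<epsilon>\<close> of the two bracketings of \<open>U \<cdot>\<^sub>\<tau>\<^sub>\<kappa> V \<cdot>\<^sub>\<tau>\<^sub>\<kappa> W\<close>, so that condition is
  associativity.

  An equation in a group of cosets is proved here by applying additive maps to both sides.  The type
  \<open>'a ambient\<close> contains a copy of every abelian group whose elements have type \<open>'a\<close>, so additive maps into it
  suffice (\<open>group_eqI\<close>).  After this step all terms are finite sums in a type of class \<open>ab_group_add\<close>, written
  \<open>Sw\<close>, \<open>Pm\<close>, \<open>Te\<close>, which may be interchanged freely.  A rule of Sweedler calculus applies to a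
  sum as soon as its summand is balanced over the tensor product in question; the lemmas on balanced
  maps record this.
\<close>

section \<open>Formal combinations with values in an abelian group\<close>

text \<open>The integer multiple \<open>n q\<close>; at most one of the two sums is nonempty.\<close>

definition zmul :: "int \<Rightarrow> 'q::ab_group_add \<Rightarrow> 'q"
  where "zmul n q = (\<Sum>i<nat n. q) - (\<Sum>i<nat (- n). q)"

lemma zmul_succ: "zmul (n + 1) q = zmul n q + q"
proof (cases "0 \<le> n")
  case True
  then have "nat (n + 1) = Suc (nat n)" by simp
  then show ?thesis using True by (simp add: zmul_def)
next
  case False
  then have "nat (- n) = Suc (nat (- (n + 1)))" "nat (n + 1) = 0" "nat n = 0" by auto
  then show ?thesis by (simp add: zmul_def)
qed

lemma zmul_0 [simp]: "zmul 0 q = 0" by (simp add: zmul_def)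

lemma zmul_pred: "zmul (n - 1) q = zmul n q - q"
  using zmul_succ[of "n - 1" q] by simp

lemma zmul_add: "zmul (m + n) q = zmul m q + zmul n q"
proof (induction n rule: int_induct[where k = 0])
  case (step1 i)
  then show ?case using zmul_succ[of "m + i" q] zmul_succ[of i q] by (simp add: add.assoc)
next
  case (step2 i)
  then have "zmul (m + (i - 1)) q = zmul m q + (zmul i q - q)"
    using zmul_pred[of "m + i" q] by (simp add: add_diff_eq)
  then show ?case by (simp add: zmul_pred)
qed simp

lemma zmul_1 [simp]: "zmul 1 q = q" using zmul_succ[of 0 q] by simp

lemma zmul_add_right: "zmul n (q + r) = zmul n q + zmul n r"
  by (induction n rule: int_induct[where k = 0]) (simp_all add: zmul_succ zmul_pred algebra_simps)

lemma zmul_0_right [simp]: "zmul n 0 = 0"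
  by (simp add: zmul_def)

text \<open>The \<open>\<int>\<close>-linear extension of \<open>f\<close>, evaluated at \<open>c\<close>.\<close>

definition fsum :: "('c \<Rightarrow>\<^sub>0 int) \<Rightarrow> ('c \<Rightarrow> 'q::ab_group_add) \<Rightarrow> 'q"
  where "fsum c f = (\<Sum>x\<in>Poly_Mapping.keys c. zmul (Poly_Mapping.lookup c x) (f x))"

lemma fsum_superset:
  assumes "finite A" "Poly_Mapping.keys c \<subseteq> A"
  shows "fsum c f = (\<Sum>x\<in>A. zmul (Poly_Mapping.lookup c x) (f x))"
  unfolding fsum_def using assms by (intro sum.mono_neutral_left) (auto simp: in_keys_iff)

lemma fsum_add: "fsum (c + d) f = fsum c f + fsum d f"
proof -
  let ?A = "Poly_Mapping.keys c \<union> Poly_Mapping.keys d"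
  have "fsum (c + d) f = (\<Sum>x\<in>?A. zmul (Poly_Mapping.lookup (c + d) x) (f x))"
    by (intro fsum_superset) (use keys_add[of c d] in auto)
  also have "\<dots> = (\<Sum>x\<in>?A. zmul (Poly_Mapping.lookup c x) (f x))
      + (\<Sum>x\<in>?A. zmul (Poly_Mapping.lookup d x) (f x))"
    by (simp add: lookup_add zmul_add sum.distrib)
  also have "\<dots> = fsum c f + fsum d f"
    by (simp add: fsum_superset[of ?A c] fsum_superset[of ?A d])
  finally show ?thesis .
qed

lemma fsum_0 [simp]: "fsum 0 f = 0" by (simp add: fsum_def)

lemma fsum_diff: "fsum (c - d) f = fsum c f - fsum d f"
  using fsum_add[of "c - d" d f] by simp

lemma fsum_frag_of [simp]: "fsum (frag_of x) f = f x"
  by (simp add: fsum_def)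

lemma fsum_distrib: "fsum c (\<lambda>x. f x + g x) = fsum c f + fsum c g"
  by (simp add: fsum_def zmul_add_right sum.distrib)

lemma fsum_zero [simp]: "fsum c (\<lambda>x. 0) = 0"
  by (simp add: fsum_def)

lemma fsum_cong: "(\<And>x. x \<in> Poly_Mapping.keys c \<Longrightarrow> f x = g x) \<Longrightarrow> fsum c f = fsum c g"
  by (simp add: fsum_def)

lemma fsum_minus: "fsum c (\<lambda>x. - f x) = - fsum c f"
  using fsum_distrib[of c f "\<lambda>x. - f x"] by (simp add: eq_neg_iff_add_eq_0 add.commute)

lemma fsum_distrib_diff: "fsum c (\<lambda>x. f x - g x) = fsum c f - fsum c g"
  using fsum_distrib[of c f "\<lambda>x. - g x"] by (simp add: fsum_minus)

lemma fsum_swap: "fsum c (\<lambda>x. fsum d (\<lambda>y. f x y)) = fsum d (\<lambda>y. fsum c (\<lambda>x. f x y))"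
proof -
  have "Poly_Mapping.keys c \<subseteq> UNIV" by simp
  then show ?thesis
    by (induction c rule: frag_induction) (simp_all add: fsum_diff fsum_distrib_diff)
qed

text \<open>
  Homomorphisms from a group record into a group given by a type class.  The carrier of the target is
  a whole type, so sums of values need no closure conditions.
\<close>

definition ghom :: "('a, 'x) monoid_scheme \<Rightarrow> ('a \<Rightarrow> 'q::ab_group_add) \<Rightarrow> bool"
  where "ghom G h \<longleftrightarrow> (\<forall>x\<in>carrier G. \<forall>y\<in>carrier G. h (x \<otimes>\<^bsub>G\<^esub> y) = h x + h y)"

lemma ghom_one: "comm_group G \<Longrightarrow> ghom G h \<Longrightarrow> h \<one>\<^bsub>G\<^esub> = 0"
proof -
  assume "comm_group G" "ghom G h"
  interpret comm_group G by fact
  show ?thesis using \<open>ghom G h\<close>[unfolded ghom_def, rule_format, of "\<one>\<^bsub>G\<^esub>" "\<one>\<^bsub>G\<^esub>"] by simp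
qed

lemma ghom_inv: "comm_group G \<Longrightarrow> ghom G h \<Longrightarrow> x \<in> carrier G \<Longrightarrow> h (inv\<^bsub>G\<^esub> x) = - h x"
proof -
  assume a: "comm_group G" "ghom G h" "x \<in> carrier G"
  interpret comm_group G by fact
  show ?thesis using a(2)[unfolded ghom_def, rule_format, of x "inv\<^bsub>G\<^esub> x"] a ghom_one[OF a(1,2)]
    by (simp add: eq_neg_iff_add_eq_0 add.commute)
qed

lemma lin_ext_closed:
  assumes "comm_group G" "\<And>p. p \<in> S \<Longrightarrow> f p \<in> carrier G" "Poly_Mapping.keys c \<subseteq> S"
  shows "lin_ext G f c \<in> carrier G"
proof -
  have "f ` S \<subseteq> carrier G" using assms by auto
  from lin_ext_hom[OF assms(1) this] assms(3) show ?thesis by (auto simp: hom_def Pi_def)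
qed

text \<open>This rule carries every expression built with \<open>lin_ext\<close> in \<open>G\<close> over to a sum in a type class.\<close>

lemma ghom_lin_ext:
  assumes G: "comm_group G" and h: "ghom G h" and f: "\<And>p. p \<in> S \<Longrightarrow> f p \<in> carrier G"
    and c: "Poly_Mapping.keys c \<subseteq> S"
  shows "h (lin_ext G f c) = fsum c (\<lambda>p. h (f p))"
proof -
  interpret comm_group G by fact
  interpret l: group_hom "free_Abelian_group S" G "lin_ext G f"
    using lin_ext_hom[OF G, of f S] f by (auto simp: group_hom_def group_hom_axioms_def)
  show ?thesis using c
  proof (induct rule: free_Abelian_group_induct[consumes 1])
    case 1
    then show ?case using l.hom_one ghom_one[OF G h] by simp
  next
    case (2 x y)
    have m: "- y \<in> carrier (free_Abelian_group S)" using 2 by simp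
    have "lin_ext G f (x - y) = lin_ext G f x \<otimes>\<^bsub>G\<^esub> inv\<^bsub>G\<^esub> lin_ext G f y"
      using l.hom_mult[of x "- y"] l.hom_inv[of y] 2 m by simp
    moreover have "lin_ext G f x \<in> carrier G" "lin_ext G f y \<in> carrier G"
      using 2 by (auto intro!: l.hom_closed)
    ultimately show ?case using 2 h ghom_inv[OF G h, of "lin_ext G f y"]
      by (simp add: ghom_def fsum_diff)
  next
    case (3 a)
    then show ?case using lin_ext_frag_of[OF G, of f a] f by simp
  qed
qed

section \<open>An ambient group for all abelian groups on a type\<close>

definition diff_closed :: "'a::ab_group_add set \<Rightarrow> bool"
  where "diff_closed N \<longleftrightarrow> 0 \<in> N \<and> (\<forall>x\<in>N. \<forall>y\<in>N. x - y \<in> N)"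

lemma diff_closedD:
  assumes "diff_closed N" "x \<in> N" "y \<in> N"
  shows "x - y \<in> N" "- x \<in> N" "x + y \<in> N"
proof -
  have m: "- z \<in> N" if "z \<in> N" for z
    using assms(1) that by (metis diff_0 diff_closed_def)
  show "x - y \<in> N" "- x \<in> N" using assms m by (auto simp: diff_closed_def)
  show "x + y \<in> N" using assms m by (metis diff_closed_def diff_minus_eq_add)
qed

text \<open>
  A family indexed by the subgroups \<open>N\<close> of the free abelian group on \<open>'a\<close>, each component taken modulo
  \<open>N\<close>.  The quotient type is thus the product of all quotients of the free abelian group on \<open>'a\<close>, and every
  abelian group with elements of type \<open>'a\<close> embeds into one of these quotients.
\<close>

definition ambient_rel ::
  "(('a \<Rightarrow>\<^sub>0 int) set \<Rightarrow> ('a \<Rightarrow>\<^sub>0 int)) \<Rightarrow> (('a \<Rightarrow>\<^sub>0 int) set \<Rightarrow> ('a \<Rightarrow>\<^sub>0 int)) \<Rightarrow> bool"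
  where "ambient_rel u v \<longleftrightarrow> (\<forall>N. diff_closed N \<longrightarrow> u N - v N \<in> N)"

quotient_type 'a ambient = "('a \<Rightarrow>\<^sub>0 int) set \<Rightarrow> ('a \<Rightarrow>\<^sub>0 int)" / ambient_rel
proof (rule equivpI)
  show "reflp (ambient_rel :: (('a \<Rightarrow>\<^sub>0 int) set \<Rightarrow> ('a \<Rightarrow>\<^sub>0 int)) \<Rightarrow> _)"
    by (auto intro: reflpI simp: ambient_rel_def diff_closed_def)
  show "symp (ambient_rel :: (('a \<Rightarrow>\<^sub>0 int) set \<Rightarrow> ('a \<Rightarrow>\<^sub>0 int)) \<Rightarrow> _)"
    unfolding symp_def ambient_rel_def 
  proof (intro allI impI)
    fix u v :: "('a \<Rightarrow>\<^sub>0 int) set \<Rightarrow> ('a \<Rightarrow>\<^sub>0 int)" and N :: "('a \<Rightarrow>\<^sub>0 int) set"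
    assume "\<forall>N. diff_closed N \<longrightarrow> u N - v N \<in> N" "diff_closed N"
    then have "- (u N - v N) \<in> N" by (intro diff_closedD(2)) auto
    then show "v N - u N \<in> N" by simp
  qed
  show "transp (ambient_rel :: (('a \<Rightarrow>\<^sub>0 int) set \<Rightarrow> ('a \<Rightarrow>\<^sub>0 int)) \<Rightarrow> _)"
    unfolding transp_def ambient_rel_def
  proof (intro allI impI)
    fix u v w :: "('a \<Rightarrow>\<^sub>0 int) set \<Rightarrow> ('a \<Rightarrow>\<^sub>0 int)" and N :: "('a \<Rightarrow>\<^sub>0 int) set"
    assume "\<forall>N. diff_closed N \<longrightarrow> u N - v N \<in> N" "\<forall>N. diff_closed N \<longrightarrow> v N - w N \<in> N" "diff_closed N"
    then have "(u N - v N) + (v N - w N) \<in> N" by (intro diff_closedD(3)) auto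
    then show "u N - w N \<in> N" by simp
  qed
qed

lemma add_diff_add2: "a + b - (c + d) = (a - c) + (b - d :: 'a::ab_group_add)"
  by (simp add: algebra_simps)

lemma minus_diff_minus2: "- a - - b = - (a - b :: 'a::ab_group_add)"
  by simp

instantiation ambient :: (type) ab_group_add
begin

lift_definition zero_ambient :: "'a ambient" is "\<lambda>_. 0" .
lift_definition plus_ambient :: "'a ambient \<Rightarrow> 'a ambient \<Rightarrow> 'a ambient" is "\<lambda>u v N. u N + v N"
  unfolding ambient_rel_def add_diff_add2 by (simp add: diff_closedD(3))
lift_definition uminus_ambient :: "'a ambient \<Rightarrow> 'a ambient" is "\<lambda>u N. - u N"
  unfolding ambient_rel_def minus_diff_minus2 using diff_closedD(2) by blast
definition minus_ambient :: "'a ambient \<Rightarrow> 'a ambient \<Rightarrow> 'a ambient" where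
  "minus_ambient x y = x + - y"

instance
proof
  fix a b c :: "'a ambient"
  show "a + b + c = a + (b + c)"
    by transfer (simp add: ambient_rel_def add.assoc diff_closed_def)
  show "a + b = b + a"
    by transfer (simp add: ambient_rel_def add.commute diff_closed_def)
  show "0 + a = a"
    by transfer (simp add: ambient_rel_def diff_closed_def)
  show "- a + a = 0"
    by transfer (simp add: ambient_rel_def diff_closed_def)
  show "a - b = a + - b" by (simp add: minus_ambient_def)
qed

end

text \<open>
  Formal combinations of elements of \<open>G\<close> whose value in \<open>G\<close> is trivial form a subgroup, and \<open>G\<close> embeds into
  the quotient by it.  All other components of the family are zero.
\<close>

definition embed :: "('a, 'x) monoid_scheme \<Rightarrow> 'a \<Rightarrow> 'a ambient"
  where "embed G x = abs_ambient (\<lambda>N. if N = {c. Poly_Mapping.keys c \<subseteq> carrier G \<and>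
    lin_ext G (\<lambda>x. x) c = \<one>\<^bsub>G\<^esub>} then frag_of x else 0)"

lemma
  assumes G: "comm_group G"
  shows ghom_embed: "ghom G (embed G)"
    and inj_embed: "\<lbrakk>x \<in> carrier G; y \<in> carrier G; embed G x = embed G y\<rbrakk> \<Longrightarrow> x = y"
proof -
  interpret comm_group G by fact
  let ?N = "{c. Poly_Mapping.keys c \<subseteq> carrier G \<and> lin_ext G (\<lambda>x. x) c = \<one>\<^bsub>G\<^esub>}"
  interpret l: group_hom "free_Abelian_group (carrier G)" G "lin_ext G (\<lambda>x. x)"
    using lin_ext_hom[OF G, of "\<lambda>x. x" "carrier G"] by (auto simp: group_hom_def group_hom_axioms_def)
  have diff: "lin_ext G (\<lambda>x. x) (x - y) = lin_ext G (\<lambda>x. x) x \<otimes>\<^bsub>G\<^esub> inv\<^bsub>G\<^esub> lin_ext G (\<lambda>x. x) y"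
    if "Poly_Mapping.keys x \<subseteq> carrier G" "Poly_Mapping.keys y \<subseteq> carrier G" for x y
    using l.hom_mult[of x "- y"] l.hom_inv[of y] that by simp
  have keys_diff': "Poly_Mapping.keys (x - y) \<subseteq> S"
    if "Poly_Mapping.keys x \<subseteq> S" "Poly_Mapping.keys y \<subseteq> S" for x y :: "'c \<Rightarrow>\<^sub>0 int" and S
    using that keys_diff[of x y] by auto
  have lof: "lin_ext G (\<lambda>x. x) (frag_of x) = x" if "x \<in> carrier G" for x
    using that by (intro lin_ext_frag_of[OF G])
  have N: "diff_closed ?N"
    using l.hom_one by (auto simp: diff_closed_def diff keys_diff')
  show "ghom G (embed G)"
    unfolding ghom_def
  proof (intro ballI)
    fix x y assume xy: "x \<in> carrier G" "y \<in> carrier G"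
    have e: "frag_of (x \<otimes>\<^bsub>G\<^esub> y) - frag_of x - frag_of y \<in> ?N"
    proof -
      have "x \<otimes>\<^bsub>G\<^esub> y \<otimes>\<^bsub>G\<^esub> inv\<^bsub>G\<^esub> x \<otimes>\<^bsub>G\<^esub> inv\<^bsub>G\<^esub> y = (x \<otimes>\<^bsub>G\<^esub> y) \<otimes>\<^bsub>G\<^esub> inv\<^bsub>G\<^esub> (x \<otimes>\<^bsub>G\<^esub> y)"
        using xy by (simp add: inv_mult m_assoc)
      then show ?thesis using xy by (simp add: diff keys_diff' lof)
    qed
    have e': "frag_of (x \<otimes>\<^bsub>G\<^esub> y) - (frag_of x + frag_of y) \<in> ?N"
      using e by (simp only: diff_diff_eq)
    have "abs_ambient (\<lambda>N. if N = ?N then frag_of (x \<otimes>\<^bsub>G\<^esub> y) else 0)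
       = abs_ambient (\<lambda>N. (if N = ?N then frag_of x else 0) + (if N = ?N then frag_of y else 0))"
      by (rule iffD2[OF ambient.abs_eq_iff]) (use e' in \<open>simp add: ambient_rel_def diff_closed_def\<close>)
    then show "embed G (x \<otimes>\<^bsub>G\<^esub> y) = embed G x + embed G y"
      by (simp add: embed_def plus_ambient.abs_eq)
  qed
  show "x = y" if xy: "x \<in> carrier G" "y \<in> carrier G" and e: "embed G x = embed G y"
  proof -
    have "ambient_rel (\<lambda>N. if N = ?N then frag_of x else 0) (\<lambda>N. if N = ?N then frag_of y else 0)"
      using e[unfolded embed_def] by (rule iffD1[OF ambient.abs_eq_iff])
    from this[unfolded ambient_rel_def, rule_format, OF N] have "frag_of x - frag_of y \<in> ?N" by simp
    then have "x \<otimes>\<^bsub>G\<^esub> inv\<^bsub>G\<^esub> y = \<one>\<^bsub>G\<^esub>" using xy by (simp add: diff lof)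
    then show ?thesis using xy inv_equality[of x "inv\<^bsub>G\<^esub> y"] by simp
  qed
qed

lemma ghomD: "ghom G h \<Longrightarrow> x \<in> carrier G \<Longrightarrow> y \<in> carrier G \<Longrightarrow> h (x \<otimes>\<^bsub>G\<^esub> y) = h x + h y"
  by (simp add: ghom_def)

text \<open>
  Additive maps into \<open>'a ambient\<close> separate the elements of \<open>G\<close>.  The target type is fixed by \<open>'a\<close>, which
  matters because a fact cannot quantify over types.
\<close>

lemma group_eqI:
  assumes "comm_group G" "x \<in> carrier G" "y \<in> carrier G"
    and "\<And>h :: 'a \<Rightarrow> 'a ambient. ghom G h \<Longrightarrow> h x = h y"
  shows "x = (y :: 'a)"
  by (rule inj_embed[OF assms(1-3)]) (rule assms(4)[OF ghom_embed[OF assms(1)]])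

section \<open>Groups given by generators and relations\<close>

text \<open>The representative of a class at which \<open>tlift\<close> evaluates\<close>

definition rep :: "('c \<Rightarrow>\<^sub>0 int) set \<Rightarrow> ('c \<Rightarrow>\<^sub>0 int)"
  where "rep t = (SOME c. c \<in> t)"

text \<open>The condition on a function on generators under which its linear extension descends to the quotient by \<open>R\<close>\<close>

definition kills :: "('c \<Rightarrow> 'q::ab_group_add) \<Rightarrow> ('c \<Rightarrow>\<^sub>0 int) set \<Rightarrow> bool"
  where "kills f R \<longleftrightarrow> (\<forall>r\<in>R. fsum r f = 0)"

locale presented_group =
  fixes S :: "'c set" and R :: "('c \<Rightarrow>\<^sub>0 int) set" and T :: "('c \<Rightarrow>\<^sub>0 int) set monoid"
  assumes rels: "\<And>r. r \<in> R \<Longrightarrow> Poly_Mapping.keys r \<subseteq> S"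
    and T_eq: "T = free_Abelian_group S Mod generate (free_Abelian_group S) R"
begin

lemma rels_subgroup: "subgroup (generate (free_Abelian_group S) R) (free_Abelian_group S)"
  using rels by (intro group.generate_is_subgroup) auto

lemma comm_group_T: "comm_group T"
  unfolding T_eq by (rule comm_group.abelian_FactGroup[OF abelian_free_Abelian_group rels_subgroup])

lemma one_T: "\<one>\<^bsub>T\<^esub> = generate (free_Abelian_group S) R"
  by (simp add: T_eq)

lemma tclass_coset: "tclass T c = generate (free_Abelian_group S) R #>\<^bsub>free_Abelian_group S\<^esub> c"
  by (auto simp: tclass_def one_T r_coset_def)

lemma carrier_T: "carrier T = tclass T ` {c. Poly_Mapping.keys c \<subseteq> S}"
proof -
  have "carrier T = (\<lambda>c. generate (free_Abelian_group S) R #>\<^bsub>free_Abelian_group S\<^esub> c) ` carrier (free_Abelian_group S)"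
    by (simp only: T_eq carrier_FactGroup)
  also have "\<dots> = tclass T ` {c. Poly_Mapping.keys c \<subseteq> S}"
    by (intro image_cong) (auto simp: tclass_coset)
  finally show ?thesis .
qed

lemma tclass_closed: "Poly_Mapping.keys c \<subseteq> S \<Longrightarrow> tclass T c \<in> carrier T"
  by (auto simp: carrier_T)

lemma tclass_mult:
  assumes "Poly_Mapping.keys c \<subseteq> S" "Poly_Mapping.keys d \<subseteq> S"
  shows "tclass T c \<otimes>\<^bsub>T\<^esub> tclass T d = tclass T (c + d)"
proof -
  interpret comm_group "free_Abelian_group S" by (rule abelian_free_Abelian_group)
  interpret normal "generate (free_Abelian_group S) R" "free_Abelian_group S"
    using rels_subgroup by (simp add: normal_iff_subgroup)
  have "X \<otimes>\<^bsub>T\<^esub> Y = X <#>\<^bsub>free_Abelian_group S\<^esub> Y" for X Y by (simp add: T_eq FactGroup_def)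
  then show ?thesis using rcos_sum[of c d] assms by (simp add: tclass_coset)
qed

lemma one_tclass: "\<one>\<^bsub>T\<^esub> = tclass T 0"
  by (auto simp: tclass_def)

lemma mem_tclass: "c \<in> tclass T c"
  using generate.one[of "free_Abelian_group S" R] by (force simp: tclass_def one_T)

text \<open>The kernel of the extension is a subgroup, so it contains everything that the relations generate.\<close>

lemma kills_generate:
  assumes "kills f R" "k \<in> generate (free_Abelian_group S) R"
  shows "fsum k f = 0"
  using assms(2)
proof (induction rule: generate.induct)
  case (inv r)
  then show ?case using assms(1) rels[OF inv] fsum_diff[of 0 r f] by (auto simp: kills_def)
qed (use assms(1) in \<open>auto simp: kills_def fsum_add\<close>)

text \<open>Evaluation does not depend on the representative.\<close>

lemma fsum_rep_tclass:
  assumes "kills f R"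
  shows "fsum (rep (tclass T c)) f = fsum c f"
proof -
  have "rep (tclass T c) \<in> tclass T c"
    unfolding rep_def by (rule someI[of "\<lambda>d. d \<in> tclass T c", OF mem_tclass])
  then show ?thesis using kills_generate[OF assms] by (auto simp: tclass_def one_T fsum_add)
qed

lemma rep_mem:
  assumes "t \<in> carrier T"
  shows "Poly_Mapping.keys (rep t) \<subseteq> S" "tclass T (rep t) = t"
proof -
  interpret F: comm_group "free_Abelian_group S" by (rule abelian_free_Abelian_group)
  obtain c where c: "Poly_Mapping.keys c \<subseteq> S" "t = tclass T c" using assms by (auto simp: carrier_T)
  have m: "rep t \<in> t" unfolding c rep_def by (rule someI[of "\<lambda>d. d \<in> tclass T c", OF mem_tclass])
  then obtain k where k: "k \<in> generate (free_Abelian_group S) R" "rep t = k + c"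
    by (auto simp: c tclass_def one_T)
  then have "Poly_Mapping.keys k \<subseteq> S" using subgroup.mem_carrier[OF rels_subgroup] by auto
  then show "Poly_Mapping.keys (rep t) \<subseteq> S" using c(1) keys_add[of k c] by (auto simp: k)
  show "tclass T (rep t) = t" using F.repr_independence[OF _ _ rels_subgroup, of "rep t" c] m c
    by (simp add: tclass_coset)
qed

lemma fsum_rep_mult:
  assumes "kills f R" "t \<in> carrier T" "u \<in> carrier T"
  shows "fsum (rep (t \<otimes>\<^bsub>T\<^esub> u)) f = fsum (rep t) f + fsum (rep u) f"
proof -
  have "t \<otimes>\<^bsub>T\<^esub> u = tclass T (rep t + rep u)"
    using tclass_mult rep_mem[OF assms(2)] rep_mem[OF assms(3)] by metis
  then show ?thesis by (simp add: fsum_rep_tclass[OF assms(1)] fsum_add)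
qed

lemma ghom_tclass:
  assumes h: "ghom T h" and c: "Poly_Mapping.keys c \<subseteq> S"
  shows "h (tclass T c) = fsum c (\<lambda>p. h (tclass T (frag_of p)))"
  using c
proof (induct rule: free_Abelian_group_induct[consumes 1])
  case 1
  then show ?case using ghom_one[OF comm_group_T h] by (simp add: one_tclass)
next
  case (2 x y)
  have k: "Poly_Mapping.keys (x - y) \<subseteq> S" using keys_diff[of x y] 2 by auto
  have "h (tclass T x) = h (tclass T (x - y)) + h (tclass T y)"
    using ghomD[OF h tclass_closed[OF k] tclass_closed[OF 2(2)]] tclass_mult[OF k 2(2)] by simp
  then show ?case using 2 by (simp add: fsum_diff)
qed simp

lemma ghom_fsum_rep:
  assumes h: "ghom T h" and t: "t \<in> carrier T"
  shows "h t = fsum (rep t) (\<lambda>p. h (tclass T (frag_of p)))"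
  using ghom_tclass[OF h rep_mem(1)[OF t]] rep_mem(2)[OF t] by simp

text \<open>With \<open>ghom_fsum_rep\<close>: additive maps on \<open>T\<close> are the same as functions on generators that kill the relations.\<close>

lemma ghom_kills:
  assumes h: "ghom T h"
  shows "kills (\<lambda>p. h (tclass T (frag_of p))) R"
  unfolding kills_def
proof
  fix r assume r: "r \<in> R"
  have r': "r \<in> generate (free_Abelian_group S) R" using r by (rule generate.incl)
  have "tclass T r = \<one>\<^bsub>T\<^esub>"
    using group.coset_join2[OF group_free_Abelian_group _ rels_subgroup r'] rels[OF r]
    by (simp add: tclass_coset one_T)
  then show "fsum r (\<lambda>p. h (tclass T (frag_of p))) = 0"
    using ghom_one[OF comm_group_T h] ghom_tclass[OF h rels[OF r]] by simp
qed

text \<open>The form in which \<open>group_eqI\<close> is used: two classes agree if all functions killing the relations agree on representatives.\<close>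

lemma T_eqI:
  assumes "t \<in> carrier T" "u \<in> carrier T"
    and "\<And>f :: 'c \<Rightarrow> ('c \<Rightarrow>\<^sub>0 int) set ambient. kills f R \<Longrightarrow> fsum (rep t) f = fsum (rep u) f"
  shows "t = u"
  using assms by (intro group_eqI[OF comm_group_T]) (simp_all add: ghom_fsum_rep ghom_kills)

end

section \<open>Sums over formal combinations of pairs\<close>

text \<open>
  Restricting the summand to the two carriers makes congruence and the interchange of sums
  unconditional.
\<close>

definition psum :: "'m set \<Rightarrow> 'n set \<Rightarrow> (('m \<times> 'n) \<Rightarrow>\<^sub>0 int) \<Rightarrow> ('m \<Rightarrow> 'n \<Rightarrow> 'q::ab_group_add) \<Rightarrow> 'q"
  where "psum A C c f = fsum c (\<lambda>(x, y). if x \<in> A \<and> y \<in> C then f x y else 0)"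

lemma psum_cong [cong]:
  "c = c' \<Longrightarrow> (\<And>x y. x \<in> A \<Longrightarrow> y \<in> C \<Longrightarrow> f x y = g x y) \<Longrightarrow> psum A C c f = psum A C c' g"
  unfolding psum_def by (auto intro!: fsum_cong)

lemma psum_eq_fsum: "Poly_Mapping.keys c \<subseteq> A \<times> C \<Longrightarrow> psum A C c f = fsum c (\<lambda>(x, y). f x y)"
  unfolding psum_def by (auto intro!: fsum_cong)

lemma psum_distrib: "psum A C c (\<lambda>x y. f x y + g x y) = psum A C c f + psum A C c g"
  unfolding psum_def fsum_distrib[symmetric] by (auto intro!: fsum_cong)

lemma psum_frag_of [simp]: "x \<in> A \<Longrightarrow> y \<in> C \<Longrightarrow> psum A C (frag_of (x, y)) f = f x y"
  by (simp add: psum_def)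

text \<open>This unconditional interchange replaces all reordering of tensor factors in the informal calculations.\<close>

lemma psum_swap:
  "psum A C c (\<lambda>x y. psum A' C' c' (\<lambda>u v. f x y u v)) = psum A' C' c' (\<lambda>u v. psum A C c (\<lambda>x y. f x y u v))"
proof -
  have "psum A C c (\<lambda>x y. psum A' C' c' (\<lambda>u v. f x y u v)) = fsum c (\<lambda>p. fsum c' (\<lambda>q.
      if fst p \<in> A \<and> snd p \<in> C \<and> fst q \<in> A' \<and> snd q \<in> C' then f (fst p) (snd p) (fst q) (snd q) else 0))"
    unfolding psum_def by (auto intro!: fsum_cong simp: split_def)
  also have "\<dots> = fsum c' (\<lambda>q. fsum c (\<lambda>p.
      if fst p \<in> A \<and> snd p \<in> C \<and> fst q \<in> A' \<and> snd q \<in> C' then f (fst p) (snd p) (fst q) (snd q) else 0))"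
    by (rule fsum_swap)
  also have "\<dots> = psum A' C' c' (\<lambda>u v. psum A C c (\<lambda>x y. f x y u v))"
    unfolding psum_def by (auto intro!: fsum_cong simp: split_def)
  finally show ?thesis .
qed

lemma ghom_tlift:
  assumes G: "comm_group G" and h: "ghom G h"
    and f: "\<And>x y. x \<in> A \<Longrightarrow> y \<in> C \<Longrightarrow> f x y \<in> carrier G" and k: "Poly_Mapping.keys (rep t) \<subseteq> A \<times> C"
  shows "h (tlift G (\<lambda>(x, y). f x y) t) = psum A C (rep t) (\<lambda>x y. h (f x y))"
proof -
  have "h (tlift G (\<lambda>(x, y). f x y) t) = fsum (rep t) (\<lambda>p. h ((\<lambda>(x, y). f x y) p))"
    unfolding tlift_def rep_def[symmetric]
    by (rule ghom_lin_ext[OF G h, where S = "A \<times> C"]) (use f k in auto)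
  then show ?thesis by (simp add: psum_eq_fsum[OF k] split_def)
qed

lemma tlift_closed:
  assumes G: "comm_group G"
    and f: "\<And>x y. x \<in> A \<Longrightarrow> y \<in> C \<Longrightarrow> f x y \<in> carrier G" and k: "Poly_Mapping.keys (rep t) \<subseteq> A \<times> C"
  shows "tlift G (\<lambda>(x, y). f x y) t \<in> carrier G"
  unfolding tlift_def rep_def[symmetric]
  by (rule lin_ext_closed[OF G, where S = "A \<times> C"]) (use f k in auto)

section \<open>Balanced maps and tensor products\<close>

definition biadditive :: "('m, 'x) ring_scheme \<Rightarrow> ('n, 'y) ring_scheme \<Rightarrow> ('m \<Rightarrow> 'n \<Rightarrow> 'q::ab_group_add) \<Rightarrow> bool"
  where "biadditive M N f \<longleftrightarrow>
    (\<forall>m\<in>carrier M. \<forall>m'\<in>carrier M. \<forall>n\<in>carrier N. f (m \<oplus>\<^bsub>M\<^esub> m') n = f m n + f m' n) \<and>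
    (\<forall>m\<in>carrier M. \<forall>n\<in>carrier N. \<forall>n'\<in>carrier N. f m (n \<oplus>\<^bsub>N\<^esub> n') = f m n + f m n')"

definition balanced :: "('m, 'x) ring_scheme \<Rightarrow> ('n, 'y) ring_scheme \<Rightarrow> 'i set \<Rightarrow> ('i \<Rightarrow> 'm \<Rightarrow> 'm)
    \<Rightarrow> ('i \<Rightarrow> 'n \<Rightarrow> 'n) \<Rightarrow> ('m \<Rightarrow> 'n \<Rightarrow> 'q::ab_group_add) \<Rightarrow> bool"
  where "balanced M N I \<rho> \<sigma> f \<longleftrightarrow> biadditive M N f \<and>
    (\<forall>i\<in>I. \<forall>m\<in>carrier M. \<forall>n\<in>carrier N. f (\<rho> i m) n = f m (\<sigma> i n))"

locale balanced_tensor = M: abelian_group M + N: abelian_group N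
  for M :: "('m, 'x) ring_scheme" and N :: "('n, 'y) ring_scheme" +
  fixes I :: "'i set" and \<rho> \<sigma>
  assumes act_left: "\<lbrakk>i \<in> I; m \<in> carrier M\<rbrakk> \<Longrightarrow> \<rho> i m \<in> carrier M"
    and act_right: "\<lbrakk>i \<in> I; n \<in> carrier N\<rbrakk> \<Longrightarrow> \<sigma> i n \<in> carrier N"
begin

abbreviation "T \<equiv> tensor M N I \<rho> \<sigma>"

lemma keys_tensor_rels:
  assumes "r \<in> tensor_rels M N I \<rho> \<sigma>"
  shows "Poly_Mapping.keys r \<subseteq> carrier M \<times> carrier N"
proof -
  have 1: "Poly_Mapping.keys (c - d) \<subseteq> S" if "Poly_Mapping.keys c \<subseteq> S" "Poly_Mapping.keys d \<subseteq> S"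
    for c d :: "('m \<times> 'n) \<Rightarrow>\<^sub>0 int" and S using keys_diff[of c d] that by auto
  show ?thesis
    using assms unfolding tensor_rels_def
    by (elim UnE CollectE exE conjE; hypsubst; intro 1) (simp_all add: act_left act_right)
qed

sublocale presented_group "carrier M \<times> carrier N" "tensor_rels M N I \<rho> \<sigma>" T
  by unfold_locales (simp_all add: keys_tensor_rels tensor_def Let_def)

lemma kills_tensor_rels:
  assumes "balanced M N I \<rho> \<sigma> f"
  shows "kills (\<lambda>(x, y). if x \<in> carrier M \<and> y \<in> carrier N then f x y else 0) (tensor_rels M N I \<rho> \<sigma>)"
proof -
  have fl: "f (m \<oplus>\<^bsub>M\<^esub> m') n = f m n + f m' n"
    if "m \<in> carrier M" "m' \<in> carrier M" "n \<in> carrier N" for m m' n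
    using assms that by (auto simp: balanced_def biadditive_def)
  have fr: "f m (n \<oplus>\<^bsub>N\<^esub> n') = f m n + f m n'"
    if "m \<in> carrier M" "n \<in> carrier N" "n' \<in> carrier N" for m n n'
    using assms that by (auto simp: balanced_def biadditive_def)
  have fb: "f (\<rho> i m) n = f m (\<sigma> i n)" if "i \<in> I" "m \<in> carrier M" "n \<in> carrier N" for i m n
    using assms that by (auto simp: balanced_def)
  have "fsum r (\<lambda>(x, y). if x \<in> carrier M \<and> y \<in> carrier N then f x y else 0) = 0"
    if r: "r \<in> tensor_rels M N I \<rho> \<sigma>" for r
  proof -
    consider (ll) x x' y where "r = frag_of (x \<oplus>\<^bsub>M\<^esub> x', y) - frag_of (x, y) - frag_of (x', y)"
          "x \<in> carrier M" "x' \<in> carrier M" "y \<in> carrier N"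
      | (rr) x y y' where "r = frag_of (x, y \<oplus>\<^bsub>N\<^esub> y') - frag_of (x, y) - frag_of (x, y')"
          "x \<in> carrier M" "y \<in> carrier N" "y' \<in> carrier N"
      | (bb) i x y where "r = frag_of (\<rho> i x, y) - frag_of (x, \<sigma> i y)"
          "i \<in> I" "x \<in> carrier M" "y \<in> carrier N"
      using r unfolding tensor_rels_def by blast
    then show ?thesis
      by cases (simp_all add: fsum_diff fl fr fb act_left act_right)
  qed
  then show ?thesis by (simp add: kills_def)
qed

lemma balanced_of_kills:
  assumes "kills f (tensor_rels M N I \<rho> \<sigma>)"
  shows "balanced M N I \<rho> \<sigma> (\<lambda>x y. f (x, y))"
  unfolding balanced_def biadditive_def
proof (intro conjI ballI)
  fix m m' n assume "m \<in> carrier M" "m' \<in> carrier M" "n \<in> carrier N"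
  then have "frag_of (m \<oplus>\<^bsub>M\<^esub> m', n) - frag_of (m, n) - frag_of (m', n) \<in> tensor_rels M N I \<rho> \<sigma>"
    unfolding tensor_rels_def by blast
  with assms have "fsum (frag_of (m \<oplus>\<^bsub>M\<^esub> m', n) - frag_of (m, n) - frag_of (m', n)) f = 0"
    by (simp only: kills_def)
  then show "f (m \<oplus>\<^bsub>M\<^esub> m', n) = f (m, n) + f (m', n)" by (simp add: fsum_diff fsum_add algebra_simps)
next
  fix m n n' assume "m \<in> carrier M" "n \<in> carrier N" "n' \<in> carrier N"
  then have "frag_of (m, n \<oplus>\<^bsub>N\<^esub> n') - frag_of (m, n) - frag_of (m, n') \<in> tensor_rels M N I \<rho> \<sigma>"
    unfolding tensor_rels_def by blast
  with assms have "fsum (frag_of (m, n \<oplus>\<^bsub>N\<^esub> n') - frag_of (m, n) - frag_of (m, n')) f = 0"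
    by (simp only: kills_def)
  then show "f (m, n \<oplus>\<^bsub>N\<^esub> n') = f (m, n) + f (m, n')" by (simp add: fsum_diff fsum_add algebra_simps)
next
  fix i m n assume "i \<in> I" "m \<in> carrier M" "n \<in> carrier N"
  then have "frag_of (\<rho> i m, n) - frag_of (m, \<sigma> i n) \<in> tensor_rels M N I \<rho> \<sigma>"
    unfolding tensor_rels_def by blast
  with assms have "fsum (frag_of (\<rho> i m, n) - frag_of (m, \<sigma> i n)) f = 0"
    by (simp only: kills_def)
  then show "f (\<rho> i m, n) = f (m, \<sigma> i n)" by (simp add: fsum_diff)
qed

abbreviation "eval t f \<equiv> psum (carrier M) (carrier N) (rep t) f"

lemma tens_closed: "m \<in> carrier M \<Longrightarrow> n \<in> carrier N \<Longrightarrow> tens T m n \<in> carrier T"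
  unfolding tens_def by (intro tclass_closed) simp

lemma eval_tclass:
  assumes "balanced M N I \<rho> \<sigma> f"
  shows "eval (tclass T c) f = psum (carrier M) (carrier N) c f"
  unfolding psum_def by (rule fsum_rep_tclass[OF kills_tensor_rels[OF assms]])

lemma eval_tens:
  assumes "balanced M N I \<rho> \<sigma> f" "m \<in> carrier M" "n \<in> carrier N"
  shows "eval (tens T m n) f = f m n"
  unfolding tens_def eval_tclass[OF assms(1)] using assms(2,3) by simp

lemma eval_mult:
  assumes "balanced M N I \<rho> \<sigma> f" "t \<in> carrier T" "u \<in> carrier T"
  shows "eval (t \<otimes>\<^bsub>T\<^esub> u) f = eval t f + eval u f"
  unfolding psum_def by (rule fsum_rep_mult[OF kills_tensor_rels[OF assms(1)] assms(2,3)])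

lemma ghom_eval:
  assumes "ghom T h" "t \<in> carrier T"
  shows "h t = eval t (\<lambda>m n. h (tens T m n))"
  using ghom_fsum_rep[OF assms] by (simp add: psum_eq_fsum[OF rep_mem(1)[OF assms(2)]] tens_def split_def)

text \<open>Together with \<open>ghom_of_balanced\<close> this is the universal property of the tensor product.\<close>

lemma balanced_ghom:
  assumes "ghom T h"
  shows "balanced M N I \<rho> \<sigma> (\<lambda>m n. h (tens T m n))"
  using balanced_of_kills[OF ghom_kills[OF assms]] by (simp add: tens_def)

lemma eqI:
  assumes "t \<in> carrier T" "u \<in> carrier T"
    and "\<And>f :: 'm \<Rightarrow> 'n \<Rightarrow> (('m \<times> 'n) \<Rightarrow>\<^sub>0 int) set ambient. balanced M N I \<rho> \<sigma> f \<Longrightarrow> eval t f = eval u f"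
  shows "t = u"
  using assms by (intro group_eqI[OF comm_group_T]) (simp_all add: ghom_eval balanced_ghom)

lemma ghom_tlift_T:
  assumes "comm_group G" "ghom G h" "t \<in> carrier T"
    and "\<And>x y. x \<in> carrier M \<Longrightarrow> y \<in> carrier N \<Longrightarrow> f x y \<in> carrier G"
  shows "h (tlift G (\<lambda>(x, y). f x y) t) = eval t (\<lambda>x y. h (f x y))"
  by (rule ghom_tlift[OF assms(1,2,4) rep_mem(1)[OF assms(3)]])

lemma tlift_T_closed:
  assumes "comm_group G" "t \<in> carrier T"
    and "\<And>x y. x \<in> carrier M \<Longrightarrow> y \<in> carrier N \<Longrightarrow> f x y \<in> carrier G"
  shows "tlift G (\<lambda>(x, y). f x y) t \<in> carrier G"
  by (rule tlift_closed[OF assms(1,3) rep_mem(1)[OF assms(2)]])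

lemma ghom_of_balanced:
  assumes "balanced M N I \<rho> \<sigma> f"
  shows "ghom T (\<lambda>t. eval t f)"
  using eval_mult[OF assms] by (simp add: ghom_def)

end

lemma balanced_add_left:
  "\<lbrakk>balanced M N I \<rho> \<sigma> f; m \<in> carrier M; m' \<in> carrier M; n \<in> carrier N\<rbrakk> \<Longrightarrow> f (m \<oplus>\<^bsub>M\<^esub> m') n = f m n + f m' n"
  by (auto simp: balanced_def biadditive_def)

lemma balanced_add_right:
  "\<lbrakk>balanced M N I \<rho> \<sigma> f; m \<in> carrier M; n \<in> carrier N; n' \<in> carrier N\<rbrakk> \<Longrightarrow> f m (n \<oplus>\<^bsub>N\<^esub> n') = f m n + f m n'"
  by (auto simp: balanced_def biadditive_def)

lemma balanced_act:
  "\<lbrakk>balanced M N I \<rho> \<sigma> f; i \<in> I; m \<in> carrier M; n \<in> carrier N\<rbrakk> \<Longrightarrow> f (\<rho> i m) n = f m (\<sigma> i n)"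
  by (auto simp: balanced_def)

lemma balancedI:
  assumes "\<And>m m' n. m \<in> carrier M \<Longrightarrow> m' \<in> carrier M \<Longrightarrow> n \<in> carrier N \<Longrightarrow> f (m \<oplus>\<^bsub>M\<^esub> m') n = f m n + f m' n"
    and "\<And>m n n'. m \<in> carrier M \<Longrightarrow> n \<in> carrier N \<Longrightarrow> n' \<in> carrier N \<Longrightarrow> f m (n \<oplus>\<^bsub>N\<^esub> n') = f m n + f m n'"
    and "\<And>i m n. i \<in> I \<Longrightarrow> m \<in> carrier M \<Longrightarrow> n \<in> carrier N \<Longrightarrow> f (\<rho> i m) n = f m (\<sigma> i n)"
  shows "balanced M N I \<rho> \<sigma> f"
  using assms by (auto simp: balanced_def biadditive_def)

lemmas balancedD = balanced_add_left balanced_add_right balanced_act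

abbreviation diamond_balanced :: "('b, 'y) ring_scheme \<Rightarrow> ('k, 'b, 'm, 'z) be_ring_scheme \<Rightarrow>
    ('k, 'b, 'n, 'w) be_ring_scheme \<Rightarrow> ('m \<Rightarrow> 'n \<Rightarrow> 'q::ab_group_add) \<Rightarrow> bool"
  where "diamond_balanced B M N \<equiv>
    balanced M N (carrier B) (\<lambda>b m. tgt M b \<otimes>\<^bsub>M\<^esub> m) (\<lambda>b n. src N b \<otimes>\<^bsub>N\<^esub> n)"

abbreviation additive :: "('a, 'x) ring_scheme \<Rightarrow> ('a \<Rightarrow> 'q::ab_group_add) \<Rightarrow> bool"
  where "additive A h \<equiv> ghom (add_monoid A) h"

lemma additiveD: "\<lbrakk>additive A h; x \<in> carrier A; y \<in> carrier A\<rbrakk> \<Longrightarrow> h (x \<oplus>\<^bsub>A\<^esub> y) = h x + h y"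
  by (simp add: ghom_def)

lemma additiveI: "(\<And>x y. \<lbrakk>x \<in> carrier A; y \<in> carrier A\<rbrakk> \<Longrightarrow> h (x \<oplus>\<^bsub>A\<^esub> y) = h x + h y) \<Longrightarrow> additive A h"
  by (simp add: ghom_def)

text \<open>The conditions that make \<open>f\<close> a map on \<open>L \<diamondop>\<^sub>B L \<diamondop>\<^sub>B L\<close>\<close>

definition tri_balanced :: "('b, 'y) ring_scheme \<Rightarrow> ('k, 'b, 'l, 'z) be_ring_scheme \<Rightarrow>
    ('l \<Rightarrow> 'l \<Rightarrow> 'l \<Rightarrow> 'q::ab_group_add) \<Rightarrow> bool"
  where "tri_balanced B L f \<longleftrightarrow>
    (\<forall>x\<in>carrier L. \<forall>x'\<in>carrier L. \<forall>y\<in>carrier L. \<forall>z\<in>carrier L. f (x \<oplus>\<^bsub>L\<^esub> x') y z = f x y z + f x' y z) \<and>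
    (\<forall>x\<in>carrier L. \<forall>y\<in>carrier L. \<forall>y'\<in>carrier L. \<forall>z\<in>carrier L. f x (y \<oplus>\<^bsub>L\<^esub> y') z = f x y z + f x y' z) \<and>
    (\<forall>x\<in>carrier L. \<forall>y\<in>carrier L. \<forall>z\<in>carrier L. \<forall>z'\<in>carrier L. f x y (z \<oplus>\<^bsub>L\<^esub> z') = f x y z + f x y z') \<and>
    (\<forall>b\<in>carrier B. \<forall>x\<in>carrier L. \<forall>y\<in>carrier L. \<forall>z\<in>carrier L. f (tgt L b \<otimes>\<^bsub>L\<^esub> x) y z = f x (src L b \<otimes>\<^bsub>L\<^esub> y) z) \<and>
    (\<forall>b\<in>carrier B. \<forall>x\<in>carrier L. \<forall>y\<in>carrier L. \<forall>z\<in>carrier L. f x (tgt L b \<otimes>\<^bsub>L\<^esub> y) z = f x y (src L b \<otimes>\<^bsub>L\<^esub> z))"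

section \<open>Sweedler calculus in a bialgebroid\<close>

context Be_ring
begin

lemma src_closed [simp]: "b \<in> carrier B \<Longrightarrow> src L b \<in> carrier L"
  using src_hom by (auto simp: kalg_hom_def ring_hom_def)
lemma tgt_closed [simp]: "b \<in> carrier B \<Longrightarrow> tgt L b \<in> carrier L"
  using tgt_hom by (auto simp: kalg_hom_def ring_hom_def opp_def)
lemma src_mult [simp]: "\<lbrakk>b \<in> carrier B; c \<in> carrier B\<rbrakk> \<Longrightarrow> src L (b \<otimes>\<^bsub>B\<^esub> c) = src L b \<otimes>\<^bsub>L\<^esub> src L c"
  using src_hom by (auto simp: kalg_hom_def ring_hom_def)
lemma tgt_mult [simp]: "\<lbrakk>b \<in> carrier B; c \<in> carrier B\<rbrakk> \<Longrightarrow> tgt L (b \<otimes>\<^bsub>B\<^esub> c) = tgt L c \<otimes>\<^bsub>L\<^esub> tgt L b"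
  using tgt_hom by (auto simp: kalg_hom_def ring_hom_def opp_def)
lemma src_add [simp]: "\<lbrakk>b \<in> carrier B; c \<in> carrier B\<rbrakk> \<Longrightarrow> src L (b \<oplus>\<^bsub>B\<^esub> c) = src L b \<oplus>\<^bsub>L\<^esub> src L c"
  using src_hom by (auto simp: kalg_hom_def ring_hom_def)
lemma tgt_add [simp]: "\<lbrakk>b \<in> carrier B; c \<in> carrier B\<rbrakk> \<Longrightarrow> tgt L (b \<oplus>\<^bsub>B\<^esub> c) = tgt L b \<oplus>\<^bsub>L\<^esub> tgt L c"
  using tgt_hom by (auto simp: kalg_hom_def ring_hom_def opp_def)
lemma src_one [simp]: "src L \<one>\<^bsub>B\<^esub> = \<one>\<^bsub>L\<^esub>"
  using src_hom by (auto simp: kalg_hom_def ring_hom_def)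
lemma tgt_one [simp]: "tgt L \<one>\<^bsub>B\<^esub> = \<one>\<^bsub>L\<^esub>"
  using tgt_hom by (auto simp: kalg_hom_def ring_hom_def opp_def)
lemma src_smult: "\<lbrakk>c \<in> carrier K; b \<in> carrier B\<rbrakk> \<Longrightarrow> src L (c \<odot>\<^bsub>B\<^esub> b) = c \<odot>\<^bsub>L\<^esub> src L b"
  using src_hom by (auto simp: kalg_hom_def)
lemma tgt_smult: "\<lbrakk>c \<in> carrier K; b \<in> carrier B\<rbrakk> \<Longrightarrow> tgt L (c \<odot>\<^bsub>B\<^esub> b) = c \<odot>\<^bsub>L\<^esub> tgt L b"
  using tgt_hom by (auto simp: kalg_hom_def opp_def)

text \<open>As rewrite rules these move \<open>tgt\<close> to the left of \<open>src\<close>, which decides equality of products of base elements.\<close>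

lemma src_tgt_left:
  "\<lbrakk>b \<in> carrier B; c \<in> carrier B; x \<in> carrier L\<rbrakk> \<Longrightarrow>
    src L b \<otimes>\<^bsub>L\<^esub> (tgt L c \<otimes>\<^bsub>L\<^esub> x) = tgt L c \<otimes>\<^bsub>L\<^esub> (src L b \<otimes>\<^bsub>L\<^esub> x)"
  by (simp add: L.A.m_assoc[symmetric] src_tgt_comm)

lemmas base_normal = src_tgt_comm src_tgt_left

sublocale D: balanced_tensor L L "carrier B" "\<lambda>b m. tgt L b \<otimes>\<^bsub>L\<^esub> m" "\<lambda>b n. src L b \<otimes>\<^bsub>L\<^esub> n"
  by unfold_locales simp_all

lemma diamond_eq: "diamond B L L = D.T"
  by (simp add: diamond_def)

lemma keys_diamond3_rels:
  assumes "r \<in> diamond3_rels B L"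
  shows "Poly_Mapping.keys r \<subseteq> carrier L \<times> carrier L \<times> carrier L"
proof -
  have 1: "Poly_Mapping.keys (c - d) \<subseteq> S" if "Poly_Mapping.keys c \<subseteq> S" "Poly_Mapping.keys d \<subseteq> S"
    for c d :: "('c \<times> 'c \<times> 'c) \<Rightarrow>\<^sub>0 int" and S using keys_diff[of c d] that by auto
  show ?thesis
    using assms unfolding diamond3_rels_def
    by (elim UnE CollectE exE conjE; hypsubst; intro 1) simp_all
qed

sublocale D3: presented_group "carrier L \<times> carrier L \<times> carrier L" "diamond3_rels B L" "diamond3 B L"
  by unfold_locales (simp_all add: keys_diamond3_rels diamond3_def Let_def)

lemma tri_balancedD:
  assumes "tri_balanced B L f"
  shows "\<lbrakk>x \<in> carrier L; x' \<in> carrier L; y \<in> carrier L; z \<in> carrier L\<rbrakk> \<Longrightarrow> f (x \<oplus>\<^bsub>L\<^esub> x') y z = f x y z + f x' y z"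
    and "\<lbrakk>x \<in> carrier L; y \<in> carrier L; y' \<in> carrier L; z \<in> carrier L\<rbrakk> \<Longrightarrow> f x (y \<oplus>\<^bsub>L\<^esub> y') z = f x y z + f x y' z"
    and "\<lbrakk>x \<in> carrier L; y \<in> carrier L; z \<in> carrier L; z' \<in> carrier L\<rbrakk> \<Longrightarrow> f x y (z \<oplus>\<^bsub>L\<^esub> z') = f x y z + f x y z'"
    and "\<lbrakk>b \<in> carrier B; x \<in> carrier L; y \<in> carrier L; z \<in> carrier L\<rbrakk> \<Longrightarrow> f (tgt L b \<otimes>\<^bsub>L\<^esub> x) y z = f x (src L b \<otimes>\<^bsub>L\<^esub> y) z"
    and "\<lbrakk>b \<in> carrier B; x \<in> carrier L; y \<in> carrier L; z \<in> carrier L\<rbrakk> \<Longrightarrow> f x (tgt L b \<otimes>\<^bsub>L\<^esub> y) z = f x y (src L b \<otimes>\<^bsub>L\<^esub> z)"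
  using assms by (auto simp: tri_balanced_def)

lemma tri_balanced_of_kills:
  assumes "kills f (diamond3_rels B L)"
  shows "tri_balanced B L (\<lambda>x y z. f (x, y, z))"
proof -
  have 3: "f p = f q + f q'" if "frag_of p - frag_of q - frag_of q' \<in> diamond3_rels B L" for p q q'
  proof -
    have "fsum (frag_of p - frag_of q - frag_of q') f = 0" using assms that by (simp only: kills_def)
    then show ?thesis by (simp only: fsum_diff fsum_frag_of) (simp add: algebra_simps)
  qed
  have 2: "f p = f q" if "frag_of p - frag_of q \<in> diamond3_rels B L" for p q
  proof -
    have "fsum (frag_of p - frag_of q) f = 0" using assms that by (simp only: kills_def)
    then show ?thesis by (simp add: fsum_diff)
  qed
  show ?thesis
    unfolding tri_balanced_def
  proof (intro conjI ballI)
    fix x x' y z assume "x \<in> carrier L" "x' \<in> carrier L" "y \<in> carrier L" "z \<in> carrier L"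
    then show "f (x \<oplus>\<^bsub>L\<^esub> x', y, z) = f (x, y, z) + f (x', y, z)"
      by (intro 3) (unfold diamond3_rels_def, blast)
  next
    fix x y y' z assume "x \<in> carrier L" "y \<in> carrier L" "y' \<in> carrier L" "z \<in> carrier L"
    then show "f (x, y \<oplus>\<^bsub>L\<^esub> y', z) = f (x, y, z) + f (x, y', z)"
      by (intro 3) (unfold diamond3_rels_def, blast)
  next
    fix x y z z' assume "x \<in> carrier L" "y \<in> carrier L" "z \<in> carrier L" "z' \<in> carrier L"
    then show "f (x, y, z \<oplus>\<^bsub>L\<^esub> z') = f (x, y, z) + f (x, y, z')"
      by (intro 3) (unfold diamond3_rels_def, blast)
  next
    fix b x y z assume "b \<in> carrier B" "x \<in> carrier L" "y \<in> carrier L" "z \<in> carrier L"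
    then show "f (tgt L b \<otimes>\<^bsub>L\<^esub> x, y, z) = f (x, src L b \<otimes>\<^bsub>L\<^esub> y, z)"
      by (intro 2) (unfold diamond3_rels_def, blast)
  next
    fix b x y z assume "b \<in> carrier B" "x \<in> carrier L" "y \<in> carrier L" "z \<in> carrier L"
    then show "f (x, tgt L b \<otimes>\<^bsub>L\<^esub> y, z) = f (x, y, src L b \<otimes>\<^bsub>L\<^esub> z)"
      by (intro 2) (unfold diamond3_rels_def, blast)
  qed
qed

lemma kills_diamond3_rels:
  assumes f: "tri_balanced B L f"
  shows "kills (\<lambda>(x, y, z). if x \<in> carrier L \<and> y \<in> carrier L \<and> z \<in> carrier L then f x y z else 0) (diamond3_rels B L)"
proof -
  note fD = tri_balancedD[OF f]
  have "fsum r (\<lambda>(x, y, z). if x \<in> carrier L \<and> y \<in> carrier L \<and> z \<in> carrier L then f x y z else 0) = 0"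
    if r: "r \<in> diamond3_rels B L" for r
  proof -
    consider (a) x x' y z where "r = frag_of (x \<oplus>\<^bsub>L\<^esub> x', y, z) - frag_of (x, y, z) - frag_of (x', y, z)"
         "x \<in> carrier L" "x' \<in> carrier L" "y \<in> carrier L" "z \<in> carrier L"
      | (b) x y y' z where "r = frag_of (x, y \<oplus>\<^bsub>L\<^esub> y', z) - frag_of (x, y, z) - frag_of (x, y', z)"
         "x \<in> carrier L" "y \<in> carrier L" "y' \<in> carrier L" "z \<in> carrier L"
      | (c) x y z z' where "r = frag_of (x, y, z \<oplus>\<^bsub>L\<^esub> z') - frag_of (x, y, z) - frag_of (x, y, z')"
         "x \<in> carrier L" "y \<in> carrier L" "z \<in> carrier L" "z' \<in> carrier L"
      | (d) b x y z where "r = frag_of (tgt L b \<otimes>\<^bsub>L\<^esub> x, y, z) - frag_of (x, src L b \<otimes>\<^bsub>L\<^esub> y, z)"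
         "b \<in> carrier B" "x \<in> carrier L" "y \<in> carrier L" "z \<in> carrier L"
      | (e) b x y z where "r = frag_of (x, tgt L b \<otimes>\<^bsub>L\<^esub> y, z) - frag_of (x, y, src L b \<otimes>\<^bsub>L\<^esub> z)"
         "b \<in> carrier B" "x \<in> carrier L" "y \<in> carrier L" "z \<in> carrier L"
      using r unfolding diamond3_rels_def by blast
    then show ?thesis
      by cases (simp_all add: fsum_diff fD)
  qed
  then show ?thesis by (simp add: kills_def)
qed

text \<open>The universal property of the triple product\<close>

lemma diamond3_tri_balanced:
  assumes f: "tri_balanced B L f"
  obtains h where "ghom (diamond3 B L) h"
    and "\<And>x y z. \<lbrakk>x \<in> carrier L; y \<in> carrier L; z \<in> carrier L\<rbrakk> \<Longrightarrow> h (tclass (diamond3 B L) (frag_of (x, y, z))) = f x y z"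
proof
  let ?f = "\<lambda>(x, y, z). if x \<in> carrier L \<and> y \<in> carrier L \<and> z \<in> carrier L then f x y z else 0"
  show "ghom (diamond3 B L) (\<lambda>t. fsum (rep t) ?f)"
    by (simp add: ghom_def D3.fsum_rep_mult[OF kills_diamond3_rels[OF f]])
  show "fsum (rep (tclass (diamond3 B L) (frag_of (x, y, z)))) ?f = f x y z"
    if "x \<in> carrier L" "y \<in> carrier L" "z \<in> carrier L" for x y z
    using that by (simp add: D3.fsum_rep_tclass[OF kills_diamond3_rels[OF f]])
qed

end

text \<open>\<open>f X\<^sub>(\<^sub>1\<^sub>) X\<^sub>(\<^sub>2\<^sub>)\<close>, summed in a type class; \<open>ghom_sw\<close> relates it to \<open>sw\<close>.\<close>

abbreviation Sw :: "('k, 'b, 'l, 'z) bialgebroid_scheme \<Rightarrow> 'l \<Rightarrow> ('l \<Rightarrow> 'l \<Rightarrow> 'q::ab_group_add) \<Rightarrow> 'q"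
  where "Sw L X f \<equiv> psum (carrier L) (carrier L) (rep (cop L X)) f"

context left_bialgebroid
begin

lemma cop_carrier: "X \<in> carrier L \<Longrightarrow> cop L X \<in> carrier D.T"
  using cop_closed[of X] by (simp add: takeuchi_def Let_def diamond_eq)

lemma ghom_sw:
  assumes "comm_group G" "ghom G h" "X \<in> carrier L"
    and "\<And>x y. \<lbrakk>x \<in> carrier L; y \<in> carrier L\<rbrakk> \<Longrightarrow> g x y \<in> carrier G"
  shows "h (sw G L g X) = Sw L X (\<lambda>x y. h (g x y))"
  unfolding sw_def by (rule D.ghom_tlift_T[OF assms(1,2) cop_carrier[OF assms(3)] assms(4)])

lemma sw_closed:
  assumes "comm_group G" "X \<in> carrier L"
    and "\<And>x y. \<lbrakk>x \<in> carrier L; y \<in> carrier L\<rbrakk> \<Longrightarrow> g x y \<in> carrier G"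
  shows "sw G L g X \<in> carrier G"
  unfolding sw_def by (rule D.tlift_T_closed[OF assms(1) cop_carrier[OF assms(2)] assms(3)])

declare cou_closed [simp] cou_one [simp]

lemma Sw_add:
  assumes "diamond_balanced B L L f" "X \<in> carrier L" "Y \<in> carrier L"
  shows "Sw L (X \<oplus>\<^bsub>L\<^esub> Y) f = Sw L X f + Sw L Y f"
  using D.eval_mult[OF assms(1)] assms(2,3) by (simp add: cop_add diamond_eq cop_carrier)

lemma Sw_base_left:
  assumes f: "diamond_balanced B L L f" and "X \<in> carrier L" "b \<in> carrier B" "c \<in> carrier B"
  shows "Sw L (src L b \<otimes>\<^bsub>L\<^esub> tgt L c \<otimes>\<^bsub>L\<^esub> X) f = Sw L X (\<lambda>x y. f (src L b \<otimes>\<^bsub>L\<^esub> x) (tgt L c \<otimes>\<^bsub>L\<^esub> y))"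
  unfolding cop_linear[OF assms(3,4,2)] diamond_eq
  by (subst ghom_sw[OF D.comm_group_T D.ghom_of_balanced[OF f]])
    (use assms in \<open>simp_all add: D.tens_closed D.eval_tens\<close>)

lemma Sw_src_left:
  assumes f: "diamond_balanced B L L f" and "X \<in> carrier L" "b \<in> carrier B"
  shows "Sw L (src L b \<otimes>\<^bsub>L\<^esub> X) f = Sw L X (\<lambda>x y. f (src L b \<otimes>\<^bsub>L\<^esub> x) y)"
  using Sw_base_left[OF f assms(2,3), of "\<one>\<^bsub>B\<^esub>"] assms by simp

lemma Sw_tgt_left:
  assumes f: "diamond_balanced B L L f" and "X \<in> carrier L" "c \<in> carrier B"
  shows "Sw L (tgt L c \<otimes>\<^bsub>L\<^esub> X) f = Sw L X (\<lambda>x y. f x (tgt L c \<otimes>\<^bsub>L\<^esub> y))"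
  using Sw_base_left[OF f assms(2), of "\<one>\<^bsub>B\<^esub>" c] assms by simp

lemma Sw_one:
  assumes f: "diamond_balanced B L L f"
  shows "Sw L \<one>\<^bsub>L\<^esub> f = f \<one>\<^bsub>L\<^esub> \<one>\<^bsub>L\<^esub>"
  by (simp add: cop_one diamond_eq D.eval_tens[OF f])

lemma Sw_src: 
  assumes f: "diamond_balanced B L L f" and "b \<in> carrier B"
  shows "Sw L (src L b) f = f (src L b) \<one>\<^bsub>L\<^esub>"
proof -
  have "diamond_balanced B L L (\<lambda>x y. f (src L b \<otimes>\<^bsub>L\<^esub> x) y)"
    by (rule balancedI) (use assms balancedD[OF f] in \<open>simp_all add: L.A.r_distr base_normal\<close>)
  from Sw_one[OF this] show ?thesis using Sw_src_left[OF f, of "\<one>\<^bsub>L\<^esub>" b] assms by simp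
qed

lemma Sw_tgt: 
  assumes f: "diamond_balanced B L L f" and "b \<in> carrier B"
  shows "Sw L (tgt L b) f = f \<one>\<^bsub>L\<^esub> (tgt L b)"
proof -
  have "diamond_balanced B L L (\<lambda>x y. f x (tgt L b \<otimes>\<^bsub>L\<^esub> y))"
    by (rule balancedI) (use assms balancedD[OF f] in \<open>simp_all add: L.A.r_distr base_normal\<close>)
  from Sw_one[OF this] show ?thesis using Sw_tgt_left[OF f, of "\<one>\<^bsub>L\<^esub>" b] assms by simp
qed

lemma Sw_mult:
  assumes f: "diamond_balanced B L L f" and "X \<in> carrier L" "Y \<in> carrier L"
  shows "Sw L (X \<otimes>\<^bsub>L\<^esub> Y) f = Sw L X (\<lambda>x1 x2. Sw L Y (\<lambda>y1 y2. f (x1 \<otimes>\<^bsub>L\<^esub> y1) (x2 \<otimes>\<^bsub>L\<^esub> y2)))"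
  unfolding cop_mult[OF assms(2,3)] diamond_eq
  by (subst ghom_sw[OF D.comm_group_T D.ghom_of_balanced[OF f]])
    (use assms in \<open>simp_all add: D.tens_closed D.eval_tens ghom_sw[OF D.comm_group_T D.ghom_of_balanced[OF f]]
      sw_closed[OF D.comm_group_T]\<close>)

text \<open>The coproduct takes values in the Takeuchi product.\<close>

lemma Sw_takeuchi:
  assumes f: "diamond_balanced B L L f" and X: "X \<in> carrier L" "b \<in> carrier B"
  shows "Sw L X (\<lambda>x y. f (x \<otimes>\<^bsub>L\<^esub> tgt L b) y) = Sw L X (\<lambda>x y. f x (y \<otimes>\<^bsub>L\<^esub> src L b))"
proof -
  note rl = D.ghom_tlift_T[OF D.comm_group_T D.ghom_of_balanced[OF f] cop_carrier[OF X(1)]]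
  have "D.eval (tlift D.T (\<lambda>(m, n). tens D.T (m \<otimes>\<^bsub>L\<^esub> tgt L b) n) (cop L X)) f =
      D.eval (tlift D.T (\<lambda>(m, n). tens D.T m (n \<otimes>\<^bsub>L\<^esub> src L b)) (cop L X)) f"
    using cop_closed[OF X(1)] X(2) by (simp add: takeuchi_def Let_def diamond_eq)
  then show ?thesis
    by (subst (asm) (1 2) rl) (use X in \<open>simp_all add: D.tens_closed D.eval_tens[OF f]\<close>)
qed

text \<open>
  \<open>\<Delta>(b) = b \<otimes> 1\<close> and multiplicativity give this once the two sums are interchanged.  The sum over \<open>X\<close>, as
  a function of the second factor, is balanced by the Takeuchi condition.
\<close>

lemma Sw_src_right:
  assumes f: "diamond_balanced B L L f" and "X \<in> carrier L" "b \<in> carrier B"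
  shows "Sw L (X \<otimes>\<^bsub>L\<^esub> src L b) f = Sw L X (\<lambda>x y. f (x \<otimes>\<^bsub>L\<^esub> src L b) y)"
proof -
  have g: "diamond_balanced B L L (\<lambda>y1 y2. Sw L X (\<lambda>x1 x2. f (x1 \<otimes>\<^bsub>L\<^esub> y1) (x2 \<otimes>\<^bsub>L\<^esub> y2)))"
  proof (rule balancedI)
    fix c m n assume c: "c \<in> carrier B" "m \<in> carrier L" "n \<in> carrier L"
    have h: "diamond_balanced B L L (\<lambda>x1 x2. f (x1 \<otimes>\<^bsub>L\<^esub> m) (x2 \<otimes>\<^bsub>L\<^esub> n))"
      by (rule balancedI) (use c balancedD[OF f] in \<open>simp_all add: L.A.l_distr L.A.m_assoc\<close>)
    show "Sw L X (\<lambda>x1 x2. f (x1 \<otimes>\<^bsub>L\<^esub> (tgt L c \<otimes>\<^bsub>L\<^esub> m)) (x2 \<otimes>\<^bsub>L\<^esub> n))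
        = Sw L X (\<lambda>x1 x2. f (x1 \<otimes>\<^bsub>L\<^esub> m) (x2 \<otimes>\<^bsub>L\<^esub> (src L c \<otimes>\<^bsub>L\<^esub> n)))"
      using Sw_takeuchi[OF h assms(2) c(1)] c by (simp add: L.A.m_assoc)
  qed (use balancedD[OF f] in \<open>simp_all add: L.A.r_distr psum_distrib\<close>)
  have "Sw L (X \<otimes>\<^bsub>L\<^esub> src L b) f = Sw L (src L b) (\<lambda>y1 y2. Sw L X (\<lambda>x1 x2. f (x1 \<otimes>\<^bsub>L\<^esub> y1) (x2 \<otimes>\<^bsub>L\<^esub> y2)))"
    using assms by (simp add: Sw_mult psum_swap[of _ _ "rep (cop L X)"])
  also have "\<dots> = Sw L X (\<lambda>x y. f (x \<otimes>\<^bsub>L\<^esub> src L b) y)"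
    using assms by (simp add: Sw_src[OF g])
  finally show ?thesis .
qed

lemma Sw_tgt_right:
  assumes f: "diamond_balanced B L L f" and "X \<in> carrier L" "b \<in> carrier B"
  shows "Sw L (X \<otimes>\<^bsub>L\<^esub> tgt L b) f = Sw L X (\<lambda>x y. f x (y \<otimes>\<^bsub>L\<^esub> tgt L b))"
proof -
  have g: "diamond_balanced B L L (\<lambda>y1 y2. Sw L X (\<lambda>x1 x2. f (x1 \<otimes>\<^bsub>L\<^esub> y1) (x2 \<otimes>\<^bsub>L\<^esub> y2)))"
  proof (rule balancedI)
    fix c m n assume c: "c \<in> carrier B" "m \<in> carrier L" "n \<in> carrier L"
    have h: "diamond_balanced B L L (\<lambda>x1 x2. f (x1 \<otimes>\<^bsub>L\<^esub> m) (x2 \<otimes>\<^bsub>L\<^esub> n))"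
      by (rule balancedI) (use c balancedD[OF f] in \<open>simp_all add: L.A.l_distr L.A.m_assoc\<close>)
    show "Sw L X (\<lambda>x1 x2. f (x1 \<otimes>\<^bsub>L\<^esub> (tgt L c \<otimes>\<^bsub>L\<^esub> m)) (x2 \<otimes>\<^bsub>L\<^esub> n))
        = Sw L X (\<lambda>x1 x2. f (x1 \<otimes>\<^bsub>L\<^esub> m) (x2 \<otimes>\<^bsub>L\<^esub> (src L c \<otimes>\<^bsub>L\<^esub> n)))"
      using Sw_takeuchi[OF h assms(2) c(1)] c by (simp add: L.A.m_assoc)
  qed (use balancedD[OF f] in \<open>simp_all add: L.A.r_distr psum_distrib\<close>)
  have "Sw L (X \<otimes>\<^bsub>L\<^esub> tgt L b) f = Sw L (tgt L b) (\<lambda>y1 y2. Sw L X (\<lambda>x1 x2. f (x1 \<otimes>\<^bsub>L\<^esub> y1) (x2 \<otimes>\<^bsub>L\<^esub> y2)))"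
    using assms by (simp add: Sw_mult psum_swap[of _ _ "rep (cop L X)"])
  also have "\<dots> = Sw L X (\<lambda>x y. f x (y \<otimes>\<^bsub>L\<^esub> tgt L b))"
    using assms by (simp add: Sw_tgt[OF g])
  finally show ?thesis .
qed

lemma Sw_coassoc:
  assumes f: "tri_balanced B L f" and X: "X \<in> carrier L"
  shows "Sw L X (\<lambda>y x3. Sw L y (\<lambda>x1 x2. f x1 x2 x3)) = Sw L X (\<lambda>x1 y. Sw L y (\<lambda>x2 x3. f x1 x2 x3))"
proof -
  obtain h where h: "ghom (diamond3 B L) h" and hf: "\<And>x y z. \<lbrakk>x \<in> carrier L; y \<in> carrier L; z \<in> carrier L\<rbrakk> \<Longrightarrow>
      h (tclass (diamond3 B L) (frag_of (x, y, z))) = f x y z"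
    by (rule diamond3_tri_balanced[OF f]) blast
  note rl = ghom_sw[OF D3.comm_group_T h] sw_closed[OF D3.comm_group_T]
  have c: "tclass (diamond3 B L) (frag_of (x, y, z)) \<in> carrier (diamond3 B L)"
    if "x \<in> carrier L" "y \<in> carrier L" "z \<in> carrier L" for x y z
    using that by (intro D3.tclass_closed) simp
  show ?thesis using arg_cong[OF coassoc[OF X], of h] X by (simp add: rl c hf)
qed

lemma Sw_counit_left:
  assumes h: "additive L h" and X: "X \<in> carrier L"
  shows "Sw L X (\<lambda>x y. h (src L (cou L x) \<otimes>\<^bsub>L\<^esub> y)) = h X"
  using arg_cong[OF counit_left[OF X], of h] X by (simp add: ghom_sw[OF L.A.a_comm_group h])

lemma Sw_counit_right:
  assumes h: "additive L h" and X: "X \<in> carrier L"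
  shows "Sw L X (\<lambda>x y. h (tgt L (cou L y) \<otimes>\<^bsub>L\<^esub> x)) = h X"
  using arg_cong[OF counit_right[OF X], of h] X by (simp add: ghom_sw[OF L.A.a_comm_group h])

lemma cou_src_left [simp]: "\<lbrakk>b \<in> carrier B; X \<in> carrier L\<rbrakk> \<Longrightarrow> cou L (src L b \<otimes>\<^bsub>L\<^esub> X) = b \<otimes>\<^bsub>B\<^esub> cou L X"
  using cou_linear[of b "\<one>\<^bsub>B\<^esub>" X] by simp

lemma cou_tgt_left [simp]: "\<lbrakk>b \<in> carrier B; X \<in> carrier L\<rbrakk> \<Longrightarrow> cou L (tgt L b \<otimes>\<^bsub>L\<^esub> X) = cou L X \<otimes>\<^bsub>B\<^esub> b"
  using cou_linear[of "\<one>\<^bsub>B\<^esub>" b X] by simp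

lemma cou_tgt [simp]: "b \<in> carrier B \<Longrightarrow> cou L (tgt L b) = b"
  using cou_tgt_left[of b "\<one>\<^bsub>L\<^esub>"] by simp

lemma cou_src_tgt_right: "\<lbrakk>b \<in> carrier B; X \<in> carrier L\<rbrakk> \<Longrightarrow> cou L (X \<otimes>\<^bsub>L\<^esub> src L b) = cou L (X \<otimes>\<^bsub>L\<^esub> tgt L b)"
  using cou_mult_src[of X "tgt L b"] by simp

end

section \<open>The translation map of a left Hopf algebroid\<close>

text \<open>The maps on \<open>L \<otimes> L\<close> over \<open>\<bar>B\<close>, where \<open>X \<bar>b \<otimes> Y = X \<otimes> \<bar>b Y\<close>\<close>

abbreviation bar_balanced :: "('b, 'y) ring_scheme \<Rightarrow> ('k, 'b, 'm, 'z) be_ring_scheme \<Rightarrow>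
    ('m \<Rightarrow> 'm \<Rightarrow> 'q::ab_group_add) \<Rightarrow> bool"
  where "bar_balanced B M \<equiv>
    balanced M M (carrier B) (\<lambda>b m. m \<otimes>\<^bsub>M\<^esub> tgt M b) (\<lambda>b n. tgt M b \<otimes>\<^bsub>M\<^esub> n)"

text \<open>\<open>f X\<^sub>+ X\<^sub>-\<close>, summed in a type class\<close>

abbreviation Pm :: "('b, 'y) ring_scheme \<Rightarrow> ('k, 'b, 'l, 'z) bialgebroid_scheme \<Rightarrow> 'l \<Rightarrow>
    ('l \<Rightarrow> 'l \<Rightarrow> 'q::ab_group_add) \<Rightarrow> 'q"
  where "Pm B L X f \<equiv> psum (carrier L) (carrier L) (rep (plus_minus B L X)) f"

sublocale Be_ring \<subseteq> bar: balanced_tensor L L "carrier B" "\<lambda>b m. m \<otimes>\<^bsub>L\<^esub> tgt L b" "\<lambda>b n. tgt L b \<otimes>\<^bsub>L\<^esub> n"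
  by unfold_locales simp_all

context left_hopf_algebroid
begin

lemma bar_eq: "tensor_bar B L = bar.T"
  by (simp add: tensor_bar_def)

abbreviation "gal \<equiv> galois_map B L"

lemma galois_bij': "bij_betw gal (carrier bar.T) (carrier D.T)"
  using galois_bij by (simp add: bar_eq diamond_eq)

lemma bar_balanced_galois:
  assumes f: "diamond_balanced B L L f"
  shows "bar_balanced B L (\<lambda>p m. Sw L p (\<lambda>p1 p2. f p1 (p2 \<otimes>\<^bsub>L\<^esub> m)))"
proof -
  have g: "diamond_balanced B L L (\<lambda>p1 p2. f p1 (p2 \<otimes>\<^bsub>L\<^esub> m))" if "m \<in> carrier L" for m
    by (rule balancedI) (use that balancedD[OF f] in \<open>simp_all add: L.A.l_distr L.A.m_assoc\<close>)
  show ?thesis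
    by (rule balancedI) (use balancedD[OF f] in
      \<open>simp_all add: L.A.r_distr psum_distrib Sw_add[OF g] Sw_tgt_right[OF g] L.A.m_assoc\<close>)
qed

text \<open>Evaluating at \<open>\<lambda>(p \<otimes> m) = p\<^sub>(\<^sub>1\<^sub>) \<otimes> p\<^sub>(\<^sub>2\<^sub>) m\<close>\<close>

lemma eval_galois:
  assumes f: "diamond_balanced B L L f" and t: "t \<in> carrier bar.T"
  shows "D.eval (gal t) f = bar.eval t (\<lambda>p m. Sw L p (\<lambda>p1 p2. f p1 (p2 \<otimes>\<^bsub>L\<^esub> m)))"
  unfolding galois_map_def Let_def diamond_eq
  by (subst bar.ghom_tlift_T[OF D.comm_group_T D.ghom_of_balanced[OF f] t])
    (simp_all add: sw_closed[OF D.comm_group_T] D.tens_closed D.eval_tens[OF f]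
      ghom_sw[OF D.comm_group_T D.ghom_of_balanced[OF f]])

lemma gal_mult:
  assumes "t \<in> carrier bar.T" "u \<in> carrier bar.T"
  shows "gal (t \<otimes>\<^bsub>bar.T\<^esub> u) = gal t \<otimes>\<^bsub>D.T\<^esub> gal u"
proof -
  interpret DT: comm_group D.T by (rule D.comm_group_T)
  interpret bT: comm_group bar.T by (rule bar.comm_group_T)
  have c: "gal s \<in> carrier D.T" if "s \<in> carrier bar.T" for s
    using galois_bij' that by (auto simp: bij_betw_def)
  show ?thesis
  proof (rule D.eqI)
    fix f :: "'l \<Rightarrow> 'l \<Rightarrow> (('l \<times> 'l) \<Rightarrow>\<^sub>0 int) set ambient"
    assume f: "diamond_balanced B L L f"
    show "D.eval (gal (t \<otimes>\<^bsub>bar.T\<^esub> u)) f = D.eval (gal t \<otimes>\<^bsub>D.T\<^esub> gal u) f"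
      using assms by (simp add: D.eval_mult[OF f] c eval_galois[OF f] bar.eval_mult[OF bar_balanced_galois[OF f]])
  qed (use assms c in simp_all)
qed

definition ginv where "ginv = inv_into (carrier bar.T) gal"

lemma ginv_closed: "t \<in> carrier D.T \<Longrightarrow> ginv t \<in> carrier bar.T"
  unfolding ginv_def by (rule inv_into_into) (simp add: bij_betw_imp_surj_on[OF galois_bij'])

lemma gal_ginv: "t \<in> carrier D.T \<Longrightarrow> gal (ginv t) = t"
  unfolding ginv_def by (rule bij_betw_inv_into_right[OF galois_bij'])

lemma ginv_gal: "t \<in> carrier bar.T \<Longrightarrow> ginv (gal t) = t"
  unfolding ginv_def by (rule bij_betw_inv_into_left[OF galois_bij'])

lemma plus_minus_ginv: "plus_minus B L X = ginv (tens D.T X \<one>\<^bsub>L\<^esub>)"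
  by (simp add: plus_minus_def ginv_def bar_eq diamond_eq)

lemma ghom_ginv:
  assumes h: "bar_balanced B L h"
  shows "ghom D.T (\<lambda>t. bar.eval (ginv t) h)"
  unfolding ghom_def
proof (intro ballI)
  interpret bT: comm_group bar.T by (rule bar.comm_group_T)
  fix t u assume tu: "t \<in> carrier D.T" "u \<in> carrier D.T"
  have "gal (ginv t \<otimes>\<^bsub>bar.T\<^esub> ginv u) = t \<otimes>\<^bsub>D.T\<^esub> u"
    using tu by (simp add: gal_mult ginv_closed gal_ginv)
  then have "ginv (t \<otimes>\<^bsub>D.T\<^esub> u) = ginv t \<otimes>\<^bsub>bar.T\<^esub> ginv u"
    using tu ginv_gal[of "ginv t \<otimes>\<^bsub>bar.T\<^esub> ginv u"] by (simp add: ginv_closed)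
  then show "bar.eval (ginv (t \<otimes>\<^bsub>D.T\<^esub> u)) h = bar.eval (ginv t) h + bar.eval (ginv u) h"
    using tu by (simp add: bar.eval_mult[OF h] ginv_closed)
qed

text \<open>
  The composite of \<open>h\<close> with the inverse Galois map.  It is characterised by \<open>ungal_inverse\<close> and
  \<open>ungal_unique\<close>, and every rule for \<open>X\<^sub>+ \<otimes> X\<^sub>-\<close> below compares two maps through this characterisation.
\<close>

definition ungal :: "('l \<Rightarrow> 'l \<Rightarrow> 'q::ab_group_add) \<Rightarrow> 'l \<Rightarrow> 'l \<Rightarrow> 'q"
  where "ungal h x y = bar.eval (ginv (tens D.T x y)) h"

lemma ungal_balanced: "bar_balanced B L h \<Longrightarrow> diamond_balanced B L L (ungal h)"
  using D.balanced_ghom[OF ghom_ginv] unfolding ungal_def .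

lemma ungal_inverse:
  assumes h: "bar_balanced B L h" and pm: "p \<in> carrier L" "m \<in> carrier L"
  shows "Sw L p (\<lambda>p1 p2. ungal h p1 (p2 \<otimes>\<^bsub>L\<^esub> m)) = h p m"
proof -
  have t: "tens bar.T p m \<in> carrier bar.T" using pm by (rule bar.tens_closed)
  have u: "diamond_balanced B L L (ungal h)" by (rule ungal_balanced[OF h])
  have c: "gal (tens bar.T p m) \<in> carrier D.T"
    using galois_bij' t by (auto simp: bij_betw_def)
  have "h p m = bar.eval (ginv (gal (tens bar.T p m))) h"
    using bar.eval_tens[OF h pm] t by (simp add: ginv_gal)
  also have "\<dots> = D.eval (gal (tens bar.T p m)) (ungal h)"
    using D.ghom_eval[OF ghom_ginv[OF h] c] by (simp add: ungal_def)
  also have "\<dots> = Sw L p (\<lambda>p1 p2. ungal h p1 (p2 \<otimes>\<^bsub>L\<^esub> m))"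
    using pm by (simp add: eval_galois[OF u t] bar.eval_tens[OF bar_balanced_galois[OF u]])
  finally show ?thesis ..
qed

lemma ungal_unique:
  assumes h: "bar_balanced B L h" and g: "diamond_balanced B L L g"
    and e: "\<And>p m. \<lbrakk>p \<in> carrier L; m \<in> carrier L\<rbrakk> \<Longrightarrow> Sw L p (\<lambda>p1 p2. g p1 (p2 \<otimes>\<^bsub>L\<^esub> m)) = h p m"
    and xy: "x \<in> carrier L" "y \<in> carrier L"
  shows "ungal h x y = g x y"
proof -
  have t: "tens D.T x y \<in> carrier D.T" using xy by (rule D.tens_closed)
  have "g x y = D.eval (gal (ginv (tens D.T x y))) g"
    using D.eval_tens[OF g xy] by (simp add: gal_ginv[OF t])
  also have "\<dots> = ungal h x y"
    by (simp add: eval_galois[OF g ginv_closed[OF t]] e ungal_def)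
  finally show ?thesis ..
qed

lemma Pm_ungal: "Pm B L x h = ungal h x \<one>\<^bsub>L\<^esub>"
  by (simp add: plus_minus_ginv ungal_def)

text \<open>The inverse Galois map is right linear over \<open>L\<close>, so it is determined by its values at \<open>x \<otimes> 1\<close>.\<close>

lemma ungal_Pm:
  assumes h: "bar_balanced B L h" and xy: "x \<in> carrier L" "y \<in> carrier L"
  shows "ungal h x y = Pm B L x (\<lambda>p m. h p (m \<otimes>\<^bsub>L\<^esub> y))"
proof -
  have 1: "bar_balanced B L (\<lambda>p m. h p (m \<otimes>\<^bsub>L\<^esub> y))"
    by (rule balancedI) (use xy balancedD[OF h] in \<open>simp_all add: L.A.l_distr L.A.m_assoc\<close>)
  have 2: "diamond_balanced B L L (\<lambda>p m. ungal h p (m \<otimes>\<^bsub>L\<^esub> y))"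
    by (rule balancedI) (use xy balancedD[OF ungal_balanced[OF h]] in \<open>simp_all add: L.A.l_distr L.A.m_assoc\<close>)
  have "ungal (\<lambda>p m. h p (m \<otimes>\<^bsub>L\<^esub> y)) x \<one>\<^bsub>L\<^esub> = ungal h x (\<one>\<^bsub>L\<^esub> \<otimes>\<^bsub>L\<^esub> y)"
    by (rule ungal_unique[OF 1 2]) (use xy in \<open>simp_all add: L.A.m_assoc ungal_inverse[OF h]\<close>)
  then show ?thesis using xy by (simp add: Pm_ungal)
qed

lemma Pm_balanced:
  "bar_balanced B L h \<Longrightarrow> diamond_balanced B L L (\<lambda>x y. Pm B L x (\<lambda>p m. h p (m \<otimes>\<^bsub>L\<^esub> y)))"
  by (rule balancedI) (simp_all add: ungal_Pm[symmetric] balancedD[OF ungal_balanced])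

text \<open>\<open>\<lambda>(\<lambda>\<^sup>-\<^sup>1(x \<otimes> 1)) = x \<otimes> 1\<close>, that is, \<open>x\<^sub>+\<^sub>(\<^sub>1\<^sub>) \<otimes> x\<^sub>+\<^sub>(\<^sub>2\<^sub>) x\<^sub>- = x \<otimes> 1\<close>\<close>

lemma Pm_Sw:
  assumes g: "diamond_balanced B L L g" and x: "x \<in> carrier L"
  shows "Pm B L x (\<lambda>p m. Sw L p (\<lambda>p1 p2. g p1 (p2 \<otimes>\<^bsub>L\<^esub> m))) = g x \<one>\<^bsub>L\<^esub>"
  unfolding Pm_ungal by (rule ungal_unique[OF bar_balanced_galois[OF g] g]) (use x in simp_all)

text \<open>\<open>\<lambda>\<^sup>-\<^sup>1(\<lambda>(p \<otimes> m)) = p \<otimes> m\<close>, that is, \<open>p\<^sub>(\<^sub>1\<^sub>)\<^sub>+ \<otimes> p\<^sub>(\<^sub>1\<^sub>)\<^sub>- p\<^sub>(\<^sub>2\<^sub>) m = p \<otimes> m\<close>\<close>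

lemma Sw_Pm:
  assumes h: "bar_balanced B L h" and p: "p \<in> carrier L" "m \<in> carrier L"
  shows "Sw L p (\<lambda>p1 p2. Pm B L p1 (\<lambda>q n. h q (n \<otimes>\<^bsub>L\<^esub> (p2 \<otimes>\<^bsub>L\<^esub> m)))) = h p m"
  using ungal_inverse[OF h p] p by (simp add: ungal_Pm[OF h])

lemma Sw_Pm_one:
  assumes h: "bar_balanced B L h" and p: "p \<in> carrier L"
  shows "Sw L p (\<lambda>p1 p2. Pm B L p1 (\<lambda>q n. h q (n \<otimes>\<^bsub>L\<^esub> p2))) = h p \<one>\<^bsub>L\<^esub>"
  using Sw_Pm[OF h p L.A.one_closed] by simp

lemma Pm_add:
  assumes h: "bar_balanced B L h" and x: "x \<in> carrier L" "y \<in> carrier L"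
  shows "Pm B L (x \<oplus>\<^bsub>L\<^esub> y) h = Pm B L x h + Pm B L y h"
  unfolding Pm_ungal using x by (simp add: balancedD[OF ungal_balanced[OF h]])

lemma Pm_tgt_left:
  assumes h: "bar_balanced B L h" and x: "x \<in> carrier L" "b \<in> carrier B"
  shows "Pm B L (tgt L b \<otimes>\<^bsub>L\<^esub> x) h = Pm B L x (\<lambda>p m. h p (m \<otimes>\<^bsub>L\<^esub> src L b))"
  using balanced_act[OF ungal_balanced[OF h] x(2,1) L.A.one_closed] x
  by (simp add: Pm_ungal[of "tgt L b \<otimes>\<^bsub>L\<^esub> x"] ungal_Pm[OF h, symmetric])

text \<open>
  In this and the following rules the base element is moved through the coproduct of \<open>p\<close> in the
  characterisation of \<open>ungal\<close>; the rule for \<open>Sw\<close> with the same base element decides where it ends up.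
\<close>

lemma Pm_src_left:
  assumes h: "bar_balanced B L h" and x: "x \<in> carrier L" "b \<in> carrier B"
  shows "Pm B L (src L b \<otimes>\<^bsub>L\<^esub> x) h = Pm B L x (\<lambda>p m. h (src L b \<otimes>\<^bsub>L\<^esub> p) m)"
  unfolding Pm_ungal
proof (rule ungal_unique[symmetric])
  show "bar_balanced B L (\<lambda>p m. h (src L b \<otimes>\<^bsub>L\<^esub> p) m)"
    by (rule balancedI) (use x balancedD[OF h] in \<open>simp_all add: L.A.r_distr L.A.m_assoc[symmetric]\<close>)
  show "diamond_balanced B L L (\<lambda>p m. ungal h (src L b \<otimes>\<^bsub>L\<^esub> p) m)"
    by (rule balancedI) (use x balancedD[OF ungal_balanced[OF h]] in \<open>simp_all add: L.A.r_distr base_normal\<close>)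
  fix p m assume pm: "p \<in> carrier L" "m \<in> carrier L"
  have 1: "diamond_balanced B L L (\<lambda>p1 p2. ungal h p1 (p2 \<otimes>\<^bsub>L\<^esub> m))"
    by (rule balancedI) (use pm balancedD[OF ungal_balanced[OF h]] in \<open>simp_all add: L.A.l_distr L.A.m_assoc\<close>)
  show "Sw L p (\<lambda>p1 p2. ungal h (src L b \<otimes>\<^bsub>L\<^esub> p1) (p2 \<otimes>\<^bsub>L\<^esub> m)) = h (src L b \<otimes>\<^bsub>L\<^esub> p) m"
    using Sw_src_left[OF 1 pm(1) x(2)] ungal_inverse[OF h, of "src L b \<otimes>\<^bsub>L\<^esub> p" m] x pm by simp
qed (use x in simp_all)

lemma Pm_src_right:
  assumes h: "bar_balanced B L h" and x: "x \<in> carrier L" "b \<in> carrier B"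
  shows "Pm B L (x \<otimes>\<^bsub>L\<^esub> src L b) h = Pm B L x (\<lambda>p m. h (p \<otimes>\<^bsub>L\<^esub> src L b) m)"
  unfolding Pm_ungal
proof (rule ungal_unique[symmetric])
  show "bar_balanced B L (\<lambda>p m. h (p \<otimes>\<^bsub>L\<^esub> src L b) m)"
  proof (rule balancedI)
    fix c m n assume "c \<in> carrier B" "m \<in> carrier L" "n \<in> carrier L"
    then show "h (m \<otimes>\<^bsub>L\<^esub> tgt L c \<otimes>\<^bsub>L\<^esub> src L b) n = h (m \<otimes>\<^bsub>L\<^esub> src L b) (tgt L c \<otimes>\<^bsub>L\<^esub> n)"
      using balanced_act[OF h, of c "m \<otimes>\<^bsub>L\<^esub> src L b" n] x by (simp add: L.A.m_assoc src_tgt_comm)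
  qed (use x balancedD[OF h] in \<open>simp_all add: L.A.l_distr\<close>)
  show "diamond_balanced B L L (\<lambda>p m. ungal h (p \<otimes>\<^bsub>L\<^esub> src L b) m)"
    by (rule balancedI) (use x balancedD[OF ungal_balanced[OF h]] in \<open>simp_all add: L.A.l_distr L.A.m_assoc\<close>)
  fix p m assume pm: "p \<in> carrier L" "m \<in> carrier L"
  have 1: "diamond_balanced B L L (\<lambda>p1 p2. ungal h p1 (p2 \<otimes>\<^bsub>L\<^esub> m))"
    by (rule balancedI) (use pm balancedD[OF ungal_balanced[OF h]] in \<open>simp_all add: L.A.l_distr L.A.m_assoc\<close>)
  show "Sw L p (\<lambda>p1 p2. ungal h (p1 \<otimes>\<^bsub>L\<^esub> src L b) (p2 \<otimes>\<^bsub>L\<^esub> m)) = h (p \<otimes>\<^bsub>L\<^esub> src L b) m"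
    using Sw_src_right[OF 1 pm(1) x(2)] ungal_inverse[OF h, of "p \<otimes>\<^bsub>L\<^esub> src L b" m] x pm by simp
qed (use x in simp_all)

lemma Pm_tgt_right:
  assumes h: "bar_balanced B L h" and x: "x \<in> carrier L" "b \<in> carrier B"
  shows "Pm B L (x \<otimes>\<^bsub>L\<^esub> tgt L b) h = Pm B L x (\<lambda>p m. h p (src L b \<otimes>\<^bsub>L\<^esub> m))"
  unfolding Pm_ungal
proof (rule ungal_unique[symmetric])
  show "bar_balanced B L (\<lambda>p m. h p (src L b \<otimes>\<^bsub>L\<^esub> m))"
    by (rule balancedI) (use x balancedD[OF h] in \<open>simp_all add: L.A.r_distr base_normal\<close>)
  show "diamond_balanced B L L (\<lambda>p m. ungal h (p \<otimes>\<^bsub>L\<^esub> tgt L b) m)"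
    by (rule balancedI) (use x balancedD[OF ungal_balanced[OF h]] in \<open>simp_all add: L.A.l_distr L.A.m_assoc\<close>)
  fix p m assume pm: "p \<in> carrier L" "m \<in> carrier L"
  have 1: "diamond_balanced B L L (\<lambda>p1 p2. ungal h p1 (p2 \<otimes>\<^bsub>L\<^esub> m))"
    by (rule balancedI) (use pm balancedD[OF ungal_balanced[OF h]] in \<open>simp_all add: L.A.l_distr L.A.m_assoc\<close>)
  show "Sw L p (\<lambda>p1 p2. ungal h (p1 \<otimes>\<^bsub>L\<^esub> tgt L b) (p2 \<otimes>\<^bsub>L\<^esub> m)) = h p (src L b \<otimes>\<^bsub>L\<^esub> m)"
    using Sw_takeuchi[OF 1 pm(1) x(2)] ungal_inverse[OF h pm(1), of "src L b \<otimes>\<^bsub>L\<^esub> m"] x pm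
    by (simp add: L.A.m_assoc)
qed (use x in simp_all)

text \<open>The analogue of the Takeuchi condition for \<open>x\<^sub>+ \<otimes> x\<^sub>-\<close>\<close>

lemma Pm_tgt_plus:
  assumes h: "bar_balanced B L h" and x: "x \<in> carrier L" "b \<in> carrier B"
  shows "Pm B L x (\<lambda>p m. h (tgt L b \<otimes>\<^bsub>L\<^esub> p) m) = Pm B L x (\<lambda>p m. h p (m \<otimes>\<^bsub>L\<^esub> tgt L b))"
proof -
  have 1: "bar_balanced B L (\<lambda>p m. h (tgt L b \<otimes>\<^bsub>L\<^esub> p) m)"
    by (rule balancedI) (use x balancedD[OF h] in \<open>simp_all add: L.A.r_distr L.A.m_assoc[symmetric]\<close>)
  have 2: "diamond_balanced B L L (\<lambda>p m. ungal h p (tgt L b \<otimes>\<^bsub>L\<^esub> m))"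
    by (rule balancedI) (use x balancedD[OF ungal_balanced[OF h]] in \<open>simp_all add: L.A.r_distr base_normal[symmetric]\<close>)
  have "ungal (\<lambda>p m. h (tgt L b \<otimes>\<^bsub>L\<^esub> p) m) x \<one>\<^bsub>L\<^esub> = ungal h x (tgt L b \<otimes>\<^bsub>L\<^esub> \<one>\<^bsub>L\<^esub>)"
  proof (rule ungal_unique[OF 1 2])
    fix p m assume pm: "p \<in> carrier L" "m \<in> carrier L"
    have 1: "diamond_balanced B L L (\<lambda>p1 p2. ungal h p1 (p2 \<otimes>\<^bsub>L\<^esub> m))"
      by (rule balancedI) (use pm balancedD[OF ungal_balanced[OF h]] in \<open>simp_all add: L.A.l_distr L.A.m_assoc\<close>)
    show "Sw L p (\<lambda>p1 p2. ungal h p1 (tgt L b \<otimes>\<^bsub>L\<^esub> (p2 \<otimes>\<^bsub>L\<^esub> m))) = h (tgt L b \<otimes>\<^bsub>L\<^esub> p) m"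
      using Sw_tgt_left[OF 1 pm(1) x(2)] ungal_inverse[OF h, of "tgt L b \<otimes>\<^bsub>L\<^esub> p" m] x pm
      by (simp add: L.A.m_assoc)
  qed (use x in simp_all)
  then show ?thesis using x by (simp add: Pm_ungal[of x "\<lambda>p m. h (tgt L b \<otimes>\<^bsub>L\<^esub> p) m"] ungal_Pm[OF h])
qed

lemma Pm_one:
  assumes h: "bar_balanced B L h"
  shows "Pm B L \<one>\<^bsub>L\<^esub> h = h \<one>\<^bsub>L\<^esub> \<one>\<^bsub>L\<^esub>"
  using ungal_inverse[OF h, of "\<one>\<^bsub>L\<^esub>" "\<one>\<^bsub>L\<^esub>"]
  by (simp add: Sw_one[OF ungal_balanced[OF h]] Pm_ungal)

text \<open>
  \<open>X\<^sub>+\<^sub>(\<^sub>1\<^sub>) \<otimes> X\<^sub>+\<^sub>(\<^sub>2\<^sub>) \<otimes> X\<^sub>- = X\<^sub>(\<^sub>1\<^sub>) \<otimes> X\<^sub>(\<^sub>2\<^sub>)\<^sub>+ \<otimes> X\<^sub>(\<^sub>2\<^sub>)\<^sub>-\<close>.  Apply \<open>Pm_Sw\<close> to the right-hand side, viewed as a function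
  of \<open>X \<otimes> 1\<close>; coassociativity then makes \<open>Sw_Pm\<close> applicable.  The two assumptions say that \<open>f\<close> is balanced on
  \<open>L \<diamondop> (L \<otimes> L)\<close>, where the inner tensor product is over \<open>\<bar>B\<close>.
\<close>

lemma Pm_Sw_plus:
  assumes 12: "\<And>z. z \<in> carrier L \<Longrightarrow> diamond_balanced B L L (\<lambda>x y. f x y z)"
    and 23: "\<And>x. x \<in> carrier L \<Longrightarrow> bar_balanced B L (f x)"
    and x: "x \<in> carrier L"
  shows "Pm B L x (\<lambda>p m. Sw L p (\<lambda>p1 p2. f p1 p2 m)) = Sw L x (\<lambda>x1 x2. Pm B L x2 (\<lambda>p m. f x1 p m))"
proof -
  note fD = balancedD[OF 12] balancedD[OF 23]
  have f': "bar_balanced B L (\<lambda>p m. f u p (m \<otimes>\<^bsub>L\<^esub> z))" if "u \<in> carrier L" "z \<in> carrier L" for u z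
    by (rule balancedI) (use that in \<open>simp_all add: fD L.A.l_distr L.A.m_assoc\<close>)
  have g: "diamond_balanced B L L (\<lambda>y1 y2. Pm B L y2 (\<lambda>p m. f y1 p (m \<otimes>\<^bsub>L\<^esub> z)))" if "z \<in> carrier L" for z
    by (rule balancedI) (use that in \<open>simp_all add: fD Pm_add[OF f'] Pm_src_left[OF f'] psum_distrib\<close>)
  \<comment> \<open>the right-hand side with \<open>X\<^sub>(\<^sub>2\<^sub>)\<^sub>-\<close> multiplied by \<open>z\<close>, so that it is defined on \<open>y \<otimes> z\<close> and is the required sum at \<open>z = 1\<close>\<close>
  define \<Phi> where "\<Phi> y z = Sw L y (\<lambda>y1 y2. Pm B L y2 (\<lambda>p m. f y1 p (m \<otimes>\<^bsub>L\<^esub> z)))" for y z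
  have \<Phi>: "diamond_balanced B L L \<Phi>"
    unfolding \<Phi>_def by (rule balancedI)
      (simp_all add: fD Sw_add[OF g] Sw_tgt_left[OF g] Pm_tgt_left[OF f'] L.A.r_distr psum_distrib L.A.m_assoc)
  have "Sw L x (\<lambda>x1 x2. Pm B L x2 (\<lambda>p m. f x1 p m)) = \<Phi> x \<one>\<^bsub>L\<^esub>"
    by (simp add: \<Phi>_def)
  also have "\<dots> = Pm B L x (\<lambda>p m. Sw L p (\<lambda>p1 p2. \<Phi> p1 (p2 \<otimes>\<^bsub>L\<^esub> m)))"
    by (rule Pm_Sw[OF \<Phi> x, symmetric])
  also have "\<dots> = Pm B L x (\<lambda>p m. Sw L p (\<lambda>p1 p2. f p1 p2 m))"
  proof (rule psum_cong[OF refl])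
    fix p m assume pm: "p \<in> carrier L" "m \<in> carrier L"
    have t: "tri_balanced B L (\<lambda>y1 y2 p2. Pm B L y2 (\<lambda>q n. f y1 q (n \<otimes>\<^bsub>L\<^esub> (p2 \<otimes>\<^bsub>L\<^esub> m))))"
      unfolding tri_balanced_def by (intro conjI ballI)
        (use pm in \<open>simp_all add: fD Pm_add[OF f'] Pm_src_left[OF f'] Pm_tgt_left[OF f'] psum_distrib
          L.A.r_distr L.A.l_distr L.A.m_assoc\<close>)
    show "Sw L p (\<lambda>p1 p2. \<Phi> p1 (p2 \<otimes>\<^bsub>L\<^esub> m)) = Sw L p (\<lambda>p1 p2. f p1 p2 m)"
      unfolding \<Phi>_def Sw_coassoc[OF t pm(1)] using pm by (simp add: Sw_Pm[OF 23])
  qed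
  finally show ?thesis ..
qed

text \<open>
  \<open>X\<^sub>+ \<otimes> X\<^sub>-\<^sub>(\<^sub>1\<^sub>) \<otimes> X\<^sub>-\<^sub>(\<^sub>2\<^sub>) = X\<^sub>+\<^sub>+ \<otimes> X\<^sub>- \<otimes> X\<^sub>+\<^sub>-\<close>.  The Galois map in the first and third factor followed by the one in
  the first and second factor is injective; \<open>h1\<close> and \<open>h2\<close> are \<open>h\<close> composed with the inverses.  Both sides become
  \<open>X \<otimes> 1 \<otimes> 1\<close> after applying these maps, by coassociativity and \<open>Pm_Sw\<close>.
\<close>

lemma Pm_Sw_minus:
  assumes 13: "\<And>u. u \<in> carrier L \<Longrightarrow> bar_balanced B L (\<lambda>p v. h p u v)"
    and 23: "\<And>p. p \<in> carrier L \<Longrightarrow> diamond_balanced B L L (h p)"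
    and x: "x \<in> carrier L"
  shows "Pm B L x (\<lambda>p m. Sw L m (\<lambda>m1 m2. h p m1 m2)) = Pm B L x (\<lambda>p m. Pm B L p (\<lambda>p' m'. h p' m m'))"
proof -
  note hD = balancedD[OF 13] balancedD[OF 23]
  define h1 where "h1 a u w = Pm B L a (\<lambda>q n. h q u (n \<otimes>\<^bsub>L\<^esub> w))" for a u w
  have b1: "bar_balanced B L (\<lambda>q n. h q u (n \<otimes>\<^bsub>L\<^esub> w))" if "u \<in> carrier L" "w \<in> carrier L" for u w
    by (rule balancedI) (use that in \<open>simp_all add: hD L.A.l_distr L.A.m_assoc\<close>)
  have h1_13: "diamond_balanced B L L (\<lambda>a w. h1 a u w)" if "u \<in> carrier L" for u
    unfolding h1_def by (rule Pm_balanced[OF 13[OF that]])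
  have h1_12: "bar_balanced B L (\<lambda>a u. h1 a u w)" if "w \<in> carrier L" for w
    unfolding h1_def by (rule balancedI)
      (use that in \<open>simp_all add: hD Pm_add[OF b1] psum_distrib Pm_tgt_right[OF b1] L.A.m_assoc\<close>)
  note h1D = balancedD[OF h1_13] balancedD[OF h1_12]
  have b2: "bar_balanced B L (\<lambda>q n. h1 q (n \<otimes>\<^bsub>L\<^esub> u) w)" if "u \<in> carrier L" "w \<in> carrier L" for u w
    by (rule balancedI) (use that in \<open>simp_all add: h1D L.A.l_distr L.A.m_assoc\<close>)
  define h2 where "h2 a u w = Pm B L a (\<lambda>q n. h1 q (n \<otimes>\<^bsub>L\<^esub> u) w)" for a u w
  have h2_12: "diamond_balanced B L L (\<lambda>a u. h2 a u w)" if "w \<in> carrier L" for w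
    unfolding h2_def by (rule Pm_balanced[OF h1_12[OF that]])
  have h2_23: "diamond_balanced B L L (h2 a)" if a: "a \<in> carrier L" for a
  proof (rule balancedI)
    fix b u w assume b: "b \<in> carrier B" "u \<in> carrier L" "w \<in> carrier L"
    show "h2 a (tgt L b \<otimes>\<^bsub>L\<^esub> u) w = h2 a u (src L b \<otimes>\<^bsub>L\<^esub> w)"
      using Pm_tgt_plus[OF b2[OF b(2,3)] a b(1)] b
      by (simp add: h2_def h1D(3)[symmetric] L.A.m_assoc)
  qed (use a in \<open>simp_all add: h1D h2_def psum_distrib L.A.r_distr\<close>)
  note h2D = balancedD[OF h2_12] balancedD[OF h2_23]
  define \<Theta> where "\<Theta> y z = Sw L z (\<lambda>z1 z2. h2 y z1 z2)" for y z
  have \<Theta>: "diamond_balanced B L L \<Theta>"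
    unfolding \<Theta>_def by (rule balancedI)
      (simp_all add: h2D(1-3) psum_distrib Sw_add[OF h2_23] Sw_src_left[OF h2_23])
  have "Pm B L x (\<lambda>p m. Sw L m (\<lambda>m1 m2. h p m1 m2)) = Pm B L x (\<lambda>p m. Sw L p (\<lambda>p1 r. \<Theta> p1 (r \<otimes>\<^bsub>L\<^esub> m)))"
  proof (rule psum_cong[OF refl])
    fix p m assume pm: "p \<in> carrier L" "m \<in> carrier L"
    have "Sw L m (\<lambda>m1 m2. h p m1 m2)
      = Sw L m (\<lambda>m1 m2. Sw L p (\<lambda>y p2. Sw L y (\<lambda>p1 r. h2 p1 (r \<otimes>\<^bsub>L\<^esub> m1) (p2 \<otimes>\<^bsub>L\<^esub> m2))))"
      using pm by (simp add: h2_def Sw_Pm[OF h1_12]) (simp add: h1_def Sw_Pm[OF 13])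
    also have "\<dots> = Sw L m (\<lambda>m1 m2. Sw L p (\<lambda>p1 y. Sw L y (\<lambda>r r2. h2 p1 (r \<otimes>\<^bsub>L\<^esub> m1) (r2 \<otimes>\<^bsub>L\<^esub> m2))))"
    proof (rule psum_cong[OF refl])
      fix m1 m2 assume m: "m1 \<in> carrier L" "m2 \<in> carrier L"
      have t: "tri_balanced B L (\<lambda>p1 r p2. h2 p1 (r \<otimes>\<^bsub>L\<^esub> m1) (p2 \<otimes>\<^bsub>L\<^esub> m2))"
        unfolding tri_balanced_def by (intro conjI ballI)
          (use m in \<open>simp_all add:  h2D(1-2) h2D(5) L.A.l_distr L.A.m_assoc, simp_all add: h2D(3) h2D(6)\<close>)
      show "Sw L p (\<lambda>y p2. Sw L y (\<lambda>p1 r. h2 p1 (r \<otimes>\<^bsub>L\<^esub> m1) (p2 \<otimes>\<^bsub>L\<^esub> m2)))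
        = Sw L p (\<lambda>p1 y. Sw L y (\<lambda>r r2. h2 p1 (r \<otimes>\<^bsub>L\<^esub> m1) (r2 \<otimes>\<^bsub>L\<^esub> m2)))"
        by (rule Sw_coassoc[OF t pm(1)])
    qed
    also have "\<dots> = Sw L p (\<lambda>p1 r. \<Theta> p1 (r \<otimes>\<^bsub>L\<^esub> m))"
      using pm by (simp add: \<Theta>_def Sw_mult[OF h2_23] psum_swap[of _ _ "rep (cop L m)"])
    finally show "Sw L m (\<lambda>m1 m2. h p m1 m2) = Sw L p (\<lambda>p1 r. \<Theta> p1 (r \<otimes>\<^bsub>L\<^esub> m))" .
  qed
  also have "\<dots> = \<Theta> x \<one>\<^bsub>L\<^esub>" by (rule Pm_Sw[OF \<Theta> x])
  also have "\<dots> = Pm B L x (\<lambda>p m. Pm B L p (\<lambda>p' m'. h p' m m'))"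
    using x by (simp add: \<Theta>_def Sw_one[OF h2_23]) (simp add: h2_def h1_def)
  finally show ?thesis .
qed

text \<open>\<open>(x y)\<^sub>+ \<otimes> (x y)\<^sub>- = x\<^sub>+ y\<^sub>+ \<otimes> y\<^sub>- x\<^sub>-\<close>.  The Galois map sends the right-hand side to \<open>x y \<otimes> 1\<close>: \<open>y\<^sub>-\<close> cancels first, then \<open>x\<^sub>-\<close>.\<close>

lemma Pm_mult:
  assumes f: "bar_balanced B L f" and xy: "x \<in> carrier L" "y \<in> carrier L"
  shows "Pm B L (x \<otimes>\<^bsub>L\<^esub> y) f = Pm B L x (\<lambda>p m. Pm B L y (\<lambda>q n. f (p \<otimes>\<^bsub>L\<^esub> q) (n \<otimes>\<^bsub>L\<^esub> m)))"
proof -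
  note u = ungal_balanced[OF f]
  note uD = balancedD[OF u]
  have u1: "diamond_balanced B L L (\<lambda>p1 p2. ungal f p1 (p2 \<otimes>\<^bsub>L\<^esub> m))" if "m \<in> carrier L" for m
    by (rule balancedI) (use that in \<open>simp_all add: uD L.A.l_distr L.A.m_assoc\<close>)
  have u2: "diamond_balanced B L L (\<lambda>p1 p2. ungal f (p1 \<otimes>\<^bsub>L\<^esub> a) (p2 \<otimes>\<^bsub>L\<^esub> m))"
    if "m \<in> carrier L" "a \<in> carrier L" for m a
    by (rule balancedI) (use that in \<open>simp_all add: uD L.A.l_distr L.A.m_assoc\<close>)
  have "Pm B L x (\<lambda>p m. Pm B L y (\<lambda>q n. f (p \<otimes>\<^bsub>L\<^esub> q) (n \<otimes>\<^bsub>L\<^esub> m)))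
      = Pm B L x (\<lambda>p m. Sw L p (\<lambda>p1 p2. ungal f (p1 \<otimes>\<^bsub>L\<^esub> y) (p2 \<otimes>\<^bsub>L\<^esub> m)))"
  proof (rule psum_cong[OF refl])
    fix p m assume pm: "p \<in> carrier L" "m \<in> carrier L"
    have k: "diamond_balanced B L L (\<lambda>q1 q2. Sw L p (\<lambda>p1 p2. ungal f (p1 \<otimes>\<^bsub>L\<^esub> q1) (p2 \<otimes>\<^bsub>L\<^esub> (q2 \<otimes>\<^bsub>L\<^esub> m))))"
    proof (rule balancedI)
      fix c q n assume c: "c \<in> carrier B" "q \<in> carrier L" "n \<in> carrier L"
      show "Sw L p (\<lambda>p1 p2. ungal f (p1 \<otimes>\<^bsub>L\<^esub> (tgt L c \<otimes>\<^bsub>L\<^esub> q)) (p2 \<otimes>\<^bsub>L\<^esub> (n \<otimes>\<^bsub>L\<^esub> m)))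
        = Sw L p (\<lambda>p1 p2. ungal f (p1 \<otimes>\<^bsub>L\<^esub> q) (p2 \<otimes>\<^bsub>L\<^esub> (src L c \<otimes>\<^bsub>L\<^esub> n \<otimes>\<^bsub>L\<^esub> m)))"
        using Sw_takeuchi[OF u2[of "n \<otimes>\<^bsub>L\<^esub> m" q] pm(1) c(1)] c pm by (simp add: L.A.m_assoc)
    qed (use pm in \<open>simp_all add: uD psum_distrib L.A.r_distr L.A.l_distr\<close>)
    have "Pm B L y (\<lambda>q n. f (p \<otimes>\<^bsub>L\<^esub> q) (n \<otimes>\<^bsub>L\<^esub> m))
      = Pm B L y (\<lambda>q n. Sw L q (\<lambda>q1 q2. Sw L p (\<lambda>p1 p2. ungal f (p1 \<otimes>\<^bsub>L\<^esub> q1) (p2 \<otimes>\<^bsub>L\<^esub> (q2 \<otimes>\<^bsub>L\<^esub> n \<otimes>\<^bsub>L\<^esub> m)))))"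
      using pm by (simp add: ungal_inverse[OF f, symmetric] Sw_mult[OF u1] L.A.m_assoc psum_swap[of _ _ "rep (cop L p)"])
    also have "\<dots> = Sw L p (\<lambda>p1 p2. ungal f (p1 \<otimes>\<^bsub>L\<^esub> y) (p2 \<otimes>\<^bsub>L\<^esub> m))"
      using Pm_Sw[OF k xy(2)] pm by simp
    finally show "Pm B L y (\<lambda>q n. f (p \<otimes>\<^bsub>L\<^esub> q) (n \<otimes>\<^bsub>L\<^esub> m))
      = Sw L p (\<lambda>p1 p2. ungal f (p1 \<otimes>\<^bsub>L\<^esub> y) (p2 \<otimes>\<^bsub>L\<^esub> m))" .
  qed
  also have "\<dots> = ungal f (x \<otimes>\<^bsub>L\<^esub> y) \<one>\<^bsub>L\<^esub>"
    by (rule Pm_Sw) (use xy uD in \<open>auto intro!: balancedI simp: L.A.l_distr L.A.m_assoc\<close>)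
  finally show ?thesis by (simp add: Pm_ungal)
qed

text \<open>Write \<open>x\<^sub>+\<close> as \<open>\<bar>\<epsilon>(x\<^sub>+\<^sub>(\<^sub>2\<^sub>)) x\<^sub>+\<^sub>(\<^sub>1\<^sub>)\<close>; then \<open>\<epsilon>(x\<^sub>-)\<close> is absorbed into this counit and \<open>Pm_Sw\<close> applies.\<close>

lemma Pm_tgt_cou:
  assumes h: "additive L h" and x: "x \<in> carrier L"
  shows "Pm B L x (\<lambda>p m. h (p \<otimes>\<^bsub>L\<^esub> tgt L (cou L m))) = h x"
proof -
  note hD = additiveD[OF h]
  have g: "diamond_balanced B L L (\<lambda>y z. h (tgt L (cou L z) \<otimes>\<^bsub>L\<^esub> y))"
    by (rule balancedI) (simp_all add: hD cou_add L.A.l_distr L.A.r_distr L.A.m_assoc)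
  have "Pm B L x (\<lambda>p m. h (p \<otimes>\<^bsub>L\<^esub> tgt L (cou L m)))
      = Pm B L x (\<lambda>p m. Sw L p (\<lambda>p1 p2. h (tgt L (cou L (p2 \<otimes>\<^bsub>L\<^esub> m)) \<otimes>\<^bsub>L\<^esub> p1)))"
  proof (rule psum_cong[OF refl])
    fix p m assume pm: "p \<in> carrier L" "m \<in> carrier L"
    have "h (p \<otimes>\<^bsub>L\<^esub> tgt L (cou L m))
       = Sw L (p \<otimes>\<^bsub>L\<^esub> tgt L (cou L m)) (\<lambda>p1 p2. h (tgt L (cou L p2) \<otimes>\<^bsub>L\<^esub> p1))"
      using Sw_counit_right[OF h, of "p \<otimes>\<^bsub>L\<^esub> tgt L (cou L m)"] pm by simp
    then show "h (p \<otimes>\<^bsub>L\<^esub> tgt L (cou L m)) = Sw L p (\<lambda>p1 p2. h (tgt L (cou L (p2 \<otimes>\<^bsub>L\<^esub> m)) \<otimes>\<^bsub>L\<^esub> p1))"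
      using pm by (simp add: Sw_tgt_right[OF g] cou_mult_tgt)
  qed
  also have "\<dots> = h x" using Pm_Sw[OF g x] x by simp
  finally show ?thesis .
qed

text \<open>The same with \<open>x\<^sub>+ = \<epsilon>(x\<^sub>+\<^sub>(\<^sub>1\<^sub>)) x\<^sub>+\<^sub>(\<^sub>2\<^sub>)\<close>\<close>

lemma Pm_src_cou:
  assumes h: "additive L h" and x: "x \<in> carrier L"
  shows "Pm B L x (\<lambda>p m. h (p \<otimes>\<^bsub>L\<^esub> m)) = h (src L (cou L x))"
proof -
  note hD = additiveD[OF h]
  have g: "diamond_balanced B L L (\<lambda>y z. h (src L (cou L y) \<otimes>\<^bsub>L\<^esub> z))"
    by (rule balancedI) (simp_all add: hD cou_add L.A.l_distr L.A.r_distr L.A.m_assoc)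
  have "Pm B L x (\<lambda>p m. h (p \<otimes>\<^bsub>L\<^esub> m))
      = Pm B L x (\<lambda>p m. Sw L p (\<lambda>p1 p2. h (src L (cou L p1) \<otimes>\<^bsub>L\<^esub> (p2 \<otimes>\<^bsub>L\<^esub> m))))"
  proof (rule psum_cong[OF refl])
    fix p m assume pm: "p \<in> carrier L" "m \<in> carrier L"
    have "additive L (\<lambda>z. h (z \<otimes>\<^bsub>L\<^esub> m))" by (rule additiveI) (use pm in \<open>simp add: hD L.A.l_distr\<close>)
    from Sw_counit_left[OF this pm(1)]
    show "h (p \<otimes>\<^bsub>L\<^esub> m) = Sw L p (\<lambda>p1 p2. h (src L (cou L p1) \<otimes>\<^bsub>L\<^esub> (p2 \<otimes>\<^bsub>L\<^esub> m)))"
      using pm by (simp add: L.A.m_assoc)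
  qed
  also have "\<dots> = h (src L (cou L x))" using Pm_Sw[OF g x] x by simp
  finally show ?thesis .
qed

end

section \<open>Exchanging factors through a skew pairing\<close>

text \<open>The composite of \<open>g\<close> with the left half \<open>X \<otimes> \<beta> \<mapsto> \<tau>[X\<^sub>(\<^sub>1\<^sub>)|\<beta>\<^sub>(\<^sub>1\<^sub>)] \<beta>\<^sub>(\<^sub>2\<^sub>) \<otimes> X\<^sub>(\<^sub>2\<^sub>)\<close> of the exchange\<close>

definition lcross :: "('k, 'b, 'p, 'w) bialgebroid_scheme \<Rightarrow> ('k, 'b, 'l, 'z) bialgebroid_scheme \<Rightarrow>
    ('l \<Rightarrow> 'p \<Rightarrow> 'b) \<Rightarrow> ('p \<Rightarrow> 'l \<Rightarrow> 'q::ab_group_add) \<Rightarrow> 'p \<Rightarrow> 'l \<Rightarrow> 'q"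
  where "lcross P L \<tau> g \<beta> X =
    Sw P \<beta> (\<lambda>\<beta>1 \<beta>2. Sw L X (\<lambda>X1 X2. g (src P (\<tau> X1 \<beta>1) \<otimes>\<^bsub>P\<^esub> \<beta>2) X2))"

text \<open>The composite of \<open>f\<close> with the right half \<open>X \<otimes> \<beta> \<mapsto> \<beta>\<^sub>+ \<otimes> \<bar>\<kappa>[X\<^sub>(\<^sub>2\<^sub>)|\<beta>\<^sub>-] X\<^sub>(\<^sub>1\<^sub>)\<close> of the exchange\<close>

definition rcross :: "('b, 'y) ring_scheme \<Rightarrow> ('k, 'b, 'p, 'w) bialgebroid_scheme \<Rightarrow> ('k, 'b, 'l, 'z) bialgebroid_scheme \<Rightarrow>
    ('l \<Rightarrow> 'p \<Rightarrow> 'b) \<Rightarrow> ('p \<Rightarrow> 'l \<Rightarrow> 'q::ab_group_add) \<Rightarrow> 'p \<Rightarrow> 'l \<Rightarrow> 'q"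
  where "rcross B P L \<kappa> f \<beta> X =
    Pm B P \<beta> (\<lambda>p m. Sw L X (\<lambda>X1 X2. f p (tgt L (\<kappa> X2 m) \<otimes>\<^bsub>L\<^esub> X1)))"

abbreviation src_balanced :: "('b, 'y) ring_scheme \<Rightarrow> ('k, 'b, 'p, 'w) be_ring_scheme \<Rightarrow> ('k, 'b, 'l, 'z) be_ring_scheme \<Rightarrow>
    ('p \<Rightarrow> 'l \<Rightarrow> 'q::ab_group_add) \<Rightarrow> bool"
  where "src_balanced B P L \<equiv> balanced P L (carrier B) (\<lambda>b \<beta>. \<beta> \<otimes>\<^bsub>P\<^esub> src P b) (\<lambda>b X. src L b \<otimes>\<^bsub>L\<^esub> X)"

abbreviation tgt_balanced :: "('b, 'y) ring_scheme \<Rightarrow> ('k, 'b, 'p, 'w) be_ring_scheme \<Rightarrow> ('k, 'b, 'l, 'z) be_ring_scheme \<Rightarrow>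
    ('p \<Rightarrow> 'l \<Rightarrow> 'q::ab_group_add) \<Rightarrow> bool"
  where "tgt_balanced B P L \<equiv> balanced P L (carrier B) (\<lambda>b \<beta>. \<beta> \<otimes>\<^bsub>P\<^esub> tgt P b) (\<lambda>b X. tgt L b \<otimes>\<^bsub>L\<^esub> X)"

text \<open>
  The two halves of the exchange need different halves of this condition: the left half is defined on
  functions balanced over \<open>B\<close>, the right half on functions balanced over \<open>\<bar>B\<close>.
\<close>

definition Be_balanced :: "('b, 'y) ring_scheme \<Rightarrow> ('k, 'b, 'p, 'w) be_ring_scheme \<Rightarrow> ('k, 'b, 'l, 'z) be_ring_scheme \<Rightarrow>
    ('p \<Rightarrow> 'l \<Rightarrow> 'q::ab_group_add) \<Rightarrow> bool"
  where "Be_balanced B P L f \<longleftrightarrow> src_balanced B P L f \<and> tgt_balanced B P L f"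

lemma Be_balancedD:
  assumes "Be_balanced B P L f"
  shows "\<lbrakk>m \<in> carrier P; m' \<in> carrier P; n \<in> carrier L\<rbrakk> \<Longrightarrow> f (m \<oplus>\<^bsub>P\<^esub> m') n = f m n + f m' n"
    and "\<lbrakk>m \<in> carrier P; n \<in> carrier L; n' \<in> carrier L\<rbrakk> \<Longrightarrow> f m (n \<oplus>\<^bsub>L\<^esub> n') = f m n + f m n'"
    and "\<lbrakk>b \<in> carrier B; m \<in> carrier P; n \<in> carrier L\<rbrakk> \<Longrightarrow> f (m \<otimes>\<^bsub>P\<^esub> src P b) n = f m (src L b \<otimes>\<^bsub>L\<^esub> n)"
    and "\<lbrakk>b \<in> carrier B; m \<in> carrier P; n \<in> carrier L\<rbrakk> \<Longrightarrow> f (m \<otimes>\<^bsub>P\<^esub> tgt P b) n = f m (tgt L b \<otimes>\<^bsub>L\<^esub> n)"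
  using assms by (auto simp: Be_balanced_def balanced_def biadditive_def)

lemma Be_balancedI:
  assumes "\<And>m m' n. \<lbrakk>m \<in> carrier P; m' \<in> carrier P; n \<in> carrier L\<rbrakk> \<Longrightarrow> f (m \<oplus>\<^bsub>P\<^esub> m') n = f m n + f m' n"
    and "\<And>m n n'. \<lbrakk>m \<in> carrier P; n \<in> carrier L; n' \<in> carrier L\<rbrakk> \<Longrightarrow> f m (n \<oplus>\<^bsub>L\<^esub> n') = f m n + f m n'"
    and "\<And>b m n. \<lbrakk>b \<in> carrier B; m \<in> carrier P; n \<in> carrier L\<rbrakk> \<Longrightarrow> f (m \<otimes>\<^bsub>P\<^esub> src P b) n = f m (src L b \<otimes>\<^bsub>L\<^esub> n)"
    and "\<And>b m n. \<lbrakk>b \<in> carrier B; m \<in> carrier P; n \<in> carrier L\<rbrakk> \<Longrightarrow> f (m \<otimes>\<^bsub>P\<^esub> tgt P b) n = f m (tgt L b \<otimes>\<^bsub>L\<^esub> n)"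
  shows "Be_balanced B P L f"
  using assms by (auto simp: Be_balanced_def balanced_def biadditive_def)

lemma Be_src_balanced: "Be_balanced B P L f \<Longrightarrow> src_balanced B P L f"
  and Be_tgt_balanced: "Be_balanced B P L f \<Longrightarrow> tgt_balanced B P L f"
  by (auto simp: Be_balanced_def)

lemma balanced_psum:
  assumes "\<And>x y. \<lbrakk>x \<in> A; y \<in> C\<rbrakk> \<Longrightarrow> balanced M N I \<rho> \<sigma> (\<lambda>m n. f m n x y)"
  shows "balanced M N I \<rho> \<sigma> (\<lambda>m n. psum A C c (\<lambda>x y. f m n x y))"
  by (rule balancedI) (simp_all add: balancedD[OF assms] psum_distrib)

locale hopf_pairing = P: left_hopf_algebroid K B P + skew_pairing K B L P \<tau>
  for K :: "('k, 'x) ring_scheme" and B :: "('k, 'b, 'y) module_scheme"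
    and P :: "('k, 'b, 'p, 'w) bialgebroid_scheme" and L :: "('k, 'b, 'l, 'z) bialgebroid_scheme"
    and \<tau> :: "'l \<Rightarrow> 'p \<Rightarrow> 'b"
begin

declare closed [simp] add_left [simp] add_right [simp] one_left [simp] one_right [simp]

text \<open>
  The single axiom for base elements splits into one rule for each position.  The rules marked \<open>simp\<close>
  take a base element out of the pairing or move it into \<open>P\<close>; the remaining ones could be used in
  either direction.
\<close>

lemma pair_src_left [simp]: "\<lbrakk>a \<in> carrier B; X \<in> carrier L; \<alpha> \<in> carrier P\<rbrakk> \<Longrightarrow> \<tau> (src L a \<otimes>\<^bsub>L\<^esub> X) \<alpha> = a \<otimes>\<^bsub>B\<^esub> \<tau> X \<alpha>"
  using base[of a "\<one>\<^bsub>B\<^esub>" "\<one>\<^bsub>B\<^esub>" "\<one>\<^bsub>B\<^esub>" "\<one>\<^bsub>B\<^esub>" X \<alpha>] by simp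

lemma pair_tgt_left [simp]: "\<lbrakk>a \<in> carrier B; X \<in> carrier L; \<alpha> \<in> carrier P\<rbrakk> \<Longrightarrow> \<tau> (tgt L a \<otimes>\<^bsub>L\<^esub> X) \<alpha> = \<tau> X (\<alpha> \<otimes>\<^bsub>P\<^esub> tgt P a)"
  using base[of "\<one>\<^bsub>B\<^esub>" a "\<one>\<^bsub>B\<^esub>" "\<one>\<^bsub>B\<^esub>" "\<one>\<^bsub>B\<^esub>" X \<alpha>] by simp

lemma pair_src_right: "\<lbrakk>a \<in> carrier B; X \<in> carrier L; \<alpha> \<in> carrier P\<rbrakk> \<Longrightarrow> \<tau> (X \<otimes>\<^bsub>L\<^esub> src L a) \<alpha> = \<tau> X (src P a \<otimes>\<^bsub>P\<^esub> \<alpha>)"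
  using base[of "\<one>\<^bsub>B\<^esub>" "\<one>\<^bsub>B\<^esub>" a "\<one>\<^bsub>B\<^esub>" "\<one>\<^bsub>B\<^esub>" X \<alpha>] by simp

lemma pair_tgt_right: "\<lbrakk>a \<in> carrier B; X \<in> carrier L; \<alpha> \<in> carrier P\<rbrakk> \<Longrightarrow> \<tau> (X \<otimes>\<^bsub>L\<^esub> tgt L a) \<alpha> = \<tau> X (\<alpha> \<otimes>\<^bsub>P\<^esub> src P a)"
  using base[of "\<one>\<^bsub>B\<^esub>" "\<one>\<^bsub>B\<^esub>" "\<one>\<^bsub>B\<^esub>" a "\<one>\<^bsub>B\<^esub>" X \<alpha>] by simp

lemma pair_tgt_P [simp]: "\<lbrakk>a \<in> carrier B; X \<in> carrier L; \<alpha> \<in> carrier P\<rbrakk> \<Longrightarrow> \<tau> X (tgt P a \<otimes>\<^bsub>P\<^esub> \<alpha>) = \<tau> X \<alpha> \<otimes>\<^bsub>B\<^esub> a"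
  using base[of "\<one>\<^bsub>B\<^esub>" "\<one>\<^bsub>B\<^esub>" "\<one>\<^bsub>B\<^esub>" "\<one>\<^bsub>B\<^esub>" a X \<alpha>] by simp

lemma pair_mult_right_1:
  "\<lbrakk>additive B h; X \<in> carrier L; \<alpha> \<in> carrier P; \<beta> \<in> carrier P\<rbrakk> \<Longrightarrow>
    h (\<tau> X (\<alpha> \<otimes>\<^bsub>P\<^esub> \<beta>)) = Sw L X (\<lambda>X1 X2. h (\<tau> X1 (\<alpha> \<otimes>\<^bsub>P\<^esub> tgt P (\<tau> X2 \<beta>))))"
  unfolding mult_right_1 by (subst L.ghom_sw[OF P.B.A.a_comm_group]) simp_all

lemma pair_mult_right_2:
  "\<lbrakk>additive B h; X \<in> carrier L; \<alpha> \<in> carrier P; \<beta> \<in> carrier P\<rbrakk> \<Longrightarrow>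
    h (\<tau> X (\<alpha> \<otimes>\<^bsub>P\<^esub> \<beta>)) = Sw L X (\<lambda>X1 X2. h (\<tau> (tgt L (\<tau> X2 \<beta>) \<otimes>\<^bsub>L\<^esub> X1) \<alpha>))"
  unfolding mult_right_2 by (subst L.ghom_sw[OF P.B.A.a_comm_group]) simp_all

lemma pair_mult_left_1:
  "\<lbrakk>additive B h; X \<in> carrier L; Y \<in> carrier L; \<alpha> \<in> carrier P\<rbrakk> \<Longrightarrow>
    h (\<tau> (X \<otimes>\<^bsub>L\<^esub> Y) \<alpha>) = Sw P \<alpha> (\<lambda>\<alpha>1 \<alpha>2. h (\<tau> (X \<otimes>\<^bsub>L\<^esub> src L (\<tau> Y \<alpha>1)) \<alpha>2))"
  unfolding mult_left_1 by (subst P.ghom_sw[OF P.B.A.a_comm_group]) simp_all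

lemma pair_mult_left_2:
  "\<lbrakk>additive B h; X \<in> carrier L; Y \<in> carrier L; \<alpha> \<in> carrier P\<rbrakk> \<Longrightarrow>
    h (\<tau> (X \<otimes>\<^bsub>L\<^esub> Y) \<alpha>) = Sw P \<alpha> (\<lambda>\<alpha>1 \<alpha>2. h (\<tau> X (src P (\<tau> Y \<alpha>1) \<otimes>\<^bsub>P\<^esub> \<alpha>2)))"
  unfolding mult_left_2 by (subst P.ghom_sw[OF P.B.A.a_comm_group]) simp_all

lemmas distr = P.L.A.l_distr P.L.A.r_distr L.L.A.l_distr L.L.A.r_distr
lemmas assoc = P.L.A.m_assoc L.L.A.m_assoc P.B.A.m_assoc
lemmas normal = P.base_normal L.base_normal

lemmas sum_LP = psum_swap[where A = "carrier L" and C = "carrier L" and A' = "carrier P" and C' = "carrier P"]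
lemmas sum_PL = psum_swap[where A = "carrier P" and C = "carrier P" and A' = "carrier L" and C' = "carrier L"]

text \<open>
  A summand must be balanced in the two components of a coproduct before a rule for that coproduct may be
  applied.  In the left half the \<open>L\<close>-components are balanced only after summation over \<open>P\<close>, because a base
  element is carried into \<open>P\<close> by the pairing and then has to pass through the Takeuchi condition.
\<close>

lemma lcross_balanced_P:
  assumes "src_balanced B P L g" "X1 \<in> carrier L" "X2 \<in> carrier L"
  shows "diamond_balanced B P P (\<lambda>\<beta>1 \<beta>2. g (src P (\<tau> X1 \<beta>1) \<otimes>\<^bsub>P\<^esub> \<beta>2) X2)"
  by (rule balancedI) (use assms(2,3) in \<open>simp_all add: balancedD[OF assms(1)] distr assoc\<close>)

lemma lcross_balanced_P':
  assumes "src_balanced B P L g" "X \<in> carrier L"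
  shows "diamond_balanced B P P (\<lambda>\<beta>1 \<beta>2. Sw L X (\<lambda>X1 X2. g (src P (\<tau> X1 \<beta>1) \<otimes>\<^bsub>P\<^esub> \<beta>2) X2))"
  by (rule balanced_psum[OF lcross_balanced_P[OF assms(1)]])

lemma lcross_balanced_L:
  assumes g: "src_balanced B P L g" and \<beta>: "\<beta> \<in> carrier P"
  shows "diamond_balanced B L L (\<lambda>X1 X2. Sw P \<beta> (\<lambda>\<beta>1 \<beta>2. g (src P (\<tau> X1 \<beta>1) \<otimes>\<^bsub>P\<^esub> \<beta>2) X2))"
proof (rule balancedI)
  fix b X1 X2 assume a: "b \<in> carrier B" "X1 \<in> carrier L" "X2 \<in> carrier L"
  show "Sw P \<beta> (\<lambda>\<beta>1 \<beta>2. g (src P (\<tau> (tgt L b \<otimes>\<^bsub>L\<^esub> X1) \<beta>1) \<otimes>\<^bsub>P\<^esub> \<beta>2) X2) =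
    Sw P \<beta> (\<lambda>\<beta>1 \<beta>2. g (src P (\<tau> X1 \<beta>1) \<otimes>\<^bsub>P\<^esub> \<beta>2) (src L b \<otimes>\<^bsub>L\<^esub> X2))"
    using P.Sw_takeuchi[OF lcross_balanced_P[OF g a(2,3)] \<beta> a(1)] a
    by (simp add: balancedD(3)[OF g, symmetric] assoc)
qed (simp_all add: balancedD[OF g] distr psum_distrib)

lemma lcross_swap:
  "lcross P L \<tau> g \<beta> X = Sw L X (\<lambda>X1 X2. Sw P \<beta> (\<lambda>\<beta>1 \<beta>2. g (src P (\<tau> X1 \<beta>1) \<otimes>\<^bsub>P\<^esub> \<beta>2) X2))"
  unfolding lcross_def by (rule psum_swap)

lemma rcross_balanced_P:
  assumes "tgt_balanced B P L f" "X1 \<in> carrier L" "X2 \<in> carrier L"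
  shows "bar_balanced B P (\<lambda>p m. f p (tgt L (\<tau> X2 m) \<otimes>\<^bsub>L\<^esub> X1))"
  by (rule balancedI) (use assms(2,3) in \<open>simp_all add: balancedD[OF assms(1)] distr assoc\<close>)

lemma rcross_balanced_P':
  assumes "tgt_balanced B P L f" "X \<in> carrier L"
  shows "bar_balanced B P (\<lambda>p m. Sw L X (\<lambda>X1 X2. f p (tgt L (\<tau> X2 m) \<otimes>\<^bsub>L\<^esub> X1)))"
  by (rule balanced_psum[OF rcross_balanced_P[OF assms(1)]])

lemma rcross_balanced_L:
  assumes f: "tgt_balanced B P L f" and pm: "p \<in> carrier P" "m \<in> carrier P"
  shows "diamond_balanced B L L (\<lambda>X1 X2. f p (tgt L (\<tau> X2 m) \<otimes>\<^bsub>L\<^esub> X1))"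
  by (rule balancedI) (use pm in \<open>simp_all add: balancedD[OF f] distr assoc\<close>)

lemma rcross_swap:
  "rcross B P L \<tau> f \<beta> X = Sw L X (\<lambda>X1 X2. Pm B P \<beta> (\<lambda>p m. f p (tgt L (\<tau> X2 m) \<otimes>\<^bsub>L\<^esub> X1)))"
  unfolding rcross_def by (rule psum_swap)

lemma lcross_cong:
  assumes "\<And>\<beta> X. \<lbrakk>\<beta> \<in> carrier P; X \<in> carrier L\<rbrakk> \<Longrightarrow> g \<beta> X = g' \<beta> X"
  shows "lcross P L \<tau> g \<beta> X = lcross P L \<tau> g' \<beta> X"
  by (simp add: lcross_def assms)

lemma rcross_cong:
  assumes "\<And>\<beta> X. \<lbrakk>\<beta> \<in> carrier P; X \<in> carrier L\<rbrakk> \<Longrightarrow> g \<beta> X = g' \<beta> X"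
  shows "rcross B P L \<tau> g \<beta> X = rcross B P L \<tau> g' \<beta> X"
  by (simp add: rcross_def assms)

lemma lcross_add:
  assumes g: "src_balanced B P L g"
  shows "\<lbrakk>\<beta> \<in> carrier P; \<beta>' \<in> carrier P; X \<in> carrier L\<rbrakk> \<Longrightarrow> lcross P L \<tau> g (\<beta> \<oplus>\<^bsub>P\<^esub> \<beta>') X = lcross P L \<tau> g \<beta> X + lcross P L \<tau> g \<beta>' X"
    and "\<lbrakk>\<beta> \<in> carrier P; X \<in> carrier L; X' \<in> carrier L\<rbrakk> \<Longrightarrow> lcross P L \<tau> g \<beta> (X \<oplus>\<^bsub>L\<^esub> X') = lcross P L \<tau> g \<beta> X + lcross P L \<tau> g \<beta> X'"
  by (simp add: lcross_def P.Sw_add[OF lcross_balanced_P'[OF g]])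
    (simp add: lcross_swap L.Sw_add[OF lcross_balanced_L[OF g]])

lemma rcross_add:
  assumes f: "tgt_balanced B P L f"
  shows "\<lbrakk>\<beta> \<in> carrier P; \<beta>' \<in> carrier P; X \<in> carrier L\<rbrakk> \<Longrightarrow> rcross B P L \<tau> f (\<beta> \<oplus>\<^bsub>P\<^esub> \<beta>') X = rcross B P L \<tau> f \<beta> X + rcross B P L \<tau> f \<beta>' X"
    and "\<lbrakk>\<beta> \<in> carrier P; X \<in> carrier L; X' \<in> carrier L\<rbrakk> \<Longrightarrow> rcross B P L \<tau> f \<beta> (X \<oplus>\<^bsub>L\<^esub> X') = rcross B P L \<tau> f \<beta> X + rcross B P L \<tau> f \<beta> X'"
  by (simp add: rcross_def P.Pm_add[OF rcross_balanced_P'[OF f]])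
    (simp add: rcross_def L.Sw_add[OF rcross_balanced_L[OF f]] psum_distrib)

lemma lcross_fun_add:
  "lcross P L \<tau> (\<lambda>\<beta> X. g \<beta> X + g' \<beta> X) \<beta> X = lcross P L \<tau> g \<beta> X + lcross P L \<tau> g' \<beta> X"
  by (simp add: lcross_def psum_distrib)

lemma rcross_fun_add:
  "rcross B P L \<tau> (\<lambda>\<beta> X. g \<beta> X + g' \<beta> X) \<beta> X = rcross B P L \<tau> g \<beta> X + rcross B P L \<tau> g' \<beta> X"
  by (simp add: rcross_def psum_distrib)

text \<open>
  Either a base element stays where it is, or it travels from one factor to the other; which of the
  two happens is determined by the component of the coproduct that carries it.
\<close>

context
  fixes g :: "'p \<Rightarrow> 'l \<Rightarrow> 'q::ab_group_add" and \<beta> X b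
  assumes g: "src_balanced B P L g" and mem: "\<beta> \<in> carrier P" "X \<in> carrier L" "b \<in> carrier B"
begin

lemma lcross_src_L: "lcross P L \<tau> g \<beta> (src L b \<otimes>\<^bsub>L\<^esub> X) = lcross P L \<tau> (\<lambda>\<beta> X. g (src P b \<otimes>\<^bsub>P\<^esub> \<beta>) X) \<beta> X"
  using mem by (simp add: lcross_swap L.Sw_src_left[OF lcross_balanced_L[OF g]] assoc)

lemma lcross_tgt_L: "lcross P L \<tau> g \<beta> (tgt L b \<otimes>\<^bsub>L\<^esub> X) = lcross P L \<tau> (\<lambda>\<beta> X. g \<beta> (tgt L b \<otimes>\<^bsub>L\<^esub> X)) \<beta> X"
  using mem by (simp add: lcross_swap L.Sw_tgt_left[OF lcross_balanced_L[OF g]])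

lemma lcross_tgt_P: "lcross P L \<tau> g (tgt P b \<otimes>\<^bsub>P\<^esub> \<beta>) X = lcross P L \<tau> (\<lambda>\<beta> X. g (tgt P b \<otimes>\<^bsub>P\<^esub> \<beta>) X) \<beta> X"
  using mem by (simp add: lcross_def P.Sw_tgt_left[OF lcross_balanced_P'[OF g]] normal)

lemma lcross_src_P_right: "lcross P L \<tau> g (\<beta> \<otimes>\<^bsub>P\<^esub> src P b) X = lcross P L \<tau> (\<lambda>\<beta> X. g \<beta> (X \<otimes>\<^bsub>L\<^esub> src L b)) \<beta> X"
proof -
  have "lcross P L \<tau> g (\<beta> \<otimes>\<^bsub>P\<^esub> src P b) X
      = Sw P \<beta> (\<lambda>\<beta>1 \<beta>2. Sw L X (\<lambda>X1 X2. g (src P (\<tau> (X1 \<otimes>\<^bsub>L\<^esub> tgt L b) \<beta>1) \<otimes>\<^bsub>P\<^esub> \<beta>2) X2))"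
    using mem by (simp add: lcross_def P.Sw_src_right[OF lcross_balanced_P'[OF g]] pair_tgt_right)
  also have "\<dots> = Sw L X (\<lambda>X1 X2. Sw P \<beta> (\<lambda>\<beta>1 \<beta>2. g (src P (\<tau> (X1 \<otimes>\<^bsub>L\<^esub> tgt L b) \<beta>1) \<otimes>\<^bsub>P\<^esub> \<beta>2) X2))"
    by (rule psum_swap)
  also have "\<dots> = lcross P L \<tau> (\<lambda>\<beta> X. g \<beta> (X \<otimes>\<^bsub>L\<^esub> src L b)) \<beta> X"
    unfolding lcross_swap by (rule L.Sw_takeuchi[OF lcross_balanced_L[OF g mem(1)] mem(2,3)])
  finally show ?thesis .
qed

lemma lcross_tgt_P_right: "lcross P L \<tau> g (\<beta> \<otimes>\<^bsub>P\<^esub> tgt P b) X = lcross P L \<tau> (\<lambda>\<beta> X. g (\<beta> \<otimes>\<^bsub>P\<^esub> tgt P b) X) \<beta> X"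
  using mem by (simp add: lcross_def P.Sw_tgt_right[OF lcross_balanced_P'[OF g]] assoc)

end

context
  fixes f :: "'p \<Rightarrow> 'l \<Rightarrow> 'q::ab_group_add" and \<beta> X b
  assumes f: "tgt_balanced B P L f" and mem: "\<beta> \<in> carrier P" "X \<in> carrier L" "b \<in> carrier B"
begin

lemma rcross_src_P: "rcross B P L \<tau> f (src P b \<otimes>\<^bsub>P\<^esub> \<beta>) X = rcross B P L \<tau> (\<lambda>\<beta> X. f (src P b \<otimes>\<^bsub>P\<^esub> \<beta>) X) \<beta> X"
  using mem by (simp add: rcross_def P.Pm_src_left[OF rcross_balanced_P'[OF f]])

lemma rcross_src_P_right: "rcross B P L \<tau> f (\<beta> \<otimes>\<^bsub>P\<^esub> src P b) X = rcross B P L \<tau> (\<lambda>\<beta> X. f (\<beta> \<otimes>\<^bsub>P\<^esub> src P b) X) \<beta> X"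
  using mem by (simp add: rcross_def P.Pm_src_right[OF rcross_balanced_P'[OF f]])

lemma rcross_src_L: "rcross B P L \<tau> f \<beta> (src L b \<otimes>\<^bsub>L\<^esub> X) = rcross B P L \<tau> (\<lambda>\<beta> X. f \<beta> (src L b \<otimes>\<^bsub>L\<^esub> X)) \<beta> X"
  using mem by (simp add: rcross_def L.Sw_src_left[OF rcross_balanced_L[OF f]] normal)

lemma rcross_tgt_L: "rcross B P L \<tau> f \<beta> (tgt L b \<otimes>\<^bsub>L\<^esub> X) = rcross B P L \<tau> (\<lambda>\<beta> X. f (tgt P b \<otimes>\<^bsub>P\<^esub> \<beta>) X) \<beta> X"
proof -
  have "rcross B P L \<tau> f \<beta> (tgt L b \<otimes>\<^bsub>L\<^esub> X)
      = Sw L X (\<lambda>X1 X2. Pm B P \<beta> (\<lambda>p m. f p (tgt L (\<tau> X2 (m \<otimes>\<^bsub>P\<^esub> tgt P b)) \<otimes>\<^bsub>L\<^esub> X1)))"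
    using mem by (simp add: rcross_def L.Sw_tgt_left[OF rcross_balanced_L[OF f]] sum_PL)
  also have "\<dots> = Sw L X (\<lambda>X1 X2. Pm B P \<beta> (\<lambda>p m. f (tgt P b \<otimes>\<^bsub>P\<^esub> p) (tgt L (\<tau> X2 m) \<otimes>\<^bsub>L\<^esub> X1)))"
    using mem by (simp add: P.Pm_tgt_plus[OF rcross_balanced_P[OF f]])
  finally show ?thesis by (simp add: rcross_swap)
qed

lemma rcross_src_L_right: "rcross B P L \<tau> f \<beta> (X \<otimes>\<^bsub>L\<^esub> src L b) = rcross B P L \<tau> (\<lambda>\<beta> X. f \<beta> (X \<otimes>\<^bsub>L\<^esub> src L b)) \<beta> X"
  using mem by (simp add: rcross_def L.Sw_src_right[OF rcross_balanced_L[OF f]] assoc)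

lemma rcross_tgt_P_right: "rcross B P L \<tau> f (\<beta> \<otimes>\<^bsub>P\<^esub> tgt P b) X = rcross B P L \<tau> (\<lambda>\<beta> X. f \<beta> (X \<otimes>\<^bsub>L\<^esub> tgt L b)) \<beta> X"
proof -
  have "rcross B P L \<tau> f (\<beta> \<otimes>\<^bsub>P\<^esub> tgt P b) X
      = Pm B P \<beta> (\<lambda>p m. Sw L X (\<lambda>X1 X2. f p (tgt L (\<tau> (X2 \<otimes>\<^bsub>L\<^esub> src L b) m) \<otimes>\<^bsub>L\<^esub> X1)))"
    using mem by (simp add: rcross_def P.Pm_tgt_right[OF rcross_balanced_P'[OF f]] pair_src_right)
  also have "\<dots> = Pm B P \<beta> (\<lambda>p m. Sw L X (\<lambda>X1 X2. f p (tgt L (\<tau> X2 m) \<otimes>\<^bsub>L\<^esub> (X1 \<otimes>\<^bsub>L\<^esub> tgt L b))))"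
    using mem by (simp add: L.Sw_takeuchi[OF rcross_balanced_L[OF f]])
  finally show ?thesis using mem by (simp add: rcross_def assoc)
qed

end

text \<open>The right half may be followed by a left half.\<close>

lemma rcross_src_balanced:
  assumes f: "Be_balanced B P L f"
  shows "src_balanced B P L (rcross B P L \<tau> f)"
proof (rule balancedI)
  fix b \<beta> X assume m: "b \<in> carrier B" "\<beta> \<in> carrier P" "X \<in> carrier L"
  show "rcross B P L \<tau> f (\<beta> \<otimes>\<^bsub>P\<^esub> src P b) X = rcross B P L \<tau> f \<beta> (src L b \<otimes>\<^bsub>L\<^esub> X)"
    unfolding rcross_src_P_right[OF Be_tgt_balanced[OF f] m(2,3,1)] rcross_src_L[OF Be_tgt_balanced[OF f] m(2,3,1)]
    by (rule rcross_cong) (simp add: Be_balancedD[OF f] m)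
qed (simp_all add: rcross_add[OF Be_tgt_balanced[OF f]])

lemma lcross_one_L:
  assumes g: "src_balanced B P L g" and m: "\<beta> \<in> carrier P"
  shows "lcross P L \<tau> g \<beta> \<one>\<^bsub>L\<^esub> = g \<beta> \<one>\<^bsub>L\<^esub>"
proof -
  have "additive P (\<lambda>\<beta>. g \<beta> \<one>\<^bsub>L\<^esub>)" by (rule additiveI) (simp add: balancedD[OF g])
  from P.Sw_counit_left[OF this m] show ?thesis
    using m by (simp add: lcross_swap L.Sw_one[OF lcross_balanced_L[OF g]])
qed

lemma lcross_one_P:
  assumes g: "src_balanced B P L g" and m: "X \<in> carrier L"
  shows "lcross P L \<tau> g \<one>\<^bsub>P\<^esub> X = g \<one>\<^bsub>P\<^esub> X"
proof -
  have "additive L (\<lambda>X. g \<one>\<^bsub>P\<^esub> X)" by (rule additiveI) (simp add: balancedD[OF g])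
  from L.Sw_counit_left[OF this m] show ?thesis
    using m balancedD(3)[OF g, of _ "\<one>\<^bsub>P\<^esub>"] by (simp add: lcross_def P.Sw_one[OF lcross_balanced_P'[OF g]])
qed

lemma rcross_one_L:
  assumes f: "tgt_balanced B P L f" and m: "\<beta> \<in> carrier P"
  shows "rcross B P L \<tau> f \<beta> \<one>\<^bsub>L\<^esub> = f \<beta> \<one>\<^bsub>L\<^esub>"
proof -
  have "additive P (\<lambda>\<beta>. f \<beta> \<one>\<^bsub>L\<^esub>)" by (rule additiveI) (simp add: balancedD[OF f])
  from P.Pm_tgt_cou[OF this m] show ?thesis
    using m by (simp add: rcross_def L.Sw_one[OF rcross_balanced_L[OF f]] balancedD(3)[OF f])
qed

lemma rcross_one_P:
  assumes f: "tgt_balanced B P L f" and m: "X \<in> carrier L"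
  shows "rcross B P L \<tau> f \<one>\<^bsub>P\<^esub> X = f \<one>\<^bsub>P\<^esub> X"
proof -
  have "additive L (\<lambda>X. f \<one>\<^bsub>P\<^esub> X)" by (rule additiveI) (simp add: balancedD[OF f])
  from L.Sw_counit_right[OF this m] show ?thesis
    using m by (simp add: rcross_def P.Pm_one[OF rcross_balanced_P'[OF f]])
qed

end

section \<open>Exchanging products\<close>

context hopf_pairing
begin

text \<open>
  Exchanging \<open>X Y\<close> with \<open>\<gamma>\<close> is exchanging first \<open>Y\<close>, then \<open>X\<close>: the pairing of a product \<open>X Y\<close> is a sum over
  \<open>\<Delta>(\<gamma>)\<close>, and coassociativity of \<open>P\<close> distributes the three components of \<open>\<gamma>\<close> over the two steps.
\<close>

lemma lcross_mult_L:
  assumes g: "src_balanced B P L g" and m: "\<gamma> \<in> carrier P" "X \<in> carrier L" "Y \<in> carrier L"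
  shows "lcross P L \<tau> g \<gamma> (X \<otimes>\<^bsub>L\<^esub> Y) =
    lcross P L \<tau> (\<lambda>\<gamma>' Y'. lcross P L \<tau> (\<lambda>\<gamma>'' X'. g \<gamma>'' (X' \<otimes>\<^bsub>L\<^esub> Y')) \<gamma>' X) \<gamma> Y"
proof -
  have tri: "tri_balanced B P (\<lambda>u v w. g (src P (\<tau> X1 (src P (\<tau> Y1 u) \<otimes>\<^bsub>P\<^esub> v)) \<otimes>\<^bsub>P\<^esub> w) Z)"
    if "X1 \<in> carrier L" "Y1 \<in> carrier L" "Z \<in> carrier L" for X1 Y1 Z
    unfolding tri_balanced_def by (intro conjI ballI) (use that in \<open>simp_all add: balancedD[OF g] distr assoc normal\<close>)
  have "lcross P L \<tau> g \<gamma> (X \<otimes>\<^bsub>L\<^esub> Y) = Sw L X (\<lambda>X1 X2. Sw L Y (\<lambda>Y1 Y2. Sw P \<gamma> (\<lambda>\<gamma>1 \<gamma>2.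
      g (src P (\<tau> (X1 \<otimes>\<^bsub>L\<^esub> Y1) \<gamma>1) \<otimes>\<^bsub>P\<^esub> \<gamma>2) (X2 \<otimes>\<^bsub>L\<^esub> Y2))))"
    using m by (simp add: lcross_swap L.Sw_mult[OF lcross_balanced_L[OF g]])
  also have "\<dots> = Sw L X (\<lambda>X1 X2. Sw L Y (\<lambda>Y1 Y2. Sw P \<gamma> (\<lambda>\<gamma>1 \<gamma>2. Sw P \<gamma>1 (\<lambda>u v.
      g (src P (\<tau> X1 (src P (\<tau> Y1 u) \<otimes>\<^bsub>P\<^esub> v)) \<otimes>\<^bsub>P\<^esub> \<gamma>2) (X2 \<otimes>\<^bsub>L\<^esub> Y2)))))"
  proof (intro psum_cong refl)
    fix X1 X2 Y1 Y2 \<gamma>1 \<gamma>2 assume "X1 \<in> carrier L" "X2 \<in> carrier L" "Y1 \<in> carrier L" "Y2 \<in> carrier L"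
      "\<gamma>1 \<in> carrier P" "\<gamma>2 \<in> carrier P"
    then show "g (src P (\<tau> (X1 \<otimes>\<^bsub>L\<^esub> Y1) \<gamma>1) \<otimes>\<^bsub>P\<^esub> \<gamma>2) (X2 \<otimes>\<^bsub>L\<^esub> Y2)
      = Sw P \<gamma>1 (\<lambda>u v. g (src P (\<tau> X1 (src P (\<tau> Y1 u) \<otimes>\<^bsub>P\<^esub> v)) \<otimes>\<^bsub>P\<^esub> \<gamma>2) (X2 \<otimes>\<^bsub>L\<^esub> Y2))"
      by (intro pair_mult_left_2 additiveI) (simp_all add: distr balancedD[OF g])
  qed
  also have "\<dots> = Sw L X (\<lambda>X1 X2. Sw L Y (\<lambda>Y1 Y2. Sw P \<gamma> (\<lambda>u r. Sw P r (\<lambda>v \<gamma>2.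
      g (src P (\<tau> X1 (src P (\<tau> Y1 u) \<otimes>\<^bsub>P\<^esub> v)) \<otimes>\<^bsub>P\<^esub> \<gamma>2) (X2 \<otimes>\<^bsub>L\<^esub> Y2)))))"
    using m by (simp add: P.Sw_coassoc[OF tri])
  also have "\<dots> = Sw L Y (\<lambda>Y1 Y2. Sw L X (\<lambda>X1 X2. Sw P \<gamma> (\<lambda>u r. Sw P r (\<lambda>v \<gamma>2.
      g (src P (\<tau> X1 (src P (\<tau> Y1 u) \<otimes>\<^bsub>P\<^esub> v)) \<otimes>\<^bsub>P\<^esub> \<gamma>2) (X2 \<otimes>\<^bsub>L\<^esub> Y2)))))"
    by (rule psum_swap)
  also have "\<dots> = lcross P L \<tau> (\<lambda>\<gamma>' Y'. lcross P L \<tau> (\<lambda>\<gamma>'' X'. g \<gamma>'' (X' \<otimes>\<^bsub>L\<^esub> Y')) \<gamma>' X) \<gamma> Y"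
    using m by (simp add: lcross_def P.Sw_src_left[OF lcross_balanced_P[OF g]] sum_PL)
  finally show ?thesis .
qed

text \<open>
  As for the left half, with \<open>Pm_Sw_minus\<close> in place of coassociativity, since the pairing of a product
  here splits \<open>\<gamma>\<^sub>-\<close>.
\<close>

lemma rcross_mult_L:
  assumes f: "tgt_balanced B P L f" and m: "\<gamma> \<in> carrier P" "X \<in> carrier L" "Y \<in> carrier L"
  shows "rcross B P L \<tau> f \<gamma> (X \<otimes>\<^bsub>L\<^esub> Y) =
    rcross B P L \<tau> (\<lambda>\<gamma>' Y'. rcross B P L \<tau> (\<lambda>\<gamma>'' X'. f \<gamma>'' (X' \<otimes>\<^bsub>L\<^esub> Y')) \<gamma>' X) \<gamma> Y"
proof -
  have f': "tgt_balanced B P L (\<lambda>\<gamma> X'. f \<gamma> (X' \<otimes>\<^bsub>L\<^esub> Y'))" if "Y' \<in> carrier L" for Y'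
    by (rule balancedI) (use that in \<open>simp_all add: balancedD[OF f] distr assoc\<close>)
  define h where "h p u v = Sw L Y (\<lambda>Y1 Y2. Sw L X (\<lambda>X1 X2.
      f p (tgt L (\<tau> X2 v) \<otimes>\<^bsub>L\<^esub> (X1 \<otimes>\<^bsub>L\<^esub> (tgt L (\<tau> Y2 u) \<otimes>\<^bsub>L\<^esub> Y1)))))" for p u v
  have tk: "Sw L X (\<lambda>X1 X2. f p (tgt L (\<tau> X2 (src P b \<otimes>\<^bsub>P\<^esub> v)) \<otimes>\<^bsub>L\<^esub> (X1 \<otimes>\<^bsub>L\<^esub> Z)))
      = Sw L X (\<lambda>X1 X2. f p (tgt L (\<tau> X2 v) \<otimes>\<^bsub>L\<^esub> (X1 \<otimes>\<^bsub>L\<^esub> (tgt L b \<otimes>\<^bsub>L\<^esub> Z))))"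
    if "p \<in> carrier P" "v \<in> carrier P" "Z \<in> carrier L" "b \<in> carrier B" for p v Z b
    using that L.Sw_takeuchi[OF rcross_balanced_L[OF f'[OF that(3)] that(1,2)] m(2) that(4)] m
    by (simp add: pair_src_right assoc)
  have h13: "bar_balanced B P (\<lambda>p v. h p u v)" if "u \<in> carrier P" for u
    by (rule balancedI) (use that m in \<open>simp_all add: h_def balancedD[OF f] distr assoc psum_distrib\<close>)
  have h23: "diamond_balanced B P P (h p)" if "p \<in> carrier P" for p
    by (rule balancedI) (use that m in \<open>simp_all add: h_def balancedD[OF f] distr assoc psum_distrib tk\<close>)
  have "rcross B P L \<tau> f \<gamma> (X \<otimes>\<^bsub>L\<^esub> Y) = Pm B P \<gamma> (\<lambda>p m. Sw L Y (\<lambda>Y1 Y2. Sw L X (\<lambda>X1 X2.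
      f p (tgt L (\<tau> (X2 \<otimes>\<^bsub>L\<^esub> Y2) m) \<otimes>\<^bsub>L\<^esub> (X1 \<otimes>\<^bsub>L\<^esub> Y1)))))"
    using m by (simp add: rcross_def L.Sw_mult[OF rcross_balanced_L[OF f]] psum_swap[of _ _ "rep (cop L X)"])
  also have "\<dots> = Pm B P \<gamma> (\<lambda>p m. Sw L Y (\<lambda>Y1 Y2. Sw L X (\<lambda>X1 X2. Sw P m (\<lambda>m1 m2.
      f p (tgt L (\<tau> (X2 \<otimes>\<^bsub>L\<^esub> src L (\<tau> Y2 m1)) m2) \<otimes>\<^bsub>L\<^esub> (X1 \<otimes>\<^bsub>L\<^esub> Y1))))))"
  proof (intro psum_cong refl)
    fix p m X1 X2 Y1 Y2 assume "p \<in> carrier P" "m \<in> carrier P" "X1 \<in> carrier L" "X2 \<in> carrier L"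
      "Y1 \<in> carrier L" "Y2 \<in> carrier L"
    then show "f p (tgt L (\<tau> (X2 \<otimes>\<^bsub>L\<^esub> Y2) m) \<otimes>\<^bsub>L\<^esub> (X1 \<otimes>\<^bsub>L\<^esub> Y1))
      = Sw P m (\<lambda>m1 m2. f p (tgt L (\<tau> (X2 \<otimes>\<^bsub>L\<^esub> src L (\<tau> Y2 m1)) m2) \<otimes>\<^bsub>L\<^esub> (X1 \<otimes>\<^bsub>L\<^esub> Y1)))"
      by (intro pair_mult_left_1 additiveI) (simp_all add: distr balancedD[OF f])
  qed
  also have "\<dots> = Pm B P \<gamma> (\<lambda>p m. Sw P m (\<lambda>m1 m2. h p m1 m2))"
    by (simp add: sum_LP h_def pair_src_right tk)
  also have "\<dots> = Pm B P \<gamma> (\<lambda>p m. Pm B P p (\<lambda>p' m'. h p' m m'))"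
    by (rule P.Pm_Sw_minus[OF h13 h23 m(1)])
  also have "\<dots> = rcross B P L \<tau> (\<lambda>\<gamma>' Y'. rcross B P L \<tau> (\<lambda>\<gamma>'' X'. f \<gamma>'' (X' \<otimes>\<^bsub>L\<^esub> Y')) \<gamma>' X) \<gamma> Y"
    using m by (simp add: h_def rcross_def sum_PL assoc)
  finally show ?thesis .
qed

text \<open>
  Exchanging \<open>X\<close> with \<open>\<beta> \<gamma>\<close> is exchanging it first with \<open>\<beta>\<close>, then with \<open>\<gamma>\<close>, by coassociativity of \<open>L\<close>.  The
  value \<open>\<tau>[X\<^sub>(\<^sub>2\<^sub>)|\<gamma>\<^sub>(\<^sub>1\<^sub>)]\<close> first appears inside the pairing with \<open>\<beta>\<^sub>(\<^sub>1\<^sub>)\<close>; the Takeuchi condition for \<open>\<beta>\<close> moves it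
  between \<open>\<beta>\<^sub>(\<^sub>2\<^sub>)\<close> and \<open>\<gamma>\<^sub>(\<^sub>2\<^sub>)\<close>.
\<close>

lemma lcross_mult_P:
  assumes g: "src_balanced B P L g" and m: "\<beta> \<in> carrier P" "\<gamma> \<in> carrier P" "X \<in> carrier L"
  shows "lcross P L \<tau> g (\<beta> \<otimes>\<^bsub>P\<^esub> \<gamma>) X =
    lcross P L \<tau> (\<lambda>\<beta>' X'. lcross P L \<tau> (\<lambda>\<gamma>' X''. g (\<beta>' \<otimes>\<^bsub>P\<^esub> \<gamma>') X'') \<gamma> X') \<beta> X"
proof -
  have g': "src_balanced B P L (\<lambda>\<gamma> X'. g (\<beta>' \<otimes>\<^bsub>P\<^esub> \<gamma>) X')" if "\<beta>' \<in> carrier P" for \<beta>'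
    by (rule balancedI) (use that in \<open>simp_all add: balancedD[OF g] distr assoc[symmetric]\<close>)
  have bal\<beta>: "diamond_balanced B P P (\<lambda>\<beta>1 \<beta>2. g (src P (\<tau> x \<beta>1) \<otimes>\<^bsub>P\<^esub> (\<beta>2 \<otimes>\<^bsub>P\<^esub> w)) z)"
    if "x \<in> carrier L" "z \<in> carrier L" "w \<in> carrier P" for x z w
    by (rule balancedI) (use that in \<open>simp_all add: balancedD[OF g] distr assoc\<close>)
  have tk\<beta>: "Sw P \<beta> (\<lambda>\<beta>1 \<beta>2. g (src P (\<tau> x (\<beta>1 \<otimes>\<^bsub>P\<^esub> tgt P b)) \<otimes>\<^bsub>P\<^esub> (\<beta>2 \<otimes>\<^bsub>P\<^esub> w)) z)
      = Sw P \<beta> (\<lambda>\<beta>1 \<beta>2. g (src P (\<tau> x \<beta>1) \<otimes>\<^bsub>P\<^esub> (\<beta>2 \<otimes>\<^bsub>P\<^esub> (src P b \<otimes>\<^bsub>P\<^esub> w))) z)"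
    if "x \<in> carrier L" "z \<in> carrier L" "w \<in> carrier P" "b \<in> carrier B" for x z w b
    using P.Sw_takeuchi[OF bal\<beta>[OF that(1-3)] m(1) that(4)] that by (simp add: assoc)
  have tk\<gamma>: "Sw P \<gamma> (\<lambda>\<gamma>1 \<gamma>2. g (v \<otimes>\<^bsub>P\<^esub> (src P (\<tau> y (\<gamma>1 \<otimes>\<^bsub>P\<^esub> tgt P b)) \<otimes>\<^bsub>P\<^esub> \<gamma>2)) z)
      = Sw P \<gamma> (\<lambda>\<gamma>1 \<gamma>2. g (v \<otimes>\<^bsub>P\<^esub> (src P (\<tau> y \<gamma>1) \<otimes>\<^bsub>P\<^esub> \<gamma>2)) (src L b \<otimes>\<^bsub>L\<^esub> z))"
    if "y \<in> carrier L" "z \<in> carrier L" "v \<in> carrier P" "b \<in> carrier B" for y z v b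
    using P.Sw_takeuchi[OF lcross_balanced_P[OF g'[OF that(3)] that(1,2)] m(2) that(4)] that
    by (simp add: assoc balancedD(3)[OF g, symmetric])
  define F where "F x y z = Sw P \<beta> (\<lambda>\<beta>1 \<beta>2. Sw P \<gamma> (\<lambda>\<gamma>1 \<gamma>2.
      g (src P (\<tau> x \<beta>1) \<otimes>\<^bsub>P\<^esub> (\<beta>2 \<otimes>\<^bsub>P\<^esub> (src P (\<tau> y \<gamma>1) \<otimes>\<^bsub>P\<^esub> \<gamma>2))) z))" for x y z
  have F2: "F x (tgt L b \<otimes>\<^bsub>L\<^esub> y) z = F x y (src L b \<otimes>\<^bsub>L\<^esub> z)"
    if a: "x \<in> carrier L" "y \<in> carrier L" "z \<in> carrier L" "b \<in> carrier B" for x y z b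
    unfolding F_def
  proof (rule psum_cong[OF refl])
    fix \<beta>1 \<beta>2 assume b: "\<beta>1 \<in> carrier P" "\<beta>2 \<in> carrier P"
    then have c: "src P (\<tau> x \<beta>1) \<otimes>\<^bsub>P\<^esub> \<beta>2 \<in> carrier P" using a by simp
    show "Sw P \<gamma> (\<lambda>\<gamma>1 \<gamma>2. g (src P (\<tau> x \<beta>1) \<otimes>\<^bsub>P\<^esub> (\<beta>2 \<otimes>\<^bsub>P\<^esub> (src P (\<tau> (tgt L b \<otimes>\<^bsub>L\<^esub> y) \<gamma>1) \<otimes>\<^bsub>P\<^esub> \<gamma>2))) z)
      = Sw P \<gamma> (\<lambda>\<gamma>1 \<gamma>2. g (src P (\<tau> x \<beta>1) \<otimes>\<^bsub>P\<^esub> (\<beta>2 \<otimes>\<^bsub>P\<^esub> (src P (\<tau> y \<gamma>1) \<otimes>\<^bsub>P\<^esub> \<gamma>2))) (src L b \<otimes>\<^bsub>L\<^esub> z))"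
      using tk\<gamma>[OF a(2,3) c a(4)] a b by (simp add: assoc)
  qed
  have F1: "F (tgt L b \<otimes>\<^bsub>L\<^esub> x) y z = F x (src L b \<otimes>\<^bsub>L\<^esub> y) z"
    if a: "x \<in> carrier L" "y \<in> carrier L" "z \<in> carrier L" "b \<in> carrier B" for x y z b
    using a by (simp add: F_def psum_swap[of _ _ "rep (cop P \<beta>)"] tk\<beta> assoc)
  have tri: "tri_balanced B L F"
    unfolding tri_balanced_def by (intro conjI ballI)
      (simp_all only: F1 F2, simp_all add: F_def balancedD[OF g] distr psum_distrib)
  have "lcross P L \<tau> g (\<beta> \<otimes>\<^bsub>P\<^esub> \<gamma>) X = Sw L X (\<lambda>Z1 X3. Sw P \<beta> (\<lambda>\<beta>1 \<beta>2. Sw P \<gamma> (\<lambda>\<gamma>1 \<gamma>2.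
      g (src P (\<tau> Z1 (\<beta>1 \<otimes>\<^bsub>P\<^esub> \<gamma>1)) \<otimes>\<^bsub>P\<^esub> (\<beta>2 \<otimes>\<^bsub>P\<^esub> \<gamma>2)) X3)))"
    using m by (simp add: lcross_swap P.Sw_mult[OF lcross_balanced_P[OF g]])
  also have "\<dots> = Sw L X (\<lambda>Z1 X3. Sw P \<beta> (\<lambda>\<beta>1 \<beta>2. Sw P \<gamma> (\<lambda>\<gamma>1 \<gamma>2. Sw L Z1 (\<lambda>X1 X2.
      g (src P (\<tau> X1 (\<beta>1 \<otimes>\<^bsub>P\<^esub> tgt P (\<tau> X2 \<gamma>1))) \<otimes>\<^bsub>P\<^esub> (\<beta>2 \<otimes>\<^bsub>P\<^esub> \<gamma>2)) X3))))"
  proof (intro psum_cong refl)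
    fix Z1 X3 \<beta>1 \<beta>2 \<gamma>1 \<gamma>2 assume "Z1 \<in> carrier L" "X3 \<in> carrier L" "\<beta>1 \<in> carrier P" "\<beta>2 \<in> carrier P"
      "\<gamma>1 \<in> carrier P" "\<gamma>2 \<in> carrier P"
    then show "g (src P (\<tau> Z1 (\<beta>1 \<otimes>\<^bsub>P\<^esub> \<gamma>1)) \<otimes>\<^bsub>P\<^esub> (\<beta>2 \<otimes>\<^bsub>P\<^esub> \<gamma>2)) X3 = Sw L Z1 (\<lambda>X1 X2.
      g (src P (\<tau> X1 (\<beta>1 \<otimes>\<^bsub>P\<^esub> tgt P (\<tau> X2 \<gamma>1))) \<otimes>\<^bsub>P\<^esub> (\<beta>2 \<otimes>\<^bsub>P\<^esub> \<gamma>2)) X3)"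
      by (intro pair_mult_right_1 additiveI) (simp_all add: distr balancedD[OF g])
  qed
  also have "\<dots> = Sw L X (\<lambda>Z1 X3. Sw L Z1 (\<lambda>X1 X2. F X1 X2 X3))"
    using m by (simp add: F_def sum_PL psum_swap[of _ _ "rep (cop P \<beta>)"] tk\<beta>)
  also have "\<dots> = Sw L X (\<lambda>X1 r. Sw L r (\<lambda>X2 X3. F X1 X2 X3))"
    by (rule L.Sw_coassoc[OF tri m(3)])
  also have "\<dots> = lcross P L \<tau> (\<lambda>\<beta>' X'. lcross P L \<tau> (\<lambda>\<gamma>' X''. g (\<beta>' \<otimes>\<^bsub>P\<^esub> \<gamma>') X'') \<gamma> X') \<beta> X"
    using m by (simp add: lcross_def F_def sum_PL assoc)
  finally show ?thesis .
qed

lemma tgt_balanced_mult_P: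
  assumes f: "tgt_balanced B P L f" and "\<beta> \<in> carrier P"
  shows "tgt_balanced B P L (\<lambda>\<gamma> X. f (\<beta> \<otimes>\<^bsub>P\<^esub> \<gamma>) X)"
  by (rule balancedI) (use assms(2) in \<open>simp_all add: balancedD[OF f] distr assoc[symmetric]\<close>)

text \<open>Here \<open>(\<beta> \<gamma>)\<^sub>- = \<gamma>\<^sub>- \<beta>\<^sub>-\<close> reverses the order, which matches the second rule for the pairing with a product.\<close>

lemma rcross_mult_P:
  assumes f: "tgt_balanced B P L f" and m: "\<beta> \<in> carrier P" "\<gamma> \<in> carrier P" "X \<in> carrier L"
  shows "rcross B P L \<tau> f (\<beta> \<otimes>\<^bsub>P\<^esub> \<gamma>) X =
    rcross B P L \<tau> (\<lambda>\<beta>' X'. rcross B P L \<tau> (\<lambda>\<gamma>' X''. f (\<beta>' \<otimes>\<^bsub>P\<^esub> \<gamma>') X'') \<gamma> X') \<beta> X"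
proof -
  have tri: "tri_balanced B L (\<lambda>x y z. f p (tgt L (\<tau> (tgt L (\<tau> z m) \<otimes>\<^bsub>L\<^esub> y) n) \<otimes>\<^bsub>L\<^esub> x))"
    if "p \<in> carrier P" "m \<in> carrier P" "n \<in> carrier P" for p m n
    unfolding tri_balanced_def by (intro conjI ballI) (use that in \<open>simp_all add: balancedD[OF f] distr assoc\<close>)
  have "rcross B P L \<tau> f (\<beta> \<otimes>\<^bsub>P\<^esub> \<gamma>) X = Pm B P \<beta> (\<lambda>p m. Pm B P \<gamma> (\<lambda>q n. Sw L X (\<lambda>X1 X2.
      f (p \<otimes>\<^bsub>P\<^esub> q) (tgt L (\<tau> X2 (n \<otimes>\<^bsub>P\<^esub> m)) \<otimes>\<^bsub>L\<^esub> X1))))"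
    using m by (simp add: rcross_def P.Pm_mult[OF rcross_balanced_P'[OF f]])
  also have "\<dots> = Pm B P \<beta> (\<lambda>p m. Pm B P \<gamma> (\<lambda>q n. Sw L X (\<lambda>X1 X2. Sw L X2 (\<lambda>x y.
      f (p \<otimes>\<^bsub>P\<^esub> q) (tgt L (\<tau> (tgt L (\<tau> y m) \<otimes>\<^bsub>L\<^esub> x) n) \<otimes>\<^bsub>L\<^esub> X1)))))"
  proof (intro psum_cong refl)
    fix p m q n X1 X2 assume "p \<in> carrier P" "m \<in> carrier P" "q \<in> carrier P" "n \<in> carrier P"
      "X1 \<in> carrier L" "X2 \<in> carrier L"
    then show "f (p \<otimes>\<^bsub>P\<^esub> q) (tgt L (\<tau> X2 (n \<otimes>\<^bsub>P\<^esub> m)) \<otimes>\<^bsub>L\<^esub> X1) = Sw L X2 (\<lambda>x y.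
      f (p \<otimes>\<^bsub>P\<^esub> q) (tgt L (\<tau> (tgt L (\<tau> y m) \<otimes>\<^bsub>L\<^esub> x) n) \<otimes>\<^bsub>L\<^esub> X1))"
      by (intro pair_mult_right_2 additiveI) (simp_all add: distr balancedD[OF f])
  qed
  also have "\<dots> = Pm B P \<beta> (\<lambda>p m. Pm B P \<gamma> (\<lambda>q n. Sw L X (\<lambda>X1 X2. Sw L X1 (\<lambda>x y.
      f (p \<otimes>\<^bsub>P\<^esub> q) (tgt L (\<tau> (tgt L (\<tau> X2 m) \<otimes>\<^bsub>L\<^esub> y) n) \<otimes>\<^bsub>L\<^esub> x)))))"
    using m by (intro psum_cong refl L.Sw_coassoc[OF tri, symmetric]) simp_all
  also have "\<dots> = rcross B P L \<tau> (\<lambda>\<beta>' X'. rcross B P L \<tau> (\<lambda>\<gamma>' X''. f (\<beta>' \<otimes>\<^bsub>P\<^esub> \<gamma>') X'') \<gamma> X') \<beta> X"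
    by (simp add: rcross_def L.Sw_tgt_left[OF rcross_balanced_L[OF f]]) (simp only: sum_PL)
  finally show ?thesis .
qed

end

locale hopf_pairing2 = t: hopf_pairing K B P L \<tau> + k: hopf_pairing K B P L \<kappa>
  for K :: "('k, 'x) ring_scheme" and B :: "('k, 'b, 'y) module_scheme"
    and P :: "('k, 'b, 'p, 'w) bialgebroid_scheme" and L :: "('k, 'b, 'l, 'z) bialgebroid_scheme"
    and \<tau> \<kappa> :: "'l \<Rightarrow> 'p \<Rightarrow> 'b"
begin

text \<open>
  A left half with \<open>X\<close> and a right half with \<open>Y\<close> commute as operations on the same \<open>\<gamma>\<close>, since they use opposite
  ends of \<open>\<gamma>\<^sub>(\<^sub>1\<^sub>) \<otimes> \<gamma>\<^sub>(\<^sub>2\<^sub>)\<^sub>+ \<otimes> \<gamma>\<^sub>(\<^sub>2\<^sub>)\<^sub>-\<close>.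
\<close>

lemma lcross_rcross_commute_P:
  fixes h :: "'p \<Rightarrow> 'l \<Rightarrow> 'l \<Rightarrow> 'q::ab_group_add"
  assumes h1: "\<And>Y. Y \<in> carrier L \<Longrightarrow> src_balanced B P L (\<lambda>\<delta> X. h \<delta> X Y)"
    and h2: "\<And>X. X \<in> carrier L \<Longrightarrow> tgt_balanced B P L (\<lambda>\<delta> Y. h \<delta> X Y)"
    and m: "\<gamma> \<in> carrier P" "X \<in> carrier L" "Y \<in> carrier L"
  shows "lcross P L \<tau> (\<lambda>\<gamma>' X'. rcross B P L \<kappa> (\<lambda>\<delta> Y'. h \<delta> X' Y') \<gamma>' Y) \<gamma> X =
    rcross B P L \<kappa> (\<lambda>\<gamma>' Y'. lcross P L \<tau> (\<lambda>\<delta> X'. h \<delta> X' Y') \<gamma>' X) \<gamma> Y"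
proof -
  have "lcross P L \<tau> (\<lambda>\<gamma>' X'. rcross B P L \<kappa> (\<lambda>\<delta> Y'. h \<delta> X' Y') \<gamma>' Y) \<gamma> X
    = Sw P \<gamma> (\<lambda>\<gamma>1 \<gamma>2. Sw L X (\<lambda>X1 X2. Pm B P \<gamma>2 (\<lambda>p m. Sw L Y (\<lambda>Y1 Y2.
        h (src P (\<tau> X1 \<gamma>1) \<otimes>\<^bsub>P\<^esub> p) X2 (tgt L (\<kappa> Y2 m) \<otimes>\<^bsub>L\<^esub> Y1)))))"
    using m by (simp add: lcross_def rcross_def t.P.Pm_src_left[OF k.rcross_balanced_P'[OF h2]])
  also have "\<dots> = Sw L X (\<lambda>X1 X2. Sw L Y (\<lambda>Y1 Y2. Sw P \<gamma> (\<lambda>\<gamma>1 \<gamma>2. Pm B P \<gamma>2 (\<lambda>p m. 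
        h (src P (\<tau> X1 \<gamma>1) \<otimes>\<^bsub>P\<^esub> p) X2 (tgt L (\<kappa> Y2 m) \<otimes>\<^bsub>L\<^esub> Y1)))))"
    by (simp add: t.sum_PL)
  also have "\<dots> = Sw L X (\<lambda>X1 X2. Sw L Y (\<lambda>Y1 Y2. Pm B P \<gamma> (\<lambda>p m. Sw P p (\<lambda>p1 p2.
        h (src P (\<tau> X1 p1) \<otimes>\<^bsub>P\<^esub> p2) X2 (tgt L (\<kappa> Y2 m) \<otimes>\<^bsub>L\<^esub> Y1)))))"
  proof (rule psum_cong[OF refl], rule psum_cong[OF refl], rule t.P.Pm_Sw_plus[symmetric, OF _ _ m(1)])
    fix X1 X2 Y1 Y2 z assume a: "X1 \<in> carrier L" "X2 \<in> carrier L" "Y1 \<in> carrier L" "Y2 \<in> carrier L" and z: "z \<in> carrier P"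
    note a = a z
    show "diamond_balanced B P P (\<lambda>p1 p2. h (src P (\<tau> X1 p1) \<otimes>\<^bsub>P\<^esub> p2) X2 (tgt L (\<kappa> Y2 z) \<otimes>\<^bsub>L\<^esub> Y1))"
      using a by (intro t.lcross_balanced_P h1) simp_all
    show "bar_balanced B P (\<lambda>p m. h (src P (\<tau> X1 z) \<otimes>\<^bsub>P\<^esub> p) X2 (tgt L (\<kappa> Y2 m) \<otimes>\<^bsub>L\<^esub> Y1))"
      using a by (intro k.rcross_balanced_P[OF k.tgt_balanced_mult_P[OF h2]]) simp_all
  qed
  also have "\<dots> = rcross B P L \<kappa> (\<lambda>\<gamma>' Y'. lcross P L \<tau> (\<lambda>\<delta> X'. h \<delta> X' Y') \<gamma>' X) \<gamma> Y"
    by (simp add: rcross_def lcross_def t.sum_PL) (rule psum_swap)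
  finally show ?thesis .
qed

text \<open>
  A left half with \<open>\<gamma>\<close> and a right half with \<open>\<beta>\<close> commute as operations on the same \<open>X\<close>, since they use opposite
  ends of \<open>X\<^sub>(\<^sub>1\<^sub>) \<otimes> X\<^sub>(\<^sub>2\<^sub>) \<otimes> X\<^sub>(\<^sub>3\<^sub>)\<close>.
\<close>

lemma lcross_rcross_commute_L:
  fixes h :: "'p \<Rightarrow> 'p \<Rightarrow> 'l \<Rightarrow> 'q::ab_group_add"
  assumes h1: "\<And>\<beta>. \<beta> \<in> carrier P \<Longrightarrow> src_balanced B P L (\<lambda>\<gamma> X. h \<beta> \<gamma> X)"
    and h2: "\<And>\<gamma>. \<gamma> \<in> carrier P \<Longrightarrow> tgt_balanced B P L (\<lambda>\<beta> X. h \<beta> \<gamma> X)"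
    and m: "\<beta> \<in> carrier P" "\<gamma> \<in> carrier P" "X \<in> carrier L"
  shows "lcross P L \<tau> (\<lambda>\<gamma>' X'. rcross B P L \<kappa> (\<lambda>\<beta>' X''. h \<beta>' \<gamma>' X'') \<beta> X') \<gamma> X =
    rcross B P L \<kappa> (\<lambda>\<beta>' X'. lcross P L \<tau> (\<lambda>\<gamma>' X''. h \<beta>' \<gamma>' X'') \<gamma> X') \<beta> X"
proof -
  note hD = balancedD[OF h1] balancedD[OF h2]
  have "lcross P L \<tau> (\<lambda>\<gamma>' X'. rcross B P L \<kappa> (\<lambda>\<beta>' X''. h \<beta>' \<gamma>' X'') \<beta> X') \<gamma> X
    = Pm B P \<beta> (\<lambda>p m. Sw L X (\<lambda>X1 r. Sw L r (\<lambda>X2 X3. Sw P \<gamma> (\<lambda>\<gamma>1 \<gamma>2.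
        h p (src P (\<tau> X1 \<gamma>1) \<otimes>\<^bsub>P\<^esub> \<gamma>2) (tgt L (\<kappa> X3 m) \<otimes>\<^bsub>L\<^esub> X2)))))"
    by (simp add: lcross_def rcross_def t.sum_PL psum_swap[of _ _ "rep (cop P \<gamma>)"])
  also have "\<dots> = Pm B P \<beta> (\<lambda>p m. Sw L X (\<lambda>r X3. Sw L r (\<lambda>X1 X2. Sw P \<gamma> (\<lambda>\<gamma>1 \<gamma>2.
        h p (src P (\<tau> X1 \<gamma>1) \<otimes>\<^bsub>P\<^esub> \<gamma>2) (tgt L (\<kappa> X3 m) \<otimes>\<^bsub>L\<^esub> X2)))))"
  proof (rule psum_cong[OF refl], rule t.L.Sw_coassoc[symmetric, OF _ m(3)])
    fix p m assume a: "p \<in> carrier P" "m \<in> carrier P"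
    note l = t.lcross_balanced_L[OF h1[OF a(1)] \<open>\<gamma> \<in> carrier P\<close>]
    show "tri_balanced B L (\<lambda>X1 X2 X3. Sw P \<gamma> (\<lambda>\<gamma>1 \<gamma>2.
        h p (src P (\<tau> X1 \<gamma>1) \<otimes>\<^bsub>P\<^esub> \<gamma>2) (tgt L (\<kappa> X3 m) \<otimes>\<^bsub>L\<^esub> X2)))"
      unfolding tri_balanced_def
    proof (intro conjI ballI)
      fix b x y z assume b: "b \<in> carrier B" "x \<in> carrier L" "y \<in> carrier L" "z \<in> carrier L"
      show "Sw P \<gamma> (\<lambda>\<gamma>1 \<gamma>2. h p (src P (\<tau> (tgt L b \<otimes>\<^bsub>L\<^esub> x) \<gamma>1) \<otimes>\<^bsub>P\<^esub> \<gamma>2) (tgt L (\<kappa> z m) \<otimes>\<^bsub>L\<^esub> y))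
        = Sw P \<gamma> (\<lambda>\<gamma>1 \<gamma>2. h p (src P (\<tau> x \<gamma>1) \<otimes>\<^bsub>P\<^esub> \<gamma>2) (tgt L (\<kappa> z m) \<otimes>\<^bsub>L\<^esub> (src L b \<otimes>\<^bsub>L\<^esub> y)))"
        using balancedD(3)[OF l b(1,2), of "tgt L (\<kappa> z m) \<otimes>\<^bsub>L\<^esub> y"] a b by (simp add: t.normal)
    qed (use a in \<open>simp_all add: hD t.distr t.assoc psum_distrib\<close>)
  qed
  also have "\<dots> = rcross B P L \<kappa> (\<lambda>\<beta>' X'. lcross P L \<tau> (\<lambda>\<gamma>' X''. h \<beta>' \<gamma>' X'') \<gamma> X') \<beta> X"
    using m by (simp add: rcross_def t.lcross_swap t.L.Sw_tgt_left[OF t.lcross_balanced_L[OF h1]])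
  finally show ?thesis .
qed

text \<open>
  The composite of \<open>f\<close> with the whole exchange.  The halves are stated for one pairing each, so \<open>\<tau>\<close> and \<open>\<kappa>\<close>
  may differ.
\<close>

definition cross :: "('p \<Rightarrow> 'l \<Rightarrow> 'q::ab_group_add) \<Rightarrow> 'p \<Rightarrow> 'l \<Rightarrow> 'q"
  where "cross f = lcross P L \<tau> (rcross B P L \<kappa> f)"

lemma cross_cong:
  assumes "\<And>\<beta> X. \<lbrakk>\<beta> \<in> carrier P; X \<in> carrier L\<rbrakk> \<Longrightarrow> g \<beta> X = g' \<beta> X"
  shows "cross g \<beta> X = cross g' \<beta> X"
  unfolding cross_def by (intro t.lcross_cong k.rcross_cong assms)

lemma cross_fun_add: "cross (\<lambda>\<beta> X. g \<beta> X + g' \<beta> X) \<beta> X = cross g \<beta> X + cross g' \<beta> X"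
  unfolding cross_def t.lcross_fun_add[symmetric] by (rule t.lcross_cong) (rule k.rcross_fun_add)

context
  fixes f :: "'p \<Rightarrow> 'l \<Rightarrow> 'q::ab_group_add"
  assumes f: "Be_balanced B P L f"
begin

lemmas fD = Be_balancedD[OF f]

lemma tf: "tgt_balanced B P L f" by (rule Be_tgt_balanced[OF f])
lemma sf: "src_balanced B P L (rcross B P L \<kappa> f)" by (rule k.rcross_src_balanced[OF f])

lemma cross_add:
  shows "\<lbrakk>\<beta> \<in> carrier P; \<beta>' \<in> carrier P; X \<in> carrier L\<rbrakk> \<Longrightarrow> cross f (\<beta> \<oplus>\<^bsub>P\<^esub> \<beta>') X = cross f \<beta> X + cross f \<beta>' X"
    and "\<lbrakk>\<beta> \<in> carrier P; X \<in> carrier L; X' \<in> carrier L\<rbrakk> \<Longrightarrow> cross f \<beta> (X \<oplus>\<^bsub>L\<^esub> X') = cross f \<beta> X + cross f \<beta> X'"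
  by (simp_all add: cross_def t.lcross_add[OF sf])

lemma cross_src_L:
  "\<lbrakk>\<beta> \<in> carrier P; X \<in> carrier L; b \<in> carrier B\<rbrakk> \<Longrightarrow> cross f \<beta> (src L b \<otimes>\<^bsub>L\<^esub> X) = cross (\<lambda>\<beta> X. f (src P b \<otimes>\<^bsub>P\<^esub> \<beta>) X) \<beta> X"
  unfolding cross_def by (subst t.lcross_src_L[OF sf]) (auto intro!: t.lcross_cong k.rcross_src_P[OF tf])

lemma cross_tgt_L:
  "\<lbrakk>\<beta> \<in> carrier P; X \<in> carrier L; b \<in> carrier B\<rbrakk> \<Longrightarrow> cross f \<beta> (tgt L b \<otimes>\<^bsub>L\<^esub> X) = cross (\<lambda>\<beta> X. f (tgt P b \<otimes>\<^bsub>P\<^esub> \<beta>) X) \<beta> X"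
  unfolding cross_def by (subst t.lcross_tgt_L[OF sf]) (auto intro!: t.lcross_cong k.rcross_tgt_L[OF tf])

lemma cross_src_P:
  "\<lbrakk>\<beta> \<in> carrier P; X \<in> carrier L; b \<in> carrier B\<rbrakk> \<Longrightarrow> cross f (\<beta> \<otimes>\<^bsub>P\<^esub> src P b) X = cross (\<lambda>\<beta> X. f \<beta> (X \<otimes>\<^bsub>L\<^esub> src L b)) \<beta> X"
  unfolding cross_def by (subst t.lcross_src_P_right[OF sf]) (auto intro!: t.lcross_cong k.rcross_src_L_right[OF tf])

lemma cross_tgt_P:
  "\<lbrakk>\<beta> \<in> carrier P; X \<in> carrier L; b \<in> carrier B\<rbrakk> \<Longrightarrow> cross f (\<beta> \<otimes>\<^bsub>P\<^esub> tgt P b) X = cross (\<lambda>\<beta> X. f \<beta> (X \<otimes>\<^bsub>L\<^esub> tgt L b)) \<beta> X"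
  unfolding cross_def by (subst t.lcross_tgt_P_right[OF sf]) (auto intro!: t.lcross_cong k.rcross_tgt_P_right[OF tf])

lemma cross_one_L: "\<beta> \<in> carrier P \<Longrightarrow> cross f \<beta> \<one>\<^bsub>L\<^esub> = f \<beta> \<one>\<^bsub>L\<^esub>"
  unfolding cross_def by (simp add: t.lcross_one_L[OF sf] k.rcross_one_L[OF tf])

lemma cross_one_P: "X \<in> carrier L \<Longrightarrow> cross f \<one>\<^bsub>P\<^esub> X = f \<one>\<^bsub>P\<^esub> X"
  unfolding cross_def by (simp add: t.lcross_one_P[OF sf] k.rcross_one_P[OF tf])

lemma Be_balanced_mult_L: "Y \<in> carrier L \<Longrightarrow> Be_balanced B P L (\<lambda>\<gamma> X. f \<gamma> (X \<otimes>\<^bsub>L\<^esub> Y))"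
  by (rule Be_balancedI) (simp_all add: fD t.distr t.assoc)

lemma Be_balanced_mult_P: "\<beta> \<in> carrier P \<Longrightarrow> Be_balanced B P L (\<lambda>\<gamma> X. f (\<beta> \<otimes>\<^bsub>P\<^esub> \<gamma>) X)"
  by (rule Be_balancedI) (simp_all add: fD t.distr t.assoc[symmetric])

end

text \<open>
  This and the next lemma are the two laws that make the product of \<open>P \<^sup>\<tau>\<bowtie>\<^sub>\<kappa> L\<close> associative.  Split both halves
  with the multiplication rules; the inner left half and the outer right half then have to change places.
\<close>

lemma cross_mult_L:
  fixes f :: "'p \<Rightarrow> 'l \<Rightarrow> 'q::ab_group_add"
  assumes f: "Be_balanced B P L f" and m: "\<gamma> \<in> carrier P" "X \<in> carrier L" "Y \<in> carrier L"
  shows "cross f \<gamma> (X \<otimes>\<^bsub>L\<^esub> Y) = cross (\<lambda>\<gamma>' Y'. cross (\<lambda>\<gamma>'' X'. f \<gamma>'' (X' \<otimes>\<^bsub>L\<^esub> Y')) \<gamma>' X) \<gamma> Y"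
proof -
  note fL = Be_balanced_mult_L[OF f]
  have "cross f \<gamma> (X \<otimes>\<^bsub>L\<^esub> Y) = lcross P L \<tau> (\<lambda>\<gamma>' Y'. lcross P L \<tau> (\<lambda>\<gamma>'' X'.
      rcross B P L \<kappa> f \<gamma>'' (X' \<otimes>\<^bsub>L\<^esub> Y')) \<gamma>' X) \<gamma> Y"
    unfolding cross_def by (rule t.lcross_mult_L[OF sf[OF f] m])
  also have "\<dots> = lcross P L \<tau> (\<lambda>\<gamma>' Y'. lcross P L \<tau> (\<lambda>\<gamma>'' X'.
      rcross B P L \<kappa> (\<lambda>\<delta> Y''. rcross B P L \<kappa> (\<lambda>\<epsilon> X''. f \<epsilon> (X'' \<otimes>\<^bsub>L\<^esub> Y'')) \<delta> X') \<gamma>'' Y') \<gamma>' X) \<gamma> Y"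
    by (intro t.lcross_cong k.rcross_mult_L[OF tf[OF f]])
  also have "\<dots> = lcross P L \<tau> (\<lambda>\<gamma>' Y'. rcross B P L \<kappa> (\<lambda>\<delta> Y''. lcross P L \<tau> (\<lambda>\<delta>' X'.
      rcross B P L \<kappa> (\<lambda>\<epsilon> X''. f \<epsilon> (X'' \<otimes>\<^bsub>L\<^esub> Y'')) \<delta>' X') \<delta> X) \<gamma>' Y') \<gamma> Y"
  proof (intro t.lcross_cong lcross_rcross_commute_P m(2))
    fix Y'' assume "Y'' \<in> carrier L"
    then show "src_balanced B P L (\<lambda>\<delta> X'. rcross B P L \<kappa> (\<lambda>\<epsilon> X''. f \<epsilon> (X'' \<otimes>\<^bsub>L\<^esub> Y'')) \<delta> X')"
      by (rule k.rcross_src_balanced[OF fL])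
  next
    fix X' assume X': "X' \<in> carrier L"
    show "tgt_balanced B P L (\<lambda>\<delta> Y''. rcross B P L \<kappa> (\<lambda>\<epsilon> X''. f \<epsilon> (X'' \<otimes>\<^bsub>L\<^esub> Y'')) \<delta> X')"
    proof (rule balancedI)
      fix b \<delta> Y assume a: "b \<in> carrier B" "\<delta> \<in> carrier P" "Y \<in> carrier L"
      show "rcross B P L \<kappa> (\<lambda>\<epsilon> X''. f \<epsilon> (X'' \<otimes>\<^bsub>L\<^esub> Y)) (\<delta> \<otimes>\<^bsub>P\<^esub> tgt P b) X'
        = rcross B P L \<kappa> (\<lambda>\<epsilon> X''. f \<epsilon> (X'' \<otimes>\<^bsub>L\<^esub> (tgt L b \<otimes>\<^bsub>L\<^esub> Y))) \<delta> X'"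
        by (subst k.rcross_tgt_P_right[OF tf[OF fL]]) (use a X' in \<open>auto intro!: k.rcross_cong simp: t.assoc\<close>)
    next
      fix \<delta> Y Y' assume a: "\<delta> \<in> carrier P" "Y \<in> carrier L" "Y' \<in> carrier L"
      show "rcross B P L \<kappa> (\<lambda>\<epsilon> X''. f \<epsilon> (X'' \<otimes>\<^bsub>L\<^esub> (Y \<oplus>\<^bsub>L\<^esub> Y'))) \<delta> X' =
        rcross B P L \<kappa> (\<lambda>\<epsilon> X''. f \<epsilon> (X'' \<otimes>\<^bsub>L\<^esub> Y)) \<delta> X' + rcross B P L \<kappa> (\<lambda>\<epsilon> X''. f \<epsilon> (X'' \<otimes>\<^bsub>L\<^esub> Y')) \<delta> X'"
        unfolding k.rcross_fun_add[symmetric]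
        by (rule k.rcross_cong) (use a in \<open>simp add: t.distr Be_balancedD[OF f]\<close>)
    qed (use X' in \<open>simp_all add: k.rcross_add[OF tf[OF fL]]\<close>)
  qed
  also have "\<dots> = cross (\<lambda>\<gamma>' Y'. cross (\<lambda>\<gamma>'' X'. f \<gamma>'' (X' \<otimes>\<^bsub>L\<^esub> Y')) \<gamma>' X) \<gamma> Y"
    by (simp add: cross_def)
  finally show ?thesis .
qed

lemma cross_mult_P:
  fixes f :: "'p \<Rightarrow> 'l \<Rightarrow> 'q::ab_group_add"
  assumes f: "Be_balanced B P L f" and m: "\<beta> \<in> carrier P" "\<gamma> \<in> carrier P" "X \<in> carrier L"
  shows "cross f (\<beta> \<otimes>\<^bsub>P\<^esub> \<gamma>) X = cross (\<lambda>\<beta>' X'. cross (\<lambda>\<gamma>' X''. f (\<beta>' \<otimes>\<^bsub>P\<^esub> \<gamma>') X'') \<gamma> X') \<beta> X"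
proof -
  note fP = Be_balanced_mult_P[OF f]
  have "cross f (\<beta> \<otimes>\<^bsub>P\<^esub> \<gamma>) X = lcross P L \<tau> (\<lambda>\<beta>' X'. lcross P L \<tau> (\<lambda>\<gamma>' X''.
      rcross B P L \<kappa> f (\<beta>' \<otimes>\<^bsub>P\<^esub> \<gamma>') X'') \<gamma> X') \<beta> X"
    unfolding cross_def by (rule t.lcross_mult_P[OF sf[OF f] m])
  also have "\<dots> = lcross P L \<tau> (\<lambda>\<beta>' X'. lcross P L \<tau> (\<lambda>\<gamma>' X''.
      rcross B P L \<kappa> (\<lambda>\<beta>'' Y. rcross B P L \<kappa> (\<lambda>\<gamma>'' Y'. f (\<beta>'' \<otimes>\<^bsub>P\<^esub> \<gamma>'') Y') \<gamma>' Y) \<beta>' X'') \<gamma> X') \<beta> X"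
    by (intro t.lcross_cong k.rcross_mult_P[OF tf[OF f]])
  also have "\<dots> = lcross P L \<tau> (\<lambda>\<beta>' X'. rcross B P L \<kappa> (\<lambda>\<beta>'' X''. lcross P L \<tau> (\<lambda>\<gamma>' Y.
      rcross B P L \<kappa> (\<lambda>\<gamma>'' Y'. f (\<beta>'' \<otimes>\<^bsub>P\<^esub> \<gamma>'') Y') \<gamma>' Y) \<gamma> X'') \<beta>' X') \<beta> X"
  proof (intro t.lcross_cong lcross_rcross_commute_L m(2))
    fix \<beta>'' assume "\<beta>'' \<in> carrier P"
    then show "src_balanced B P L (\<lambda>\<gamma> X. rcross B P L \<kappa> (\<lambda>\<gamma>'' Y'. f (\<beta>'' \<otimes>\<^bsub>P\<^esub> \<gamma>'') Y') \<gamma> X)"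
      by (rule k.rcross_src_balanced[OF fP])
  next
    fix \<gamma> assume \<gamma>: "\<gamma> \<in> carrier P"
    show "tgt_balanced B P L (\<lambda>\<beta> X. rcross B P L \<kappa> (\<lambda>\<gamma>'' Y'. f (\<beta> \<otimes>\<^bsub>P\<^esub> \<gamma>'') Y') \<gamma> X)"
    proof (rule balancedI)
      fix b \<beta> Y assume a: "b \<in> carrier B" "\<beta> \<in> carrier P" "Y \<in> carrier L"
      show "rcross B P L \<kappa> (\<lambda>\<gamma>'' Y'. f (\<beta> \<otimes>\<^bsub>P\<^esub> tgt P b \<otimes>\<^bsub>P\<^esub> \<gamma>'') Y') \<gamma> Y
        = rcross B P L \<kappa> (\<lambda>\<gamma>'' Y'. f (\<beta> \<otimes>\<^bsub>P\<^esub> \<gamma>'') Y') \<gamma> (tgt L b \<otimes>\<^bsub>L\<^esub> Y)"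
        by (subst k.rcross_tgt_L[OF tf[OF fP]]) (use a \<gamma> in \<open>auto intro!: k.rcross_cong simp: t.assoc\<close>)
    next
      fix \<beta> \<beta>' Y assume a: "\<beta> \<in> carrier P" "\<beta>' \<in> carrier P" "Y \<in> carrier L"
      show "rcross B P L \<kappa> (\<lambda>\<gamma>'' Y'. f ((\<beta> \<oplus>\<^bsub>P\<^esub> \<beta>') \<otimes>\<^bsub>P\<^esub> \<gamma>'') Y') \<gamma> Y =
        rcross B P L \<kappa> (\<lambda>\<gamma>'' Y'. f (\<beta> \<otimes>\<^bsub>P\<^esub> \<gamma>'') Y') \<gamma> Y + rcross B P L \<kappa> (\<lambda>\<gamma>'' Y'. f (\<beta>' \<otimes>\<^bsub>P\<^esub> \<gamma>'') Y') \<gamma> Y"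
        unfolding k.rcross_fun_add[symmetric]
        by (rule k.rcross_cong) (use a in \<open>simp add: t.distr Be_balancedD[OF f]\<close>)
    qed (use \<gamma> in \<open>simp_all add: k.rcross_add[OF tf[OF fP]]\<close>)
  qed
  also have "\<dots> = cross (\<lambda>\<beta>' X'. cross (\<lambda>\<gamma>' X''. f (\<beta>' \<otimes>\<^bsub>P\<^esub> \<gamma>') X'') \<gamma> X') \<beta> X"
    by (simp add: cross_def)
  finally show ?thesis .
qed

end

section \<open>Exchange, coproduct and counit\<close>

text \<open>The coproduct \<open>\<beta> \<otimes> X \<mapsto> (\<beta>\<^sub>(\<^sub>1\<^sub>) \<otimes> X\<^sub>(\<^sub>1\<^sub>)) \<otimes> (\<beta>\<^sub>(\<^sub>2\<^sub>) \<otimes> X\<^sub>(\<^sub>2\<^sub>))\<close> in evaluated form\<close>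

definition Sw2 :: "('k, 'b, 'p, 'w) bialgebroid_scheme \<Rightarrow> ('k, 'b, 'l, 'z) bialgebroid_scheme \<Rightarrow>
    ('p \<Rightarrow> 'l \<Rightarrow> 'p \<Rightarrow> 'l \<Rightarrow> 'q::ab_group_add) \<Rightarrow> 'p \<Rightarrow> 'l \<Rightarrow> 'q"
  where "Sw2 P L F \<beta> X = Sw P \<beta> (\<lambda>\<beta>1 \<beta>2. Sw L X (\<lambda>X1 X2. F \<beta>1 X1 \<beta>2 X2))"

text \<open>
  A function on two copies of \<open>P \<otimes> L\<close> that is balanced over \<open>\<bar>B\<close> in the first copy and over \<open>B\<close> in the
  second.  The stages between the two halves of an exchange satisfy only this much.
\<close>

definition split_balanced :: "('b, 'y) ring_scheme \<Rightarrow> ('k, 'b, 'p, 'w) be_ring_scheme \<Rightarrow> ('k, 'b, 'l, 'z) be_ring_scheme \<Rightarrow>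
    ('p \<Rightarrow> 'l \<Rightarrow> 'p \<Rightarrow> 'l \<Rightarrow> 'q::ab_group_add) \<Rightarrow> bool"
  where "split_balanced B P L F \<longleftrightarrow>
    (\<forall>\<beta>\<in>carrier P. \<forall>X\<in>carrier L. tgt_balanced B P L (\<lambda>\<beta>1 X1. F \<beta>1 X1 \<beta> X)) \<and>
    (\<forall>\<beta>\<in>carrier P. \<forall>X\<in>carrier L. src_balanced B P L (F \<beta> X)) \<and>
    (\<forall>b\<in>carrier B. \<forall>\<beta>\<in>carrier P. \<forall>X\<in>carrier L. \<forall>\<beta>'\<in>carrier P. \<forall>X'\<in>carrier L.
      F (tgt P b \<otimes>\<^bsub>P\<^esub> \<beta>) X \<beta>' X' = F \<beta> X (src P b \<otimes>\<^bsub>P\<^esub> \<beta>') X')"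

lemma split_balancedD:
  assumes "split_balanced B P L F"
  shows "\<lbrakk>\<beta> \<in> carrier P; X \<in> carrier L\<rbrakk> \<Longrightarrow> tgt_balanced B P L (\<lambda>\<beta>1 X1. F \<beta>1 X1 \<beta> X)"
    and "\<lbrakk>\<beta> \<in> carrier P; X \<in> carrier L\<rbrakk> \<Longrightarrow> src_balanced B P L (F \<beta> X)"
    and "\<lbrakk>b \<in> carrier B; \<beta> \<in> carrier P; X \<in> carrier L; \<beta>' \<in> carrier P; X' \<in> carrier L\<rbrakk> \<Longrightarrow>
      F (tgt P b \<otimes>\<^bsub>P\<^esub> \<beta>) X \<beta>' X' = F \<beta> X (src P b \<otimes>\<^bsub>P\<^esub> \<beta>') X'"
  using assms by (auto simp: split_balanced_def)

context hopf_pairing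
begin

context
  fixes F :: "'p \<Rightarrow> 'l \<Rightarrow> 'p \<Rightarrow> 'l \<Rightarrow> 'q::ab_group_add"
  assumes F: "split_balanced B P L F"
begin

lemmas FD = balancedD[OF split_balancedD(1)[OF F]] balancedD[OF split_balancedD(2)[OF F]] split_balancedD(3)[OF F]

lemma Sw2_balanced_P:
  assumes "X1 \<in> carrier L" "X2 \<in> carrier L"
  shows "diamond_balanced B P P (\<lambda>\<beta>1 \<beta>2. F \<beta>1 X1 \<beta>2 X2)"
  by (rule balancedI) (use assms in \<open>simp_all add: FD\<close>)

lemma Sw2_takeuchi:
  assumes "\<beta> \<in> carrier P" "X1 \<in> carrier L" "X2 \<in> carrier L" "b \<in> carrier B"
  shows "Sw P \<beta> (\<lambda>\<beta>1 \<beta>2. F \<beta>1 (tgt L b \<otimes>\<^bsub>L\<^esub> X1) \<beta>2 X2) = Sw P \<beta> (\<lambda>\<beta>1 \<beta>2. F \<beta>1 X1 \<beta>2 (src L b \<otimes>\<^bsub>L\<^esub> X2))"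
  using P.Sw_takeuchi[OF Sw2_balanced_P[OF assms(2,3)] assms(1,4)] assms by (simp add: FD)

lemma Sw2_balanced_L:
  assumes "\<beta> \<in> carrier P"
  shows "diamond_balanced B L L (\<lambda>X1 X2. Sw P \<beta> (\<lambda>\<beta>1 \<beta>2. F \<beta>1 X1 \<beta>2 X2))"
  by (rule balancedI) (use assms in \<open>simp_all add: FD(1,2,4,5) psum_distrib Sw2_takeuchi\<close>)

lemma Sw2_add:
  "\<lbrakk>\<beta> \<in> carrier P; \<beta>' \<in> carrier P; X \<in> carrier L\<rbrakk> \<Longrightarrow> Sw2 P L F (\<beta> \<oplus>\<^bsub>P\<^esub> \<beta>') X = Sw2 P L F \<beta> X + Sw2 P L F \<beta>' X"
  "\<lbrakk>\<beta> \<in> carrier P; X \<in> carrier L; X' \<in> carrier L\<rbrakk> \<Longrightarrow> Sw2 P L F \<beta> (X \<oplus>\<^bsub>L\<^esub> X') = Sw2 P L F \<beta> X + Sw2 P L F \<beta> X'"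
  unfolding Sw2_def
  by (simp add: P.Sw_add[OF balanced_psum[OF Sw2_balanced_P]])
    (simp add: sum_PL L.Sw_add[OF Sw2_balanced_L])

lemma Sw2_swap: "Sw2 P L F \<beta> X = Sw L X (\<lambda>X1 X2. Sw P \<beta> (\<lambda>\<beta>1 \<beta>2. F \<beta>1 X1 \<beta>2 X2))"
  unfolding Sw2_def by (rule psum_swap)

lemma Sw2_src_P: "\<lbrakk>\<beta> \<in> carrier P; X \<in> carrier L; b \<in> carrier B\<rbrakk> \<Longrightarrow>
    Sw2 P L F (src P b \<otimes>\<^bsub>P\<^esub> \<beta>) X = Sw2 P L (\<lambda>\<beta>1. F (src P b \<otimes>\<^bsub>P\<^esub> \<beta>1)) \<beta> X"
  by (simp add: Sw2_def P.Sw_src_left[OF balanced_psum[OF Sw2_balanced_P]])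

lemma Sw2_tgt_P: "\<lbrakk>\<beta> \<in> carrier P; X \<in> carrier L; b \<in> carrier B\<rbrakk> \<Longrightarrow>
    Sw2 P L F (tgt P b \<otimes>\<^bsub>P\<^esub> \<beta>) X = Sw2 P L (\<lambda>\<beta>1 X1 \<beta>2. F \<beta>1 X1 (tgt P b \<otimes>\<^bsub>P\<^esub> \<beta>2)) \<beta> X"
  by (simp add: Sw2_def P.Sw_tgt_left[OF balanced_psum[OF Sw2_balanced_P]])

lemma Sw2_tgt_L: "\<lbrakk>\<beta> \<in> carrier P; X \<in> carrier L; b \<in> carrier B\<rbrakk> \<Longrightarrow>
    Sw2 P L F \<beta> (tgt L b \<otimes>\<^bsub>L\<^esub> X) = Sw2 P L (\<lambda>\<beta>1 X1 \<beta>2 X2. F \<beta>1 X1 \<beta>2 (tgt L b \<otimes>\<^bsub>L\<^esub> X2)) \<beta> X"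
  by (simp add: Sw2_swap[unfolded Sw2_def] Sw2_def sum_PL L.Sw_tgt_left[OF Sw2_balanced_L])

text \<open>The left half acts on the first leg of a coproduct, by coassociativity of both coproducts.\<close>

lemma lcross_Sw2:
  assumes s: "\<And>\<beta>' X'. \<lbrakk>\<beta>' \<in> carrier P; X' \<in> carrier L\<rbrakk> \<Longrightarrow> src_balanced B P L (\<lambda>\<beta> X. F \<beta> X \<beta>' X')"
    and m: "\<beta> \<in> carrier P" "X \<in> carrier L"
  shows "lcross P L \<tau> (Sw2 P L F) \<beta> X =
    Sw2 P L (\<lambda>\<beta>1 X1 \<beta>2 X2. lcross P L \<tau> (\<lambda>u x. F u x \<beta>2 X2) \<beta>1 X1) \<beta> X"
proof -
  define G where "G x1 X1 X2 = Sw P \<beta> (\<lambda>u r. Sw P r (\<lambda>v w. F (src P (\<tau> x1 u) \<otimes>\<^bsub>P\<^esub> v) X1 w X2))" for x1 X1 X2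
  have triP: "tri_balanced B P (\<lambda>u v w. F (src P (\<tau> x1 u) \<otimes>\<^bsub>P\<^esub> v) X1 w X2)"
    if "x1 \<in> carrier L" "X1 \<in> carrier L" "X2 \<in> carrier L" for x1 X1 X2
    unfolding tri_balanced_def by (intro conjI ballI) (use that in \<open>simp_all add: FD distr assoc normal\<close>)
  have G': "G x1 X1 X2 = Sw P \<beta> (\<lambda>y w. Sw P y (\<lambda>u v. F (src P (\<tau> x1 u) \<otimes>\<^bsub>P\<^esub> v) X1 w X2))"
    if "x1 \<in> carrier L" "X1 \<in> carrier L" "X2 \<in> carrier L" for x1 X1 X2
    unfolding G_def by (rule P.Sw_coassoc[OF triP[OF that] m(1), symmetric])
  have G1: "G (tgt L b \<otimes>\<^bsub>L\<^esub> x1) X1 X2 = G x1 (src L b \<otimes>\<^bsub>L\<^esub> X1) X2"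
    if a: "x1 \<in> carrier L" "X1 \<in> carrier L" "X2 \<in> carrier L" "b \<in> carrier B" for x1 X1 X2 b
  proof -
    have "Sw P y (\<lambda>u v. F (src P (\<tau> (tgt L b \<otimes>\<^bsub>L\<^esub> x1) u) \<otimes>\<^bsub>P\<^esub> v) X1 w X2)
        = Sw P y (\<lambda>u v. F (src P (\<tau> x1 u) \<otimes>\<^bsub>P\<^esub> v) (src L b \<otimes>\<^bsub>L\<^esub> X1) w X2)"
      if "y \<in> carrier P" "w \<in> carrier P" for y w
      using balancedD(3)[OF lcross_balanced_L[OF s[OF that(2) a(3)] that(1)] a(4,1,2)] .
    then show ?thesis using a by (simp add: G')
  qed
  have G2: "G x1 (tgt L b \<otimes>\<^bsub>L\<^esub> X1) X2 = G x1 X1 (src L b \<otimes>\<^bsub>L\<^esub> X2)"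
    if a: "x1 \<in> carrier L" "X1 \<in> carrier L" "X2 \<in> carrier L" "b \<in> carrier B" for x1 X1 X2 b
    unfolding G_def
  proof (rule psum_cong[OF refl])
    fix u r assume b: "u \<in> carrier P" "r \<in> carrier P"
    show "Sw P r (\<lambda>v w. F (src P (\<tau> x1 u) \<otimes>\<^bsub>P\<^esub> v) (tgt L b \<otimes>\<^bsub>L\<^esub> X1) w X2)
      = Sw P r (\<lambda>v w. F (src P (\<tau> x1 u) \<otimes>\<^bsub>P\<^esub> v) X1 w (src L b \<otimes>\<^bsub>L\<^esub> X2))"
      using Sw2_takeuchi[of "src P (\<tau> x1 u) \<otimes>\<^bsub>P\<^esub> r" X1 X2 b] a b
      by (simp add: P.Sw_src_left[OF Sw2_balanced_P])
  qed
  have tri: "tri_balanced B L G"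
    unfolding tri_balanced_def by (intro conjI ballI)
      (simp_all only: G1 G2, simp_all add: G_def FD distr psum_distrib)
  have "lcross P L \<tau> (Sw2 P L F) \<beta> X = Sw L X (\<lambda>x1 y. Sw L y (\<lambda>X1 X2. G x1 X1 X2))"
    using m by (simp add: lcross_swap Sw2_src_P) (simp add: Sw2_def G_def sum_PL)
  also have "\<dots> = Sw L X (\<lambda>y X2. Sw L y (\<lambda>x1 X1. G x1 X1 X2))"
    by (rule L.Sw_coassoc[OF tri m(2), symmetric])
  also have "\<dots> = Sw2 P L (\<lambda>\<beta>1 X1 \<beta>2 X2. lcross P L \<tau> (\<lambda>u x. F u x \<beta>2 X2) \<beta>1 X1) \<beta> X"
    by (simp add: G' Sw2_def lcross_def sum_PL)
  finally show ?thesis .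
qed

text \<open>The right half acts on the second leg, by coassociativity of \<open>L\<close> and \<open>Pm_Sw_plus\<close> for \<open>P\<close>.\<close>

lemma rcross_Sw2:
  assumes t: "\<And>\<beta>' X'. \<lbrakk>\<beta>' \<in> carrier P; X' \<in> carrier L\<rbrakk> \<Longrightarrow> tgt_balanced B P L (F \<beta>' X')"
    and m: "\<beta> \<in> carrier P" "X \<in> carrier L"
  shows "rcross B P L \<tau> (Sw2 P L F) \<beta> X =
    Sw2 P L (\<lambda>\<beta>1 X1 \<beta>2 X2. rcross B P L \<tau> (F \<beta>1 X1) \<beta>2 X2) \<beta> X"
proof -
  define G where "G p m X1 X2 x3 = Sw P p (\<lambda>p1 p2. F p1 X1 p2 (tgt L (\<tau> x3 m) \<otimes>\<^bsub>L\<^esub> X2))" for p m X1 X2 x3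
  have tri: "tri_balanced B L (G p m)" if a: "p \<in> carrier P" "m \<in> carrier P" for p m
    unfolding tri_balanced_def by (intro conjI ballI)
      (use a in \<open>simp_all add: G_def FD(1,2,4,5) distr assoc psum_distrib Sw2_takeuchi normal\<close>)
  have "rcross B P L \<tau> (Sw2 P L F) \<beta> X = Pm B P \<beta> (\<lambda>p m. Sw L X (\<lambda>y x3. Sw L y (\<lambda>X1 X2. G p m X1 X2 x3)))"
    using m by (simp add: rcross_def Sw2_tgt_L) (simp add: Sw2_def G_def sum_PL)
  also have "\<dots> = Pm B P \<beta> (\<lambda>p m. Sw L X (\<lambda>X1 y. Sw L y (\<lambda>X2 x3. G p m X1 X2 x3)))"
    using m by (simp add: L.Sw_coassoc[OF tri])
  also have "\<dots> = Sw L X (\<lambda>X1 y. Sw L y (\<lambda>X2 x3. Pm B P \<beta> (\<lambda>p m. G p m X1 X2 x3)))"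
    by (simp add: sum_PL)
  also have "\<dots> = Sw L X (\<lambda>X1 y. Sw L y (\<lambda>X2 x3. Sw P \<beta> (\<lambda>\<beta>1 \<beta>2. Pm B P \<beta>2 (\<lambda>p m. F \<beta>1 X1 p (tgt L (\<tau> x3 m) \<otimes>\<^bsub>L\<^esub> X2)))))"
  proof (rule psum_cong[OF refl], rule psum_cong[OF refl])
    fix X1 X2 x3 assume a: "X1 \<in> carrier L" "X2 \<in> carrier L" "x3 \<in> carrier L"
    show "Pm B P \<beta> (\<lambda>p m. G p m X1 X2 x3) = Sw P \<beta> (\<lambda>\<beta>1 \<beta>2. Pm B P \<beta>2 (\<lambda>p m. F \<beta>1 X1 p (tgt L (\<tau> x3 m) \<otimes>\<^bsub>L\<^esub> X2)))"
      unfolding G_def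
    proof (rule P.Pm_Sw_plus[OF _ _ m(1)])
      fix z assume z: "z \<in> carrier P"
      show "diamond_balanced B P P (\<lambda>x y. F x X1 y (tgt L (\<tau> x3 z) \<otimes>\<^bsub>L\<^esub> X2))"
        using a z by (intro Sw2_balanced_P) simp_all
      show "bar_balanced B P (\<lambda>p m. F z X1 p (tgt L (\<tau> x3 m) \<otimes>\<^bsub>L\<^esub> X2))"
        using a z by (intro rcross_balanced_P t) simp_all
    qed
  qed
  also have "\<dots> = Sw2 P L (\<lambda>\<beta>1 X1 \<beta>2 X2. rcross B P L \<tau> (F \<beta>1 X1) \<beta>2 X2) \<beta> X"
    by (simp add: Sw2_def rcross_def sum_PL)
  finally show ?thesis .
qed

text \<open>
  The middle components \<open>X\<^sub>(\<^sub>2\<^sub>), X\<^sub>(\<^sub>3\<^sub>)\<close> of \<open>X\<close> are paired with \<open>\<beta>\<^sub>(\<^sub>1\<^sub>)\<^sub>-\<close> and \<open>\<beta>\<^sub>(\<^sub>2\<^sub>)\<close>.  The rule for the pairing with a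
  product combines the two values into the pairing of a single component with \<open>\<beta>\<^sub>(\<^sub>1\<^sub>)\<^sub>- \<beta>\<^sub>(\<^sub>2\<^sub>)\<close>; then
  \<open>\<beta>\<^sub>(\<^sub>1\<^sub>)\<^sub>+ \<otimes> \<beta>\<^sub>(\<^sub>1\<^sub>)\<^sub>- \<beta>\<^sub>(\<^sub>2\<^sub>) = \<beta> \<otimes> 1\<close> turns the pairing into a counit.
\<close>

lemma rcross_lcross_cancel:
  assumes m: "\<beta> \<in> carrier P" "X \<in> carrier L"
  shows "Sw2 P L (\<lambda>\<beta>1 X1 \<beta>2 X2. rcross B P L \<tau> (\<lambda>u x. lcross P L \<tau> (F u x) \<beta>2 X2) \<beta>1 X1) \<beta> X = Sw2 P L F \<beta> X"
proof -
  \<comment> \<open>the summand in the four components of \<open>X\<close>; its balancedness at each of the three places is checked separately\<close>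
  define M where "M x1 x2 y1 y2 = Sw P \<beta> (\<lambda>\<beta>1 \<beta>2. Pm B P \<beta>1 (\<lambda>p m. Sw P \<beta>2 (\<lambda>v w.
      F p (tgt L (\<tau> x2 m) \<otimes>\<^bsub>L\<^esub> x1) (src P (\<tau> y1 v) \<otimes>\<^bsub>P\<^esub> w) y2)))" for x1 x2 y1 y2
  \<comment> \<open>the value of the second pairing moved inside the first, ready for the rule for the pairing with a product\<close>
  have M_alt: "M x1 x2 y1 y2 = Sw P \<beta> (\<lambda>\<beta>1 \<beta>2. Sw P \<beta>2 (\<lambda>v w. Pm B P \<beta>1 (\<lambda>p m.
      F p (tgt L (\<tau> (tgt L (\<tau> y1 v) \<otimes>\<^bsub>L\<^esub> x2) m) \<otimes>\<^bsub>L\<^esub> x1) w y2)))"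
    if a: "x1 \<in> carrier L" "x2 \<in> carrier L" "y1 \<in> carrier L" "y2 \<in> carrier L" for x1 x2 y1 y2
    unfolding M_def
  proof (rule psum_cong[OF refl])
    fix \<beta>1 \<beta>2 assume b: "\<beta>1 \<in> carrier P" "\<beta>2 \<in> carrier P"
    have "Pm B P \<beta>1 (\<lambda>p m. F p (tgt L (\<tau> x2 m) \<otimes>\<^bsub>L\<^esub> x1) (src P (\<tau> y1 v) \<otimes>\<^bsub>P\<^esub> w) y2)
        = Pm B P \<beta>1 (\<lambda>p m. F p (tgt L (\<tau> (tgt L (\<tau> y1 v) \<otimes>\<^bsub>L\<^esub> x2) m) \<otimes>\<^bsub>L\<^esub> x1) w y2)"
      if c: "v \<in> carrier P" "w \<in> carrier P" for v w
      using P.Pm_tgt_plus[OF rcross_balanced_P[OF split_balancedD(1)[OF F c(2) a(4)] a(1,2)] b(1), of "\<tau> y1 v"]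
        a b c by (simp add: FD(7))
    then have "Sw P \<beta>2 (\<lambda>v w. Pm B P \<beta>1 (\<lambda>p m. F p (tgt L (\<tau> x2 m) \<otimes>\<^bsub>L\<^esub> x1) (src P (\<tau> y1 v) \<otimes>\<^bsub>P\<^esub> w) y2))
      = Sw P \<beta>2 (\<lambda>v w. Pm B P \<beta>1 (\<lambda>p m. F p (tgt L (\<tau> (tgt L (\<tau> y1 v) \<otimes>\<^bsub>L\<^esub> x2) m) \<otimes>\<^bsub>L\<^esub> x1) w y2))"
      by (rule psum_cong[OF refl])
    then show "Pm B P \<beta>1 (\<lambda>p m. Sw P \<beta>2 (\<lambda>v w. F p (tgt L (\<tau> x2 m) \<otimes>\<^bsub>L\<^esub> x1) (src P (\<tau> y1 v) \<otimes>\<^bsub>P\<^esub> w) y2))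
      = Sw P \<beta>2 (\<lambda>v w. Pm B P \<beta>1 (\<lambda>p m. F p (tgt L (\<tau> (tgt L (\<tau> y1 v) \<otimes>\<^bsub>L\<^esub> x2) m) \<otimes>\<^bsub>L\<^esub> x1) w y2))"
      by (simp add: psum_swap[of _ _ "rep (plus_minus B P \<beta>1)"])
  qed
  have M_add1: "M (x1 \<oplus>\<^bsub>L\<^esub> x1') x2 y1 y2 = M x1 x2 y1 y2 + M x1' x2 y1 y2"
    if "x1 \<in> carrier L" "x2 \<in> carrier L" "y1 \<in> carrier L" "y2 \<in> carrier L" "x1' \<in> carrier L" for x1 x2 y1 y2 x1'
    using that by (simp add: M_def FD(1,2,4,5) distr psum_distrib)
  have M_add2: "M x1 (x2 \<oplus>\<^bsub>L\<^esub> x2') y1 y2 = M x1 x2 y1 y2 + M x1 x2' y1 y2"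
    if "x1 \<in> carrier L" "x2 \<in> carrier L" "y1 \<in> carrier L" "y2 \<in> carrier L" "x2' \<in> carrier L" for x1 x2 y1 y2 x2'
    using that by (simp add: M_def FD(1,2,4,5) distr psum_distrib)
  have M_add3: "M x1 x2 (y1 \<oplus>\<^bsub>L\<^esub> y1') y2 = M x1 x2 y1 y2 + M x1 x2 y1' y2"
    if "x1 \<in> carrier L" "x2 \<in> carrier L" "y1 \<in> carrier L" "y2 \<in> carrier L" "y1' \<in> carrier L" for x1 x2 y1 y2 y1'
    using that by (simp add: M_def FD(1,2,4,5) distr psum_distrib)
  have M_add4: "M x1 x2 y1 (y2 \<oplus>\<^bsub>L\<^esub> y2') = M x1 x2 y1 y2 + M x1 x2 y1 y2'"
    if "x1 \<in> carrier L" "x2 \<in> carrier L" "y1 \<in> carrier L" "y2 \<in> carrier L" "y2' \<in> carrier L" for x1 x2 y1 y2 y2'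
    using that by (simp add: M_def FD(1,2,4,5) distr psum_distrib)
  note M_add = M_add1 M_add2 M_add3 M_add4
  have M12: "M (tgt L b \<otimes>\<^bsub>L\<^esub> x1) x2 y1 y2 = M x1 (src L b \<otimes>\<^bsub>L\<^esub> x2) y1 y2"
    if "x1 \<in> carrier L" "x2 \<in> carrier L" "y1 \<in> carrier L" "y2 \<in> carrier L" "b \<in> carrier B" for x1 x2 y1 y2 b
    using that by (simp add: M_def assoc)
  have M23: "M x1 (tgt L b \<otimes>\<^bsub>L\<^esub> x2) y1 y2 = M x1 x2 (src L b \<otimes>\<^bsub>L\<^esub> y1) y2"
    if "x1 \<in> carrier L" "x2 \<in> carrier L" "y1 \<in> carrier L" "y2 \<in> carrier L" "b \<in> carrier B" for x1 x2 y1 y2 b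
    using that by (simp add: M_alt assoc)
  have M34: "M x1 x2 (tgt L b \<otimes>\<^bsub>L\<^esub> y1) y2 = M x1 x2 y1 (src L b \<otimes>\<^bsub>L\<^esub> y2)"
    if a: "x1 \<in> carrier L" "x2 \<in> carrier L" "y1 \<in> carrier L" "y2 \<in> carrier L" "b \<in> carrier B" for x1 x2 y1 y2 b
    unfolding M_def
  proof (rule psum_cong[OF refl], rule psum_cong[OF refl])
    fix \<beta>1 \<beta>2 p m assume b: "\<beta>1 \<in> carrier P" "\<beta>2 \<in> carrier P" "p \<in> carrier P" "m \<in> carrier P"
    then have c: "tgt L (\<tau> x2 m) \<otimes>\<^bsub>L\<^esub> x1 \<in> carrier L" using a by simp
    show "Sw P \<beta>2 (\<lambda>v w. F p (tgt L (\<tau> x2 m) \<otimes>\<^bsub>L\<^esub> x1) (src P (\<tau> (tgt L b \<otimes>\<^bsub>L\<^esub> y1) v) \<otimes>\<^bsub>P\<^esub> w) y2)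
      = Sw P \<beta>2 (\<lambda>v w. F p (tgt L (\<tau> x2 m) \<otimes>\<^bsub>L\<^esub> x1) (src P (\<tau> y1 v) \<otimes>\<^bsub>P\<^esub> w) (src L b \<otimes>\<^bsub>L\<^esub> y2))"
      using balancedD(3)[OF lcross_balanced_L[OF split_balancedD(2)[OF F b(3) c] b(2)] a(5,3,4)] .
  qed
  have M34b: "diamond_balanced B L L (M x1 x2)" if "x1 \<in> carrier L" "x2 \<in> carrier L" for x1 x2
    by (rule balancedI) (use that in \<open>simp_all add: M34 M_add\<close>)
  have tri1: "tri_balanced B L (\<lambda>x1 x2 X2. Sw L X2 (\<lambda>y1 y2. M x1 x2 y1 y2))"
    unfolding tri_balanced_def by (intro conjI ballI)
      (simp_all add: M12 M23 M_add L.Sw_add[OF M34b] L.Sw_src_left[OF M34b] psum_distrib)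
  have tri2: "tri_balanced B L (M x1)" if "x1 \<in> carrier L" for x1
    unfolding tri_balanced_def by (intro conjI ballI) (use that in \<open>simp_all add: M23 M34 M_add\<close>)
  \<comment> \<open>\<open>M\<close> with its two middle components combined into \<open>z\<close>\<close>
  define N where "N x1 z y2 = Sw P \<beta> (\<lambda>\<beta>1 \<beta>2. Sw P \<beta>2 (\<lambda>v w. Pm B P \<beta>1 (\<lambda>p m.
      F p (tgt L (\<tau> z (m \<otimes>\<^bsub>P\<^esub> v)) \<otimes>\<^bsub>L\<^esub> x1) w y2)))" for x1 z y2
  have MN: "Sw L z (\<lambda>x2 y1. M x1 x2 y1 y2) = N x1 z y2"
    if a: "x1 \<in> carrier L" "z \<in> carrier L" "y2 \<in> carrier L" for x1 z y2
  proof -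
    have "F p (tgt L (\<tau> z (m \<otimes>\<^bsub>P\<^esub> v)) \<otimes>\<^bsub>L\<^esub> x1) w y2 = Sw L z (\<lambda>x2 y1.
        F p (tgt L (\<tau> (tgt L (\<tau> y1 v) \<otimes>\<^bsub>L\<^esub> x2) m) \<otimes>\<^bsub>L\<^esub> x1) w y2)"
      if "p \<in> carrier P" "m \<in> carrier P" "v \<in> carrier P" "w \<in> carrier P" for p m v w
      by (rule pair_mult_right_2[OF additiveI]) (use a that in \<open>simp_all add: FD distr\<close>)
    then show ?thesis using a by (simp add: M_alt N_def sum_PL)
  qed
  have N: "N x1 z y2 = Sw P \<beta> (\<lambda>y w. F y (tgt L (cou L z) \<otimes>\<^bsub>L\<^esub> x1) w y2)"
    if a: "x1 \<in> carrier L" "z \<in> carrier L" "y2 \<in> carrier L" for x1 z y2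
  proof -
    have r: "bar_balanced B P (\<lambda>p m. F p (tgt L (\<tau> z m) \<otimes>\<^bsub>L\<^esub> x1) w y2)" if "w \<in> carrier P" for w
      using a that by (intro rcross_balanced_P split_balancedD(1)[OF F])
    have r': "bar_balanced B P (\<lambda>p m. F p (tgt L (\<tau> z (m \<otimes>\<^bsub>P\<^esub> v)) \<otimes>\<^bsub>L\<^esub> x1) w y2)"
      if "v \<in> carrier P" "w \<in> carrier P" for v w
      by (rule balancedI) (use a that in \<open>simp_all add: FD distr assoc\<close>)
    have tri: "tri_balanced B P (\<lambda>\<beta>1 v w. Pm B P \<beta>1 (\<lambda>p m. F p (tgt L (\<tau> z (m \<otimes>\<^bsub>P\<^esub> v)) \<otimes>\<^bsub>L\<^esub> x1) w y2))"
      unfolding tri_balanced_def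
    proof (intro conjI ballI)
      fix b x v w assume b: "b \<in> carrier B" "x \<in> carrier P" "v \<in> carrier P" "w \<in> carrier P"
      show "Pm B P x (\<lambda>p m. F p (tgt L (\<tau> z (m \<otimes>\<^bsub>P\<^esub> (tgt P b \<otimes>\<^bsub>P\<^esub> v))) \<otimes>\<^bsub>L\<^esub> x1) w y2) =
            Pm B P x (\<lambda>p m. F p (tgt L (\<tau> z (m \<otimes>\<^bsub>P\<^esub> v)) \<otimes>\<^bsub>L\<^esub> x1) (src P b \<otimes>\<^bsub>P\<^esub> w) y2)"
        using P.Pm_tgt_plus[OF r'[OF b(3,4)] b(2,1)] a b by (simp add: FD(7) assoc)
    qed (use a in \<open>simp_all add: P.Pm_add[OF r'] P.Pm_tgt_left[OF r'] FD(1,2,4,5) distr assoc psum_distrib\<close>)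
    have "N x1 z y2 = Sw P \<beta> (\<lambda>y w. Sw P y (\<lambda>\<beta>1 v. Pm B P \<beta>1 (\<lambda>p m.
        F p (tgt L (\<tau> z (m \<otimes>\<^bsub>P\<^esub> v)) \<otimes>\<^bsub>L\<^esub> x1) w y2)))"
      unfolding N_def by (rule P.Sw_coassoc[OF tri m(1), symmetric])
    also have "\<dots> = Sw P \<beta> (\<lambda>y w. F y (tgt L (cou L z) \<otimes>\<^bsub>L\<^esub> x1) w y2)"
      using a by (simp add: P.Sw_Pm_one[OF r])
    finally show ?thesis .
  qed
  have tri3: "tri_balanced B L N"
    unfolding tri_balanced_def by (intro conjI ballI)
      (simp_all add: N FD(1,2,4,5) L.cou_add distr psum_distrib assoc Sw2_takeuchi m)
  have "Sw2 P L (\<lambda>\<beta>1 X1 \<beta>2 X2. rcross B P L \<tau> (\<lambda>u x. lcross P L \<tau> (F u x) \<beta>2 X2) \<beta>1 X1) \<beta> X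
      = Sw L X (\<lambda>X1 X2. Sw L X1 (\<lambda>x1 x2. Sw L X2 (\<lambda>y1 y2. M x1 x2 y1 y2)))"
    by (simp add: Sw2_def rcross_def lcross_def M_def sum_PL)
  also have "\<dots> = Sw L X (\<lambda>x1 r. Sw L r (\<lambda>x2 X2. Sw L X2 (\<lambda>y1 y2. M x1 x2 y1 y2)))"
    by (rule L.Sw_coassoc[OF tri1 m(2)])
  also have "\<dots> = Sw L X (\<lambda>x1 r. Sw L r (\<lambda>z y2. Sw L z (\<lambda>x2 y1. M x1 x2 y1 y2)))"
    by (rule psum_cong[OF refl], rule L.Sw_coassoc[OF tri2, symmetric])
  also have "\<dots> = Sw L X (\<lambda>x1 r. Sw L r (\<lambda>z y2. N x1 z y2))"
    by (simp add: MN)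
  also have "\<dots> = Sw L X (\<lambda>q y2. Sw L q (\<lambda>x1 z. N x1 z y2))"
    by (rule L.Sw_coassoc[OF tri3 m(2), symmetric])
  also have "\<dots> = Sw L X (\<lambda>q y2. Sw P \<beta> (\<lambda>y w. Sw L q (\<lambda>x1 z. F y (tgt L (cou L z) \<otimes>\<^bsub>L\<^esub> x1) w y2)))"
    by (simp add: N sum_PL)
  also have "\<dots> = Sw L X (\<lambda>q y2. Sw P \<beta> (\<lambda>y w. F y q w y2))"
    by (intro psum_cong[OF refl] L.Sw_counit_right additiveI) (simp_all add: FD)
  also have "\<dots> = Sw2 P L F \<beta> X" by (rule Sw2_swap[symmetric])
  finally show ?thesis .
qed

end

text \<open>
  For \<open>f = \<epsilon>(\<alpha> -)\<close> this computes \<open>\<epsilon>((\<alpha> \<otimes> X) (\<beta> \<otimes> Y))\<close>, with \<open>e = \<epsilon>(Y)\<close>, when both pairings are equal.  The counit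
  of \<open>L\<close> removes one component of \<open>X\<close>; the two pairings that remain combine into the pairing of \<open>X\<close>
  with \<open>\<beta>\<^sub>+ e \<beta>\<^sub>-\<close>, which is a base element by \<open>Pm_src_cou\<close>.
\<close>

lemma lcross_rcross_counit:
  assumes f: "additive P f" and fs: "\<And>b \<alpha>. \<lbrakk>b \<in> carrier B; \<alpha> \<in> carrier P\<rbrakk> \<Longrightarrow> f (\<alpha> \<otimes>\<^bsub>P\<^esub> src P b) = f (\<alpha> \<otimes>\<^bsub>P\<^esub> tgt P b)"
    and fc: "\<And>\<alpha> b. \<lbrakk>b \<in> carrier B; \<alpha> \<in> carrier P\<rbrakk> \<Longrightarrow> f (src P b \<otimes>\<^bsub>P\<^esub> \<alpha>) = f (src P b \<otimes>\<^bsub>P\<^esub> src P (cou P \<alpha>))"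
    and m: "\<beta> \<in> carrier P" "X \<in> carrier L" "e \<in> carrier B"
  shows "lcross P L \<tau> (rcross B P L \<tau> (\<lambda>p x. f (p \<otimes>\<^bsub>P\<^esub> src P (cou L (x \<otimes>\<^bsub>L\<^esub> src L e))))) \<beta> X
    = f (src P (cou L (X \<otimes>\<^bsub>L\<^esub> src L (cou P (\<beta> \<otimes>\<^bsub>P\<^esub> src P e)))))"
proof -
  note fD = additiveD[OF f]
  have r: "rcross B P L \<tau> (\<lambda>p x. f (p \<otimes>\<^bsub>P\<^esub> src P (cou L (x \<otimes>\<^bsub>L\<^esub> src L e)))) \<gamma> Y
      = Pm B P \<gamma> (\<lambda>p m. f (p \<otimes>\<^bsub>P\<^esub> src P (\<tau> Y (src P e \<otimes>\<^bsub>P\<^esub> m))))"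
    if a: "\<gamma> \<in> carrier P" "Y \<in> carrier L" for \<gamma> Y
    unfolding rcross_def
  proof (rule psum_cong[OF refl])
    fix p m assume b: "p \<in> carrier P" "m \<in> carrier P"
    have d: "diamond_balanced B L L (\<lambda>X1 X2. f (p \<otimes>\<^bsub>P\<^esub> src P (cou L X1 \<otimes>\<^bsub>B\<^esub> \<tau> X2 m)))"
      by (rule balancedI) (use b in \<open>simp_all add: L.cou_add fD distr assoc\<close>)
    have h: "additive L (\<lambda>x. f (p \<otimes>\<^bsub>P\<^esub> src P (\<tau> x (src P e \<otimes>\<^bsub>P\<^esub> m))))"
      by (rule additiveI) (use b \<open>e \<in> carrier B\<close> in \<open>simp_all add: fD distr\<close>)
    have "Sw L Y (\<lambda>X1 X2. f (p \<otimes>\<^bsub>P\<^esub> src P (cou L (tgt L (\<tau> X2 m) \<otimes>\<^bsub>L\<^esub> X1 \<otimes>\<^bsub>L\<^esub> src L e))))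
      = Sw L Y (\<lambda>X1 X2. f (p \<otimes>\<^bsub>P\<^esub> src P (cou L (X1 \<otimes>\<^bsub>L\<^esub> tgt L e) \<otimes>\<^bsub>B\<^esub> \<tau> X2 m)))"
      using b \<open>e \<in> carrier B\<close> by (simp add: assoc L.cou_src_tgt_right del: P.src_mult)
    also have "\<dots> = Sw L Y (\<lambda>X1 X2. f (p \<otimes>\<^bsub>P\<^esub> src P (\<tau> (src L (cou L X1) \<otimes>\<^bsub>L\<^esub> X2) (src P e \<otimes>\<^bsub>P\<^esub> m))))"
      using L.Sw_takeuchi[OF d a(2) \<open>e \<in> carrier B\<close>] b \<open>e \<in> carrier B\<close> by (simp add: pair_src_right)
    also have "\<dots> = f (p \<otimes>\<^bsub>P\<^esub> src P (\<tau> Y (src P e \<otimes>\<^bsub>P\<^esub> m)))"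
      by (rule L.Sw_counit_left[OF h a(2)])
    finally show "Sw L Y (\<lambda>X1 X2. f (p \<otimes>\<^bsub>P\<^esub> src P (cou L (tgt L (\<tau> X2 m) \<otimes>\<^bsub>L\<^esub> X1 \<otimes>\<^bsub>L\<^esub> src L e))))
      = f (p \<otimes>\<^bsub>P\<^esub> src P (\<tau> Y (src P e \<otimes>\<^bsub>P\<^esub> m)))" .
  qed
  have t: "f (src P a \<otimes>\<^bsub>P\<^esub> (p \<otimes>\<^bsub>P\<^esub> src P c)) = f (src P (a \<otimes>\<^bsub>B\<^esub> cou P (p \<otimes>\<^bsub>P\<^esub> tgt P c)))"
    if "a \<in> carrier B" "p \<in> carrier P" "c \<in> carrier B" for a p c
    using that fs[of c "src P a \<otimes>\<^bsub>P\<^esub> p"] fc[of a "p \<otimes>\<^bsub>P\<^esub> tgt P c"] by (simp add: assoc)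
  define Q where "Q x y = Pm B P \<beta> (\<lambda>q n. f (src P (\<tau> x (q \<otimes>\<^bsub>P\<^esub> tgt P (\<tau> y (src P e \<otimes>\<^bsub>P\<^esub> n))))))" for x y
  have Q: "Sw P \<beta> (\<lambda>\<beta>1 \<beta>2. Pm B P \<beta>2 (\<lambda>p n. f (src P (\<tau> x \<beta>1 \<otimes>\<^bsub>B\<^esub> cou P (p \<otimes>\<^bsub>P\<^esub> tgt P (\<tau> y (src P e \<otimes>\<^bsub>P\<^esub> n))))))) = Q x y"
    if a: "x \<in> carrier L" "y \<in> carrier L" for x y
  proof -
    have "Sw P \<beta> (\<lambda>\<beta>1 \<beta>2. Pm B P \<beta>2 (\<lambda>p n. f (src P (\<tau> x \<beta>1 \<otimes>\<^bsub>B\<^esub> cou P (p \<otimes>\<^bsub>P\<^esub> tgt P (\<tau> y (src P e \<otimes>\<^bsub>P\<^esub> n)))))))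
      = Pm B P \<beta> (\<lambda>q n. Sw P q (\<lambda>\<beta>1 p. f (src P (\<tau> x \<beta>1 \<otimes>\<^bsub>B\<^esub> cou P (p \<otimes>\<^bsub>P\<^esub> tgt P (\<tau> y (src P e \<otimes>\<^bsub>P\<^esub> n)))))))"
    proof (rule P.Pm_Sw_plus[OF _ _ m(1), symmetric])
      fix z assume z: "z \<in> carrier P"
      show "diamond_balanced B P P (\<lambda>\<beta>1 p. f (src P (\<tau> x \<beta>1 \<otimes>\<^bsub>B\<^esub> cou P (p \<otimes>\<^bsub>P\<^esub> tgt P (\<tau> y (src P e \<otimes>\<^bsub>P\<^esub> z))))))"
        by (rule balancedI) (use a z m in \<open>simp_all add: P.cou_add fD distr assoc\<close>)
      show "bar_balanced B P (\<lambda>p n. f (src P (\<tau> x z \<otimes>\<^bsub>B\<^esub> cou P (p \<otimes>\<^bsub>P\<^esub> tgt P (\<tau> y (src P e \<otimes>\<^bsub>P\<^esub> n))))))"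
        by (rule balancedI) (use a z m in \<open>simp_all add: P.cou_add fD distr assoc normal\<close>)
    qed
    also have "\<dots> = Q x y"
      unfolding Q_def
    proof (rule psum_cong[OF refl])
      fix q n assume b: "q \<in> carrier P" "n \<in> carrier P"
      define c where "c = \<tau> y (src P e \<otimes>\<^bsub>P\<^esub> n)"
      have c: "c \<in> carrier B" using a b m by (simp add: c_def)
      have d: "diamond_balanced B P P (\<lambda>q1 q2. f (src P (\<tau> x (tgt P (cou P q2) \<otimes>\<^bsub>P\<^esub> q1))))"
        by (rule balancedI) (use a in \<open>simp_all add: P.cou_add fD distr assoc\<close>)
      have h: "additive P (\<lambda>q. f (src P (\<tau> x q)))"
        by (rule additiveI) (use a in \<open>simp_all add: fD\<close>)
      have "Sw P q (\<lambda>\<beta>1 p. f (src P (\<tau> x \<beta>1 \<otimes>\<^bsub>B\<^esub> cou P (p \<otimes>\<^bsub>P\<^esub> tgt P c))))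
         = Sw P (q \<otimes>\<^bsub>P\<^esub> tgt P c) (\<lambda>q1 q2. f (src P (\<tau> x (tgt P (cou P q2) \<otimes>\<^bsub>P\<^esub> q1))))"
        using P.Sw_tgt_right[OF d b(1) c] a b c by simp
      also have "\<dots> = f (src P (\<tau> x (q \<otimes>\<^bsub>P\<^esub> tgt P c)))"
        using P.Sw_counit_right[OF h, of "q \<otimes>\<^bsub>P\<^esub> tgt P c"] b c by simp
      finally show "Sw P q (\<lambda>\<beta>1 p. f (src P (\<tau> x \<beta>1 \<otimes>\<^bsub>B\<^esub> cou P (p \<otimes>\<^bsub>P\<^esub> tgt P (\<tau> y (src P e \<otimes>\<^bsub>P\<^esub> n))))))
         = f (src P (\<tau> x (q \<otimes>\<^bsub>P\<^esub> tgt P (\<tau> y (src P e \<otimes>\<^bsub>P\<^esub> n)))))" by (simp add: c_def)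
    qed
    finally show ?thesis .
  qed
  have b: "bar_balanced B P (\<lambda>q n. f (src P (\<tau> X (q \<otimes>\<^bsub>P\<^esub> n))))"
    by (rule balancedI) (use m in \<open>simp_all add: fD distr assoc\<close>)
  have h: "additive P (\<lambda>z. f (src P (\<tau> X z)))"
    by (rule additiveI) (use m in \<open>simp_all add: fD\<close>)
  have h': "additive B (\<lambda>z. f (src P z))"
    by (rule additiveI) (simp_all add: fD)
  have "lcross P L \<tau> (rcross B P L \<tau> (\<lambda>p x. f (p \<otimes>\<^bsub>P\<^esub> src P (cou L (x \<otimes>\<^bsub>L\<^esub> src L e))))) \<beta> X
    = Sw P \<beta> (\<lambda>\<beta>1 \<beta>2. Sw L X (\<lambda>X1 X2. Pm B P \<beta>2 (\<lambda>p n. f (src P (\<tau> X1 \<beta>1) \<otimes>\<^bsub>P\<^esub> (p \<otimes>\<^bsub>P\<^esub> src P (\<tau> X2 (src P e \<otimes>\<^bsub>P\<^esub> n)))))))"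
  proof -
    have bb: "bar_balanced B P (\<lambda>p n. f (p \<otimes>\<^bsub>P\<^esub> src P (\<tau> Y (src P e \<otimes>\<^bsub>P\<^esub> n))))" if "Y \<in> carrier L" for Y
    proof (rule balancedI)
      fix i p n assume a: "i \<in> carrier B" "p \<in> carrier P" "n \<in> carrier P"
      show "f (p \<otimes>\<^bsub>P\<^esub> tgt P i \<otimes>\<^bsub>P\<^esub> src P (\<tau> Y (src P e \<otimes>\<^bsub>P\<^esub> n))) =
        f (p \<otimes>\<^bsub>P\<^esub> src P (\<tau> Y (src P e \<otimes>\<^bsub>P\<^esub> (tgt P i \<otimes>\<^bsub>P\<^esub> n))))"
        using a m that fs[of i "p \<otimes>\<^bsub>P\<^esub> src P (\<tau> Y (src P e \<otimes>\<^bsub>P\<^esub> n))"] by (simp add: assoc normal)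
    qed (use m that in \<open>simp_all add: fD distr\<close>)
    show ?thesis
      unfolding lcross_def by (intro psum_cong[OF refl]) (use m in \<open>simp add: r P.Pm_src_left[OF bb] assoc\<close>)
  qed
  also have "\<dots> = Sw L X (\<lambda>X1 X2. Q X1 X2)"
    using m by (simp add: t Q[symmetric] sum_PL del: P.src_mult)
  also have "\<dots> = Pm B P \<beta> (\<lambda>q n. f (src P (\<tau> X (q \<otimes>\<^bsub>P\<^esub> (src P e \<otimes>\<^bsub>P\<^esub> n)))))"
    using m by (simp add: Q_def sum_LP pair_mult_right_1[OF h', where X = X])
  also have "\<dots> = f (src P (\<tau> X (src P (cou P (\<beta> \<otimes>\<^bsub>P\<^esub> tgt P e)))))"
    using m P.Pm_src_cou[OF h, of "\<beta> \<otimes>\<^bsub>P\<^esub> tgt P e"] by (simp add: P.Pm_tgt_right[OF b])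
  also have "\<dots> = f (src P (cou L (X \<otimes>\<^bsub>L\<^esub> src L (cou P (\<beta> \<otimes>\<^bsub>P\<^esub> src P e)))))"
    using m pair_src_right[of "cou P (\<beta> \<otimes>\<^bsub>P\<^esub> src P e)" X "\<one>\<^bsub>P\<^esub>"] by (simp add: P.cou_src_tgt_right)
  finally show ?thesis .
qed

end

context hopf_pairing2
begin

text \<open>
  The two halves may be performed in either order also on the same \<open>\<beta>\<close> and \<open>X\<close>: both orders use
  \<open>X\<^sub>(\<^sub>1\<^sub>) \<otimes> X\<^sub>(\<^sub>2\<^sub>) \<otimes> X\<^sub>(\<^sub>3\<^sub>)\<close> and \<open>\<beta>\<^sub>(\<^sub>1\<^sub>) \<otimes> \<beta>\<^sub>(\<^sub>2\<^sub>)\<^sub>+ \<otimes> \<beta>\<^sub>(\<^sub>2\<^sub>)\<^sub>-\<close>.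
\<close>

lemma lcross_rcross_commute:
  fixes f :: "'p \<Rightarrow> 'l \<Rightarrow> 'q::ab_group_add"
  assumes f: "Be_balanced B P L f" and m: "\<beta> \<in> carrier P" "X \<in> carrier L"
  shows "rcross B P L \<kappa> (lcross P L \<tau> f) \<beta> X = lcross P L \<tau> (rcross B P L \<kappa> f) \<beta> X"
proof -
  note s = Be_src_balanced[OF f] and tg = Be_tgt_balanced[OF f]
  define G where "G p m X1 X2 X3 = Sw P p (\<lambda>p1 p2. f (src P (\<tau> X1 p1) \<otimes>\<^bsub>P\<^esub> p2) (tgt L (\<kappa> X3 m) \<otimes>\<^bsub>L\<^esub> X2))" for p m X1 X2 X3
  have tri: "tri_balanced B L (G p m)" if a: "p \<in> carrier P" "m \<in> carrier P" for p m
    unfolding tri_balanced_def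
  proof (intro conjI ballI)
    fix b x y z assume b: "b \<in> carrier B" "x \<in> carrier L" "y \<in> carrier L" "z \<in> carrier L"
    show "G p m (tgt L b \<otimes>\<^bsub>L\<^esub> x) y z = G p m x (src L b \<otimes>\<^bsub>L\<^esub> y) z"
      using balancedD(3)[OF t.lcross_balanced_L[OF s a(1)] b(1,2), of "tgt L (\<kappa> z m) \<otimes>\<^bsub>L\<^esub> y"] a b
      by (simp add: G_def t.normal)
  qed (use a in \<open>simp_all add: G_def Be_balancedD[OF f] t.distr t.assoc psum_distrib\<close>)
  have "rcross B P L \<kappa> (lcross P L \<tau> f) \<beta> X = Pm B P \<beta> (\<lambda>p m. Sw L X (\<lambda>r X3. Sw L r (\<lambda>X1 X2. G p m X1 X2 X3)))"
    by (simp add: rcross_def t.lcross_swap t.L.Sw_tgt_left[OF t.lcross_balanced_L[OF s]] G_def)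
  also have "\<dots> = Pm B P \<beta> (\<lambda>p m. Sw L X (\<lambda>X1 r. Sw L r (\<lambda>X2 X3. G p m X1 X2 X3)))"
    using m by (simp add: t.L.Sw_coassoc[OF tri])
  also have "\<dots> = Sw L X (\<lambda>X1 r. Sw L r (\<lambda>X2 X3. Pm B P \<beta> (\<lambda>p m. G p m X1 X2 X3)))"
    by (simp add: t.sum_PL)
  also have "\<dots> = Sw L X (\<lambda>X1 r. Sw L r (\<lambda>X2 X3. Sw P \<beta> (\<lambda>\<beta>1 \<beta>2. Pm B P \<beta>2 (\<lambda>p m.
      f (src P (\<tau> X1 \<beta>1) \<otimes>\<^bsub>P\<^esub> p) (tgt L (\<kappa> X3 m) \<otimes>\<^bsub>L\<^esub> X2)))))"
  proof (rule psum_cong[OF refl], rule psum_cong[OF refl])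
    fix X1 X2 X3 assume a: "X1 \<in> carrier L" "X2 \<in> carrier L" "X3 \<in> carrier L"
    show "Pm B P \<beta> (\<lambda>p m. G p m X1 X2 X3) = Sw P \<beta> (\<lambda>\<beta>1 \<beta>2. Pm B P \<beta>2 (\<lambda>p m.
      f (src P (\<tau> X1 \<beta>1) \<otimes>\<^bsub>P\<^esub> p) (tgt L (\<kappa> X3 m) \<otimes>\<^bsub>L\<^esub> X2)))"
      unfolding G_def
    proof (rule t.P.Pm_Sw_plus[OF _ _ m(1)])
      fix z assume z: "z \<in> carrier P"
      show "diamond_balanced B P P (\<lambda>p1 p2. f (src P (\<tau> X1 p1) \<otimes>\<^bsub>P\<^esub> p2) (tgt L (\<kappa> X3 z) \<otimes>\<^bsub>L\<^esub> X2))"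
        using a z by (intro t.lcross_balanced_P s) simp_all
      show "bar_balanced B P (\<lambda>p m. f (src P (\<tau> X1 z) \<otimes>\<^bsub>P\<^esub> p) (tgt L (\<kappa> X3 m) \<otimes>\<^bsub>L\<^esub> X2))"
        using a z by (intro k.rcross_balanced_P[OF k.tgt_balanced_mult_P[OF tg]]) simp_all
    qed
  qed
  also have "\<dots> = lcross P L \<tau> (rcross B P L \<kappa> f) \<beta> X"
    using m by (simp add: lcross_def rcross_def t.P.Pm_src_left[OF k.rcross_balanced_P[OF tg]] t.sum_PL)
  finally show ?thesis .
qed

end

locale hopf_pairing3 = tk: hopf_pairing2 K B P L \<tau> \<kappa> + s: hopf_pairing K B P L \<sigma>
  for K :: "('k, 'x) ring_scheme" and B :: "('k, 'b, 'y) module_scheme"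
    and P :: "('k, 'b, 'p, 'w) bialgebroid_scheme" and L :: "('k, 'b, 'l, 'z) bialgebroid_scheme"
    and \<tau> \<kappa> \<sigma> :: "'l \<Rightarrow> 'p \<Rightarrow> 'b"
begin

sublocale ks: hopf_pairing2 K B P L \<kappa> \<sigma> by unfold_locales
sublocale ts: hopf_pairing2 K B P L \<tau> \<sigma> by unfold_locales

text \<open>
  The left half for \<open>\<tau>\<close> acts on the first leg and the right half for \<open>\<sigma>\<close> on the second.  Inserting the
  cancelling halves for \<open>\<kappa>\<close> completes both to whole exchanges.
\<close>

theorem cross_Sw2:
  fixes F :: "'p \<Rightarrow> 'l \<Rightarrow> 'p \<Rightarrow> 'l \<Rightarrow> 'q::ab_group_add"
  assumes F1: "\<And>\<beta> X. \<lbrakk>\<beta> \<in> carrier P; X \<in> carrier L\<rbrakk> \<Longrightarrow> Be_balanced B P L (\<lambda>\<beta>1 X1. F \<beta>1 X1 \<beta> X)"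
    and F2: "\<And>\<beta> X. \<lbrakk>\<beta> \<in> carrier P; X \<in> carrier L\<rbrakk> \<Longrightarrow> Be_balanced B P L (F \<beta> X)"
    and F12: "\<And>b \<beta> X \<beta>' X'. \<lbrakk>b \<in> carrier B; \<beta> \<in> carrier P; X \<in> carrier L; \<beta>' \<in> carrier P; X' \<in> carrier L\<rbrakk> \<Longrightarrow>
      F (tgt P b \<otimes>\<^bsub>P\<^esub> \<beta>) X \<beta>' X' = F \<beta> X (src P b \<otimes>\<^bsub>P\<^esub> \<beta>') X'"
    and m: "\<beta> \<in> carrier P" "X \<in> carrier L"
  shows "ts.cross (Sw2 P L F) \<beta> X =
    Sw2 P L (\<lambda>\<beta>1 X1 \<beta>2 X2. tk.cross (\<lambda>u x. ks.cross (F u x) \<beta>2 X2) \<beta>1 X1) \<beta> X"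
proof -
  note t = F2[THEN Be_tgt_balanced]
  have sF: "split_balanced B P L F"
    unfolding split_balanced_def using F1 F2 F12 by (auto intro: Be_src_balanced Be_tgt_balanced)
  define F' where "F' u x = rcross B P L \<sigma> (F u x)" for u x
  have F'1: "Be_balanced B P L (\<lambda>\<beta>1 X1. F' \<beta>1 X1 \<beta> X)" if a: "\<beta> \<in> carrier P" "X \<in> carrier L" for \<beta> X
    by (rule Be_balancedI) (use a in \<open>auto simp: F'_def Be_balancedD[OF F1] s.rcross_fun_add[symmetric] intro!: s.rcross_cong\<close>)
  have F'2: "src_balanced B P L (F' \<beta> X)" if a: "\<beta> \<in> carrier P" "X \<in> carrier L" for \<beta> X
    unfolding F'_def by (rule s.rcross_src_balanced[OF F2[OF a]])
  have F'12: "F' (tgt P b \<otimes>\<^bsub>P\<^esub> \<beta>) X \<beta>' X' = F' \<beta> X (src P b \<otimes>\<^bsub>P\<^esub> \<beta>') X'"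
    if a: "b \<in> carrier B" "\<beta> \<in> carrier P" "X \<in> carrier L" "\<beta>' \<in> carrier P" "X' \<in> carrier L" for b \<beta> X \<beta>' X'
    unfolding F'_def s.rcross_src_P[OF t[OF a(2,3)] a(4,5,1)] by (rule s.rcross_cong) (simp add: F12 a)
  have sF': "split_balanced B P L F'"
    unfolding split_balanced_def using F'1 F'2 F'12 by (auto intro: Be_tgt_balanced)
  define F'' where "F'' u x u' x' = lcross P L \<tau> (\<lambda>v y. F' v y u' x') u x" for u x u' x'
  have F''1: "tgt_balanced B P L (\<lambda>\<beta>1 X1. F'' \<beta>1 X1 \<beta> X)" if a: "\<beta> \<in> carrier P" "X \<in> carrier L" for \<beta> X
  proof (rule balancedI)
    note b = Be_src_balanced[OF F'1[OF a]]
    fix c u x assume c: "c \<in> carrier B" "u \<in> carrier P" "x \<in> carrier L"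
    show "F'' (u \<otimes>\<^bsub>P\<^esub> tgt P c) x \<beta> X = F'' u (tgt L c \<otimes>\<^bsub>L\<^esub> x) \<beta> X"
      unfolding F''_def tk.t.lcross_tgt_P_right[OF b c(2,3,1)] tk.t.lcross_tgt_L[OF b c(2,3,1)]
      by (rule tk.t.lcross_cong) (simp add: Be_balancedD[OF F'1[OF a]] c)
  qed (simp_all add: F''_def tk.t.lcross_add[OF Be_src_balanced[OF F'1[OF a]]])
  have F''2: "src_balanced B P L (F'' \<beta> X)" if a: "\<beta> \<in> carrier P" "X \<in> carrier L" for \<beta> X
    by (rule balancedI) (use a in \<open>auto simp: F''_def balancedD[OF F'2] tk.t.lcross_fun_add[symmetric] intro!: tk.t.lcross_cong\<close>)
  have F''12: "F'' (tgt P b \<otimes>\<^bsub>P\<^esub> \<beta>) X \<beta>' X' = F'' \<beta> X (src P b \<otimes>\<^bsub>P\<^esub> \<beta>') X'"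
    if a: "b \<in> carrier B" "\<beta> \<in> carrier P" "X \<in> carrier L" "\<beta>' \<in> carrier P" "X' \<in> carrier L" for b \<beta> X \<beta>' X'
    unfolding F''_def tk.t.lcross_tgt_P[OF Be_src_balanced[OF F'1[OF a(4,5)]] a(2,3,1)]
    by (rule tk.t.lcross_cong) (simp add: F'12 a)
  have sF'': "split_balanced B P L F''"
    unfolding split_balanced_def using F''1 F''2 F''12 by auto
  have "ts.cross (Sw2 P L F) \<beta> X = lcross P L \<tau> (Sw2 P L F') \<beta> X"
    unfolding ts.cross_def by (rule tk.t.lcross_cong) (simp add: s.rcross_Sw2[OF sF t] F'_def[abs_def])
  also have "\<dots> = Sw2 P L F'' \<beta> X"
    using tk.t.lcross_Sw2[OF sF' Be_src_balanced[OF F'1] m] by (simp add: F''_def[abs_def])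
  also have "\<dots> = Sw2 P L (\<lambda>\<beta>1 X1 \<beta>2 X2. rcross B P L \<kappa> (\<lambda>u x. lcross P L \<kappa> (F'' u x) \<beta>2 X2) \<beta>1 X1) \<beta> X"
    by (rule tk.k.rcross_lcross_cancel[OF sF'' m, symmetric])
  also have "\<dots> = Sw2 P L (\<lambda>\<beta>1 X1 \<beta>2 X2. tk.cross (\<lambda>u x. ks.cross (F u x) \<beta>2 X2) \<beta>1 X1) \<beta> X"
    unfolding Sw2_def
  proof (rule psum_cong[OF refl], rule psum_cong[OF refl])
    fix \<beta>1 \<beta>2 X1 X2 assume a: "\<beta>1 \<in> carrier P" "\<beta>2 \<in> carrier P" "X1 \<in> carrier L" "X2 \<in> carrier L"
    have K: "Be_balanced B P L (\<lambda>v y. lcross P L \<kappa> (F' v y) \<beta>2 X2)"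
      by (rule Be_balancedI) (use a in \<open>auto simp: Be_balancedD[OF F'1] tk.k.lcross_fun_add[symmetric] intro!: tk.k.lcross_cong\<close>)
    have sw: "lcross P L \<kappa> (F'' u x) \<beta>2 X2 = lcross P L \<tau> (\<lambda>v y. lcross P L \<kappa> (F' v y) \<beta>2 X2) u x" for u x
    proof -
      have "lcross P L \<kappa> (F'' u x) \<beta>2 X2 = Sw P \<beta>2 (\<lambda>\<beta>1 \<beta>2. Sw P u (\<lambda>b1 b2. Sw L X2 (\<lambda>X1 X2. Sw L x (\<lambda>x1 x2.
          F' (src P (\<tau> x1 b1) \<otimes>\<^bsub>P\<^esub> b2) x2 (src P (\<kappa> X1 \<beta>1) \<otimes>\<^bsub>P\<^esub> \<beta>2) X2))))"
        by (simp add: lcross_def F''_def tk.t.sum_LP)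
      also have "\<dots> = Sw P u (\<lambda>b1 b2. Sw P \<beta>2 (\<lambda>\<beta>1 \<beta>2. Sw L x (\<lambda>x1 x2. Sw L X2 (\<lambda>X1 X2.
          F' (src P (\<tau> x1 b1) \<otimes>\<^bsub>P\<^esub> b2) x2 (src P (\<kappa> X1 \<beta>1) \<otimes>\<^bsub>P\<^esub> \<beta>2) X2))))"
        by (subst psum_swap) (intro psum_cong[OF refl] psum_swap)
      also have "\<dots> = lcross P L \<tau> (\<lambda>v y. lcross P L \<kappa> (F' v y) \<beta>2 X2) u x"
        by (simp add: lcross_def tk.t.sum_LP)
      finally show ?thesis .
    qed
    show "rcross B P L \<kappa> (\<lambda>u x. lcross P L \<kappa> (F'' u x) \<beta>2 X2) \<beta>1 X1
        = tk.cross (\<lambda>u x. ks.cross (F u x) \<beta>2 X2) \<beta>1 X1"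
      using tk.lcross_rcross_commute[OF K a(1,3)] by (simp add: sw tk.cross_def ks.cross_def F'_def[symmetric])
  qed
  finally show ?thesis .
qed

end

section \<open>The ring structure on the double cross product\<close>

text \<open>The function on \<open>P \<otimes> L\<close> given by \<open>f\<close>, evaluated at \<open>V\<close>\<close>

abbreviation Te :: "('k, 'b, 'p, 'w) be_ring_scheme \<Rightarrow> ('k, 'b, 'l, 'z) be_ring_scheme \<Rightarrow> (('p \<times> 'l) \<Rightarrow>\<^sub>0 int) set \<Rightarrow>
    ('p \<Rightarrow> 'l \<Rightarrow> 'q::ab_group_add) \<Rightarrow> 'q"
  where "Te P L V f \<equiv> psum (carrier P) (carrier L) (rep V) f"

lemma Be_balanced_psum:
  assumes "\<And>x y. \<lbrakk>x \<in> A; y \<in> C\<rbrakk> \<Longrightarrow> Be_balanced B P L (\<lambda>m n. f m n x y)"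
  shows "Be_balanced B P L (\<lambda>m n. psum A C c (\<lambda>x y. f m n x y))"
  by (rule Be_balancedI) (simp_all add: Be_balancedD[OF assms] psum_distrib)

lemma (in left_hopf_algebroid) plus_minus_closed: "X \<in> carrier L \<Longrightarrow> plus_minus B L X \<in> carrier bar.T"
  by (simp add: plus_minus_ginv ginv_closed D.tens_closed)

lemma (in kalgebra) smult_one_left: "\<lbrakk>c \<in> carrier K; x \<in> carrier A\<rbrakk> \<Longrightarrow> (c \<odot>\<^bsub>A\<^esub> \<one>\<^bsub>A\<^esub>) \<otimes>\<^bsub>A\<^esub> x = c \<odot>\<^bsub>A\<^esub> x"
  by (simp add: smult_mult_left)

lemma (in kalgebra) smult_one_right: "\<lbrakk>c \<in> carrier K; x \<in> carrier A\<rbrakk> \<Longrightarrow> x \<otimes>\<^bsub>A\<^esub> (c \<odot>\<^bsub>A\<^esub> \<one>\<^bsub>A\<^esub>) = c \<odot>\<^bsub>A\<^esub> x"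
  by (simp add: smult_mult_right)

text \<open>Scalars of \<open>K\<close> act through the base, so balancedness over the base covers them.\<close>

lemma (in Be_ring) src_scalar:
  "\<lbrakk>c \<in> carrier K; x \<in> carrier L\<rbrakk> \<Longrightarrow> src L (c \<odot>\<^bsub>B\<^esub> \<one>\<^bsub>B\<^esub>) \<otimes>\<^bsub>L\<^esub> x = c \<odot>\<^bsub>L\<^esub> x"
  "\<lbrakk>c \<in> carrier K; x \<in> carrier L\<rbrakk> \<Longrightarrow> x \<otimes>\<^bsub>L\<^esub> src L (c \<odot>\<^bsub>B\<^esub> \<one>\<^bsub>B\<^esub>) = c \<odot>\<^bsub>L\<^esub> x"
  by (simp_all add: src_smult L.smult_one_left L.smult_one_right)

context hopf_pairing
begin

sublocale T: balanced_tensor P L "carrier B \<times> carrier B"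
  "\<lambda>(b, c) \<alpha>. \<alpha> \<otimes>\<^bsub>P\<^esub> src P b \<otimes>\<^bsub>P\<^esub> tgt P c" "\<lambda>(b, c) X. src L b \<otimes>\<^bsub>L\<^esub> tgt L c \<otimes>\<^bsub>L\<^esub> X"
  by unfold_locales auto

lemma tensor_Be_eq: "tensor_Be B P L = T.T"
  by (simp add: tensor_Be_def)

lemma T_balanced_iff: "balanced P L (carrier B \<times> carrier B)
    (\<lambda>(b, c) \<alpha>. \<alpha> \<otimes>\<^bsub>P\<^esub> src P b \<otimes>\<^bsub>P\<^esub> tgt P c) (\<lambda>(b, c) X. src L b \<otimes>\<^bsub>L\<^esub> tgt L c \<otimes>\<^bsub>L\<^esub> X) f
  \<longleftrightarrow> Be_balanced B P L f" (is "?l \<longleftrightarrow> ?r")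
proof
  assume f: ?l
  have *: "f (\<alpha> \<otimes>\<^bsub>P\<^esub> src P b \<otimes>\<^bsub>P\<^esub> tgt P c) X = f \<alpha> (src L b \<otimes>\<^bsub>L\<^esub> tgt L c \<otimes>\<^bsub>L\<^esub> X)"
    if "b \<in> carrier B" "c \<in> carrier B" "\<alpha> \<in> carrier P" "X \<in> carrier L" for \<alpha> b c X
    using balanced_act[OF f, of "(b, c)" \<alpha> X] that by simp
  show ?r
    by (rule Be_balancedI) (use *[of "\<one>\<^bsub>B\<^esub>"] *[of _ "\<one>\<^bsub>B\<^esub>"] in \<open>simp_all add: balanced_add_left[OF f] balanced_add_right[OF f]\<close>)
next
  assume f: ?r
  show ?l
    by (rule balancedI) (auto simp: Be_balancedD[OF f] L.L.A.m_assoc)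
qed

lemma Te_tens:
  "\<lbrakk>Be_balanced B P L f; \<alpha> \<in> carrier P; X \<in> carrier L\<rbrakk> \<Longrightarrow> Te P L (tens (tensor_Be B P L) \<alpha> X) f = f \<alpha> X"
  unfolding tensor_Be_eq by (rule T.eval_tens) (simp_all only: T_balanced_iff)

lemma Te_add:
  "\<lbrakk>Be_balanced B P L f; V \<in> carrier (tensor_Be B P L); W \<in> carrier (tensor_Be B P L)\<rbrakk> \<Longrightarrow>
    Te P L (V \<otimes>\<^bsub>tensor_Be B P L\<^esub> W) f = Te P L V f + Te P L W f"
  unfolding tensor_Be_eq by (rule T.eval_mult) (simp_all only: T_balanced_iff)

lemma Te_eqI:
  assumes "V \<in> carrier (tensor_Be B P L)" "W \<in> carrier (tensor_Be B P L)"
    and "\<And>f :: 'p \<Rightarrow> 'l \<Rightarrow> (('p \<times> 'l) \<Rightarrow>\<^sub>0 int) set ambient. Be_balanced B P L f \<Longrightarrow> Te P L V f = Te P L W f"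
  shows "V = W"
  using assms unfolding tensor_Be_eq by (intro T.eqI) (simp_all only: T_balanced_iff)

lemma T_comm_group: "comm_group (tensor_Be B P L)"
  unfolding tensor_Be_eq by (rule T.comm_group_T)

lemma tens_T_closed [simp]: "\<lbrakk>\<alpha> \<in> carrier P; X \<in> carrier L\<rbrakk> \<Longrightarrow> tens (tensor_Be B P L) \<alpha> X \<in> carrier (tensor_Be B P L)"
  unfolding tensor_Be_eq by (rule T.tens_closed)

lemma ghom_Te: "Be_balanced B P L f \<Longrightarrow> ghom (tensor_Be B P L) (\<lambda>V. Te P L V f)"
  by (simp add: ghom_def Te_add)

lemma ghom_T:
  "\<lbrakk>ghom (tensor_Be B P L) h; V \<in> carrier (tensor_Be B P L)\<rbrakk> \<Longrightarrow> h V = Te P L V (\<lambda>\<alpha> X. h (tens (tensor_Be B P L) \<alpha> X))"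
  unfolding tensor_Be_eq by (rule T.ghom_eval)

lemma Be_balanced_ghom:
  "ghom (tensor_Be B P L) h \<Longrightarrow> Be_balanced B P L (\<lambda>\<alpha> X. h (tens (tensor_Be B P L) \<alpha> X))"
  unfolding tensor_Be_eq T_balanced_iff[symmetric] by (rule T.balanced_ghom)

lemma ghom_tlift_Be:
  assumes "comm_group G" "ghom G h" "V \<in> carrier (tensor_Be B P L)"
    and "\<And>x y. x \<in> carrier P \<Longrightarrow> y \<in> carrier L \<Longrightarrow> f x y \<in> carrier G"
  shows "h (tlift G (\<lambda>(x, y). f x y) V) = Te P L V (\<lambda>x y. h (f x y))"
  using assms unfolding tensor_Be_eq by (rule T.ghom_tlift_T)

lemma tlift_Be_closed:
  assumes "comm_group G" "V \<in> carrier (tensor_Be B P L)"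
    and "\<And>x y. x \<in> carrier P \<Longrightarrow> y \<in> carrier L \<Longrightarrow> f x y \<in> carrier G"
  shows "tlift G (\<lambda>(x, y). f x y) V \<in> carrier G"
  using assms unfolding tensor_Be_eq by (rule T.tlift_T_closed)

end

context hopf_pairing2
begin

abbreviation "T \<equiv> tensor_Be B P L"
abbreviation "H \<equiv> bowtie B P L \<tau> \<kappa>"

lemma H_carrier [simp]: "carrier H = carrier T" by (simp add: bowtie_def Let_def)
lemma H_one: "\<one>\<^bsub>H\<^esub> = tens T \<one>\<^bsub>P\<^esub> \<one>\<^bsub>L\<^esub>" by (simp add: bowtie_def Let_def)
lemma H_zero: "\<zero>\<^bsub>H\<^esub> = \<one>\<^bsub>T\<^esub>" by (simp add: bowtie_def Let_def)
lemma H_add: "V \<oplus>\<^bsub>H\<^esub> W = V \<otimes>\<^bsub>T\<^esub> W" by (simp add: bowtie_def Let_def)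
lemma H_src: "src H b = tens T (src P b) \<one>\<^bsub>L\<^esub>" by (simp add: bowtie_def Let_def)
lemma H_tgt: "tgt H b = tens T (tgt P b) \<one>\<^bsub>L\<^esub>" by (simp add: bowtie_def Let_def)
lemma H_smult: "c \<odot>\<^bsub>H\<^esub> V = tlift T (\<lambda>(\<alpha>, X). tens T (c \<odot>\<^bsub>P\<^esub> \<alpha>) X) V" by (simp add: bowtie_def Let_def)
lemma H_mult: "\<lbrakk>V \<in> carrier T; W \<in> carrier T\<rbrakk> \<Longrightarrow>
    V \<otimes>\<^bsub>H\<^esub> W = tlift T (\<lambda>(\<alpha>, X). tlift T (\<lambda>(\<beta>, Y). bowtie_mult_pure B P L \<tau> \<kappa> \<alpha> X \<beta> Y) W) V"
  by (simp add: bowtie_def Let_def)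

lemma comm_group_H: "comm_group (add_monoid H)"
proof -
  interpret comm_group T by (rule t.T_comm_group)
  show ?thesis
    by (rule comm_groupI) (simp_all add: H_add H_zero m_assoc l_inv_ex, simp add: m_comm)
qed

lemma mult_pure_closed:
  assumes "\<alpha> \<in> carrier P" "X \<in> carrier L" "\<beta> \<in> carrier P" "Y \<in> carrier L"
  shows "bowtie_mult_pure B P L \<tau> \<kappa> \<alpha> X \<beta> Y \<in> carrier T"
  unfolding bowtie_mult_pure_def Let_def sw3_def
  using assms by (intro t.P.sw_closed t.T_comm_group t.P.bar.tlift_T_closed t.L.sw_closed t.tens_T_closed t.P.plus_minus_closed) simp_all

text \<open>\<open>bowtie_mult_pure\<close> uses three components of \<open>X\<close> at once, \<open>cross\<close> takes them off one after the other.\<close>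

lemma cross_expand:
  assumes g: "Be_balanced B P L g" and m: "\<beta> \<in> carrier P" "X \<in> carrier L"
  shows "cross g \<beta> X = Sw L X (\<lambda>X1 r. Sw L r (\<lambda>X2 X3. Sw P \<beta> (\<lambda>\<beta>1 \<beta>2. Pm B P \<beta>2 (\<lambda>p m.
    g (src P (\<tau> X1 \<beta>1) \<otimes>\<^bsub>P\<^esub> p) (tgt L (\<kappa> X3 m) \<otimes>\<^bsub>L\<^esub> X2)))))"
  using m by (simp add: cross_def lcross_def rcross_def t.P.Pm_src_left[OF k.rcross_balanced_P[OF Be_tgt_balanced[OF g]]] t.sum_PL)

lemma cross_cong':
  assumes "\<beta> = \<beta>'" "X = X'" "\<And>\<beta> X. \<lbrakk>\<beta> \<in> carrier P; X \<in> carrier L\<rbrakk> \<Longrightarrow> g \<beta> X = g' \<beta> X"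
  shows "cross g \<beta> X = cross g' \<beta>' X'"
  unfolding assms(1,2) by (rule cross_cong[OF assms(3)])

lemma Te_mult_pure:
  assumes f: "Be_balanced B P L f" and m: "\<alpha> \<in> carrier P" "X \<in> carrier L" "\<beta> \<in> carrier P" "Y \<in> carrier L"
  shows "Te P L (bowtie_mult_pure B P L \<tau> \<kappa> \<alpha> X \<beta> Y) f = cross (\<lambda>p x. f (\<alpha> \<otimes>\<^bsub>P\<^esub> p) (x \<otimes>\<^bsub>L\<^esub> Y)) \<beta> X"
proof -
  note g = t.ghom_Te[OF f] and G = t.T_comm_group
  have f': "Be_balanced B P L (\<lambda>p x. f (\<alpha> \<otimes>\<^bsub>P\<^esub> p) (x \<otimes>\<^bsub>L\<^esub> Y))"
    using Be_balanced_mult_L[OF Be_balanced_mult_P[OF f m(1)] m(4)] .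
  have "Te P L (bowtie_mult_pure B P L \<tau> \<kappa> \<alpha> X \<beta> Y) f = Sw P \<beta> (\<lambda>\<beta>1 \<beta>2. Pm B P \<beta>2 (\<lambda>\<beta>p \<beta>m.
      Sw L X (\<lambda>X1 r. Sw L r (\<lambda>X2 X3. f (\<alpha> \<otimes>\<^bsub>P\<^esub> src P (\<tau> X1 \<beta>1) \<otimes>\<^bsub>P\<^esub> \<beta>p) (tgt L (\<kappa> X3 \<beta>m) \<otimes>\<^bsub>L\<^esub> X2 \<otimes>\<^bsub>L\<^esub> Y)))))"
    unfolding bowtie_mult_pure_def Let_def sw3_def
    using m by (simp add: t.P.ghom_sw[OF G g] t.P.bar.ghom_tlift_T[OF G g] t.L.ghom_sw[OF G g]
        t.Te_tens[OF f] t.P.bar.tlift_T_closed[OF G] t.L.sw_closed[OF G] t.P.plus_minus_closed)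
  also have "\<dots> = cross (\<lambda>p x. f (\<alpha> \<otimes>\<^bsub>P\<^esub> p) (x \<otimes>\<^bsub>L\<^esub> Y)) \<beta> X"
    using m by (simp add: cross_expand[OF f'] t.assoc t.sum_PL)
  finally show ?thesis .
qed

lemma mult_closed: "\<lbrakk>V \<in> carrier T; W \<in> carrier T\<rbrakk> \<Longrightarrow> V \<otimes>\<^bsub>H\<^esub> W \<in> carrier T"
  unfolding H_mult by (intro t.tlift_Be_closed t.T_comm_group mult_pure_closed)

text \<open>All facts about the product are derived from this one formula.\<close>

lemma Te_mult:
  assumes f: "Be_balanced B P L f" and m: "V \<in> carrier T" "W \<in> carrier T"
  shows "Te P L (V \<otimes>\<^bsub>H\<^esub> W) f = Te P L V (\<lambda>\<alpha> X. Te P L W (\<lambda>\<beta> Y. cross (\<lambda>p x. f (\<alpha> \<otimes>\<^bsub>P\<^esub> p) (x \<otimes>\<^bsub>L\<^esub> Y)) \<beta> X))"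
  using m by (simp add: H_mult t.ghom_tlift_Be[OF t.T_comm_group t.ghom_Te[OF f]] t.tlift_Be_closed[OF t.T_comm_group]
      mult_pure_closed Te_mult_pure[OF f])

lemma cross_balanced_left:
  assumes f: "Be_balanced B P L f" and m: "\<beta> \<in> carrier P" "Y \<in> carrier L"
  shows "Be_balanced B P L (\<lambda>\<alpha> X. cross (\<lambda>p x. f (\<alpha> \<otimes>\<^bsub>P\<^esub> p) (x \<otimes>\<^bsub>L\<^esub> Y)) \<beta> X)"
proof -
  note fY = Be_balanced_mult_L[OF f m(2)]
  note g = Be_balanced_mult_P[OF fY]
  show ?thesis
  proof (rule Be_balancedI)
    fix \<alpha> \<alpha>' X assume a: "\<alpha> \<in> carrier P" "\<alpha>' \<in> carrier P" "X \<in> carrier L"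
    show "cross (\<lambda>p x. f ((\<alpha> \<oplus>\<^bsub>P\<^esub> \<alpha>') \<otimes>\<^bsub>P\<^esub> p) (x \<otimes>\<^bsub>L\<^esub> Y)) \<beta> X =
      cross (\<lambda>p x. f (\<alpha> \<otimes>\<^bsub>P\<^esub> p) (x \<otimes>\<^bsub>L\<^esub> Y)) \<beta> X + cross (\<lambda>p x. f (\<alpha>' \<otimes>\<^bsub>P\<^esub> p) (x \<otimes>\<^bsub>L\<^esub> Y)) \<beta> X"
      unfolding cross_fun_add[symmetric] by (rule cross_cong) (use a m in \<open>simp add: t.distr Be_balancedD[OF f]\<close>)
  next
    fix b \<alpha> X assume a: "b \<in> carrier B" "\<alpha> \<in> carrier P" "X \<in> carrier L"
    show "cross (\<lambda>p x. f (\<alpha> \<otimes>\<^bsub>P\<^esub> src P b \<otimes>\<^bsub>P\<^esub> p) (x \<otimes>\<^bsub>L\<^esub> Y)) \<beta> X =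
      cross (\<lambda>p x. f (\<alpha> \<otimes>\<^bsub>P\<^esub> p) (x \<otimes>\<^bsub>L\<^esub> Y)) \<beta> (src L b \<otimes>\<^bsub>L\<^esub> X)"
      unfolding cross_src_L[OF g[OF a(2)] m(1) a(3,1)] by (rule cross_cong) (use a in \<open>simp add: t.assoc\<close>)
    show "cross (\<lambda>p x. f (\<alpha> \<otimes>\<^bsub>P\<^esub> tgt P b \<otimes>\<^bsub>P\<^esub> p) (x \<otimes>\<^bsub>L\<^esub> Y)) \<beta> X =
      cross (\<lambda>p x. f (\<alpha> \<otimes>\<^bsub>P\<^esub> p) (x \<otimes>\<^bsub>L\<^esub> Y)) \<beta> (tgt L b \<otimes>\<^bsub>L\<^esub> X)"
      unfolding cross_tgt_L[OF g[OF a(2)] m(1) a(3,1)] by (rule cross_cong) (use a in \<open>simp add: t.assoc\<close>)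
  qed (simp add: cross_add[OF g] m)
qed

lemma cross_balanced_right:
  assumes f: "Be_balanced B P L f" and m: "\<alpha> \<in> carrier P" "X \<in> carrier L"
  shows "Be_balanced B P L (\<lambda>\<beta> Y. cross (\<lambda>p x. f (\<alpha> \<otimes>\<^bsub>P\<^esub> p) (x \<otimes>\<^bsub>L\<^esub> Y)) \<beta> X)"
proof -
  note g = Be_balanced_mult_L[OF Be_balanced_mult_P[OF f m(1)]]
  show ?thesis
  proof (rule Be_balancedI)
    fix \<beta> Y Y' assume a: "\<beta> \<in> carrier P" "Y \<in> carrier L" "Y' \<in> carrier L"
    show "cross (\<lambda>p x. f (\<alpha> \<otimes>\<^bsub>P\<^esub> p) (x \<otimes>\<^bsub>L\<^esub> (Y \<oplus>\<^bsub>L\<^esub> Y'))) \<beta> X =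
      cross (\<lambda>p x. f (\<alpha> \<otimes>\<^bsub>P\<^esub> p) (x \<otimes>\<^bsub>L\<^esub> Y)) \<beta> X + cross (\<lambda>p x. f (\<alpha> \<otimes>\<^bsub>P\<^esub> p) (x \<otimes>\<^bsub>L\<^esub> Y')) \<beta> X"
      unfolding cross_fun_add[symmetric] by (rule cross_cong) (use a m in \<open>simp add: t.distr Be_balancedD[OF f]\<close>)
  next
    fix b \<beta> Y assume a: "b \<in> carrier B" "\<beta> \<in> carrier P" "Y \<in> carrier L"
    show "cross (\<lambda>p x. f (\<alpha> \<otimes>\<^bsub>P\<^esub> p) (x \<otimes>\<^bsub>L\<^esub> Y)) (\<beta> \<otimes>\<^bsub>P\<^esub> src P b) X =
      cross (\<lambda>p x. f (\<alpha> \<otimes>\<^bsub>P\<^esub> p) (x \<otimes>\<^bsub>L\<^esub> (src L b \<otimes>\<^bsub>L\<^esub> Y))) \<beta> X"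
      unfolding cross_src_P[OF g[OF a(3)] a(2) m(2) a(1)] by (rule cross_cong) (use a in \<open>simp add: t.assoc\<close>)
    show "cross (\<lambda>p x. f (\<alpha> \<otimes>\<^bsub>P\<^esub> p) (x \<otimes>\<^bsub>L\<^esub> Y)) (\<beta> \<otimes>\<^bsub>P\<^esub> tgt P b) X =
      cross (\<lambda>p x. f (\<alpha> \<otimes>\<^bsub>P\<^esub> p) (x \<otimes>\<^bsub>L\<^esub> (tgt L b \<otimes>\<^bsub>L\<^esub> Y))) \<beta> X"
      unfolding cross_tgt_P[OF g[OF a(3)] a(2) m(2) a(1)] by (rule cross_cong) (use a in \<open>simp add: t.assoc\<close>)
  qed (simp add: cross_add[OF g] m)
qed

lemma cross_psum:
  "cross (\<lambda>p x. psum A C c (\<lambda>u v. g u v p x)) \<beta> X = psum A C c (\<lambda>u v. cross (g u v) \<beta> X)"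
proof -
  have r: "rcross B P L \<kappa> (\<lambda>p x. psum A C c (\<lambda>u v. g u v p x)) \<gamma> Y = psum A C c (\<lambda>u v. rcross B P L \<kappa> (g u v) \<gamma> Y)" for \<gamma> Y
    unfolding rcross_def by (subst psum_swap[of A C c], rule psum_cong[OF refl], rule psum_swap)
  show ?thesis
    unfolding cross_def r[abs_def] unfolding lcross_def r
    by (subst psum_swap[of A C c], rule psum_cong[OF refl], rule psum_swap)
qed

text \<open>Exchanges of unrelated pairs of factors do not interact.\<close>

lemma cross_cross_swap:
  "cross (\<lambda>p x. cross (\<lambda>q y. g p x q y) \<gamma> Y) \<beta> X = cross (\<lambda>q y. cross (\<lambda>p x. g p x q y) \<beta> X) \<gamma> Y"
proof -
  have e: "cross k \<gamma> Y = Sw P \<gamma> (\<lambda>\<beta>1 \<beta>2. Sw L Y (\<lambda>X1 X2. Pm B P (src P (\<tau> X1 \<beta>1) \<otimes>\<^bsub>P\<^esub> \<beta>2) (\<lambda>p m.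
      Sw L X2 (\<lambda>y1 y2. k p (tgt L (\<kappa> y2 m) \<otimes>\<^bsub>L\<^esub> y1)))))" for k :: "'p \<Rightarrow> 'l \<Rightarrow> 'q::ab_group_add"
    by (simp add: cross_def lcross_def rcross_def)
  show ?thesis by (subst (1 2) e) (simp only: cross_psum)
qed

lemma Te_mult_left_balanced:
  assumes f: "Be_balanced B P L f"
  shows "Be_balanced B P L (\<lambda>\<alpha> X. Te P L W (\<lambda>\<beta> Y. cross (\<lambda>p x. f (\<alpha> \<otimes>\<^bsub>P\<^esub> p) (x \<otimes>\<^bsub>L\<^esub> Y)) \<beta> X))"
  by (rule Be_balanced_psum[OF cross_balanced_left[OF f]])

text \<open>Both bracketings are sums of the same three nested exchanges, by \<open>cross_mult_L\<close> on one side and \<open>cross_mult_P\<close> on the other.\<close>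

lemma mult_assoc:
  assumes m: "U \<in> carrier T" "V \<in> carrier T" "W \<in> carrier T"
  shows "U \<otimes>\<^bsub>H\<^esub> V \<otimes>\<^bsub>H\<^esub> W = U \<otimes>\<^bsub>H\<^esub> (V \<otimes>\<^bsub>H\<^esub> W)"
proof (rule t.Te_eqI)
  fix f :: "'p \<Rightarrow> 'l \<Rightarrow> (('p \<times> 'l) \<Rightarrow>\<^sub>0 int) set ambient" assume f: "Be_balanced B P L f"
  have core: "cross (\<lambda>p x. cross (\<lambda>p' x'. f (\<alpha> \<otimes>\<^bsub>P\<^esub> p \<otimes>\<^bsub>P\<^esub> p') (x' \<otimes>\<^bsub>L\<^esub> Z)) \<gamma> (x \<otimes>\<^bsub>L\<^esub> Y)) \<beta> X
      = cross (\<lambda>p' y'. cross (\<lambda>p x. f (\<alpha> \<otimes>\<^bsub>P\<^esub> p) (x \<otimes>\<^bsub>L\<^esub> (y' \<otimes>\<^bsub>L\<^esub> Z))) (\<beta> \<otimes>\<^bsub>P\<^esub> p') X) \<gamma> Y"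
    if a: "\<alpha> \<in> carrier P" "X \<in> carrier L" "\<beta> \<in> carrier P" "Y \<in> carrier L" "\<gamma> \<in> carrier P" "Z \<in> carrier L" for \<alpha> X \<beta> Y \<gamma> Z
  proof -
    have "cross (\<lambda>p x. cross (\<lambda>p' x'. f (\<alpha> \<otimes>\<^bsub>P\<^esub> p \<otimes>\<^bsub>P\<^esub> p') (x' \<otimes>\<^bsub>L\<^esub> Z)) \<gamma> (x \<otimes>\<^bsub>L\<^esub> Y)) \<beta> X
      = cross (\<lambda>p x. cross (\<lambda>p' y'. cross (\<lambda>q z. f (\<alpha> \<otimes>\<^bsub>P\<^esub> (p \<otimes>\<^bsub>P\<^esub> q)) (z \<otimes>\<^bsub>L\<^esub> (y' \<otimes>\<^bsub>L\<^esub> Z))) p' x) \<gamma> Y) \<beta> X"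
    proof (rule cross_cong)
      fix p x assume b: "p \<in> carrier P" "x \<in> carrier L"
      then have c: "\<alpha> \<otimes>\<^bsub>P\<^esub> p \<in> carrier P" using a by simp
      show "cross (\<lambda>p' x'. f (\<alpha> \<otimes>\<^bsub>P\<^esub> p \<otimes>\<^bsub>P\<^esub> p') (x' \<otimes>\<^bsub>L\<^esub> Z)) \<gamma> (x \<otimes>\<^bsub>L\<^esub> Y)
        = cross (\<lambda>p' y'. cross (\<lambda>q z. f (\<alpha> \<otimes>\<^bsub>P\<^esub> (p \<otimes>\<^bsub>P\<^esub> q)) (z \<otimes>\<^bsub>L\<^esub> (y' \<otimes>\<^bsub>L\<^esub> Z))) p' x) \<gamma> Y"
        unfolding cross_mult_L[OF Be_balanced_mult_L[OF Be_balanced_mult_P[OF f c] a(6)] a(5) b(2) a(4)]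
        by (intro cross_cong) (use a b in \<open>simp add: t.assoc\<close>)
    qed
    also have "\<dots> = cross (\<lambda>p' y'. cross (\<lambda>p x. cross (\<lambda>q z. f (\<alpha> \<otimes>\<^bsub>P\<^esub> (p \<otimes>\<^bsub>P\<^esub> q)) (z \<otimes>\<^bsub>L\<^esub> (y' \<otimes>\<^bsub>L\<^esub> Z))) p' x) \<beta> X) \<gamma> Y"
      by (rule cross_cross_swap)
    also have "\<dots> = cross (\<lambda>p' y'. cross (\<lambda>p x. f (\<alpha> \<otimes>\<^bsub>P\<^esub> p) (x \<otimes>\<^bsub>L\<^esub> (y' \<otimes>\<^bsub>L\<^esub> Z))) (\<beta> \<otimes>\<^bsub>P\<^esub> p') X) \<gamma> Y"
      by (intro cross_cong cross_mult_P[symmetric] Be_balanced_mult_L[OF Be_balanced_mult_P[OF f]]) (use a in simp_all)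
    finally show ?thesis .
  qed
  have "Te P L (U \<otimes>\<^bsub>H\<^esub> V \<otimes>\<^bsub>H\<^esub> W) f = Te P L U (\<lambda>\<alpha> X. Te P L V (\<lambda>\<beta> Y. Te P L W (\<lambda>\<gamma> Z.
      cross (\<lambda>p x. cross (\<lambda>p' x'. f (\<alpha> \<otimes>\<^bsub>P\<^esub> p \<otimes>\<^bsub>P\<^esub> p') (x' \<otimes>\<^bsub>L\<^esub> Z)) \<gamma> (x \<otimes>\<^bsub>L\<^esub> Y)) \<beta> X)))"
    using m by (simp add: Te_mult[OF f] Te_mult[OF Te_mult_left_balanced[OF f]] mult_closed cross_psum)
  also have "\<dots> = Te P L U (\<lambda>\<alpha> X. Te P L V (\<lambda>\<beta> Y. Te P L W (\<lambda>\<gamma> Z.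
      cross (\<lambda>p' y'. cross (\<lambda>p x. f (\<alpha> \<otimes>\<^bsub>P\<^esub> p) (x \<otimes>\<^bsub>L\<^esub> (y' \<otimes>\<^bsub>L\<^esub> Z))) (\<beta> \<otimes>\<^bsub>P\<^esub> p') X) \<gamma> Y)))"
    by (simp add: core)
  also have "\<dots> = Te P L (U \<otimes>\<^bsub>H\<^esub> (V \<otimes>\<^bsub>H\<^esub> W)) f"
    using m by (simp add: Te_mult[OF f] Te_mult[OF cross_balanced_right[OF f]] mult_closed)
  finally show "Te P L (U \<otimes>\<^bsub>H\<^esub> V \<otimes>\<^bsub>H\<^esub> W) f = Te P L (U \<otimes>\<^bsub>H\<^esub> (V \<otimes>\<^bsub>H\<^esub> W)) f" .
qed (use m in \<open>simp_all add: mult_closed\<close>)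

text \<open>
  Multiplication by elements \<open>\<beta> \<otimes> 1\<close> on the left and by base elements on the right does not involve the
  pairings.
\<close>

lemma Te_base_left:
  assumes f: "Be_balanced B P L f" and m: "V \<in> carrier T" "b \<in> carrier P"
  shows "Te P L (tens T b \<one>\<^bsub>L\<^esub> \<otimes>\<^bsub>H\<^esub> V) f = Te P L V (\<lambda>\<alpha> X. f (b \<otimes>\<^bsub>P\<^esub> \<alpha>) X)"
  using m by (simp add: Te_mult[OF f] t.Te_tens[OF Te_mult_left_balanced[OF f]]
      cross_one_L[OF Be_balanced_mult_L[OF Be_balanced_mult_P[OF f]]])

lemma Te_src_right:
  assumes f: "Be_balanced B P L f" and m: "V \<in> carrier T" "b \<in> carrier B"
  shows "Te P L (V \<otimes>\<^bsub>H\<^esub> tens T (src P b) \<one>\<^bsub>L\<^esub>) f = Te P L V (\<lambda>\<alpha> X. f \<alpha> (X \<otimes>\<^bsub>L\<^esub> src L b))"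
proof -
  note g = Be_balanced_mult_L[OF Be_balanced_mult_P[OF f]]
  have "cross (\<lambda>p x. f (\<alpha> \<otimes>\<^bsub>P\<^esub> p) (x \<otimes>\<^bsub>L\<^esub> \<one>\<^bsub>L\<^esub>)) (src P b) X = f \<alpha> (X \<otimes>\<^bsub>L\<^esub> src L b)"
    if a: "\<alpha> \<in> carrier P" "X \<in> carrier L" for \<alpha> X
    using cross_src_P[OF g[OF a(1) t.L.L.A.one_closed], of "\<one>\<^bsub>P\<^esub>" X b]
      cross_one_P[OF g[OF a(1), of "src L b"] a(2)] a m
    by (simp add: t.assoc cong: cross_cong')
  then show ?thesis using m by (simp add: Te_mult[OF f] t.Te_tens[OF cross_balanced_right[OF f]])
qed

lemma Te_tgt_right:
  assumes f: "Be_balanced B P L f" and m: "V \<in> carrier T" "b \<in> carrier B"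
  shows "Te P L (V \<otimes>\<^bsub>H\<^esub> tens T (tgt P b) \<one>\<^bsub>L\<^esub>) f = Te P L V (\<lambda>\<alpha> X. f \<alpha> (X \<otimes>\<^bsub>L\<^esub> tgt L b))"
proof -
  note g = Be_balanced_mult_L[OF Be_balanced_mult_P[OF f]]
  have "cross (\<lambda>p x. f (\<alpha> \<otimes>\<^bsub>P\<^esub> p) (x \<otimes>\<^bsub>L\<^esub> \<one>\<^bsub>L\<^esub>)) (tgt P b) X = f \<alpha> (X \<otimes>\<^bsub>L\<^esub> tgt L b)"
    if a: "\<alpha> \<in> carrier P" "X \<in> carrier L" for \<alpha> X
    using cross_tgt_P[OF g[OF a(1) t.L.L.A.one_closed], of "\<one>\<^bsub>P\<^esub>" X b]
      cross_one_P[OF g[OF a(1), of "tgt L b"] a(2)] a m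
    by (simp add: t.assoc cong: cross_cong')
  then show ?thesis using m by (simp add: Te_mult[OF f] t.Te_tens[OF cross_balanced_right[OF f]])
qed

lemma mult_one_left: "V \<in> carrier T \<Longrightarrow> \<one>\<^bsub>H\<^esub> \<otimes>\<^bsub>H\<^esub> V = V"
  unfolding H_one by (rule t.Te_eqI) (simp_all add: mult_closed Te_base_left)

lemma mult_one_right: "V \<in> carrier T \<Longrightarrow> V \<otimes>\<^bsub>H\<^esub> \<one>\<^bsub>H\<^esub> = V"
  unfolding H_one by (rule t.Te_eqI) (simp_all add: mult_closed Te_src_right[where b = "\<one>\<^bsub>B\<^esub>", simplified])

lemma mult_add_left:
  assumes m: "U \<in> carrier T" "V \<in> carrier T" "W \<in> carrier T"
  shows "(U \<oplus>\<^bsub>H\<^esub> V) \<otimes>\<^bsub>H\<^esub> W = U \<otimes>\<^bsub>H\<^esub> W \<oplus>\<^bsub>H\<^esub> V \<otimes>\<^bsub>H\<^esub> W"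
proof -
  interpret TT: comm_group T by (rule t.T_comm_group)
  show ?thesis
    by (rule t.Te_eqI) (use m in \<open>simp_all add: H_add mult_closed Te_mult t.Te_add t.Te_add[OF Te_mult_left_balanced]\<close>)
qed

lemma mult_add_right:
  assumes m: "U \<in> carrier T" "V \<in> carrier T" "W \<in> carrier T"
  shows "W \<otimes>\<^bsub>H\<^esub> (U \<oplus>\<^bsub>H\<^esub> V) = W \<otimes>\<^bsub>H\<^esub> U \<oplus>\<^bsub>H\<^esub> W \<otimes>\<^bsub>H\<^esub> V"
proof -
  interpret TT: comm_group T by (rule t.T_comm_group)
  show ?thesis
    by (rule t.Te_eqI) (use m in \<open>simp_all add: H_add mult_closed Te_mult t.Te_add t.Te_add[OF cross_balanced_right] psum_distrib\<close>)
qed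

lemma ring_H: "ring H"
proof (rule ringI)
  show "abelian_group H" by (rule comm_group_abelian_groupI[OF comm_group_H])
  show "Group.monoid H"
    by (rule monoidI) (simp_all add: H_one mult_closed mult_assoc mult_one_left[unfolded H_one] mult_one_right[unfolded H_one])
qed (simp_all add: mult_add_left mult_add_right)

lemma smult_closed: "\<lbrakk>c \<in> carrier K; V \<in> carrier T\<rbrakk> \<Longrightarrow> c \<odot>\<^bsub>H\<^esub> V \<in> carrier T"
  unfolding H_smult by (rule t.tlift_Be_closed[OF t.T_comm_group]) simp_all

lemma Be_balanced_smult:
  assumes f: "Be_balanced B P L f" and c: "c \<in> carrier K"
  shows "Be_balanced B P L (\<lambda>\<alpha> X. f (c \<odot>\<^bsub>P\<^esub> \<alpha>) X)"
  by (rule Be_balancedI) (use c in \<open>simp_all add: t.P.L.smult_r_distr Be_balancedD(1,2)[OF f]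
    t.P.L.smult_mult_left[symmetric] Be_balancedD(3,4)[OF f]\<close>)

lemma Te_smult:
  assumes f: "Be_balanced B P L f" and m: "c \<in> carrier K" "V \<in> carrier T"
  shows "Te P L (c \<odot>\<^bsub>H\<^esub> V) f = Te P L V (\<lambda>\<alpha> X. f (c \<odot>\<^bsub>P\<^esub> \<alpha>) X)"
  unfolding H_smult using m by (subst t.ghom_tlift_Be[OF t.T_comm_group t.ghom_Te[OF f]]) (simp_all add: t.Te_tens[OF f])

lemma cross_smult:
  assumes f: "Be_balanced B P L f" and m: "c \<in> carrier K" "\<beta> \<in> carrier P" "X \<in> carrier L"
  shows "cross f (c \<odot>\<^bsub>P\<^esub> \<beta>) X = cross (\<lambda>p x. f (c \<odot>\<^bsub>P\<^esub> p) x) \<beta> X"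
proof -
  let ?c = "c \<odot>\<^bsub>B\<^esub> \<one>\<^bsub>B\<^esub>"
  have c: "?c \<in> carrier B" using m by simp
  have "cross f (\<beta> \<otimes>\<^bsub>P\<^esub> src P ?c) X = cross (\<lambda>\<beta> X. f \<beta> (X \<otimes>\<^bsub>L\<^esub> src L ?c)) \<beta> X"
    by (rule cross_src_P[OF f m(2,3) c])
  also have "\<dots> = cross (\<lambda>p x. f (c \<odot>\<^bsub>P\<^esub> p) x) \<beta> X"
  proof (rule cross_cong)
    fix p x assume a: "p \<in> carrier P" "x \<in> carrier L"
    have "f p (x \<otimes>\<^bsub>L\<^esub> src L ?c) = f p (src L ?c \<otimes>\<^bsub>L\<^esub> x)"
      using a m by (simp add: t.L.src_scalar)
    also have "\<dots> = f (c \<odot>\<^bsub>P\<^esub> p) x"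
      using Be_balancedD(3)[OF f c a] a m by (simp add: t.P.src_scalar)
    finally show "f p (x \<otimes>\<^bsub>L\<^esub> src L ?c) = f (c \<odot>\<^bsub>P\<^esub> p) x" .
  qed
  finally show ?thesis using m by (simp add: t.P.src_scalar)
qed

lemma module_H: "module K H"
proof (rule moduleI)
  interpret TT: comm_group T by (rule t.T_comm_group)
  show "cring K" using t.P.B.field_axioms by (simp add: field_def domain_def)
  show "abelian_group H" by (rule comm_group_abelian_groupI[OF comm_group_H])
  fix a b V W assume m: "a \<in> carrier K" "b \<in> carrier K" "V \<in> carrier H" "W \<in> carrier H"
  show "(a \<oplus>\<^bsub>K\<^esub> b) \<odot>\<^bsub>H\<^esub> V = a \<odot>\<^bsub>H\<^esub> V \<oplus>\<^bsub>H\<^esub> b \<odot>\<^bsub>H\<^esub> V"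
    by (rule t.Te_eqI) (use m in \<open>simp_all add: H_add smult_closed Te_smult t.Te_add t.P.L.smult_l_distr Be_balancedD(1) psum_distrib\<close>)
  show "a \<odot>\<^bsub>H\<^esub> (V \<oplus>\<^bsub>H\<^esub> W) = a \<odot>\<^bsub>H\<^esub> V \<oplus>\<^bsub>H\<^esub> a \<odot>\<^bsub>H\<^esub> W"
    by (rule t.Te_eqI) (use m in \<open>simp_all add: H_add smult_closed Te_smult t.Te_add t.Te_add[OF Be_balanced_smult]\<close>)
  show "(a \<otimes>\<^bsub>K\<^esub> b) \<odot>\<^bsub>H\<^esub> V = a \<odot>\<^bsub>H\<^esub> (b \<odot>\<^bsub>H\<^esub> V)"
    by (rule t.Te_eqI) (use m in \<open>simp_all add: smult_closed Te_smult Te_smult[OF Be_balanced_smult] t.P.L.smult_assoc1\<close>)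
next
  fix V assume m: "V \<in> carrier H"
  show "\<one>\<^bsub>K\<^esub> \<odot>\<^bsub>H\<^esub> V = V"
    by (rule t.Te_eqI) (use m in \<open>simp_all add: smult_closed Te_smult\<close>)
qed (simp add: smult_closed)

lemma kalgebra_H: "kalgebra K H"
proof (intro kalgebra.intro kalgebra_axioms.intro)
  show "field K" by (rule t.P.B.field_axioms)
  show "ring H" by (rule ring_H)
  show "module K H" by (rule module_H)
  fix c V W assume m: "c \<in> carrier K" "V \<in> carrier H" "W \<in> carrier H"
  show "(c \<odot>\<^bsub>H\<^esub> V) \<otimes>\<^bsub>H\<^esub> W = c \<odot>\<^bsub>H\<^esub> (V \<otimes>\<^bsub>H\<^esub> W)"
    by (rule t.Te_eqI) (use m in \<open>simp_all add: smult_closed mult_closed Te_smult Te_mult Te_smult[OF Te_mult_left_balanced]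
      Te_mult[OF Be_balanced_smult] t.P.L.smult_mult_left cong: cross_cong'\<close>)
  show "V \<otimes>\<^bsub>H\<^esub> (c \<odot>\<^bsub>H\<^esub> W) = c \<odot>\<^bsub>H\<^esub> (V \<otimes>\<^bsub>H\<^esub> W)"
    by (rule t.Te_eqI) (use m in \<open>simp_all add: smult_closed mult_closed Te_smult Te_mult Te_smult[OF cross_balanced_right]
      Te_mult[OF Be_balanced_smult] cross_smult[OF Be_balanced_mult_L[OF Be_balanced_mult_P]] t.P.L.smult_mult_right cong: cross_cong'\<close>)
qed

lemma tens_add_left: "\<lbrakk>\<alpha> \<in> carrier P; \<beta> \<in> carrier P; X \<in> carrier L\<rbrakk> \<Longrightarrow> tens T (\<alpha> \<oplus>\<^bsub>P\<^esub> \<beta>) X = tens T \<alpha> X \<otimes>\<^bsub>T\<^esub> tens T \<beta> X"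
proof -
  interpret TT: comm_group T by (rule t.T_comm_group)
  assume "\<alpha> \<in> carrier P" "\<beta> \<in> carrier P" "X \<in> carrier L"
  then show ?thesis by (intro t.Te_eqI) (simp_all add: t.Te_tens t.Te_add Be_balancedD(1))
qed

lemma tens_smult_left: "\<lbrakk>c \<in> carrier K; \<alpha> \<in> carrier P; X \<in> carrier L\<rbrakk> \<Longrightarrow> tens T (c \<odot>\<^bsub>P\<^esub> \<alpha>) X = c \<odot>\<^bsub>H\<^esub> tens T \<alpha> X"
  by (intro t.Te_eqI) (simp_all add: t.Te_tens Te_smult t.Te_tens[OF Be_balanced_smult] smult_closed)

lemma tens_mult_left: "\<lbrakk>\<alpha> \<in> carrier P; \<beta> \<in> carrier P; X \<in> carrier L\<rbrakk> \<Longrightarrow> tens T \<alpha> \<one>\<^bsub>L\<^esub> \<otimes>\<^bsub>H\<^esub> tens T \<beta> X = tens T (\<alpha> \<otimes>\<^bsub>P\<^esub> \<beta>) X"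
  by (intro t.Te_eqI) (simp_all add: t.Te_tens Te_base_left t.Te_tens[OF Be_balanced_mult_P] mult_closed)

lemma tens_mult_src: "\<lbrakk>\<alpha> \<in> carrier P; X \<in> carrier L; b \<in> carrier B\<rbrakk> \<Longrightarrow> tens T \<alpha> X \<otimes>\<^bsub>H\<^esub> src H b = tens T \<alpha> (X \<otimes>\<^bsub>L\<^esub> src L b)"
  unfolding H_src by (intro t.Te_eqI) (simp_all add: t.Te_tens Te_src_right t.Te_tens[OF Be_balanced_mult_L] mult_closed)

lemma tens_mult_tgt: "\<lbrakk>\<alpha> \<in> carrier P; X \<in> carrier L; b \<in> carrier B\<rbrakk> \<Longrightarrow> tens T \<alpha> X \<otimes>\<^bsub>H\<^esub> tgt H b = tens T \<alpha> (X \<otimes>\<^bsub>L\<^esub> tgt L b)"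
  unfolding H_tgt by (intro t.Te_eqI) (simp_all add: t.Te_tens Te_tgt_right t.Te_tens[OF Be_balanced_mult_L] mult_closed)

theorem Be_ring_H: "Be_ring K B H"
proof (intro Be_ring.intro Be_ring_axioms.intro)
  show "kalgebra K B" by (rule t.P.B.kalgebra_axioms)
  show "kalgebra K H" by (rule kalgebra_H)
  show "src H \<in> kalg_hom K B H"
    by (auto simp: kalg_hom_def ring_hom_def H_src H_add H_one tens_mult_left tens_add_left tens_smult_left[symmetric] t.P.src_smult)
  show "tgt H \<in> kalg_hom K (opp B) H"
    by (auto simp: kalg_hom_def ring_hom_def opp_def H_tgt H_add H_one tens_mult_left tens_add_left tens_smult_left[symmetric] t.P.tgt_smult)
  show "src H b \<otimes>\<^bsub>H\<^esub> tgt H c = tgt H c \<otimes>\<^bsub>H\<^esub> src H b" if "b \<in> carrier B" "c \<in> carrier B" for b c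
    using that by (simp add: H_src H_tgt tens_mult_left t.P.src_tgt_comm)
qed

end

section \<open>The bialgebroid structure on the double cross product\<close>

text \<open>
  The diamond product of a ring with itself depends only on its addition and on the multiplication by
  base elements; the products for different pairings agree in these.
\<close>

lemma tensor_cong:
  assumes "carrier M = carrier M'" "carrier N = carrier N'"
    and "\<And>m m'. \<lbrakk>m \<in> carrier M; m' \<in> carrier M\<rbrakk> \<Longrightarrow> m \<oplus>\<^bsub>M\<^esub> m' = m \<oplus>\<^bsub>M'\<^esub> m'"
    and "\<And>n n'. \<lbrakk>n \<in> carrier N; n' \<in> carrier N\<rbrakk> \<Longrightarrow> n \<oplus>\<^bsub>N\<^esub> n' = n \<oplus>\<^bsub>N'\<^esub> n'"
    and "\<And>i m. \<lbrakk>i \<in> I; m \<in> carrier M\<rbrakk> \<Longrightarrow> \<rho> i m = \<rho>' i m"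
    and "\<And>i n. \<lbrakk>i \<in> I; n \<in> carrier N\<rbrakk> \<Longrightarrow> \<sigma> i n = \<sigma>' i n"
  shows "tensor M N I \<rho> \<sigma> = tensor M' N' I \<rho>' \<sigma>'"
proof -
  have "tensor_rels M N I \<rho> \<sigma> = tensor_rels M' N' I \<rho>' \<sigma>'"
    unfolding tensor_rels_def assms(1,2)[symmetric]
    by (intro arg_cong2[where f = "(\<union>)"] Collect_cong) (metis assms(3-6))+
  then show ?thesis by (simp add: tensor_def assms(1,2))
qed

lemma kalgebra_cong:
  assumes A: "kalgebra K A" and e: "carrier A' = carrier A" "monoid.mult A' = monoid.mult A" "one A' = one A"
    "ring.zero A' = ring.zero A" "ring.add A' = ring.add A" "smult A' = smult A"
  shows "kalgebra K A'"
proof -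
  interpret k: kalgebra K A by fact
  have ab: "abelian_group A'"
    by (rule abelian_groupI) (simp_all add: e k.A.add.m_ac k.A.add.l_inv_ex)
  have "ring A'"
    by (rule ringI[OF ab monoidI]) (simp_all add: e k.A.m_assoc k.A.l_distr k.A.r_distr)
  moreover have "module K A'"
    by (rule moduleI[OF _ ab]) (use k.field_axioms in \<open>simp_all add: e field_def domain_def k.smult_l_distr k.smult_r_distr k.smult_assoc1\<close>)
  ultimately show ?thesis
    using k.field_axioms by (simp add: kalgebra_def kalgebra_axioms_def e k.smult_mult_left k.smult_mult_right)
qed

lemma psum_swap22:
  "psum A1 C1 c1 (\<lambda>x y. psum A2 C2 c2 (\<lambda>z w. psum A3 C3 c3 (\<lambda>p q. psum A4 C4 c4 (\<lambda>u v. f x y z w p q u v)))) =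
   psum A3 C3 c3 (\<lambda>p q. psum A4 C4 c4 (\<lambda>u v. psum A1 C1 c1 (\<lambda>x y. psum A2 C2 c2 (\<lambda>z w. f x y z w p q u v))))"
proof -
  have "psum A1 C1 c1 (\<lambda>x y. psum A2 C2 c2 (\<lambda>z w. psum A3 C3 c3 (\<lambda>p q. psum A4 C4 c4 (\<lambda>u v. f x y z w p q u v)))) =
     psum A1 C1 c1 (\<lambda>x y. psum A3 C3 c3 (\<lambda>p q. psum A2 C2 c2 (\<lambda>z w. psum A4 C4 c4 (\<lambda>u v. f x y z w p q u v))))"
    by (intro psum_cong[OF refl] psum_swap)
  also have "\<dots> = psum A3 C3 c3 (\<lambda>p q. psum A1 C1 c1 (\<lambda>x y. psum A2 C2 c2 (\<lambda>z w. psum A4 C4 c4 (\<lambda>u v. f x y z w p q u v))))"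
    by (rule psum_swap)
  also have "\<dots> = psum A3 C3 c3 (\<lambda>p q. psum A1 C1 c1 (\<lambda>x y. psum A4 C4 c4 (\<lambda>u v. psum A2 C2 c2 (\<lambda>z w. f x y z w p q u v))))"
    by (rule psum_cong[OF refl], rule psum_cong[OF refl], rule psum_swap)
  also have "\<dots> = psum A3 C3 c3 (\<lambda>p q. psum A4 C4 c4 (\<lambda>u v. psum A1 C1 c1 (\<lambda>x y. psum A2 C2 c2 (\<lambda>z w. f x y z w p q u v))))"
    by (rule psum_cong[OF refl], rule psum_swap)
  finally show ?thesis .
qed

context hopf_pairing
begin

text \<open>The conditions on \<open>F\<close> that make \<open>F\<close> a balanced map on two copies of \<open>P \<otimes> L\<close>.\<close>

definition pair_balanced :: "('p \<Rightarrow> 'l \<Rightarrow> 'p \<Rightarrow> 'l \<Rightarrow> 'q::ab_group_add) \<Rightarrow> bool"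
  where "pair_balanced F \<longleftrightarrow>
    (\<forall>\<beta>\<in>carrier P. \<forall>X\<in>carrier L. Be_balanced B P L (\<lambda>\<beta>1 X1. F \<beta>1 X1 \<beta> X)) \<and>
    (\<forall>\<beta>\<in>carrier P. \<forall>X\<in>carrier L. Be_balanced B P L (F \<beta> X)) \<and>
    (\<forall>b\<in>carrier B. \<forall>\<beta>\<in>carrier P. \<forall>X\<in>carrier L. \<forall>\<beta>'\<in>carrier P. \<forall>X'\<in>carrier L.
      F (tgt P b \<otimes>\<^bsub>P\<^esub> \<beta>) X \<beta>' X' = F \<beta> X (src P b \<otimes>\<^bsub>P\<^esub> \<beta>') X')"

lemma pair_balancedD:
  assumes "pair_balanced F"
  shows "\<lbrakk>\<beta> \<in> carrier P; X \<in> carrier L\<rbrakk> \<Longrightarrow> Be_balanced B P L (\<lambda>\<beta>1 X1. F \<beta>1 X1 \<beta> X)"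
    and "\<lbrakk>\<beta> \<in> carrier P; X \<in> carrier L\<rbrakk> \<Longrightarrow> Be_balanced B P L (F \<beta> X)"
    and "\<lbrakk>b \<in> carrier B; \<beta> \<in> carrier P; X \<in> carrier L; \<beta>' \<in> carrier P; X' \<in> carrier L\<rbrakk> \<Longrightarrow>
      F (tgt P b \<otimes>\<^bsub>P\<^esub> \<beta>) X \<beta>' X' = F \<beta> X (src P b \<otimes>\<^bsub>P\<^esub> \<beta>') X'"
  using assms by (auto simp: pair_balanced_def)

lemma pair_split_balanced: "pair_balanced F \<Longrightarrow> split_balanced B P L F"
  unfolding pair_balanced_def split_balanced_def by (auto intro: Be_src_balanced Be_tgt_balanced)

lemma Sw2_Be_balanced:
  assumes F: "pair_balanced F"
  shows "Be_balanced B P L (Sw2 P L F)"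
proof (rule Be_balancedI)
  note s = pair_split_balanced[OF F]
  note PB = Sw2_balanced_P[OF s] and LB = Sw2_balanced_L[OF s]
  note FD = Be_balancedD[OF pair_balancedD(1)[OF F]] Be_balancedD[OF pair_balancedD(2)[OF F]]
  fix b \<beta> X assume m: "b \<in> carrier B" "\<beta> \<in> carrier P" "X \<in> carrier L"
  show "Sw2 P L F (\<beta> \<otimes>\<^bsub>P\<^esub> src P b) X = Sw2 P L F \<beta> (src L b \<otimes>\<^bsub>L\<^esub> X)"
    using m by (simp add: Sw2_swap[OF s] L.Sw_src_left[OF LB] P.Sw_src_right[OF PB] FD)
  show "Sw2 P L F (\<beta> \<otimes>\<^bsub>P\<^esub> tgt P b) X = Sw2 P L F \<beta> (tgt L b \<otimes>\<^bsub>L\<^esub> X)"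
    using m by (simp add: Sw2_swap[OF s] L.Sw_tgt_left[OF LB] P.Sw_tgt_right[OF PB] FD)
qed (simp_all add: Sw2_add[OF pair_split_balanced[OF F]])

text \<open>
  Coassociativity is applied to \<open>P\<close> and to \<open>L\<close> in turn.  The summand in \<open>L\<close> is balanced only after summation
  over \<open>P\<close>.  Balancedness in its first two components is seen from the bracketing of \<open>P\<close> that has its first
  two components in one coproduct, balancedness in the last two from the other bracketing.
\<close>

lemma Sw2_coassoc:
  assumes F12: "\<And>\<alpha> X. \<lbrakk>\<alpha> \<in> carrier P; X \<in> carrier L\<rbrakk> \<Longrightarrow> pair_balanced (\<lambda>\<alpha>1 X1 \<alpha>2 X2. F \<alpha>1 X1 \<alpha>2 X2 \<alpha> X)"
    and F23: "\<And>\<alpha> X. \<lbrakk>\<alpha> \<in> carrier P; X \<in> carrier L\<rbrakk> \<Longrightarrow> pair_balanced (F \<alpha> X)"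
    and m: "\<alpha> \<in> carrier P" "X \<in> carrier L"
  shows "Sw2 P L (\<lambda>u y \<alpha>3 X3. Sw2 P L (\<lambda>\<alpha>1 X1 \<alpha>2 X2. F \<alpha>1 X1 \<alpha>2 X2 \<alpha>3 X3) u y) \<alpha> X =
    Sw2 P L (\<lambda>\<alpha>1 X1 u y. Sw2 P L (\<lambda>\<alpha>2 X2 \<alpha>3 X3. F \<alpha>1 X1 \<alpha>2 X2 \<alpha>3 X3) u y) \<alpha> X"
proof -
  note D12 = pair_balancedD[OF F12] and D23 = pair_balancedD[OF F23]
  note FD = Be_balancedD(1,2)[OF D12(1)] Be_balancedD(1,2)[OF D12(2)] Be_balancedD(1,2)[OF D23(2)] D12(3) D23(3)
  define G where "G X1 X2 X3 = Sw P \<alpha> (\<lambda>u \<alpha>3. Sw P u (\<lambda>\<alpha>1 \<alpha>2. F \<alpha>1 X1 \<alpha>2 X2 \<alpha>3 X3))" for X1 X2 X3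
  have triP: "tri_balanced B P (\<lambda>\<alpha>1 \<alpha>2 \<alpha>3. F \<alpha>1 X1 \<alpha>2 X2 \<alpha>3 X3)"
    if "X1 \<in> carrier L" "X2 \<in> carrier L" "X3 \<in> carrier L" for X1 X2 X3
    unfolding tri_balanced_def by (intro conjI ballI) (use that in \<open>simp_all add: FD\<close>)
  have G': "G X1 X2 X3 = Sw P \<alpha> (\<lambda>\<alpha>1 u. Sw P u (\<lambda>\<alpha>2 \<alpha>3. F \<alpha>1 X1 \<alpha>2 X2 \<alpha>3 X3))"
    if "X1 \<in> carrier L" "X2 \<in> carrier L" "X3 \<in> carrier L" for X1 X2 X3
    unfolding G_def by (rule P.Sw_coassoc[OF triP[OF that] m(1)])
  have G1: "G (tgt L b \<otimes>\<^bsub>L\<^esub> X1) X2 X3 = G X1 (src L b \<otimes>\<^bsub>L\<^esub> X2) X3"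
    if "X1 \<in> carrier L" "X2 \<in> carrier L" "X3 \<in> carrier L" "b \<in> carrier B" for X1 X2 X3 b
    using that by (simp add: G_def Sw2_takeuchi[OF pair_split_balanced[OF F12]])
  have G2: "G X1 (tgt L b \<otimes>\<^bsub>L\<^esub> X2) X3 = G X1 X2 (src L b \<otimes>\<^bsub>L\<^esub> X3)"
    if "X1 \<in> carrier L" "X2 \<in> carrier L" "X3 \<in> carrier L" "b \<in> carrier B" for X1 X2 X3 b
    using that by (simp add: G' Sw2_takeuchi[OF pair_split_balanced[OF F23]])
  have tri: "tri_balanced B L G"
    unfolding tri_balanced_def by (intro conjI ballI)
      (simp_all only: G1 G2, simp_all add: G_def FD psum_distrib)
  have "Sw2 P L (\<lambda>u y \<alpha>3 X3. Sw2 P L (\<lambda>\<alpha>1 X1 \<alpha>2 X2. F \<alpha>1 X1 \<alpha>2 X2 \<alpha>3 X3) u y) \<alpha> X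
      = Sw L X (\<lambda>y X3. Sw L y (\<lambda>X1 X2. G X1 X2 X3))"
    by (simp add: Sw2_def G_def sum_PL)
  also have "\<dots> = Sw L X (\<lambda>X1 y. Sw L y (\<lambda>X2 X3. G X1 X2 X3))"
    by (rule L.Sw_coassoc[OF tri m(2)])
  also have "\<dots> = Sw2 P L (\<lambda>\<alpha>1 X1 u y. Sw2 P L (\<lambda>\<alpha>2 X2 \<alpha>3 X3. F \<alpha>1 X1 \<alpha>2 X2 \<alpha>3 X3) u y) \<alpha> X"
    by (simp add: Sw2_def G' sum_PL)
  finally show ?thesis .
qed

text \<open>The counit of \<open>L\<close> is carried into \<open>P\<close> as a base element and returns to \<open>L\<close> through balancedness.\<close>

lemma Sw2_counit_left:
  assumes f: "Be_balanced B P L f" and m: "\<beta> \<in> carrier P" "X \<in> carrier L"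
  shows "Sw2 P L (\<lambda>\<beta>1 X1 \<beta>2 X2. f (src P (cou P (\<beta>1 \<otimes>\<^bsub>P\<^esub> src P (cou L X1))) \<otimes>\<^bsub>P\<^esub> \<beta>2) X2) \<beta> X = f \<beta> X"
proof -
  note fD = Be_balancedD[OF f]
  have d: "diamond_balanced B P P (\<lambda>\<beta>1 \<beta>2. f (src P (cou P \<beta>1) \<otimes>\<^bsub>P\<^esub> \<beta>2) X2)" if "X2 \<in> carrier L" for X2
    by (rule balancedI) (use that in \<open>simp_all add: fD P.cou_add distr assoc\<close>)
  have h: "additive P (\<lambda>\<beta>. f \<beta> X2)" if "X2 \<in> carrier L" for X2
    by (rule additiveI) (use that in \<open>simp add: fD\<close>)
  have h': "additive L (f \<beta>)" by (rule additiveI) (use m in \<open>simp add: fD\<close>)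
  have "Sw2 P L (\<lambda>\<beta>1 X1 \<beta>2 X2. f (src P (cou P (\<beta>1 \<otimes>\<^bsub>P\<^esub> src P (cou L X1))) \<otimes>\<^bsub>P\<^esub> \<beta>2) X2) \<beta> X
      = Sw L X (\<lambda>X1 X2. Sw P \<beta> (\<lambda>\<beta>1 \<beta>2. f (src P (cou P (\<beta>1 \<otimes>\<^bsub>P\<^esub> tgt P (cou L X1))) \<otimes>\<^bsub>P\<^esub> \<beta>2) X2))"
    by (simp add: Sw2_def sum_PL P.cou_src_tgt_right)
  also have "\<dots> = Sw L X (\<lambda>X1 X2. f (\<beta> \<otimes>\<^bsub>P\<^esub> src P (cou L X1)) X2)"
  proof (rule psum_cong[OF refl])
    fix X1 X2 assume a: "X1 \<in> carrier L" "X2 \<in> carrier L"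
    have k: "additive P (\<lambda>\<beta>. f (\<beta> \<otimes>\<^bsub>P\<^esub> src P (cou L X1)) X2)"
      by (rule additiveI) (use a in \<open>simp add: fD distr\<close>)
    show "Sw P \<beta> (\<lambda>\<beta>1 \<beta>2. f (src P (cou P (\<beta>1 \<otimes>\<^bsub>P\<^esub> tgt P (cou L X1))) \<otimes>\<^bsub>P\<^esub> \<beta>2) X2) = f (\<beta> \<otimes>\<^bsub>P\<^esub> src P (cou L X1)) X2"
      using P.Sw_takeuchi[OF d[OF a(2)] m(1), of "cou L X1"] P.Sw_counit_left[OF k m(1)] a
      by (simp add: assoc)
  qed
  also have "\<dots> = f \<beta> X"
    using L.Sw_counit_left[OF h' m(2)] m by (simp add: fD)
  finally show ?thesis .
qed

lemma Sw2_counit_right: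
  assumes f: "Be_balanced B P L f" and m: "\<beta> \<in> carrier P" "X \<in> carrier L"
  shows "Sw2 P L (\<lambda>\<beta>1 X1 \<beta>2 X2. f (tgt P (cou P (\<beta>2 \<otimes>\<^bsub>P\<^esub> src P (cou L X2))) \<otimes>\<^bsub>P\<^esub> \<beta>1) X1) \<beta> X = f \<beta> X"
proof -
  note fD = Be_balancedD[OF f]
  have d: "diamond_balanced B P P (\<lambda>\<beta>1 \<beta>2. f (tgt P (cou P \<beta>2) \<otimes>\<^bsub>P\<^esub> \<beta>1) X1)" if "X1 \<in> carrier L" for X1
    by (rule balancedI) (use that in \<open>simp_all add: fD P.cou_add distr assoc\<close>)
  have h': "additive L (f \<beta>)" by (rule additiveI) (use m in \<open>simp add: fD\<close>)
  have "Sw2 P L (\<lambda>\<beta>1 X1 \<beta>2 X2. f (tgt P (cou P (\<beta>2 \<otimes>\<^bsub>P\<^esub> src P (cou L X2))) \<otimes>\<^bsub>P\<^esub> \<beta>1) X1) \<beta> X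
      = Sw L X (\<lambda>X1 X2. Sw P \<beta> (\<lambda>\<beta>1 \<beta>2. f (tgt P (cou P (\<beta>2 \<otimes>\<^bsub>P\<^esub> src P (cou L X2))) \<otimes>\<^bsub>P\<^esub> \<beta>1) X1))"
    by (simp add: Sw2_def sum_PL)
  also have "\<dots> = Sw L X (\<lambda>X1 X2. f (\<beta> \<otimes>\<^bsub>P\<^esub> tgt P (cou L X2)) X1)"
  proof (rule psum_cong[OF refl])
    fix X1 X2 assume a: "X1 \<in> carrier L" "X2 \<in> carrier L"
    have k: "additive P (\<lambda>\<beta>. f (\<beta> \<otimes>\<^bsub>P\<^esub> tgt P (cou L X2)) X1)"
      by (rule additiveI) (use a in \<open>simp add: fD distr\<close>)
    show "Sw P \<beta> (\<lambda>\<beta>1 \<beta>2. f (tgt P (cou P (\<beta>2 \<otimes>\<^bsub>P\<^esub> src P (cou L X2))) \<otimes>\<^bsub>P\<^esub> \<beta>1) X1) = f (\<beta> \<otimes>\<^bsub>P\<^esub> tgt P (cou L X2)) X1"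
      using P.Sw_takeuchi[OF d[OF a(1)] m(1), of "cou L X2"] P.Sw_counit_right[OF k m(1)] a
      by (simp add: assoc)
  qed
  also have "\<dots> = f \<beta> X"
    using L.Sw_counit_right[OF h' m(2)] m by (simp add: fD)
  finally show ?thesis .
qed

end

context hopf_pairing3
begin

text \<open>\<open>cross_Sw2\<close> with the outer factors \<open>\<alpha>\<close> and \<open>Y\<close> split by multiplicativity of the two coproducts\<close>

lemma cross_Sw2_mult:
  fixes F :: "'p \<Rightarrow> 'l \<Rightarrow> 'p \<Rightarrow> 'l \<Rightarrow> 'q::ab_group_add"
  assumes F: "s.pair_balanced F" and m: "\<alpha> \<in> carrier P" "X \<in> carrier L" "\<beta> \<in> carrier P" "Y \<in> carrier L"
  shows "ts.cross (\<lambda>p x. Sw2 P L F (\<alpha> \<otimes>\<^bsub>P\<^esub> p) (x \<otimes>\<^bsub>L\<^esub> Y)) \<beta> X =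
    Sw2 P L (\<lambda>\<alpha>1 X1 \<alpha>2 X2. Sw2 P L (\<lambda>\<beta>1 Y1 \<beta>2 Y2.
      tk.cross (\<lambda>p x. ks.cross (\<lambda>p' x'. F (\<alpha>1 \<otimes>\<^bsub>P\<^esub> p) (x \<otimes>\<^bsub>L\<^esub> Y1) (\<alpha>2 \<otimes>\<^bsub>P\<^esub> p') (x' \<otimes>\<^bsub>L\<^esub> Y2)) \<beta>2 X2) \<beta>1 X1) \<beta> Y) \<alpha> X"
proof -
  note sp = s.pair_split_balanced[OF F]
  note FD = s.pair_balancedD[OF F]
  define F' where "F' p x p' x' = Sw P \<alpha> (\<lambda>\<alpha>1 \<alpha>2. Sw L Y (\<lambda>Y1 Y2.
      F (\<alpha>1 \<otimes>\<^bsub>P\<^esub> p) (x \<otimes>\<^bsub>L\<^esub> Y1) (\<alpha>2 \<otimes>\<^bsub>P\<^esub> p') (x' \<otimes>\<^bsub>L\<^esub> Y2)))" for p x p' x'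
  have F'1: "Be_balanced B P L (\<lambda>p x. F' p x p' x')" if "p' \<in> carrier P" "x' \<in> carrier L" for p' x'
    unfolding F'_def by (intro Be_balanced_psum tk.Be_balanced_mult_L[OF tk.Be_balanced_mult_P[OF FD(1)]]) (use that in simp_all)
  have F'2: "Be_balanced B P L (F' p x)" if "p \<in> carrier P" "x \<in> carrier L" for p x
    unfolding F'_def[abs_def] by (intro Be_balanced_psum tk.Be_balanced_mult_L[OF tk.Be_balanced_mult_P[OF FD(2)]]) (use that in simp_all)
  have F'12: "F' (tgt P b \<otimes>\<^bsub>P\<^esub> p) x p' x' = F' p x (src P b \<otimes>\<^bsub>P\<^esub> p') x'"
    if a: "b \<in> carrier B" "p \<in> carrier P" "x \<in> carrier L" "p' \<in> carrier P" "x' \<in> carrier L" for b p x p' x'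
  proof -
    have d: "diamond_balanced B P P (\<lambda>\<alpha>1 \<alpha>2. Sw L Y (\<lambda>Y1 Y2. F (\<alpha>1 \<otimes>\<^bsub>P\<^esub> p) (x \<otimes>\<^bsub>L\<^esub> Y1) (\<alpha>2 \<otimes>\<^bsub>P\<^esub> p') (x' \<otimes>\<^bsub>L\<^esub> Y2)))"
      by (intro balanced_psum balancedI) (use a in \<open>simp_all add: Be_balancedD(1)[OF FD(1)] Be_balancedD(1)[OF FD(2)] FD(3) s.distr s.assoc\<close>)
    show ?thesis
      using tk.t.P.Sw_takeuchi[OF d m(1) a(1)] a unfolding F'_def by (simp add: s.assoc)
  qed
  have e: "Sw2 P L F (\<alpha> \<otimes>\<^bsub>P\<^esub> p) (x \<otimes>\<^bsub>L\<^esub> Y) = Sw2 P L F' p x" if "p \<in> carrier P" "x \<in> carrier L" for p x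
  proof -
    have "Sw2 P L F (\<alpha> \<otimes>\<^bsub>P\<^esub> p) (x \<otimes>\<^bsub>L\<^esub> Y) = Sw L x (\<lambda>x1 x2. Sw L Y (\<lambda>Y1 Y2. Sw P \<alpha> (\<lambda>\<alpha>1 \<alpha>2. Sw P p (\<lambda>p1 p2.
        F (\<alpha>1 \<otimes>\<^bsub>P\<^esub> p1) (x1 \<otimes>\<^bsub>L\<^esub> Y1) (\<alpha>2 \<otimes>\<^bsub>P\<^esub> p2) (x2 \<otimes>\<^bsub>L\<^esub> Y2)))))"
      using that m by (simp add: s.Sw2_swap[OF sp] tk.t.L.Sw_mult[OF s.Sw2_balanced_L[OF sp]])
        (simp add: tk.t.P.Sw_mult[OF s.Sw2_balanced_P[OF sp]])
    also have "\<dots> = Sw2 P L F' p x"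
      by (simp add: Sw2_def F'_def s.sum_PL psum_swap[of _ _ "rep (cop P \<alpha>)"])
    finally show ?thesis .
  qed
  have "ts.cross (\<lambda>p x. Sw2 P L F (\<alpha> \<otimes>\<^bsub>P\<^esub> p) (x \<otimes>\<^bsub>L\<^esub> Y)) \<beta> X = ts.cross (Sw2 P L F') \<beta> X"
    by (rule ts.cross_cong) (rule e)
  also have "\<dots> = Sw2 P L (\<lambda>\<beta>1 X1 \<beta>2 X2. tk.cross (\<lambda>u x. ks.cross (F' u x) \<beta>2 X2) \<beta>1 X1) \<beta> X"
    by (rule cross_Sw2[OF F'1 F'2 F'12 m(3,2)])
  also have "\<dots> = Sw P \<beta> (\<lambda>\<beta>1 \<beta>2. Sw L X (\<lambda>X1 X2. Sw P \<alpha> (\<lambda>\<alpha>1 \<alpha>2. Sw L Y (\<lambda>Y1 Y2.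
      tk.cross (\<lambda>p x. ks.cross (\<lambda>p' x'. F (\<alpha>1 \<otimes>\<^bsub>P\<^esub> p) (x \<otimes>\<^bsub>L\<^esub> Y1) (\<alpha>2 \<otimes>\<^bsub>P\<^esub> p') (x' \<otimes>\<^bsub>L\<^esub> Y2)) \<beta>2 X2) \<beta>1 X1))))"
    unfolding Sw2_def F'_def[abs_def] ks.cross_psum tk.cross_psum ..
  also have "\<dots> = Sw P \<alpha> (\<lambda>\<alpha>1 \<alpha>2. Sw P \<beta> (\<lambda>\<beta>1 \<beta>2. Sw L X (\<lambda>X1 X2. Sw L Y (\<lambda>Y1 Y2.
      tk.cross (\<lambda>p x. ks.cross (\<lambda>p' x'. F (\<alpha>1 \<otimes>\<^bsub>P\<^esub> p) (x \<otimes>\<^bsub>L\<^esub> Y1) (\<alpha>2 \<otimes>\<^bsub>P\<^esub> p') (x' \<otimes>\<^bsub>L\<^esub> Y2)) \<beta>2 X2) \<beta>1 X1))))"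
    by (subst psum_swap[of "carrier P" "carrier P" "rep (cop P \<alpha>)"], rule psum_cong[OF refl], rule psum_swap)
  also have "\<dots> = Sw P \<alpha> (\<lambda>\<alpha>1 \<alpha>2. Sw L X (\<lambda>X1 X2. Sw P \<beta> (\<lambda>\<beta>1 \<beta>2. Sw L Y (\<lambda>Y1 Y2.
      tk.cross (\<lambda>p x. ks.cross (\<lambda>p' x'. F (\<alpha>1 \<otimes>\<^bsub>P\<^esub> p) (x \<otimes>\<^bsub>L\<^esub> Y1) (\<alpha>2 \<otimes>\<^bsub>P\<^esub> p') (x' \<otimes>\<^bsub>L\<^esub> Y2)) \<beta>2 X2) \<beta>1 X1))))"
    by (rule psum_cong[OF refl], rule psum_swap)
  finally show ?thesis by (simp add: Sw2_def)
qed

end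

context hopf_pairing2
begin

lemma ghom_mult_tens:
  assumes h: "ghom T h" and m: "\<alpha> \<in> carrier P" "X \<in> carrier L" "\<beta> \<in> carrier P" "Y \<in> carrier L"
  shows "h (tens T \<alpha> X \<otimes>\<^bsub>H\<^esub> tens T \<beta> Y) = cross (\<lambda>p x. h (tens T (\<alpha> \<otimes>\<^bsub>P\<^esub> p) (x \<otimes>\<^bsub>L\<^esub> Y))) \<beta> X"
proof -
  note b = t.Be_balanced_ghom[OF h]
  have c: "tens T \<alpha> X \<in> carrier T" "tens T \<beta> Y \<in> carrier T" using m by simp_all
  show ?thesis
    unfolding t.ghom_T[OF h mult_closed[OF c]] Te_mult[OF b c] t.Te_tens[OF Te_mult_left_balanced[OF b] m(1,2)]
    by (rule t.Te_tens[OF cross_balanced_right[OF b m(1,2)] m(3,4)])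
qed

end

context hopf_pairing
begin

interpretation tt: hopf_pairing2 K B P L \<tau> \<tau> by unfold_locales

abbreviation "T' \<equiv> tensor_Be B P L"
abbreviation "HB \<equiv> bowtie_bialgebroid B P L \<tau>"

text \<open>
  The record of the bialgebroid agrees with that of the ring except for the two added fields.  The
  lemmas with prefix \<open>HB\<close> restate the facts about \<open>bowtie\<close> for it.
\<close>

lemma HB_simps:
  "carrier HB = carrier T'" "monoid.mult HB = monoid.mult (bowtie B P L \<tau> \<tau>)" "one HB = one (bowtie B P L \<tau> \<tau>)"
  "ring.zero HB = \<one>\<^bsub>T'\<^esub>" "ring.add HB = monoid.mult T'"
  "smult HB = smult (bowtie B P L \<tau> \<tau>)" "src HB = src (bowtie B P L \<tau> \<tau>)" "tgt HB = tgt (bowtie B P L \<tau> \<tau>)"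
  by (simp_all add: bowtie_bialgebroid_def Let_def be_ring.defs bialgebroid.defs bowtie_def)

lemma HB_cop: "cop HB = (let H = bowtie B P L \<tau> \<tau>; D = diamond B H H in
    tlift D (\<lambda>(\<alpha>, X). sw D P (\<lambda>\<alpha>1 \<alpha>2. sw D L (\<lambda>X1 X2. tens D (tens T' \<alpha>1 X1) (tens T' \<alpha>2 X2)) X) \<alpha>))"
  by (simp add: bowtie_bialgebroid_def Let_def be_ring.defs bialgebroid.defs bowtie_def)

lemma HB_cou: "cou HB = tlift (add_monoid B) (\<lambda>(\<alpha>, X). cou P (\<alpha> \<otimes>\<^bsub>P\<^esub> src P (cou L X)))"
  by (simp add: bowtie_bialgebroid_def Let_def be_ring.defs bialgebroid.defs bowtie_def)

lemma HB_truncate: "be_ring.truncate HB = bowtie B P L \<tau> \<tau>"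
  by (simp add: bowtie_bialgebroid_def Let_def be_ring.defs bialgebroid.defs bowtie_def)

lemma HB_Be_ring: "Be_ring K B HB"
proof -
  interpret b: Be_ring K B "bowtie B P L \<tau> \<tau>" by (rule tt.Be_ring_H)
  have "kalgebra K HB"
    by (rule kalgebra_cong[OF b.L.kalgebra_axioms]) (simp_all add: HB_simps tt.H_zero tt.H_add fun_eq_iff)
  moreover have "src HB \<in> kalg_hom K B HB" "tgt HB \<in> kalg_hom K (opp B) HB"
    using b.src_hom b.tgt_hom by (simp_all add: HB_simps kalg_hom_def ring_hom_def tt.H_add)
  ultimately show ?thesis
    using b.src_tgt_comm P.B.kalgebra_axioms by (simp add: HB_simps Be_ring_def Be_ring_axioms_def)
qed

interpretation hb: Be_ring K B HB by (rule HB_Be_ring)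

lemma HB_diamond: "diamond B (bowtie B P L \<tau> \<tau>) (bowtie B P L \<tau> \<tau>) = hb.D.T"
  unfolding diamond_def by (rule tensor_cong) (simp_all add: HB_simps tt.H_add)

lemma HB_additive: "additive HB h \<longleftrightarrow> ghom T' h"
  by (simp add: ghom_def HB_simps)

lemmas HB_ghom_T = ghom_T[folded HB_additive HB_simps(1)]
  and HB_Be_balanced = Be_balanced_ghom[folded HB_additive]
  and HB_additive_Te = ghom_Te[folded HB_additive]
  and HB_tens_closed [simp] = tens_T_closed[folded HB_simps(1)]
  and HB_tens_left = tt.tens_mult_left[folded HB_simps(2)]
  and HB_tens_src = tt.tens_mult_src[folded HB_simps(2,7)]
  and HB_tens_tgt = tt.tens_mult_tgt[folded HB_simps(2,8)]
  and HB_src = tt.H_src[folded HB_simps(7)]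
  and HB_tgt = tt.H_tgt[folded HB_simps(8)]
  and HB_one = tt.H_one[folded HB_simps(3)]
  and HB_Te_left = tt.Te_base_left[folded HB_simps(1,2)]
  and HB_ghom_tlift = ghom_tlift_Be[folded HB_simps(1)]
  and HB_tlift_closed = tlift_Be_closed[folded HB_simps(1)]

text \<open>A balanced map on the diamond product, restricted to tensors\<close>

lemma HB_pair_balanced:
  assumes g: "diamond_balanced B HB HB g"
  shows "pair_balanced (\<lambda>\<beta> X \<beta>' X'. g (tens T' \<beta> X) (tens T' \<beta>' X'))"
proof -
  have "additive HB (\<lambda>V. g V W)" "additive HB (g W)" if "W \<in> carrier HB" for W
    using balanced_add_left[OF g] balanced_add_right[OF g] that by (simp_all add: additiveI)
  note b = this[THEN HB_Be_balanced]
  have "g (tens T' (tgt P b \<otimes>\<^bsub>P\<^esub> \<beta>) X) (tens T' \<beta>' X') = g (tens T' \<beta> X) (tens T' (src P b \<otimes>\<^bsub>P\<^esub> \<beta>') X')"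
    if "b \<in> carrier B" "\<beta> \<in> carrier P" "X \<in> carrier L" "\<beta>' \<in> carrier P" "X' \<in> carrier L" for b \<beta> X \<beta>' X'
    using balanced_act[OF g, of b "tens T' \<beta> X" "tens T' \<beta>' X'"] that by (simp add: HB_src HB_tgt HB_tens_left)
  then show ?thesis
    unfolding pair_balanced_def by (auto intro: b HB_tens_closed)
qed

lemma HB_cop_carrier: "V \<in> carrier HB \<Longrightarrow> cop HB V \<in> carrier hb.D.T"
  unfolding HB_cop Let_def HB_diamond
  by (intro HB_tlift_closed hb.D.comm_group_T P.sw_closed L.sw_closed hb.D.tens_closed HB_tens_closed)

text \<open>This reduces Sweedler sums of the double cross product to those of \<open>P\<close> and \<open>L\<close>.\<close>

lemma Sw_HB:
  assumes g: "diamond_balanced B HB HB g" and V: "V \<in> carrier HB"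
  shows "Sw HB V g = Te P L V (Sw2 P L (\<lambda>\<beta> X \<beta>' X'. g (tens T' \<beta> X) (tens T' \<beta>' X')))"
proof -
  note G = hb.D.comm_group_T and h = hb.D.ghom_of_balanced[OF g]
  show ?thesis
    unfolding HB_cop Let_def HB_diamond
    by (subst HB_ghom_tlift[OF G h V])
      (simp_all add: P.sw_closed[OF G] L.sw_closed[OF G] hb.D.tens_closed P.ghom_sw[OF G h] L.ghom_sw[OF G h]
        hb.D.eval_tens[OF g] Sw2_def)
qed

lemma Sw_HB_tens:
  assumes g: "diamond_balanced B HB HB g" and m: "\<beta> \<in> carrier P" "X \<in> carrier L"
  shows "Sw HB (tens T' \<beta> X) g = Sw2 P L (\<lambda>\<beta> X \<beta>' X'. g (tens T' \<beta> X) (tens T' \<beta>' X')) \<beta> X"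
  unfolding Sw_HB[OF g HB_tens_closed[OF m]] by (rule Te_tens[OF Sw2_Be_balanced[OF HB_pair_balanced[OF g]] m])

lemma HB_ghom_sw:
  assumes "comm_group G" "ghom G h" "V \<in> carrier HB"
    and "\<And>x y. \<lbrakk>x \<in> carrier HB; y \<in> carrier HB\<rbrakk> \<Longrightarrow> g x y \<in> carrier G"
  shows "h (sw G HB g V) = Sw HB V (\<lambda>x y. h (g x y))"
  unfolding sw_def by (rule hb.D.ghom_tlift_T[OF assms(1,2) HB_cop_carrier[OF assms(3)] assms(4)])

lemma HB_sw_closed:
  assumes "comm_group G" "V \<in> carrier HB"
    and "\<And>x y. \<lbrakk>x \<in> carrier HB; y \<in> carrier HB\<rbrakk> \<Longrightarrow> g x y \<in> carrier G"
  shows "sw G HB g V \<in> carrier G"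
  unfolding sw_def by (rule hb.D.tlift_T_closed[OF assms(1) HB_cop_carrier[OF assms(2)] assms(3)])

lemma HB_Sw_additive:
  assumes g: "diamond_balanced B HB HB g"
  shows "additive HB (\<lambda>V. Sw HB V g)"
  by (rule additiveI) (simp add: Sw_HB[OF g] additiveD[OF HB_additive_Te[OF Sw2_Be_balanced[OF HB_pair_balanced[OF g]]]])

lemma HB_src_left_balanced:
  assumes g: "diamond_balanced B HB HB g" and b: "b \<in> carrier B"
  shows "diamond_balanced B HB HB (\<lambda>x y. g (src HB b \<otimes>\<^bsub>HB\<^esub> x) y)"
proof (rule balancedI)
  fix i m n assume "i \<in> carrier B" "m \<in> carrier HB" "n \<in> carrier HB"
  then show "g (src HB b \<otimes>\<^bsub>HB\<^esub> (tgt HB i \<otimes>\<^bsub>HB\<^esub> m)) n = g (src HB b \<otimes>\<^bsub>HB\<^esub> m) (src HB i \<otimes>\<^bsub>HB\<^esub> n)"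
    unfolding hb.src_tgt_left[OF b \<open>i \<in> carrier B\<close> \<open>m \<in> carrier HB\<close>] using b by (intro balanced_act[OF g]) simp_all
qed (use b balancedD(1,2)[OF g] hb.L.A.r_distr in simp_all)

lemma HB_tgt_left_balanced:
  assumes g: "diamond_balanced B HB HB g" and b: "b \<in> carrier B"
  shows "diamond_balanced B HB HB (\<lambda>x y. g x (tgt HB b \<otimes>\<^bsub>HB\<^esub> y))"
proof (rule balancedI)
  fix i m n assume "i \<in> carrier B" "m \<in> carrier HB" "n \<in> carrier HB"
  then show "g (tgt HB i \<otimes>\<^bsub>HB\<^esub> m) (tgt HB b \<otimes>\<^bsub>HB\<^esub> n) = g m (tgt HB b \<otimes>\<^bsub>HB\<^esub> (src HB i \<otimes>\<^bsub>HB\<^esub> n))"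
    unfolding hb.src_tgt_left[OF \<open>i \<in> carrier B\<close> b \<open>n \<in> carrier HB\<close>, symmetric] using b by (intro balanced_act[OF g]) simp_all
qed (use b balancedD(1,2)[OF g] hb.L.A.r_distr in simp_all)

lemma HB_Sw_src_left:
  assumes g: "diamond_balanced B HB HB g" and m: "b \<in> carrier B" "V \<in> carrier HB"
  shows "Sw HB (src HB b \<otimes>\<^bsub>HB\<^esub> V) g = Sw HB V (\<lambda>x y. g (src HB b \<otimes>\<^bsub>HB\<^esub> x) y)"
proof -
  note F = HB_pair_balanced[OF g]
  have "Sw HB (src HB b \<otimes>\<^bsub>HB\<^esub> V) g = Te P L V (Sw2 P L (\<lambda>\<beta> X \<beta>' X'. g (tens T' (src P b \<otimes>\<^bsub>P\<^esub> \<beta>) X) (tens T' \<beta>' X')))"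
    using m by (simp add: Sw_HB[OF g] HB_src HB_Te_left[OF Sw2_Be_balanced[OF F]] Sw2_src_P[OF pair_split_balanced[OF F]])
  also have "\<dots> = Sw HB V (\<lambda>x y. g (src HB b \<otimes>\<^bsub>HB\<^esub> x) y)"
    unfolding Sw_HB[OF HB_src_left_balanced[OF g m(1)] m(2)] using m by (simp add: Sw2_def HB_src HB_tens_left)
  finally show ?thesis .
qed

lemma HB_Sw_tgt_left:
  assumes g: "diamond_balanced B HB HB g" and m: "b \<in> carrier B" "V \<in> carrier HB"
  shows "Sw HB (tgt HB b \<otimes>\<^bsub>HB\<^esub> V) g = Sw HB V (\<lambda>x y. g x (tgt HB b \<otimes>\<^bsub>HB\<^esub> y))"
proof -
  note F = HB_pair_balanced[OF g]
  have "Sw HB (tgt HB b \<otimes>\<^bsub>HB\<^esub> V) g = Te P L V (Sw2 P L (\<lambda>\<beta> X \<beta>' X'. g (tens T' \<beta> X) (tens T' (tgt P b \<otimes>\<^bsub>P\<^esub> \<beta>') X')))"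
    using m by (simp add: Sw_HB[OF g] HB_tgt HB_Te_left[OF Sw2_Be_balanced[OF F]] Sw2_tgt_P[OF pair_split_balanced[OF F]])
  also have "\<dots> = Sw HB V (\<lambda>x y. g x (tgt HB b \<otimes>\<^bsub>HB\<^esub> y))"
    unfolding Sw_HB[OF HB_tgt_left_balanced[OF g m(1)] m(2)] using m by (simp add: Sw2_def HB_tgt HB_tens_left)
  finally show ?thesis .
qed

text \<open>Base elements multiplied from the right end up in \<open>L\<close>, where the Takeuchi condition is known.\<close>

lemma HB_Sw_takeuchi:
  assumes g: "diamond_balanced B HB HB g" and m: "b \<in> carrier B" "V \<in> carrier HB"
  shows "Te P L V (Sw2 P L (\<lambda>\<beta> X \<beta>' X'. g (tens T' \<beta> X \<otimes>\<^bsub>HB\<^esub> tgt HB b) (tens T' \<beta>' X')))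
    = Te P L V (Sw2 P L (\<lambda>\<beta> X \<beta>' X'. g (tens T' \<beta> X) (tens T' \<beta>' X' \<otimes>\<^bsub>HB\<^esub> src HB b)))"
proof (rule psum_cong[OF refl])
  fix \<beta> X assume a: "\<beta> \<in> carrier P" "X \<in> carrier L"
  show "Sw2 P L (\<lambda>\<beta> X \<beta>' X'. g (tens T' \<beta> X \<otimes>\<^bsub>HB\<^esub> tgt HB b) (tens T' \<beta>' X')) \<beta> X
    = Sw2 P L (\<lambda>\<beta> X \<beta>' X'. g (tens T' \<beta> X) (tens T' \<beta>' X' \<otimes>\<^bsub>HB\<^esub> src HB b)) \<beta> X"
    using L.Sw_takeuchi[OF Sw2_balanced_L[OF pair_split_balanced[OF HB_pair_balanced[OF g]] a(1)] a(2) m(1)] m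
    by (simp add: Sw2_def sum_PL HB_tens_src HB_tens_tgt)
qed

lemma HB_tgt_right_balanced:
  assumes g: "diamond_balanced B HB HB g" and b: "b \<in> carrier B"
  shows "diamond_balanced B HB HB (\<lambda>x y. g (x \<otimes>\<^bsub>HB\<^esub> tgt HB b) y)"
proof (rule balancedI)
  fix i m n assume a: "i \<in> carrier B" "m \<in> carrier HB" "n \<in> carrier HB"
  show "g (tgt HB i \<otimes>\<^bsub>HB\<^esub> m \<otimes>\<^bsub>HB\<^esub> tgt HB b) n = g (m \<otimes>\<^bsub>HB\<^esub> tgt HB b) (src HB i \<otimes>\<^bsub>HB\<^esub> n)"
    unfolding hb.L.A.m_assoc[OF hb.tgt_closed[OF a(1)] a(2) hb.tgt_closed[OF b]]
    by (rule balanced_act[OF g a(1) _ a(3)]) (use a b in simp)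
qed (use b balancedD(1,2)[OF g] hb.L.A.l_distr in simp_all)

lemma HB_src_right_balanced:
  assumes g: "diamond_balanced B HB HB g" and b: "b \<in> carrier B"
  shows "diamond_balanced B HB HB (\<lambda>x y. g x (y \<otimes>\<^bsub>HB\<^esub> src HB b))"
proof (rule balancedI)
  fix i m n assume a: "i \<in> carrier B" "m \<in> carrier HB" "n \<in> carrier HB"
  show "g (tgt HB i \<otimes>\<^bsub>HB\<^esub> m) (n \<otimes>\<^bsub>HB\<^esub> src HB b) = g m (src HB i \<otimes>\<^bsub>HB\<^esub> n \<otimes>\<^bsub>HB\<^esub> src HB b)"
    unfolding hb.L.A.m_assoc[OF hb.src_closed[OF a(1)] a(3) hb.src_closed[OF b]]
    by (rule balanced_act[OF g a(1,2)]) (use a b in simp)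
qed (use b balancedD(1,2)[OF g] hb.L.A.l_distr in simp_all)

lemma HB_cop_takeuchi:
  assumes V: "V \<in> carrier HB"
  shows "cop HB V \<in> takeuchi B HB HB"
  unfolding takeuchi_def Let_def hb.diamond_eq
proof (intro CollectI conjI ballI)
  show c: "cop HB V \<in> carrier hb.D.T" by (rule HB_cop_carrier[OF V])
  fix b assume b: "b \<in> carrier B"
  show "tlift hb.D.T (\<lambda>(m, n). tens hb.D.T (m \<otimes>\<^bsub>HB\<^esub> tgt HB b) n) (cop HB V) =
    tlift hb.D.T (\<lambda>(m, n). tens hb.D.T m (n \<otimes>\<^bsub>HB\<^esub> src HB b)) (cop HB V)"
  proof (rule hb.D.eqI)
    have cl: "m \<otimes>\<^bsub>HB\<^esub> tgt HB b \<in> carrier HB" "m \<otimes>\<^bsub>HB\<^esub> src HB b \<in> carrier HB" if "m \<in> carrier HB" for m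
      using that b by simp_all
    show "tlift hb.D.T (\<lambda>(m, n). tens hb.D.T (m \<otimes>\<^bsub>HB\<^esub> tgt HB b) n) (cop HB V) \<in> carrier hb.D.T"
      "tlift hb.D.T (\<lambda>(m, n). tens hb.D.T m (n \<otimes>\<^bsub>HB\<^esub> src HB b)) (cop HB V) \<in> carrier hb.D.T"
      using cl by (intro hb.D.tlift_T_closed[OF hb.D.comm_group_T c] hb.D.tens_closed; simp)+
    fix f :: "('p \<times> 'l \<Rightarrow>\<^sub>0 int) set \<Rightarrow> ('p \<times> 'l \<Rightarrow>\<^sub>0 int) set \<Rightarrow>
      ((('p \<times> 'l \<Rightarrow>\<^sub>0 int) set \<times> ('p \<times> 'l \<Rightarrow>\<^sub>0 int) set) \<Rightarrow>\<^sub>0 int) set ambient"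
    assume f: "diamond_balanced B HB HB f"
    note gt = hb.D.ghom_tlift_T[OF hb.D.comm_group_T hb.D.ghom_of_balanced[OF f] c]
    have "hb.D.eval (tlift hb.D.T (\<lambda>(m, n). tens hb.D.T (m \<otimes>\<^bsub>HB\<^esub> tgt HB b) n) (cop HB V)) f
        = Sw HB V (\<lambda>m n. f (m \<otimes>\<^bsub>HB\<^esub> tgt HB b) n)"
      by (subst gt) (use cl in \<open>simp_all add: hb.D.tens_closed hb.D.eval_tens[OF f]\<close>)
    also have "\<dots> = Sw HB V (\<lambda>m n. f m (n \<otimes>\<^bsub>HB\<^esub> src HB b))"
      unfolding Sw_HB[OF HB_tgt_right_balanced[OF f b] V] Sw_HB[OF HB_src_right_balanced[OF f b] V]
      by (rule HB_Sw_takeuchi[OF f b V])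
    also have "\<dots> = hb.D.eval (tlift hb.D.T (\<lambda>(m, n). tens hb.D.T m (n \<otimes>\<^bsub>HB\<^esub> src HB b)) (cop HB V)) f"
      by (subst gt) (use cl in \<open>simp_all add: hb.D.tens_closed hb.D.eval_tens[OF f]\<close>)
    finally show "hb.D.eval (tlift hb.D.T (\<lambda>(m, n). tens hb.D.T (m \<otimes>\<^bsub>HB\<^esub> tgt HB b) n) (cop HB V)) f
      = hb.D.eval (tlift hb.D.T (\<lambda>(m, n). tens hb.D.T m (n \<otimes>\<^bsub>HB\<^esub> src HB b)) (cop HB V)) f" .
  qed
qed

lemma HB_cop_add:
  assumes m: "V \<in> carrier HB" "W \<in> carrier HB"
  shows "cop HB (V \<oplus>\<^bsub>HB\<^esub> W) = cop HB V \<otimes>\<^bsub>hb.D.T\<^esub> cop HB W"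
proof (rule hb.D.eqI)
  interpret DT: comm_group hb.D.T by (rule hb.D.comm_group_T)
  show "cop HB (V \<oplus>\<^bsub>HB\<^esub> W) \<in> carrier hb.D.T" "cop HB V \<otimes>\<^bsub>hb.D.T\<^esub> cop HB W \<in> carrier hb.D.T"
    using m by (simp_all add: HB_cop_carrier)
qed (use m in \<open>simp add: additiveD[OF HB_Sw_additive] hb.D.eval_mult HB_cop_carrier\<close>)

lemma HB_cop_linear:
  assumes m: "b \<in> carrier B" "c \<in> carrier B" "V \<in> carrier HB"
  shows "cop HB (src HB b \<otimes>\<^bsub>HB\<^esub> tgt HB c \<otimes>\<^bsub>HB\<^esub> V) =
      sw hb.D.T HB (\<lambda>X1 X2. tens hb.D.T (src HB b \<otimes>\<^bsub>HB\<^esub> X1) (tgt HB c \<otimes>\<^bsub>HB\<^esub> X2)) V"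
proof (rule hb.D.eqI)
  have cl: "src HB b \<otimes>\<^bsub>HB\<^esub> x \<in> carrier HB" "tgt HB c \<otimes>\<^bsub>HB\<^esub> x \<in> carrier HB" if "x \<in> carrier HB" for x
    using that m by simp_all
  have a: "src HB b \<otimes>\<^bsub>HB\<^esub> tgt HB c \<otimes>\<^bsub>HB\<^esub> V = src HB b \<otimes>\<^bsub>HB\<^esub> (tgt HB c \<otimes>\<^bsub>HB\<^esub> V)"
    using m by (intro hb.L.A.m_assoc) simp_all
  have cl': "tgt HB c \<otimes>\<^bsub>HB\<^esub> V \<in> carrier HB" "src HB b \<otimes>\<^bsub>HB\<^esub> (tgt HB c \<otimes>\<^bsub>HB\<^esub> V) \<in> carrier HB"
    using m by simp_all
  show "cop HB (src HB b \<otimes>\<^bsub>HB\<^esub> tgt HB c \<otimes>\<^bsub>HB\<^esub> V) \<in> carrier hb.D.T"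
    unfolding a by (rule HB_cop_carrier[OF cl'(2)])
  show "sw hb.D.T HB (\<lambda>X1 X2. tens hb.D.T (src HB b \<otimes>\<^bsub>HB\<^esub> X1) (tgt HB c \<otimes>\<^bsub>HB\<^esub> X2)) V \<in> carrier hb.D.T"
    by (intro HB_sw_closed hb.D.comm_group_T hb.D.tens_closed cl m)
  fix f :: "('p \<times> 'l \<Rightarrow>\<^sub>0 int) set \<Rightarrow> ('p \<times> 'l \<Rightarrow>\<^sub>0 int) set \<Rightarrow>
      ((('p \<times> 'l \<Rightarrow>\<^sub>0 int) set \<times> ('p \<times> 'l \<Rightarrow>\<^sub>0 int) set) \<Rightarrow>\<^sub>0 int) set ambient"
  assume f: "diamond_balanced B HB HB f"
  have "Sw HB (src HB b \<otimes>\<^bsub>HB\<^esub> tgt HB c \<otimes>\<^bsub>HB\<^esub> V) f = Sw HB V (\<lambda>x y. f (src HB b \<otimes>\<^bsub>HB\<^esub> x) (tgt HB c \<otimes>\<^bsub>HB\<^esub> y))"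
    unfolding a HB_Sw_src_left[OF f m(1) cl'(1)] HB_Sw_tgt_left[OF HB_src_left_balanced[OF f m(1)] m(2,3)] ..
  also have "\<dots> = hb.D.eval (sw hb.D.T HB (\<lambda>X1 X2. tens hb.D.T (src HB b \<otimes>\<^bsub>HB\<^esub> X1) (tgt HB c \<otimes>\<^bsub>HB\<^esub> X2)) V) f"
    by (subst HB_ghom_sw[OF hb.D.comm_group_T hb.D.ghom_of_balanced[OF f] m(3)])
      (use cl in \<open>auto intro!: hb.D.tens_closed psum_cong simp: hb.D.eval_tens[OF f]\<close>)
  finally show "Sw HB (src HB b \<otimes>\<^bsub>HB\<^esub> tgt HB c \<otimes>\<^bsub>HB\<^esub> V) f
    = hb.D.eval (sw hb.D.T HB (\<lambda>X1 X2. tens hb.D.T (src HB b \<otimes>\<^bsub>HB\<^esub> X1) (tgt HB c \<otimes>\<^bsub>HB\<^esub> X2)) V) f" .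
qed

end

context hopf_pairing2
begin

text \<open>
  The right-hand sides of this and the next two lemmas do not mention the pairings, so these
  products agree for all of them.
\<close>

lemma tens_left_eq:
  assumes m: "\<alpha> \<in> carrier P" "V \<in> carrier T"
  shows "tens T \<alpha> \<one>\<^bsub>L\<^esub> \<otimes>\<^bsub>H\<^esub> V = tlift T (\<lambda>(\<beta>, X). tens T (\<alpha> \<otimes>\<^bsub>P\<^esub> \<beta>) X) V"
proof (rule t.Te_eqI)
  note G = t.T_comm_group
  show "tens T \<alpha> \<one>\<^bsub>L\<^esub> \<otimes>\<^bsub>H\<^esub> V \<in> carrier T" using m by (simp add: mult_closed)
  show "tlift T (\<lambda>(\<beta>, X). tens T (\<alpha> \<otimes>\<^bsub>P\<^esub> \<beta>) X) V \<in> carrier T" by (rule t.tlift_Be_closed[OF G m(2)]) (use m in simp)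
  fix f :: "'p \<Rightarrow> 'l \<Rightarrow> (('p \<times> 'l) \<Rightarrow>\<^sub>0 int) set ambient" assume f: "Be_balanced B P L f"
  show "Te P L (tens T \<alpha> \<one>\<^bsub>L\<^esub> \<otimes>\<^bsub>H\<^esub> V) f = Te P L (tlift T (\<lambda>(\<beta>, X). tens T (\<alpha> \<otimes>\<^bsub>P\<^esub> \<beta>) X) V) f"
    unfolding Te_base_left[OF f m(2,1)]
    by (subst t.ghom_tlift_Be[OF G t.ghom_Te[OF f] m(2)]) (use m in \<open>simp_all add: t.Te_tens[OF f]\<close>)
qed

lemma mult_src_eq:
  assumes m: "b \<in> carrier B" "V \<in> carrier T"
  shows "V \<otimes>\<^bsub>H\<^esub> src H b = tlift T (\<lambda>(\<alpha>, X). tens T \<alpha> (X \<otimes>\<^bsub>L\<^esub> src L b)) V"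
proof (rule t.Te_eqI)
  note G = t.T_comm_group
  show "V \<otimes>\<^bsub>H\<^esub> src H b \<in> carrier T" using m by (simp add: mult_closed H_src)
  show "tlift T (\<lambda>(\<alpha>, X). tens T \<alpha> (X \<otimes>\<^bsub>L\<^esub> src L b)) V \<in> carrier T" by (rule t.tlift_Be_closed[OF G m(2)]) (use m in simp)
  fix f :: "'p \<Rightarrow> 'l \<Rightarrow> (('p \<times> 'l) \<Rightarrow>\<^sub>0 int) set ambient" assume f: "Be_balanced B P L f"
  show "Te P L (V \<otimes>\<^bsub>H\<^esub> src H b) f = Te P L (tlift T (\<lambda>(\<alpha>, X). tens T \<alpha> (X \<otimes>\<^bsub>L\<^esub> src L b)) V) f"
    unfolding H_src Te_src_right[OF f m(2,1)]
    by (subst t.ghom_tlift_Be[OF G t.ghom_Te[OF f] m(2)]) (use m in \<open>simp_all add: t.Te_tens[OF f]\<close>)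
qed

lemma mult_tgt_eq:
  assumes m: "b \<in> carrier B" "V \<in> carrier T"
  shows "V \<otimes>\<^bsub>H\<^esub> tgt H b = tlift T (\<lambda>(\<alpha>, X). tens T \<alpha> (X \<otimes>\<^bsub>L\<^esub> tgt L b)) V"
proof (rule t.Te_eqI)
  note G = t.T_comm_group
  show "V \<otimes>\<^bsub>H\<^esub> tgt H b \<in> carrier T" using m by (simp add: mult_closed H_tgt)
  show "tlift T (\<lambda>(\<alpha>, X). tens T \<alpha> (X \<otimes>\<^bsub>L\<^esub> tgt L b)) V \<in> carrier T" by (rule t.tlift_Be_closed[OF G m(2)]) (use m in simp)
  fix f :: "'p \<Rightarrow> 'l \<Rightarrow> (('p \<times> 'l) \<Rightarrow>\<^sub>0 int) set ambient" assume f: "Be_balanced B P L f"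
  show "Te P L (V \<otimes>\<^bsub>H\<^esub> tgt H b) f = Te P L (tlift T (\<lambda>(\<alpha>, X). tens T \<alpha> (X \<otimes>\<^bsub>L\<^esub> tgt L b)) V) f"
    unfolding H_tgt Te_tgt_right[OF f m(2,1)]
    by (subst t.ghom_tlift_Be[OF G t.ghom_Te[OF f] m(2)]) (use m in \<open>simp_all add: t.Te_tens[OF f]\<close>)
qed

end

context hopf_pairing
begin

interpretation tt: hopf_pairing2 K B P L \<tau> \<tau> by unfold_locales
interpretation hb: Be_ring K B HB by (rule HB_Be_ring)

lemmas HB_tens_left_eq = tt.tens_left_eq[folded HB_simps(1,2)]
  and HB_mult_src_eq = tt.mult_src_eq[folded HB_simps(1,2,7)]
  and HB_mult_tgt_eq = tt.mult_tgt_eq[folded HB_simps(1,2,8)]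
  and HB_Te_mult = tt.Te_mult[folded HB_simps(1,2)]
  and HB_Te_src_right = tt.Te_src_right[folded HB_simps(1,2) HB_src]
  and HB_Te_tgt_right = tt.Te_tgt_right[folded HB_simps(1,2) HB_tgt]

lemma HB_Sw_coassoc:
  assumes f: "tri_balanced B HB f" and V: "V \<in> carrier HB"
  shows "Sw HB V (\<lambda>Y V3. Sw HB Y (\<lambda>V1 V2. f V1 V2 V3)) = Sw HB V (\<lambda>V1 Y. Sw HB Y (\<lambda>V2 V3. f V1 V2 V3))"
proof -
  note fD = hb.tri_balancedD[OF f]
  have b12: "diamond_balanced B HB HB (\<lambda>V1 V2. f V1 V2 V3)" if "V3 \<in> carrier HB" for V3
    by (rule balancedI) (use that in \<open>simp_all add: fD\<close>)
  have b23: "diamond_balanced B HB HB (f V1)" if "V1 \<in> carrier HB" for V1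
    by (rule balancedI) (use that in \<open>simp_all add: fD\<close>)
  have l: "diamond_balanced B HB HB (\<lambda>Y V3. Sw HB Y (\<lambda>V1 V2. f V1 V2 V3))"
    by (rule balancedI) (simp_all add: additiveD[OF HB_Sw_additive[OF b12]] HB_Sw_tgt_left[OF b12] fD psum_distrib)
  have r: "diamond_balanced B HB HB (\<lambda>V1 Y. Sw HB Y (\<lambda>V2 V3. f V1 V2 V3))"
    by (rule balancedI) (simp_all add: additiveD[OF HB_Sw_additive[OF b23]] HB_Sw_src_left[OF b23] fD psum_distrib)
  have "Sw HB V (\<lambda>Y V3. Sw HB Y (\<lambda>V1 V2. f V1 V2 V3)) = Te P L V (Sw2 P L (\<lambda>u y \<alpha>3 X3.
      Sw2 P L (\<lambda>\<alpha>1 X1 \<alpha>2 X2. f (tens T' \<alpha>1 X1) (tens T' \<alpha>2 X2) (tens T' \<alpha>3 X3)) u y))"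
    unfolding Sw_HB[OF l V]
    by (intro psum_cong refl) (simp add: Sw2_def[of P L "\<lambda>u y. F u y" for F] Sw_HB_tens[OF b12])
  also have "\<dots> = Te P L V (Sw2 P L (\<lambda>\<alpha>1 X1 u y.
      Sw2 P L (\<lambda>\<alpha>2 X2 \<alpha>3 X3. f (tens T' \<alpha>1 X1) (tens T' \<alpha>2 X2) (tens T' \<alpha>3 X3)) u y))"
    by (intro psum_cong refl Sw2_coassoc HB_pair_balanced b12 b23 HB_tens_closed)
  also have "\<dots> = Sw HB V (\<lambda>V1 Y. Sw HB Y (\<lambda>V2 V3. f V1 V2 V3))"
    unfolding Sw_HB[OF r V]
    by (intro psum_cong refl) (simp add: Sw2_def[of P L "\<lambda>u y. F u y" for F] Sw_HB_tens[OF b23])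
  finally show ?thesis .
qed

lemma HB_coassoc:
  assumes V: "V \<in> carrier HB"
  shows "sw (diamond3 B HB) HB (\<lambda>Y X3.
        sw (diamond3 B HB) HB (\<lambda>X1 X2. tclass (diamond3 B HB) (frag_of (X1, X2, X3))) Y) V =
      sw (diamond3 B HB) HB (\<lambda>X1 Y.
        sw (diamond3 B HB) HB (\<lambda>X2 X3. tclass (diamond3 B HB) (frag_of (X1, X2, X3))) Y) V"
proof (rule hb.D3.T_eqI)
  note G = hb.D3.comm_group_T
  have c: "tclass (diamond3 B HB) (frag_of (x, y, z)) \<in> carrier (diamond3 B HB)"
    if "x \<in> carrier HB" "y \<in> carrier HB" "z \<in> carrier HB" for x y z
    using that by (intro hb.D3.tclass_closed) simp
  show "sw (diamond3 B HB) HB (\<lambda>Y X3.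
        sw (diamond3 B HB) HB (\<lambda>X1 X2. tclass (diamond3 B HB) (frag_of (X1, X2, X3))) Y) V \<in> carrier (diamond3 B HB)"
    "sw (diamond3 B HB) HB (\<lambda>X1 Y.
        sw (diamond3 B HB) HB (\<lambda>X2 X3. tclass (diamond3 B HB) (frag_of (X1, X2, X3))) Y) V \<in> carrier (diamond3 B HB)"
    by (intro HB_sw_closed G c V; assumption)+
  fix f :: "_ \<Rightarrow> ((('p \<times> 'l \<Rightarrow>\<^sub>0 int) set \<times> ('p \<times> 'l \<Rightarrow>\<^sub>0 int) set \<times> ('p \<times> 'l \<Rightarrow>\<^sub>0 int) set) \<Rightarrow>\<^sub>0 int) set ambient"
  assume f: "kills f (diamond3_rels B HB)"
  have h: "ghom (diamond3 B HB) (\<lambda>t. fsum (rep t) f)"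
    by (simp add: ghom_def hb.D3.fsum_rep_mult[OF f])
  show "fsum (rep (sw (diamond3 B HB) HB (\<lambda>Y X3.
        sw (diamond3 B HB) HB (\<lambda>X1 X2. tclass (diamond3 B HB) (frag_of (X1, X2, X3))) Y) V)) f =
      fsum (rep (sw (diamond3 B HB) HB (\<lambda>X1 Y.
        sw (diamond3 B HB) HB (\<lambda>X2 X3. tclass (diamond3 B HB) (frag_of (X1, X2, X3))) Y) V)) f"
    using HB_Sw_coassoc[OF hb.tri_balanced_of_kills[OF f] V] V
    by (simp add: HB_ghom_sw[OF G h] HB_sw_closed[OF G] c hb.D3.fsum_rep_tclass[OF f])
qed

lemma HB_cop_one: "cop HB \<one>\<^bsub>HB\<^esub> = tens hb.D.T \<one>\<^bsub>HB\<^esub> \<one>\<^bsub>HB\<^esub>"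
proof (rule hb.D.eqI)
  show "cop HB \<one>\<^bsub>HB\<^esub> \<in> carrier hb.D.T" "tens hb.D.T \<one>\<^bsub>HB\<^esub> \<one>\<^bsub>HB\<^esub> \<in> carrier hb.D.T"
    by (simp_all add: HB_cop_carrier hb.D.tens_closed)
  fix f :: "('p \<times> 'l \<Rightarrow>\<^sub>0 int) set \<Rightarrow> ('p \<times> 'l \<Rightarrow>\<^sub>0 int) set \<Rightarrow>
      ((('p \<times> 'l \<Rightarrow>\<^sub>0 int) set \<times> ('p \<times> 'l \<Rightarrow>\<^sub>0 int) set) \<Rightarrow>\<^sub>0 int) set ambient"
  assume f: "diamond_balanced B HB HB f"
  note s = pair_split_balanced[OF HB_pair_balanced[OF f]]
  have "Sw HB \<one>\<^bsub>HB\<^esub> f = f \<one>\<^bsub>HB\<^esub> \<one>\<^bsub>HB\<^esub>"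
    unfolding HB_one Sw_HB_tens[OF f P.L.A.one_closed L.L.A.one_closed] Sw2_swap[OF s]
      L.Sw_one[OF Sw2_balanced_L[OF s P.L.A.one_closed]] P.Sw_one[OF Sw2_balanced_P[OF s L.L.A.one_closed L.L.A.one_closed]] ..
  then show "Sw HB \<one>\<^bsub>HB\<^esub> f = hb.D.eval (tens hb.D.T \<one>\<^bsub>HB\<^esub> \<one>\<^bsub>HB\<^esub>) f"
    using hb.D.eval_tens[OF f hb.L.A.one_closed hb.L.A.one_closed] by simp
qed

lemma additive_HB_cou:
  assumes h: "additive B h"
  shows "Be_balanced B P L (\<lambda>\<alpha> X. h (cou P (\<alpha> \<otimes>\<^bsub>P\<^esub> src P (cou L X))))"
proof (rule Be_balancedI)
  fix b \<beta> X assume m: "b \<in> carrier B" "\<beta> \<in> carrier P" "X \<in> carrier L"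
  show "h (cou P (\<beta> \<otimes>\<^bsub>P\<^esub> tgt P b \<otimes>\<^bsub>P\<^esub> src P (cou L X))) = h (cou P (\<beta> \<otimes>\<^bsub>P\<^esub> src P (cou L (tgt L b \<otimes>\<^bsub>L\<^esub> X))))"
    using m P.cou_src_tgt_right[of b "\<beta> \<otimes>\<^bsub>P\<^esub> src P (cou L X)"] by (simp add: assoc normal)
qed (simp_all add: additiveD[OF h] P.cou_add L.cou_add distr assoc)

lemma HB_cou_eq:
  assumes "additive B h" "V \<in> carrier HB"
  shows "h (cou HB V) = Te P L V (\<lambda>\<alpha> X. h (cou P (\<alpha> \<otimes>\<^bsub>P\<^esub> src P (cou L X))))"
  unfolding HB_cou by (rule HB_ghom_tlift[OF P.B.A.a_comm_group assms]) simp

lemma HB_cou_closed: "V \<in> carrier HB \<Longrightarrow> cou HB V \<in> carrier B"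
  unfolding HB_cou using HB_tlift_closed[OF P.B.A.a_comm_group, of V "\<lambda>\<alpha> X. cou P (\<alpha> \<otimes>\<^bsub>P\<^esub> src P (cou L X))"] by simp

lemma B_eqI:
  assumes "b \<in> carrier B" "c \<in> carrier B" "\<And>h :: 'b \<Rightarrow> 'b ambient. additive B h \<Longrightarrow> h b = h c"
  shows "b = c"
  using assms by (intro group_eqI[OF P.B.A.a_comm_group]) simp_all

lemma HB_cou_tens: "\<lbrakk>\<alpha> \<in> carrier P; X \<in> carrier L\<rbrakk> \<Longrightarrow> cou HB (tens T' \<alpha> X) = cou P (\<alpha> \<otimes>\<^bsub>P\<^esub> src P (cou L X))"
  by (rule B_eqI) (simp_all add: HB_cou_closed HB_cou_eq Te_tens[OF additive_HB_cou])

lemma HB_cou_add: "\<lbrakk>V \<in> carrier HB; W \<in> carrier HB\<rbrakk> \<Longrightarrow> cou HB (V \<oplus>\<^bsub>HB\<^esub> W) = cou HB V \<oplus>\<^bsub>B\<^esub> cou HB W"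
  by (rule B_eqI)
    (simp_all add: HB_cou_closed additiveD HB_cou_eq additiveD[OF HB_additive_Te[OF additive_HB_cou]])

lemma HB_cou_linear:
  assumes m: "b \<in> carrier B" "c \<in> carrier B" "V \<in> carrier HB"
  shows "cou HB (src HB b \<otimes>\<^bsub>HB\<^esub> tgt HB c \<otimes>\<^bsub>HB\<^esub> V) = b \<otimes>\<^bsub>B\<^esub> cou HB V \<otimes>\<^bsub>B\<^esub> c"
proof (rule B_eqI)
  have a: "src HB b \<otimes>\<^bsub>HB\<^esub> tgt HB c \<otimes>\<^bsub>HB\<^esub> V = src HB b \<otimes>\<^bsub>HB\<^esub> (tgt HB c \<otimes>\<^bsub>HB\<^esub> V)"
    using m by (intro hb.L.A.m_assoc) simp_all
  have cl: "tgt HB c \<otimes>\<^bsub>HB\<^esub> V \<in> carrier HB" "src HB b \<otimes>\<^bsub>HB\<^esub> (tgt HB c \<otimes>\<^bsub>HB\<^esub> V) \<in> carrier HB" using m by simp_all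
  show "cou HB (src HB b \<otimes>\<^bsub>HB\<^esub> tgt HB c \<otimes>\<^bsub>HB\<^esub> V) \<in> carrier B" unfolding a by (rule HB_cou_closed[OF cl(2)])
  show "b \<otimes>\<^bsub>B\<^esub> cou HB V \<otimes>\<^bsub>B\<^esub> c \<in> carrier B" using m by (simp add: HB_cou_closed)
  fix h :: "'b \<Rightarrow> 'b ambient" assume h: "additive B h"
  have h': "additive B (\<lambda>z. h (b \<otimes>\<^bsub>B\<^esub> z \<otimes>\<^bsub>B\<^esub> c))"
    by (rule additiveI) (use m in \<open>simp add: P.B.A.l_distr P.B.A.r_distr additiveD[OF h]\<close>)
  note g = additive_HB_cou[OF h]
  have g': "Be_balanced B P L (\<lambda>\<alpha> X. h (cou P (src P b \<otimes>\<^bsub>P\<^esub> \<alpha> \<otimes>\<^bsub>P\<^esub> src P (cou L X))))"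
    using tt.Be_balanced_mult_P[OF g, of "src P b"] m by simp
  have "h (cou HB (src HB b \<otimes>\<^bsub>HB\<^esub> (tgt HB c \<otimes>\<^bsub>HB\<^esub> V))) =
      Te P L V (\<lambda>\<alpha> X. h (cou P (src P b \<otimes>\<^bsub>P\<^esub> (tgt P c \<otimes>\<^bsub>P\<^esub> \<alpha>) \<otimes>\<^bsub>P\<^esub> src P (cou L X))))"
    unfolding HB_cou_eq[OF h cl(2)] unfolding HB_src HB_tgt
    unfolding HB_Te_left[OF g cl(1)[unfolded HB_tgt] P.src_closed[OF m(1)]] HB_Te_left[OF g' m(3) P.tgt_closed[OF m(2)]] ..
  also have "\<dots> = Te P L V (\<lambda>\<alpha> X. h (b \<otimes>\<^bsub>B\<^esub> cou P (\<alpha> \<otimes>\<^bsub>P\<^esub> src P (cou L X)) \<otimes>\<^bsub>B\<^esub> c))"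
    using m by (simp add: assoc)
  finally show "h (cou HB (src HB b \<otimes>\<^bsub>HB\<^esub> tgt HB c \<otimes>\<^bsub>HB\<^esub> V)) = h (b \<otimes>\<^bsub>B\<^esub> cou HB V \<otimes>\<^bsub>B\<^esub> c)"
    unfolding a HB_cou_eq[OF h' m(3)] .
qed

lemma HB_cou_one: "cou HB \<one>\<^bsub>HB\<^esub> = \<one>\<^bsub>B\<^esub>"
  by (simp add: HB_one HB_cou_tens)

lemma HB_cou_src_left: "\<lbrakk>b \<in> carrier B; V \<in> carrier HB\<rbrakk> \<Longrightarrow> cou HB (src HB b \<otimes>\<^bsub>HB\<^esub> V) = b \<otimes>\<^bsub>B\<^esub> cou HB V"
  using HB_cou_linear[of b "\<one>\<^bsub>B\<^esub>" V] by (simp add: HB_cou_closed)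

lemma HB_cou_tgt_left: "\<lbrakk>b \<in> carrier B; V \<in> carrier HB\<rbrakk> \<Longrightarrow> cou HB (tgt HB b \<otimes>\<^bsub>HB\<^esub> V) = cou HB V \<otimes>\<^bsub>B\<^esub> b"
  using HB_cou_linear[of "\<one>\<^bsub>B\<^esub>" b V] by (simp add: HB_cou_closed)

lemma HB_counit_left:
  assumes V: "V \<in> carrier HB"
  shows "sw (add_monoid HB) HB (\<lambda>V1 V2. src HB (cou HB V1) \<otimes>\<^bsub>HB\<^esub> V2) V = V"
proof (rule group_eqI)
  show "comm_group (add_monoid HB)" by (rule hb.L.A.a_comm_group)
  note G = this
  show "sw (add_monoid HB) HB (\<lambda>V1 V2. src HB (cou HB V1) \<otimes>\<^bsub>HB\<^esub> V2) V \<in> carrier (add_monoid HB)"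
    by (rule HB_sw_closed[OF G V]) (simp add: HB_cou_closed)
  show "V \<in> carrier (add_monoid HB)" using V by simp
  fix h :: "('p \<times> 'l \<Rightarrow>\<^sub>0 int) set \<Rightarrow> ('p \<times> 'l \<Rightarrow>\<^sub>0 int) set ambient" assume h: "additive HB h"
  have d: "diamond_balanced B HB HB (\<lambda>V1 V2. h (src HB (cou HB V1) \<otimes>\<^bsub>HB\<^esub> V2))"
    by (rule balancedI) (simp_all add: HB_cou_closed HB_cou_add HB_cou_tgt_left hb.L.A.l_distr hb.L.A.r_distr hb.L.A.m_assoc additiveD[OF h])
  have "h (sw (add_monoid HB) HB (\<lambda>V1 V2. src HB (cou HB V1) \<otimes>\<^bsub>HB\<^esub> V2) V) = Sw HB V (\<lambda>V1 V2. h (src HB (cou HB V1) \<otimes>\<^bsub>HB\<^esub> V2))"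
    by (rule HB_ghom_sw[OF G h V]) (simp add: HB_cou_closed)
  also have "\<dots> = Te P L V (Sw2 P L (\<lambda>\<beta>1 X1 \<beta>2 X2. h (tens T' (src P (cou P (\<beta>1 \<otimes>\<^bsub>P\<^esub> src P (cou L X1))) \<otimes>\<^bsub>P\<^esub> \<beta>2) X2)))"
    unfolding Sw_HB[OF d V] by (simp add: Sw2_def HB_cou_tens HB_src HB_tens_left)
  also have "\<dots> = Te P L V (\<lambda>\<beta> X. h (tens T' \<beta> X))"
    by (intro psum_cong refl Sw2_counit_left HB_Be_balanced h)
  also have "\<dots> = h V" by (rule HB_ghom_T[OF h V, symmetric])
  finally show "h (sw (add_monoid HB) HB (\<lambda>V1 V2. src HB (cou HB V1) \<otimes>\<^bsub>HB\<^esub> V2) V) = h V" .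
qed

lemma HB_counit_right:
  assumes V: "V \<in> carrier HB"
  shows "sw (add_monoid HB) HB (\<lambda>V1 V2. tgt HB (cou HB V2) \<otimes>\<^bsub>HB\<^esub> V1) V = V"
proof (rule group_eqI)
  show "comm_group (add_monoid HB)" by (rule hb.L.A.a_comm_group)
  note G = this
  show "sw (add_monoid HB) HB (\<lambda>V1 V2. tgt HB (cou HB V2) \<otimes>\<^bsub>HB\<^esub> V1) V \<in> carrier (add_monoid HB)"
    by (rule HB_sw_closed[OF G V]) (simp add: HB_cou_closed)
  show "V \<in> carrier (add_monoid HB)" using V by simp
  fix h :: "('p \<times> 'l \<Rightarrow>\<^sub>0 int) set \<Rightarrow> ('p \<times> 'l \<Rightarrow>\<^sub>0 int) set ambient" assume h: "additive HB h"
  have d: "diamond_balanced B HB HB (\<lambda>V1 V2. h (tgt HB (cou HB V2) \<otimes>\<^bsub>HB\<^esub> V1))"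
    by (rule balancedI) (simp_all add: HB_cou_closed HB_cou_add HB_cou_src_left hb.L.A.l_distr hb.L.A.r_distr hb.L.A.m_assoc additiveD[OF h])
  have "h (sw (add_monoid HB) HB (\<lambda>V1 V2. tgt HB (cou HB V2) \<otimes>\<^bsub>HB\<^esub> V1) V) = Sw HB V (\<lambda>V1 V2. h (tgt HB (cou HB V2) \<otimes>\<^bsub>HB\<^esub> V1))"
    by (rule HB_ghom_sw[OF G h V]) (simp add: HB_cou_closed)
  also have "\<dots> = Te P L V (Sw2 P L (\<lambda>\<beta>1 X1 \<beta>2 X2. h (tens T' (tgt P (cou P (\<beta>2 \<otimes>\<^bsub>P\<^esub> src P (cou L X2))) \<otimes>\<^bsub>P\<^esub> \<beta>1) X1)))"
    unfolding Sw_HB[OF d V] by (simp add: Sw2_def HB_cou_tens HB_tgt HB_tens_left)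
  also have "\<dots> = Te P L V (\<lambda>\<beta> X. h (tens T' \<beta> X))"
    by (intro psum_cong refl Sw2_counit_right HB_Be_balanced h)
  also have "\<dots> = h V" by (rule HB_ghom_T[OF h V, symmetric])
  finally show "h (sw (add_monoid HB) HB (\<lambda>V1 V2. tgt HB (cou HB V2) \<otimes>\<^bsub>HB\<^esub> V1) V) = h V" .
qed

lemma HB_cou_src_tgt_right:
  assumes m: "V \<in> carrier HB" "b \<in> carrier B"
  shows "cou HB (V \<otimes>\<^bsub>HB\<^esub> src HB b) = cou HB (V \<otimes>\<^bsub>HB\<^esub> tgt HB b)"
proof (rule B_eqI)
  have cl: "V \<otimes>\<^bsub>HB\<^esub> src HB b \<in> carrier HB" "V \<otimes>\<^bsub>HB\<^esub> tgt HB b \<in> carrier HB" using m by simp_all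
  then show "cou HB (V \<otimes>\<^bsub>HB\<^esub> src HB b) \<in> carrier B" "cou HB (V \<otimes>\<^bsub>HB\<^esub> tgt HB b) \<in> carrier B"
    by (simp_all add: HB_cou_closed)
  fix h :: "'b \<Rightarrow> 'b ambient" assume h: "additive B h"
  show "h (cou HB (V \<otimes>\<^bsub>HB\<^esub> src HB b)) = h (cou HB (V \<otimes>\<^bsub>HB\<^esub> tgt HB b))"
    unfolding HB_cou_eq[OF h cl(1)] HB_cou_eq[OF h cl(2)]
      HB_Te_src_right[OF additive_HB_cou[OF h] m] HB_Te_tgt_right[OF additive_HB_cou[OF h] m]
    using m by (simp add: L.cou_src_tgt_right)
qed

text \<open>
  \<open>lcross_rcross_counit\<close> evaluates the counit of the exchange; its value depends on \<open>Y\<close> and \<open>\<beta>\<close> only through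
  \<open>\<epsilon>(\<beta> \<otimes> Y)\<close>.
\<close>

lemma HB_cou_mult_src:
  assumes m: "V \<in> carrier HB" "W \<in> carrier HB"
  shows "cou HB (V \<otimes>\<^bsub>HB\<^esub> src HB (cou HB W)) = cou HB (V \<otimes>\<^bsub>HB\<^esub> W)"
proof (rule B_eqI)
  have w: "cou HB W \<in> carrier B" by (rule HB_cou_closed[OF m(2)])
  have cl: "V \<otimes>\<^bsub>HB\<^esub> src HB (cou HB W) \<in> carrier HB" "V \<otimes>\<^bsub>HB\<^esub> W \<in> carrier HB" using m w by simp_all
  then show "cou HB (V \<otimes>\<^bsub>HB\<^esub> src HB (cou HB W)) \<in> carrier B" "cou HB (V \<otimes>\<^bsub>HB\<^esub> W) \<in> carrier B"
    by (simp_all add: HB_cou_closed)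
  fix h :: "'b \<Rightarrow> 'b ambient" assume h: "additive B h"
  have "h (cou HB (V \<otimes>\<^bsub>HB\<^esub> W)) = Te P L V (\<lambda>\<alpha> X. Te P L W (\<lambda>\<beta> Y.
      tt.cross (\<lambda>p x. h (cou P (\<alpha> \<otimes>\<^bsub>P\<^esub> p \<otimes>\<^bsub>P\<^esub> src P (cou L (x \<otimes>\<^bsub>L\<^esub> Y))))) \<beta> X))"
    unfolding HB_cou_eq[OF h cl(2)] by (rule HB_Te_mult[OF additive_HB_cou[OF h] m])
  also have "\<dots> = Te P L V (\<lambda>\<alpha> X. h (cou P (\<alpha> \<otimes>\<^bsub>P\<^esub> src P (cou L (X \<otimes>\<^bsub>L\<^esub> src L (cou HB W))))))"
  proof (intro psum_cong refl)
    fix \<alpha> X assume a: "\<alpha> \<in> carrier P" "X \<in> carrier L"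
    have f: "additive P (\<lambda>z. h (cou P (\<alpha> \<otimes>\<^bsub>P\<^esub> z)))"
      by (rule additiveI) (use a in \<open>simp add: distr P.cou_add additiveD[OF h]\<close>)
    have fs: "h (cou P (\<alpha> \<otimes>\<^bsub>P\<^esub> (z \<otimes>\<^bsub>P\<^esub> src P b))) = h (cou P (\<alpha> \<otimes>\<^bsub>P\<^esub> (z \<otimes>\<^bsub>P\<^esub> tgt P b)))"
      if "b \<in> carrier B" "z \<in> carrier P" for b z
      using P.cou_src_tgt_right[of b "\<alpha> \<otimes>\<^bsub>P\<^esub> z"] a that by (simp add: assoc)
    have fc: "h (cou P (\<alpha> \<otimes>\<^bsub>P\<^esub> (src P b \<otimes>\<^bsub>P\<^esub> z))) = h (cou P (\<alpha> \<otimes>\<^bsub>P\<^esub> (src P b \<otimes>\<^bsub>P\<^esub> src P (cou P z))))"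
      if "b \<in> carrier B" "z \<in> carrier P" for b z
      using P.cou_mult_src[of "\<alpha> \<otimes>\<^bsub>P\<^esub> src P b" z] a that by (simp add: assoc)
    have k: "additive B (\<lambda>b. h (cou P (\<alpha> \<otimes>\<^bsub>P\<^esub> src P (cou L (X \<otimes>\<^bsub>L\<^esub> src L b)))))"
      by (rule additiveI) (use a in \<open>simp add: distr L.cou_add P.cou_add additiveD[OF h]\<close>)
    have "tt.cross (\<lambda>p x. h (cou P (\<alpha> \<otimes>\<^bsub>P\<^esub> p \<otimes>\<^bsub>P\<^esub> src P (cou L (x \<otimes>\<^bsub>L\<^esub> Y))))) \<beta> X
        = h (cou P (\<alpha> \<otimes>\<^bsub>P\<^esub> src P (cou L (X \<otimes>\<^bsub>L\<^esub> src L (cou P (\<beta> \<otimes>\<^bsub>P\<^esub> src P (cou L Y)))))))"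
      if b: "\<beta> \<in> carrier P" "Y \<in> carrier L" for \<beta> Y
    proof -
      have "tt.cross (\<lambda>p x. h (cou P (\<alpha> \<otimes>\<^bsub>P\<^esub> p \<otimes>\<^bsub>P\<^esub> src P (cou L (x \<otimes>\<^bsub>L\<^esub> Y))))) \<beta> X
          = tt.cross (\<lambda>p x. h (cou P (\<alpha> \<otimes>\<^bsub>P\<^esub> (p \<otimes>\<^bsub>P\<^esub> src P (cou L (x \<otimes>\<^bsub>L\<^esub> src L (cou L Y))))))) \<beta> X"
        by (rule tt.cross_cong) (use a b in \<open>simp add: assoc L.cou_mult_src\<close>)
      also have "\<dots> = h (cou P (\<alpha> \<otimes>\<^bsub>P\<^esub> src P (cou L (X \<otimes>\<^bsub>L\<^esub> src L (cou P (\<beta> \<otimes>\<^bsub>P\<^esub> src P (cou L Y)))))))"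
        unfolding tt.cross_def by (rule lcross_rcross_counit[OF f fs fc b(1) a(2) L.cou_closed[OF b(2)]])
      finally show ?thesis .
    qed
    then show "Te P L W (\<lambda>\<beta> Y. tt.cross (\<lambda>p x. h (cou P (\<alpha> \<otimes>\<^bsub>P\<^esub> p \<otimes>\<^bsub>P\<^esub> src P (cou L (x \<otimes>\<^bsub>L\<^esub> Y))))) \<beta> X)
        = h (cou P (\<alpha> \<otimes>\<^bsub>P\<^esub> src P (cou L (X \<otimes>\<^bsub>L\<^esub> src L (cou HB W)))))"
      unfolding HB_cou_eq[OF k m(2)] by (intro psum_cong refl)
  qed
  also have "\<dots> = h (cou HB (V \<otimes>\<^bsub>HB\<^esub> src HB (cou HB W)))"
    unfolding HB_cou_eq[OF h cl(1)] by (rule HB_Te_src_right[OF additive_HB_cou[OF h] m(1) w, symmetric])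
  finally show "h (cou HB (V \<otimes>\<^bsub>HB\<^esub> src HB (cou HB W))) = h (cou HB (V \<otimes>\<^bsub>HB\<^esub> W))" ..
qed

end

lemma psum_Sw2:
  "psum A C c (\<lambda>x y. Sw2 P L (F x y) \<beta> X) = Sw2 P L (\<lambda>\<beta>1 X1 \<beta>2 X2. psum A C c (\<lambda>x y. F x y \<beta>1 X1 \<beta>2 X2)) \<beta> X"
  unfolding Sw2_def psum_swap[of A C c] ..

lemma Sw2_Sw2:
  "Sw2 P L (\<lambda>\<alpha>1 X1 \<alpha>2 X2. Sw2 P L (\<lambda>\<beta>1 Y1 \<beta>2 Y2. F \<alpha>1 X1 \<alpha>2 X2 \<beta>1 Y1 \<beta>2 Y2) \<beta> Y) \<alpha> X =
   Sw2 P L (\<lambda>\<beta>1 Y1 \<beta>2 Y2. Sw2 P L (\<lambda>\<alpha>1 X1 \<alpha>2 X2. F \<alpha>1 X1 \<alpha>2 X2 \<beta>1 Y1 \<beta>2 Y2) \<alpha> X) \<beta> Y"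
  unfolding Sw2_def by (rule psum_swap22)

section \<open>Coproducts of mixed products\<close>

context hopf_pairing3
begin

lemma base_left_indep: "\<lbrakk>x \<in> carrier P; V \<in> carrier tk.T\<rbrakk> \<Longrightarrow> tens tk.T x \<one>\<^bsub>L\<^esub> \<otimes>\<^bsub>s.HB\<^esub> V = tens tk.T x \<one>\<^bsub>L\<^esub> \<otimes>\<^bsub>tk.H\<^esub> V"
  by (simp add: s.HB_tens_left_eq[unfolded s.HB_simps(1)] tk.tens_left_eq)

lemma src_right_indep: "\<lbrakk>b \<in> carrier B; V \<in> carrier tk.T\<rbrakk> \<Longrightarrow> V \<otimes>\<^bsub>s.HB\<^esub> src s.HB b = V \<otimes>\<^bsub>tk.H\<^esub> src tk.H b"
  by (simp add: s.HB_mult_src_eq[unfolded s.HB_simps(1)] tk.mult_src_eq)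

lemma tgt_right_indep: "\<lbrakk>b \<in> carrier B; V \<in> carrier tk.T\<rbrakk> \<Longrightarrow> V \<otimes>\<^bsub>s.HB\<^esub> tgt s.HB b = V \<otimes>\<^bsub>tk.H\<^esub> tgt tk.H b"
  by (simp add: s.HB_mult_tgt_eq[unfolded s.HB_simps(1)] tk.mult_tgt_eq)

end

context hopf_pairing3
begin

text \<open>
  The coproduct of a \<open>\<tau>\<sigma>\<close>-product is the \<open>\<tau>\<kappa>\<close>-product of the first components and the \<open>\<kappa>\<sigma>\<close>-product of the
  second ones.  On tensors this is \<open>cross_Sw2_mult\<close>.  For fixed \<open>V\<^sub>(\<^sub>1\<^sub>), V\<^sub>(\<^sub>2\<^sub>)\<close> the summand is not balanced in the
  components of \<open>W\<close>, so the sum over \<open>V\<close> is taken first; the Takeuchi condition for \<open>V\<close> then makes the result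
  balanced.
\<close>

lemma Sw_mult:
  fixes g :: "(('p \<times> 'l) \<Rightarrow>\<^sub>0 int) set \<Rightarrow> (('p \<times> 'l) \<Rightarrow>\<^sub>0 int) set \<Rightarrow> 'q::ab_group_add"
  assumes g: "diamond_balanced B tk.k.HB tk.k.HB g" and m: "V \<in> carrier tk.k.HB" "W \<in> carrier tk.k.HB"
  shows "Sw tk.k.HB (V \<otimes>\<^bsub>ts.H\<^esub> W) g =
    Sw tk.k.HB V (\<lambda>V1 V2. Sw tk.k.HB W (\<lambda>W1 W2. g (V1 \<otimes>\<^bsub>tk.H\<^esub> W1) (V2 \<otimes>\<^bsub>ks.H\<^esub> W2)))"
proof -
  interpret tkk: hopf_pairing3 K B P L \<tau> \<kappa> \<kappa> by unfold_locales
  interpret ksk: hopf_pairing3 K B P L \<kappa> \<sigma> \<kappa> by unfold_locales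
  note c = tk.k.HB_simps(1)
  note mT = m[unfolded c]
  note gadd = balancedD(1,2)[OF g, unfolded c tk.k.HB_simps(5)]
  note madd = tk.mult_add_left[unfolded tk.H_add] tk.mult_add_right[unfolded tk.H_add]
    ks.mult_add_left[unfolded ks.H_add] ks.mult_add_right[unfolded ks.H_add]
  note F = tk.k.HB_pair_balanced[OF g]
  note tl = tk.t.tens_T_closed
  have base: "tgt tk.k.HB b = tens tk.T (tgt P b) \<one>\<^bsub>L\<^esub>" "src tk.k.HB b = tens tk.T (src P b) \<one>\<^bsub>L\<^esub>" for b
    by (simp_all add: tk.k.HB_src tk.k.HB_tgt)
  have gact: "g (tens tk.T (tgt P i) \<one>\<^bsub>L\<^esub> \<otimes>\<^bsub>tk.H\<^esub> x) y = g x (tens tk.T (src P i) \<one>\<^bsub>L\<^esub> \<otimes>\<^bsub>ks.H\<^esub> y)"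
    if "i \<in> carrier B" "x \<in> carrier tk.T" "y \<in> carrier tk.T" for i x y
  proof -
    have "g (tgt tk.k.HB i \<otimes>\<^bsub>tk.k.HB\<^esub> x) y = g x (src tk.k.HB i \<otimes>\<^bsub>tk.k.HB\<^esub> y)"
      using that by (intro balanced_act[OF g]) (simp_all add: c)
    then show ?thesis
      unfolding base tkk.base_left_indep[OF tk.t.P.tgt_closed[OF that(1)] that(2)] ksk.base_left_indep[OF tk.t.P.src_closed[OF that(1)] that(3)] .
  qed
  have bV: "diamond_balanced B tk.k.HB tk.k.HB (\<lambda>V1 V2. g (V1 \<otimes>\<^bsub>tk.H\<^esub> W1) (V2 \<otimes>\<^bsub>ks.H\<^esub> W2))"
    if w: "W1 \<in> carrier tk.T" "W2 \<in> carrier tk.T" for W1 W2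
  proof (rule balancedI)
    fix i V1 V2 assume a: "i \<in> carrier B" "V1 \<in> carrier tk.k.HB" "V2 \<in> carrier tk.k.HB"
    have l: "(tgt tk.k.HB i \<otimes>\<^bsub>tk.k.HB\<^esub> V1) \<otimes>\<^bsub>tk.H\<^esub> W1 = tens tk.T (tgt P i) \<one>\<^bsub>L\<^esub> \<otimes>\<^bsub>tk.H\<^esub> (V1 \<otimes>\<^bsub>tk.H\<^esub> W1)"
      using a w by (simp add: c base tkk.base_left_indep tk.mult_assoc)
    have r: "(src tk.k.HB i \<otimes>\<^bsub>tk.k.HB\<^esub> V2) \<otimes>\<^bsub>ks.H\<^esub> W2 = tens tk.T (src P i) \<one>\<^bsub>L\<^esub> \<otimes>\<^bsub>ks.H\<^esub> (V2 \<otimes>\<^bsub>ks.H\<^esub> W2)"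
      using a w by (simp add: c base ksk.base_left_indep ks.mult_assoc)
    show "g ((tgt tk.k.HB i \<otimes>\<^bsub>tk.k.HB\<^esub> V1) \<otimes>\<^bsub>tk.H\<^esub> W1) (V2 \<otimes>\<^bsub>ks.H\<^esub> W2) =
      g (V1 \<otimes>\<^bsub>tk.H\<^esub> W1) ((src tk.k.HB i \<otimes>\<^bsub>tk.k.HB\<^esub> V2) \<otimes>\<^bsub>ks.H\<^esub> W2)"
      unfolding l r using a w by (intro gact tk.mult_closed ks.mult_closed) (simp_all add: c)
  qed (use w in \<open>simp_all add: c tk.k.HB_simps(5) madd gadd tk.mult_closed ks.mult_closed\<close>)
  define G where "G W1 W2 = Te P L V (Sw2 P L (\<lambda>\<alpha>1 X1 \<alpha>2 X2. g (tens tk.T \<alpha>1 X1 \<otimes>\<^bsub>tk.H\<^esub> W1) (tens tk.T \<alpha>2 X2 \<otimes>\<^bsub>ks.H\<^esub> W2)))" for W1 W2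
  have SG: "Sw tk.k.HB V (\<lambda>V1 V2. g (V1 \<otimes>\<^bsub>tk.H\<^esub> W1) (V2 \<otimes>\<^bsub>ks.H\<^esub> W2)) = G W1 W2"
    if "W1 \<in> carrier tk.k.HB" "W2 \<in> carrier tk.k.HB" for W1 W2
    unfolding G_def using that by (intro tk.k.Sw_HB[OF bV m(1)]) (simp_all add: c)
  have bG: "diamond_balanced B tk.k.HB tk.k.HB G"
  proof (rule balancedI)
    fix i W1 W2 assume a: "i \<in> carrier B" "W1 \<in> carrier tk.k.HB" "W2 \<in> carrier tk.k.HB"
    note aT = a[unfolded c]
    have l: "x \<otimes>\<^bsub>tk.k.HB\<^esub> tgt tk.k.HB i \<otimes>\<^bsub>tk.H\<^esub> W1 = x \<otimes>\<^bsub>tk.H\<^esub> (tgt tk.k.HB i \<otimes>\<^bsub>tk.k.HB\<^esub> W1)"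
      if "x \<in> carrier tk.T" for x
      unfolding tkk.tgt_right_indep[OF aT(1) that] unfolding base tk.H_tgt tkk.base_left_indep[OF tk.t.P.tgt_closed[OF aT(1)] aT(2)]
      by (rule tk.mult_assoc[OF that _ aT(2)]) (use aT in simp)
    have r: "x \<otimes>\<^bsub>tk.k.HB\<^esub> src tk.k.HB i \<otimes>\<^bsub>ks.H\<^esub> W2 = x \<otimes>\<^bsub>ks.H\<^esub> (src tk.k.HB i \<otimes>\<^bsub>tk.k.HB\<^esub> W2)"
      if "x \<in> carrier tk.T" for x
      unfolding ksk.src_right_indep[OF aT(1) that] unfolding base ks.H_src ksk.base_left_indep[OF tk.t.P.src_closed[OF aT(1)] aT(3)]
      by (rule ks.mult_assoc[OF that _ aT(3)]) (use aT in simp)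
    show "G (tgt tk.k.HB i \<otimes>\<^bsub>tk.k.HB\<^esub> W1) W2 = G W1 (src tk.k.HB i \<otimes>\<^bsub>tk.k.HB\<^esub> W2)"
      using tk.k.HB_Sw_takeuchi[OF bV[OF aT(2,3)] a(1) m(1)]
      by (simp add: G_def Sw2_def l r)
  qed (simp_all add: G_def Sw2_def c tk.k.HB_simps(5) madd gadd tk.mult_closed ks.mult_closed psum_distrib)
  have "Sw tk.k.HB (V \<otimes>\<^bsub>ts.H\<^esub> W) g = Te P L V (\<lambda>\<alpha> X. Te P L W (\<lambda>\<beta> Y.
      ts.cross (\<lambda>p x. Sw2 P L (\<lambda>\<beta> X \<beta>' X'. g (tens tk.T \<beta> X) (tens tk.T \<beta>' X')) (\<alpha> \<otimes>\<^bsub>P\<^esub> p) (x \<otimes>\<^bsub>L\<^esub> Y)) \<beta> X))"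
    unfolding tk.k.Sw_HB[OF g ts.mult_closed[OF mT, folded c]]
    by (rule ts.Te_mult[OF tk.k.Sw2_Be_balanced[OF F] mT])
  also have "\<dots> = Te P L V (\<lambda>\<alpha> X. Te P L W (\<lambda>\<beta> Y. Sw2 P L (\<lambda>\<alpha>1 X1 \<alpha>2 X2. Sw2 P L (\<lambda>\<beta>1 Y1 \<beta>2 Y2.
      g (tens tk.T \<alpha>1 X1 \<otimes>\<^bsub>tk.H\<^esub> tens tk.T \<beta>1 Y1) (tens tk.T \<alpha>2 X2 \<otimes>\<^bsub>ks.H\<^esub> tens tk.T \<beta>2 Y2)) \<beta> Y) \<alpha> X))"
  proof (intro psum_cong refl)
    fix \<alpha> X \<beta> Y assume a: "\<alpha> \<in> carrier P" "X \<in> carrier L" "\<beta> \<in> carrier P" "Y \<in> carrier L"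
    have h1: "ghom tk.T (\<lambda>z. g z y)" and h2: "ghom tk.T (g y)" if "y \<in> carrier tk.T" for y
      using that by (simp_all add: ghom_def gadd)
    have e: "tk.cross (\<lambda>p x. ks.cross (\<lambda>p' x'. g (tens tk.T (\<alpha>1 \<otimes>\<^bsub>P\<^esub> p) (x \<otimes>\<^bsub>L\<^esub> Y1)) (tens tk.T (\<alpha>2 \<otimes>\<^bsub>P\<^esub> p') (x' \<otimes>\<^bsub>L\<^esub> Y2))) \<beta>2 X2) \<beta>1 X1
      = g (tens tk.T \<alpha>1 X1 \<otimes>\<^bsub>tk.H\<^esub> tens tk.T \<beta>1 Y1) (tens tk.T \<alpha>2 X2 \<otimes>\<^bsub>ks.H\<^esub> tens tk.T \<beta>2 Y2)"
      if b: "\<alpha>1 \<in> carrier P" "X1 \<in> carrier L" "\<alpha>2 \<in> carrier P" "X2 \<in> carrier L"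
        "\<beta>1 \<in> carrier P" "Y1 \<in> carrier L" "\<beta>2 \<in> carrier P" "Y2 \<in> carrier L" for \<alpha>1 X1 \<alpha>2 X2 \<beta>1 Y1 \<beta>2 Y2
    proof -
      have y: "tens tk.T \<alpha>2 X2 \<otimes>\<^bsub>ks.H\<^esub> tens tk.T \<beta>2 Y2 \<in> carrier tk.T" using b by (intro ks.mult_closed tl)
      show ?thesis
        unfolding tk.ghom_mult_tens[OF h1[OF y] b(1,2,5,6)]
        by (rule tk.cross_cong, rule ks.ghom_mult_tens[OF h2 b(3,4,7,8), symmetric]) (use b in simp)
    qed
    show "ts.cross (\<lambda>p x. Sw2 P L (\<lambda>\<beta> X \<beta>' X'. g (tens tk.T \<beta> X) (tens tk.T \<beta>' X')) (\<alpha> \<otimes>\<^bsub>P\<^esub> p) (x \<otimes>\<^bsub>L\<^esub> Y)) \<beta> X =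
      Sw2 P L (\<lambda>\<alpha>1 X1 \<alpha>2 X2. Sw2 P L (\<lambda>\<beta>1 Y1 \<beta>2 Y2.
        g (tens tk.T \<alpha>1 X1 \<otimes>\<^bsub>tk.H\<^esub> tens tk.T \<beta>1 Y1) (tens tk.T \<alpha>2 X2 \<otimes>\<^bsub>ks.H\<^esub> tens tk.T \<beta>2 Y2)) \<beta> Y) \<alpha> X"
      unfolding cross_Sw2_mult[OF F a] unfolding Sw2_def by (intro psum_cong refl e)
  qed
  also have "\<dots> = Te P L W (\<lambda>\<beta> Y. Te P L V (\<lambda>\<alpha> X. Sw2 P L (\<lambda>\<beta>1 Y1 \<beta>2 Y2. Sw2 P L (\<lambda>\<alpha>1 X1 \<alpha>2 X2. 
      g (tens tk.T \<alpha>1 X1 \<otimes>\<^bsub>tk.H\<^esub> tens tk.T \<beta>1 Y1) (tens tk.T \<alpha>2 X2 \<otimes>\<^bsub>ks.H\<^esub> tens tk.T \<beta>2 Y2)) \<alpha> X) \<beta> Y))"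
    by (subst psum_swap) (subst Sw2_Sw2, rule refl)
  also have "\<dots> = Te P L W (Sw2 P L (\<lambda>\<beta>1 Y1 \<beta>2 Y2. G (tens tk.T \<beta>1 Y1) (tens tk.T \<beta>2 Y2)))"
    unfolding psum_Sw2 G_def ..
  also have "\<dots> = Sw tk.k.HB W G"
    by (rule tk.k.Sw_HB[OF bG m(2), symmetric])
  also have "\<dots> = Sw tk.k.HB W (\<lambda>W1 W2. Sw tk.k.HB V (\<lambda>V1 V2. g (V1 \<otimes>\<^bsub>tk.H\<^esub> W1) (V2 \<otimes>\<^bsub>ks.H\<^esub> W2)))"
    by (intro psum_cong refl SG[symmetric])
  finally show ?thesis unfolding psum_swap[of _ _ "rep (cop tk.k.HB W)"] .
qed

end

context hopf_pairing
begin

interpretation tt: hopf_pairing2 K B P L \<tau> \<tau> by unfold_locales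
interpretation ttt: hopf_pairing3 K B P L \<tau> \<tau> \<tau> by unfold_locales
interpretation hb: Be_ring K B HB by (rule HB_Be_ring)

lemma HB_cop_mult:
  assumes m: "V \<in> carrier HB" "W \<in> carrier HB"
  shows "cop HB (V \<otimes>\<^bsub>HB\<^esub> W) = sw hb.D.T HB (\<lambda>V1 V2. sw hb.D.T HB (\<lambda>W1 W2.
    tens hb.D.T (V1 \<otimes>\<^bsub>HB\<^esub> W1) (V2 \<otimes>\<^bsub>HB\<^esub> W2)) W) V"
proof (rule hb.D.eqI)
  note G = hb.D.comm_group_T
  show "cop HB (V \<otimes>\<^bsub>HB\<^esub> W) \<in> carrier hb.D.T" by (intro HB_cop_carrier hb.L.A.m_closed m)
  show "sw hb.D.T HB (\<lambda>V1 V2. sw hb.D.T HB (\<lambda>W1 W2. tens hb.D.T (V1 \<otimes>\<^bsub>HB\<^esub> W1) (V2 \<otimes>\<^bsub>HB\<^esub> W2)) W) V \<in> carrier hb.D.T"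
    by (intro HB_sw_closed G hb.D.tens_closed hb.L.A.m_closed m)
  fix f :: "('p \<times> 'l \<Rightarrow>\<^sub>0 int) set \<Rightarrow> ('p \<times> 'l \<Rightarrow>\<^sub>0 int) set \<Rightarrow>
      ((('p \<times> 'l \<Rightarrow>\<^sub>0 int) set \<times> ('p \<times> 'l \<Rightarrow>\<^sub>0 int) set) \<Rightarrow>\<^sub>0 int) set ambient"
  assume f: "diamond_balanced B HB HB f"
  note h = hb.D.ghom_of_balanced[OF f]
  show "Sw HB (V \<otimes>\<^bsub>HB\<^esub> W) f = hb.D.eval (sw hb.D.T HB (\<lambda>V1 V2. sw hb.D.T HB (\<lambda>W1 W2.
    tens hb.D.T (V1 \<otimes>\<^bsub>HB\<^esub> W1) (V2 \<otimes>\<^bsub>HB\<^esub> W2)) W) V) f"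
    using m ttt.Sw_mult[OF f m, folded HB_simps(2)]
    by (simp add: HB_ghom_sw[OF G h] HB_sw_closed[OF G] hb.D.tens_closed hb.D.eval_tens[OF f])
qed

theorem HB_left_bialgebroid: "left_bialgebroid K B HB"
  by (intro left_bialgebroid.intro HB_Be_ring left_bialgebroid_axioms.intro; (unfold hb.diamond_eq)?;
    (intro HB_cop_takeuchi HB_cop_add HB_cop_linear HB_cou_closed HB_cou_add HB_cou_linear HB_coassoc HB_counit_left
      HB_counit_right HB_cop_mult HB_cop_one HB_cou_one HB_cou_mult_src; assumption)?)
    (simp add: HB_cou_src_tgt_right[symmetric] HB_cou_closed HB_cou_mult_src)

end

section \<open>The cocycle and its twists\<close>

context hopf_pairing3
begin

interpretation hm: left_bialgebroid K B tk.k.HB by (rule tk.k.HB_left_bialgebroid)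

text \<open>The counit on the first leg of \<open>Sw_mult\<close>\<close>

lemma twist_left:
  assumes h: "additive tk.k.HB h" and m: "V \<in> carrier tk.k.HB" "W \<in> carrier tk.k.HB"
  shows "Sw tk.k.HB V (\<lambda>V1 V2. Sw tk.k.HB W (\<lambda>W1 W2.
      h (src tk.k.HB (cou tk.k.HB (V1 \<otimes>\<^bsub>tk.H\<^esub> W1)) \<otimes>\<^bsub>tk.k.HB\<^esub> (V2 \<otimes>\<^bsub>ks.H\<^esub> W2)))) = h (V \<otimes>\<^bsub>ts.H\<^esub> W)"
proof -
  have d: "diamond_balanced B tk.k.HB tk.k.HB (\<lambda>V1 V2. h (src tk.k.HB (cou tk.k.HB V1) \<otimes>\<^bsub>tk.k.HB\<^esub> V2))"
    by (rule balancedI) (simp_all add: hm.cou_add hm.L.A.l_distr hm.L.A.r_distr hm.L.A.m_assoc additiveD[OF h])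
  have c: "V \<otimes>\<^bsub>ts.H\<^esub> W \<in> carrier tk.k.HB"
    using m by (simp add: tk.k.HB_simps(1) ts.mult_closed)
  show ?thesis
    using hm.Sw_counit_left[OF h c] Sw_mult[OF d m] by simp
qed

lemma twist_right:
  assumes h: "additive tk.k.HB h" and m: "V \<in> carrier tk.k.HB" "W \<in> carrier tk.k.HB"
  shows "Sw tk.k.HB V (\<lambda>V1 V2. Sw tk.k.HB W (\<lambda>W1 W2.
      h (tgt tk.k.HB (cou tk.k.HB (V2 \<otimes>\<^bsub>ks.H\<^esub> W2)) \<otimes>\<^bsub>tk.k.HB\<^esub> (V1 \<otimes>\<^bsub>tk.H\<^esub> W1)))) = h (V \<otimes>\<^bsub>ts.H\<^esub> W)"
proof -
  have d: "diamond_balanced B tk.k.HB tk.k.HB (\<lambda>V1 V2. h (tgt tk.k.HB (cou tk.k.HB V2) \<otimes>\<^bsub>tk.k.HB\<^esub> V1))"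
    by (rule balancedI) (simp_all add: hm.cou_add hm.L.A.l_distr hm.L.A.r_distr hm.L.A.m_assoc additiveD[OF h])
  have c: "V \<otimes>\<^bsub>ts.H\<^esub> W \<in> carrier tk.k.HB"
    using m by (simp add: tk.k.HB_simps(1) ts.mult_closed)
  show ?thesis
    using hm.Sw_counit_right[OF h c] Sw_mult[OF d m] by simp
qed

text \<open>
  The functions \<open>\<epsilon>(V \<cdot> W)\<close> for the various products multiply under convolution like the arrows of a groupoid
  whose objects are the skew pairings.
\<close>

lemma conv_cou:
  assumes m: "V \<in> carrier tk.k.HB" "W \<in> carrier tk.k.HB"
  shows "conv B tk.k.HB (\<lambda>V W. cou tk.k.HB (V \<otimes>\<^bsub>tk.H\<^esub> W)) (\<lambda>V W. cou tk.k.HB (V \<otimes>\<^bsub>ks.H\<^esub> W)) V W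
    = cou tk.k.HB (V \<otimes>\<^bsub>ts.H\<^esub> W)"
proof (rule tk.k.B_eqI)
  note G = tk.t.P.B.A.a_comm_group
  have cl: "x \<otimes>\<^bsub>tk.H\<^esub> y \<in> carrier tk.k.HB" "x \<otimes>\<^bsub>ks.H\<^esub> y \<in> carrier tk.k.HB" "x \<otimes>\<^bsub>ts.H\<^esub> y \<in> carrier tk.k.HB"
    if "x \<in> carrier tk.k.HB" "y \<in> carrier tk.k.HB" for x y
    using that by (simp_all add: tk.k.HB_simps(1) tk.mult_closed ks.mult_closed ts.mult_closed)
  show "conv B tk.k.HB (\<lambda>V W. cou tk.k.HB (V \<otimes>\<^bsub>tk.H\<^esub> W)) (\<lambda>V W. cou tk.k.HB (V \<otimes>\<^bsub>ks.H\<^esub> W)) V W \<in> carrier B"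
    unfolding conv_def
    using hm.sw_closed[OF G m(1), of "\<lambda>V1 V2. sw (add_monoid B) tk.k.HB (\<lambda>W1 W2. cou tk.k.HB (V1 \<otimes>\<^bsub>tk.H\<^esub> W1) \<otimes>\<^bsub>B\<^esub> cou tk.k.HB (V2 \<otimes>\<^bsub>ks.H\<^esub> W2)) W"]
      hm.sw_closed[OF G m(2)] cl by simp
  show "cou tk.k.HB (V \<otimes>\<^bsub>ts.H\<^esub> W) \<in> carrier B" using cl m by simp
  fix h :: "'b \<Rightarrow> 'b ambient" assume h: "additive B h"
  have hc: "additive tk.k.HB (\<lambda>v. h (cou tk.k.HB v))"
    by (rule additiveI) (simp add: hm.cou_add additiveD[OF h])
  show "h (conv B tk.k.HB (\<lambda>V W. cou tk.k.HB (V \<otimes>\<^bsub>tk.H\<^esub> W)) (\<lambda>V W. cou tk.k.HB (V \<otimes>\<^bsub>ks.H\<^esub> W)) V W)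
    = h (cou tk.k.HB (V \<otimes>\<^bsub>ts.H\<^esub> W))"
    unfolding conv_def using twist_left[OF hc m] m
    by (simp add: hm.ghom_sw[OF G h] hm.sw_closed[OF G, simplified] cl)
qed

end

context hopf_pairing3
begin

interpretation hs: left_bialgebroid K B s.HB by (rule s.HB_left_bialgebroid)

text \<open>
  The left \<open>B\<^sup>e\<close>-linearity of the counit, with associativity and the fact that multiplication by base elements
  is the same in both products
\<close>

lemma Gamma_Be_hom: "(\<lambda>V W. cou s.HB (V \<otimes>\<^bsub>tk.H\<^esub> W)) \<in> Be_hom2 B s.HB"
proof -
  note c = s.HB_simps(1)
  have bs: "src s.HB b = tens tk.T (src P b) \<one>\<^bsub>L\<^esub>" "tgt s.HB b = tens tk.T (tgt P b) \<one>\<^bsub>L\<^esub>" for b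
    by (simp_all add: s.HB_src s.HB_tgt)
  have cl: "x \<otimes>\<^bsub>tk.H\<^esub> y \<in> carrier s.HB" if "x \<in> carrier s.HB" "y \<in> carrier s.HB" for x y
    using that by (simp add: c tk.mult_closed)
  have lft: "src s.HB b \<otimes>\<^bsub>s.HB\<^esub> tgt s.HB d \<otimes>\<^bsub>s.HB\<^esub> W = src tk.H b \<otimes>\<^bsub>tk.H\<^esub> (tgt tk.H d \<otimes>\<^bsub>tk.H\<^esub> W)"
    if m: "W \<in> carrier s.HB" "b \<in> carrier B" "d \<in> carrier B" for W b d
  proof -
    have "src s.HB b \<otimes>\<^bsub>s.HB\<^esub> tgt s.HB d \<otimes>\<^bsub>s.HB\<^esub> W = src s.HB b \<otimes>\<^bsub>s.HB\<^esub> (tgt s.HB d \<otimes>\<^bsub>s.HB\<^esub> W)"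
      by (rule hs.L.A.m_assoc) (use m in simp_all)
    then show ?thesis using m by (simp add: bs tk.H_src tk.H_tgt c base_left_indep tk.mult_closed)
  qed
  have mid: "V \<otimes>\<^bsub>s.HB\<^esub> src s.HB b \<otimes>\<^bsub>s.HB\<^esub> tgt s.HB d \<otimes>\<^bsub>tk.H\<^esub> W = V \<otimes>\<^bsub>tk.H\<^esub> (src s.HB b \<otimes>\<^bsub>s.HB\<^esub> tgt s.HB d \<otimes>\<^bsub>s.HB\<^esub> W)"
    if m: "V \<in> carrier s.HB" "W \<in> carrier s.HB" "b \<in> carrier B" "d \<in> carrier B" for V W b d
    unfolding lft[OF m(2-4)] using m by (simp add: c src_right_indep tgt_right_indep tk.mult_assoc tk.mult_closed tk.H_src tk.H_tgt)
  have lin: "cou s.HB (src s.HB b \<otimes>\<^bsub>s.HB\<^esub> tgt s.HB d \<otimes>\<^bsub>s.HB\<^esub> V \<otimes>\<^bsub>tk.H\<^esub> W) = b \<otimes>\<^bsub>B\<^esub> cou s.HB (V \<otimes>\<^bsub>tk.H\<^esub> W) \<otimes>\<^bsub>B\<^esub> d"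
    if m: "V \<in> carrier s.HB" "W \<in> carrier s.HB" "b \<in> carrier B" "d \<in> carrier B" for V W b d
  proof -
    have "src s.HB b \<otimes>\<^bsub>s.HB\<^esub> tgt s.HB d \<otimes>\<^bsub>s.HB\<^esub> V \<otimes>\<^bsub>tk.H\<^esub> W = src s.HB b \<otimes>\<^bsub>s.HB\<^esub> tgt s.HB d \<otimes>\<^bsub>s.HB\<^esub> (V \<otimes>\<^bsub>tk.H\<^esub> W)"
      unfolding lft[OF m(1,3,4)] lft[OF cl[OF m(1,2)] m(3,4)] using m by (simp add: c tk.mult_assoc tk.mult_closed tk.H_src tk.H_tgt)
    then show ?thesis using hs.cou_linear[OF m(3,4) cl[OF m(1,2)]] by simp
  qed
  have add: "cou s.HB ((V \<oplus>\<^bsub>s.HB\<^esub> V') \<otimes>\<^bsub>tk.H\<^esub> W) = cou s.HB (V \<otimes>\<^bsub>tk.H\<^esub> W) \<oplus>\<^bsub>B\<^esub> cou s.HB (V' \<otimes>\<^bsub>tk.H\<^esub> W)"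
    "cou s.HB (W \<otimes>\<^bsub>tk.H\<^esub> (V \<oplus>\<^bsub>s.HB\<^esub> V')) = cou s.HB (W \<otimes>\<^bsub>tk.H\<^esub> V) \<oplus>\<^bsub>B\<^esub> cou s.HB (W \<otimes>\<^bsub>tk.H\<^esub> V')"
    if "V \<in> carrier s.HB" "V' \<in> carrier s.HB" "W \<in> carrier s.HB" for V V' W
    using that hs.cou_add[OF cl[of V W] cl[of V' W]] hs.cou_add[OF cl[of W V] cl[of W V']]
      tk.mult_add_left[of V V' W] tk.mult_add_right[of V V' W]
    by (simp_all add: c s.HB_simps(5) tk.H_add)
  show ?thesis
    unfolding Be_hom2_def by (simp add: add mid lin cl)
qed

end

context hopf_pairing2
begin

interpretation hk: left_bialgebroid K B k.HB by (rule k.HB_left_bialgebroid)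
interpretation ht: left_bialgebroid K B t.HB by (rule t.HB_left_bialgebroid)
interpretation tkt: hopf_pairing3 K B P L \<tau> \<kappa> \<tau> by unfold_locales
interpretation tkk: hopf_pairing3 K B P L \<tau> \<kappa> \<kappa> by unfold_locales

lemma cou_cong: "cou t.HB = cou k.HB"
  by (simp add: t.HB_cou k.HB_cou)

lemma diamond_cong: "diamond B (bowtie B P L \<tau> \<tau>) (bowtie B P L \<tau> \<tau>) = diamond B (bowtie B P L \<kappa> \<kappa>) (bowtie B P L \<kappa> \<kappa>)"
  unfolding diamond_def
proof (rule tensor_cong)
  fix b V assume "b \<in> carrier B" "V \<in> carrier (bowtie B P L \<tau> \<tau>)"
  then have a: "b \<in> carrier B" "V \<in> carrier T" by (simp_all add: bowtie_def Let_def)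
  show "tgt (bowtie B P L \<tau> \<tau>) b \<otimes>\<^bsub>bowtie B P L \<tau> \<tau>\<^esub> V = tgt (bowtie B P L \<kappa> \<kappa>) b \<otimes>\<^bsub>bowtie B P L \<kappa> \<kappa>\<^esub> V"
    using a tkt.base_left_indep[of "tgt P b" V] tkk.base_left_indep[of "tgt P b" V]
    by (simp add: t.HB_simps(2) k.HB_simps(2) t.HB_tgt[unfolded t.HB_simps(8)] k.HB_tgt[unfolded k.HB_simps(8)])
  show "src (bowtie B P L \<tau> \<tau>) b \<otimes>\<^bsub>bowtie B P L \<tau> \<tau>\<^esub> V = src (bowtie B P L \<kappa> \<kappa>) b \<otimes>\<^bsub>bowtie B P L \<kappa> \<kappa>\<^esub> V"
    using a tkt.base_left_indep[of "src P b" V] tkk.base_left_indep[of "src P b" V]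
    by (simp add: t.HB_simps(2) k.HB_simps(2) t.HB_src[unfolded t.HB_simps(7)] k.HB_src[unfolded k.HB_simps(7)])
qed (simp_all add: bowtie_def Let_def)

text \<open>The coproduct is defined by the same formula for all pairings, but in a diamond product that refers to the ring.\<close>

lemma cop_cong: "cop t.HB = cop k.HB"
  unfolding t.HB_cop k.HB_cop Let_def diamond_cong ..

lemma conv_cong: "conv B t.HB = conv B k.HB"
  by (simp add: fun_eq_iff conv_def sw_def cop_cong)

text \<open>
  \<open>\<epsilon>(V W) = \<epsilon>(V \<epsilon>(W))\<close> in both bialgebroids, and the product with the base element \<open>\<epsilon>(W)\<close> does not involve the
  pairing.  So the units for convolution agree.
\<close>

lemma cou_mult_cong:
  assumes m: "V \<in> carrier k.HB" "W \<in> carrier k.HB"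
  shows "cou k.HB (V \<otimes>\<^bsub>t.HB\<^esub> W) = cou k.HB (V \<otimes>\<^bsub>k.HB\<^esub> W)"
proof -
  have b: "cou k.HB W \<in> carrier B" using m by simp
  have "V \<otimes>\<^bsub>t.HB\<^esub> src t.HB (cou k.HB W) = V \<otimes>\<^bsub>k.HB\<^esub> src k.HB (cou k.HB W)"
    using b m by (simp add: tkt.src_right_indep tkk.src_right_indep k.HB_simps(1))
  then show ?thesis
    using ht.cou_mult_src[of V W] hk.cou_mult_src[of V W] m by (simp add: cou_cong k.HB_simps(1) t.HB_simps(1))
qed

end

context hopf_pairing2
begin

interpretation hk: left_bialgebroid K B k.HB by (rule k.HB_left_bialgebroid)
interpretation ht: left_bialgebroid K B t.HB by (rule t.HB_left_bialgebroid)
interpretation w: hopf_pairing2 K B P L \<kappa> \<tau> by unfold_locales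

context
  fixes \<Gamma> \<Gamma>'
  defines "\<Gamma> \<equiv> \<lambda>V W. cou k.HB (V \<otimes>\<^bsub>H\<^esub> W)" and "\<Gamma>' \<equiv> \<lambda>V W. cou k.HB (V \<otimes>\<^bsub>w.H\<^esub> W)"
begin

interpretation tkk: hopf_pairing3 K B P L \<tau> \<kappa> \<kappa> by unfold_locales
interpretation tkt: hopf_pairing3 K B P L \<tau> \<kappa> \<tau> by unfold_locales
interpretation ktk: hopf_pairing3 K B P L \<kappa> \<tau> \<kappa> by unfold_locales
interpretation kkt: hopf_pairing3 K B P L \<kappa> \<kappa> \<tau> by unfold_locales

text \<open>\<open>conv_cou\<close> for the pairings \<open>\<tau>, \<kappa>, \<tau>\<close> and \<open>\<kappa>, \<tau>, \<kappa>\<close>\<close>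

lemma Gamma_conv_inverse: "conv_inverse B k.HB \<Gamma> \<Gamma>'"
  unfolding conv_inverse_def
proof (intro conjI ballI)
  show "\<Gamma> \<in> Be_hom2 B k.HB" unfolding \<Gamma>_def by (rule tkk.Gamma_Be_hom)
  show "\<Gamma>' \<in> Be_hom2 B k.HB" unfolding \<Gamma>'_def by (rule ktk.Gamma_Be_hom)
  fix V W assume m: "V \<in> carrier k.HB" "W \<in> carrier k.HB"
  show "conv B k.HB \<Gamma> \<Gamma>' V W = cou k.HB (V \<otimes>\<^bsub>k.HB\<^esub> W)"
    unfolding \<Gamma>_def \<Gamma>'_def tkt.conv_cou[OF m] cou_mult_cong[OF m, unfolded t.HB_simps(2)] ..
  have "conv B t.HB \<Gamma>' \<Gamma> V W = cou t.HB (V \<otimes>\<^bsub>k.HB\<^esub> W)"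
    unfolding \<Gamma>_def \<Gamma>'_def k.HB_simps(2) cou_cong[symmetric]
    by (rule ktk.conv_cou) (use m in \<open>simp_all add: k.HB_simps(1) t.HB_simps(1)\<close>)
  then show "conv B k.HB \<Gamma>' \<Gamma> V W = cou k.HB (V \<otimes>\<^bsub>k.HB\<^esub> W)"
    unfolding conv_cong cou_cong .
qed

text \<open>
  \<open>twist_left\<close> as an equation in the group.  The group \<open>G\<close> is left general because \<open>add_monoid\<close> keeps the
  remaining fields of a record, so that the additive monoids of the bialgebroid and of its underlying
  ring are different records.
\<close>

lemma twist_left_eq:
  assumes G: "comm_group G" and cG: "carrier G = carrier k.HB" and aG: "monoid.mult G = ring.add k.HB"
    and m: "V \<in> carrier k.HB" "W \<in> carrier k.HB"
  shows "sw G k.HB (\<lambda>V1 V2. sw G k.HB (\<lambda>W1 W2.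
      src k.HB (\<Gamma> V1 W1) \<otimes>\<^bsub>k.HB\<^esub> (V2 \<otimes>\<^bsub>k.HB\<^esub> W2)) W) V = V \<otimes>\<^bsub>H\<^esub> W"
proof (rule group_eqI[OF G])
  have cl: "x \<otimes>\<^bsub>H\<^esub> y \<in> carrier k.HB" if "x \<in> carrier k.HB" "y \<in> carrier k.HB" for x y
    using that by (simp add: k.HB_simps(1) mult_closed)
  have e: "src k.HB (\<Gamma> x y) \<otimes>\<^bsub>k.HB\<^esub> (x' \<otimes>\<^bsub>k.HB\<^esub> y') \<in> carrier G"
    if "x \<in> carrier k.HB" "y \<in> carrier k.HB" "x' \<in> carrier k.HB" "y' \<in> carrier k.HB" for x y x' y'
    using that cl by (simp add: \<Gamma>_def cG)
  show "sw G k.HB (\<lambda>V1 V2. sw G k.HB (\<lambda>W1 W2. src k.HB (\<Gamma> V1 W1) \<otimes>\<^bsub>k.HB\<^esub> (V2 \<otimes>\<^bsub>k.HB\<^esub> W2)) W) V \<in> carrier G"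
    by (intro hk.sw_closed[OF G] m e)
  show "V \<otimes>\<^bsub>H\<^esub> W \<in> carrier G" using cl[OF m] by (simp add: cG)
  fix h :: "('p \<times> 'l \<Rightarrow>\<^sub>0 int) set \<Rightarrow> ('p \<times> 'l \<Rightarrow>\<^sub>0 int) set ambient" assume hG: "ghom G h"
  then have h: "additive k.HB h" by (simp add: ghom_def cG aG)
  have "h (sw G k.HB (\<lambda>V1 V2. sw G k.HB (\<lambda>W1 W2. src k.HB (\<Gamma> V1 W1) \<otimes>\<^bsub>k.HB\<^esub> (V2 \<otimes>\<^bsub>k.HB\<^esub> W2)) W) V)
    = Sw k.HB V (\<lambda>V1 V2. h (sw G k.HB (\<lambda>W1 W2. src k.HB (\<Gamma> V1 W1) \<otimes>\<^bsub>k.HB\<^esub> (V2 \<otimes>\<^bsub>k.HB\<^esub> W2)) W))"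
    by (intro hk.ghom_sw[OF G hG] hk.sw_closed[OF G] m e)
  also have "\<dots> = Sw k.HB V (\<lambda>V1 V2. Sw k.HB W (\<lambda>W1 W2. h (src k.HB (\<Gamma> V1 W1) \<otimes>\<^bsub>k.HB\<^esub> (V2 \<otimes>\<^bsub>k.HB\<^esub> W2))))"
    by (intro psum_cong refl hk.ghom_sw[OF G hG] m e)
  also have "\<dots> = h (V \<otimes>\<^bsub>H\<^esub> W)"
    unfolding \<Gamma>_def by (rule tkk.twist_left[OF h m, folded k.HB_simps(2)])
  finally show "h (sw G k.HB (\<lambda>V1 V2. sw G k.HB (\<lambda>W1 W2. src k.HB (\<Gamma> V1 W1) \<otimes>\<^bsub>k.HB\<^esub> (V2 \<otimes>\<^bsub>k.HB\<^esub> W2)) W) V)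
    = h (V \<otimes>\<^bsub>H\<^esub> W)" .
qed

text \<open>By \<open>twist_left_eq\<close> the cocycle condition is associativity of the product for \<open>\<tau>, \<kappa>\<close>.\<close>

lemma two_cocycle_Gamma: "two_cocycle K B k.HB \<Gamma>"
proof (intro two_cocycle.intro two_cocycle_axioms.intro)
  show "left_bialgebroid K B k.HB" by (rule k.HB_left_bialgebroid)
  show "\<Gamma> \<in> Be_hom2 B k.HB" unfolding \<Gamma>_def by (rule tkk.Gamma_Be_hom)
  show "\<exists>\<Gamma>'. conv_inverse B k.HB \<Gamma> \<Gamma>'" using Gamma_conv_inverse by blast
  fix U V W assume m: "U \<in> carrier k.HB" "V \<in> carrier k.HB" "W \<in> carrier k.HB"
  show "\<Gamma> U (sw (add_monoid k.HB) k.HB (\<lambda>V1 V2. sw (add_monoid k.HB) k.HB (\<lambda>W1 W2.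
          src k.HB (\<Gamma> V1 W1) \<otimes>\<^bsub>k.HB\<^esub> (V2 \<otimes>\<^bsub>k.HB\<^esub> W2)) W) V) =
      \<Gamma> (sw (add_monoid k.HB) k.HB (\<lambda>U1 U2. sw (add_monoid k.HB) k.HB (\<lambda>V1 V2.
          src k.HB (\<Gamma> U1 V1) \<otimes>\<^bsub>k.HB\<^esub> (U2 \<otimes>\<^bsub>k.HB\<^esub> V2)) V) U) W"
    unfolding twist_left_eq[OF hk.L.A.a_comm_group partial_object.simps(1) monoid.simps(1) m(2,3)] twist_left_eq[OF hk.L.A.a_comm_group partial_object.simps(1) monoid.simps(1) m(1,2)]
    using m by (simp add: \<Gamma>_def mult_assoc k.HB_simps(1))
next
  fix V assume "V \<in> carrier k.HB"
  then show "\<Gamma> \<one>\<^bsub>k.HB\<^esub> V = cou k.HB V \<and> \<Gamma> V \<one>\<^bsub>k.HB\<^esub> = cou k.HB V"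
    using mult_one_left[of V] mult_one_right[of V] by (simp add: \<Gamma>_def k.HB_one H_one k.HB_simps(1))
next
  fix V W b assume m: "V \<in> carrier k.HB" "W \<in> carrier k.HB" "b \<in> carrier B"
  have c: "V \<otimes>\<^bsub>H\<^esub> W \<in> carrier k.HB" using m by (simp add: k.HB_simps(1) mult_closed)
  have "V \<otimes>\<^bsub>H\<^esub> (W \<otimes>\<^bsub>k.HB\<^esub> src k.HB b) = (V \<otimes>\<^bsub>H\<^esub> W) \<otimes>\<^bsub>k.HB\<^esub> src k.HB b"
    "V \<otimes>\<^bsub>H\<^esub> (W \<otimes>\<^bsub>k.HB\<^esub> tgt k.HB b) = (V \<otimes>\<^bsub>H\<^esub> W) \<otimes>\<^bsub>k.HB\<^esub> tgt k.HB b"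
    using m by (simp_all add: k.HB_simps(1) tkk.src_right_indep tkk.tgt_right_indep mult_assoc mult_closed H_src H_tgt)
  then show "\<Gamma> V (W \<otimes>\<^bsub>k.HB\<^esub> src k.HB b) = \<Gamma> V (W \<otimes>\<^bsub>k.HB\<^esub> tgt k.HB b)"
    unfolding \<Gamma>_def by (simp add: hk.cou_src_tgt_right[OF m(3) c])
qed

lemma left_twist_eq: "bowtie B P L \<tau> \<kappa> = left_twist \<Gamma> (cop k.HB) (be_ring.truncate k.HB)"
proof -
  let ?A = "bowtie B P L \<kappa> \<kappa>"
  have s: "sw (add_monoid ?A) k.HB (\<lambda>V1 V2. sw (add_monoid ?A) k.HB (\<lambda>W1 W2.
      src k.HB (\<Gamma> V1 W1) \<otimes>\<^bsub>k.HB\<^esub> (V2 \<otimes>\<^bsub>k.HB\<^esub> W2)) W) V = V \<otimes>\<^bsub>H\<^esub> W"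
    if "V \<in> carrier k.HB" "W \<in> carrier k.HB" for V W
    by (rule twist_left_eq[OF tkk.ks.comm_group_H _ _ that]) (simp_all add: k.HB_simps bowtie_def Let_def)
  have "monoid.mult H = (\<lambda>V\<in>carrier k.HB. \<lambda>W\<in>carrier k.HB. V \<otimes>\<^bsub>H\<^esub> W)"
    by (simp add: k.HB_simps(1) bowtie_def Let_def restrict_def fun_eq_iff)
  also have "\<dots> = (\<lambda>V\<in>carrier k.HB. \<lambda>W\<in>carrier k.HB. sw (add_monoid ?A) k.HB (\<lambda>V1 V2. sw (add_monoid ?A) k.HB (\<lambda>W1 W2.
      src k.HB (\<Gamma> V1 W1) \<otimes>\<^bsub>k.HB\<^esub> (V2 \<otimes>\<^bsub>k.HB\<^esub> W2)) W) V)"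
    by (intro restrict_ext) (rule s[symmetric])
  finally have e: "monoid.mult H = \<dots>" .
  show ?thesis
  proof (rule be_ring.equality)
    show "monoid.mult H = monoid.mult (left_twist \<Gamma> (cop k.HB) (be_ring.truncate k.HB))"
      unfolding e left_twist_def k.HB_truncate sw_def by (simp add: k.HB_simps(1,2,7))
  qed (simp_all add: left_twist_def k.HB_truncate, simp_all add: bowtie_def Let_def)
qed

text \<open>
  The inner sums over the last two components are \<open>twist_right\<close> for \<open>\<kappa>, \<kappa>, \<tau>\<close>, which yields \<open>\<cdot>\<^sub>\<kappa>\<^sub>\<tau>\<close>; the remaining
  sum is \<open>twist_left\<close> for \<open>\<tau>, \<kappa>, \<tau>\<close>.
\<close>

lemma cocycle_twist_eq: "t.HB = cocycle_twist k.HB \<Gamma> \<Gamma>'"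
proof -
  have cl: "x \<otimes>\<^bsub>H\<^esub> y \<in> carrier k.HB" "x \<otimes>\<^bsub>w.H\<^esub> y \<in> carrier k.HB" "x \<otimes>\<^bsub>t.HB\<^esub> y \<in> carrier k.HB"
    if "x \<in> carrier k.HB" "y \<in> carrier k.HB" for x y
    using that ht.L.A.m_closed[of x y] by (simp_all add: k.HB_simps(1) t.HB_simps(1) mult_closed w.mult_closed)
  have cG: "\<Gamma> x y \<in> carrier B" "\<Gamma>' x y \<in> carrier B" if "x \<in> carrier k.HB" "y \<in> carrier k.HB" for x y
    using that cl by (simp_all add: \<Gamma>_def \<Gamma>'_def)
  let ?E = "\<lambda>V1 V2 V3 W1 W2 W3. src k.HB (\<Gamma> V1 W1) \<otimes>\<^bsub>k.HB\<^esub> tgt k.HB (\<Gamma>' V3 W3) \<otimes>\<^bsub>k.HB\<^esub> (V2 \<otimes>\<^bsub>k.HB\<^esub> W2)"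
  let ?S = "\<lambda>V W. sw3 (add_monoid k.HB) k.HB (\<lambda>V1 V2 V3. sw3 (add_monoid k.HB) k.HB (?E V1 V2 V3) W) V"
  note G = hk.L.A.a_comm_group
  have E: "?E V1 V2 V3 W1 W2 W3 \<in> carrier k.HB"
    if "V1 \<in> carrier k.HB" "V2 \<in> carrier k.HB" "V3 \<in> carrier k.HB" "W1 \<in> carrier k.HB" "W2 \<in> carrier k.HB" "W3 \<in> carrier k.HB"
    for V1 V2 V3 W1 W2 W3 using that by (simp add: cG)
  have E': "?E V1 V2 V3 W1 W2 W3 \<in> carrier (add_monoid k.HB)"
    if "V1 \<in> carrier k.HB" "V2 \<in> carrier k.HB" "V3 \<in> carrier k.HB" "W1 \<in> carrier k.HB" "W2 \<in> carrier k.HB" "W3 \<in> carrier k.HB"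
    for V1 V2 V3 W1 W2 W3 using E[OF that] by simp
  have eq: "V \<otimes>\<^bsub>t.HB\<^esub> W = ?S V W" if m: "V \<in> carrier k.HB" "W \<in> carrier k.HB" for V W
  proof (rule group_eqI)
    show "comm_group (add_monoid k.HB)" by (rule G)
    show "V \<otimes>\<^bsub>t.HB\<^esub> W \<in> carrier (add_monoid k.HB)" using cl m by simp
    show "?S V W \<in> carrier (add_monoid k.HB)"
      unfolding sw3_def by (intro hk.sw_closed[OF G] m E')
    fix h :: "('p \<times> 'l \<Rightarrow>\<^sub>0 int) set \<Rightarrow> ('p \<times> 'l \<Rightarrow>\<^sub>0 int) set ambient" assume h: "additive k.HB h"
    have "h (?S V W) = Sw k.HB V (\<lambda>V1 y. Sw k.HB y (\<lambda>V2 V3. Sw k.HB W (\<lambda>W1 z. Sw k.HB z (\<lambda>W2 W3. h (?E V1 V2 V3 W1 W2 W3)))))"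
      unfolding sw3_def using m by (simp add: hk.ghom_sw[OF G h] hk.sw_closed[OF G, simplified] E)
    also have "\<dots> = Sw k.HB V (\<lambda>V1 y. Sw k.HB W (\<lambda>W1 z. Sw k.HB y (\<lambda>V2 V3. Sw k.HB z (\<lambda>W2 W3. h (?E V1 V2 V3 W1 W2 W3)))))"
      by (intro psum_cong refl psum_swap)
    also have "\<dots> = Sw k.HB V (\<lambda>V1 y. Sw k.HB W (\<lambda>W1 z. h (src k.HB (\<Gamma> V1 W1) \<otimes>\<^bsub>k.HB\<^esub> (y \<otimes>\<^bsub>w.H\<^esub> z))))"
    proof (intro psum_cong refl)
      fix V1 y W1 z assume a: "V1 \<in> carrier k.HB" "y \<in> carrier k.HB" "W1 \<in> carrier k.HB" "z \<in> carrier k.HB"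
      have h': "additive k.HB (\<lambda>v. h (src k.HB (\<Gamma> V1 W1) \<otimes>\<^bsub>k.HB\<^esub> v))"
        by (rule additiveI) (use a cG in \<open>simp add: hk.L.A.r_distr additiveD[OF h]\<close>)
      show "Sw k.HB y (\<lambda>V2 V3. Sw k.HB z (\<lambda>W2 W3. h (?E V1 V2 V3 W1 W2 W3))) = h (src k.HB (\<Gamma> V1 W1) \<otimes>\<^bsub>k.HB\<^esub> (y \<otimes>\<^bsub>w.H\<^esub> z))"
        unfolding kkt.twist_right[OF h' a(2,4), symmetric]
      proof (intro psum_cong refl)
        fix V2 V3 W2 W3 assume b: "V2 \<in> carrier k.HB" "V3 \<in> carrier k.HB" "W2 \<in> carrier k.HB" "W3 \<in> carrier k.HB"
        have "?E V1 V2 V3 W1 W2 W3 = src k.HB (\<Gamma> V1 W1) \<otimes>\<^bsub>k.HB\<^esub> (tgt k.HB (\<Gamma>' V3 W3) \<otimes>\<^bsub>k.HB\<^esub> (V2 \<otimes>\<^bsub>k.HB\<^esub> W2))"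
          by (rule hk.L.A.m_assoc) (use a b cG in simp_all)
        then show "h (?E V1 V2 V3 W1 W2 W3) = h (src k.HB (\<Gamma> V1 W1) \<otimes>\<^bsub>k.HB\<^esub>
            (tgt k.HB (cou k.HB (V3 \<otimes>\<^bsub>w.H\<^esub> W3)) \<otimes>\<^bsub>k.HB\<^esub> (V2 \<otimes>\<^bsub>bowtie B P L \<kappa> \<kappa>\<^esub> W2)))"
          by (simp add: \<Gamma>'_def k.HB_simps(2))
      qed
    qed
    also have "\<dots> = h (V \<otimes>\<^bsub>t.HB\<^esub> W)"
      unfolding \<Gamma>_def t.HB_simps(2) by (rule tkt.twist_left[OF h m])
    finally show "h (V \<otimes>\<^bsub>t.HB\<^esub> W) = h (?S V W)" ..
  qed
  have "monoid.mult t.HB = (\<lambda>V\<in>carrier k.HB. \<lambda>W\<in>carrier k.HB. V \<otimes>\<^bsub>t.HB\<^esub> W)"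
    unfolding t.HB_simps(2) k.HB_simps(1) by (simp add: bowtie_def Let_def restrict_def fun_eq_iff)
  also have "\<dots> = (\<lambda>V\<in>carrier k.HB. \<lambda>W\<in>carrier k.HB. ?S V W)"
    by (intro restrict_ext) (rule eq)
  finally have e: "monoid.mult t.HB = \<dots>" .
  show ?thesis
  proof (rule bialgebroid.equality)
    show "monoid.mult t.HB = monoid.mult (cocycle_twist k.HB \<Gamma> \<Gamma>')"
      unfolding e cocycle_twist_def by simp
  qed (simp_all add: cocycle_twist_def cop_cong cou_cong, simp_all add: t.HB_simps k.HB_simps bowtie_def Let_def)
qed

end

end

theorem lemma5p4:
  fixes K :: "'k ring" and B :: "('k, 'b) module"
    and P :: "('k, 'b, 'p) bialgebroid" and L :: "('k, 'b, 'l) bialgebroid"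
    and \<tau> \<kappa> :: "'l \<Rightarrow> 'p \<Rightarrow> 'b"
  assumes "left_hopf_algebroid K B P" and "left_hopf_algebroid K B L"
    and "faithfully_flat_over_base TYPE(('p \<times> 'l) list) B P"
    and "faithfully_flat_over_base TYPE(('p \<times> 'l) list) B L"
    and "skew_pairing K B L P \<tau>" and "skew_pairing K B L P \<kappa>"
  shows "let H = bowtie_bialgebroid B P L \<kappa>;
             \<Gamma> = (\<lambda>V W. cou H (V \<otimes>\<^bsub>bowtie B P L \<tau> \<kappa>\<^esub> W));
             \<Gamma>' = (\<lambda>V W. cou H (V \<otimes>\<^bsub>bowtie B P L \<kappa> \<tau>\<^esub> W))
         in two_cocycle K B H \<Gamma>
          \<and> conv_inverse B H \<Gamma> \<Gamma>'
          \<and> bowtie_bialgebroid B P L \<tau> = cocycle_twist H \<Gamma> \<Gamma>'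
          \<and> bowtie B P L \<tau> \<kappa> = left_twist \<Gamma> (cop H) (be_ring.truncate H)"
proof -
  interpret hopf_pairing2 K B P L \<tau> \<kappa>
    using assms(1,5,6) by (simp add: hopf_pairing2_def hopf_pairing_def)
  show ?thesis
    unfolding Let_def by (intro conjI two_cocycle_Gamma Gamma_conv_inverse cocycle_twist_eq left_twist_eq)
qed

end
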